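(* Let $R$ be a commutative Noetherian ring. \begin{enumerate} \item If $H$ is an $\alpha$-bialgebra (respectively a Hopf $\alpha$-algebra) over $R$, then $(H,H^{\circ})$ is a bialgebra $\alpha$-pairing (respectively a Hopf $\alpha$-pairing). If moreover $H$ is commutative (cocommutative), then $H^{\circ}$ is cocommutative (commutative). \item If $R$ is hereditary, then $H\mapsto H^{\circ}$ gives self-adjoint contravariant functors $$(-)^{\circ}:\mathbf{Big}_R\to\mathbf{Big}_R,\qquad(-)^{\circ}:\mathbf{Hopf}_R\to\mathbf{Hopf}_R,$$ as well as $$\mathbf{CBig}_R\to\mathbf{CCBig}_R,\quad\mathbf{CCBig}_R\to\mathbf{CBig}_R,\qquad\mathbf{CHopf}_R\to\mathbf{CCHopf}_R,\quad\mathbf{CCHopf}_R\to\mathbf{CHopf}_R.$$ \end{enumerate}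
   Context: For an $R$-algebra $A$, $A^{\circ}=\{f\in A^*: f(I)=0\text{ for some two-sided ideal }I\text{ of }A\text{ with }A/I\text{ finitely generated over }R\}$, $A^*=\mathrm{Hom}_R(A,R)$. An $R$-pairing $(V,W)$ with form $\langle-,-\rangle$ satisfies the $\alpha$-condition if for every $R$-module $M$ the map $M\otimes_RW\to\mathrm{Hom}_R(V,M)$, $\sum m_i\otimes w_i\mapsto[v\mapsto\sum m_i\langle v,w_i\rangle]$ is injective. $A$ is an $\alpha$-algebra if the $R$-cofinite ideals (those $I$ with $A/I$ finitely generated over $R$) form a filter and $(A,A^{\circ})$ with the evaluation form satisfies the $\alpha$-condition. An $\alpha$-bialgebra (Hopf $\alpha$-algebra) is an $R$-bialgebra (Hopf $R$-algebra) that is an $\alpha$-algebra. $H^{\circ}$ carries the structure dual to $H$: convolution product, unity $\varepsilon_H$, comultiplication determined by $f(hh')=\sum f_1(h)f_2(h')$, counit $f\mapsto f(1_H)$, and antipode $f\mapsto f\circ S_H$ in the Hopf case. A bialgebra (Hopf) $\alpha$-pairing $(H,K)$ is a pair of $R$-bialgebras (Hopf $R$-algebras) with an $R$-bilinear form such that the induced maps $H\to K^*$, $K\to H^*$ are $R$-algebra morphisms (duals with convolution), satisfying the $\alpha$-condition; thus (1) includes that $H^\circ$ is an $R$-bialgebra (Hopf $R$-algebra). $R$ is hereditary if every ideal of $R$ is projective. $\mathbf{Big}_R$, $\mathbf{Hopf}_R$ are the categories of $R$-bialgebras and of Hopf $R$-algebras; prefix $\mathbf{C}$ (respectively $\mathbf{CC}$)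 denotes the full subcategory of commutative (respectively cocommutative) objects. "Self-adjoint" means that there is a bijection, natural in $H$ and $K$, between bialgebra (Hopf algebra) morphisms $H\to K^{\circ}$ and $K\to H^{\circ}$; for the (co)commutative versions it means that the two contravariant functors in opposite directions are adjoint to each other in this sense. *)

theory Defs
  imports "HOL-Algebra.Module" "HOL-Algebra.Ring_Divisibility"
begin

section \<open>Modules over a commutative ring\<close>

definition reg_mod :: "('r, 'z) ring_scheme \<Rightarrow> ('r, 'r) module" where
  "reg_mod R = \<lparr>carrier = carrier R, monoid.mult = monoid.mult R, monoid.one = monoid.one R,
     ring.zero = ring.zero R, ring.add = ring.add R, smult = monoid.mult R\<rparr>"

definition lin_map ::
  "('r, 'z) ring_scheme \<Rightarrow> ('r, 'm, 'u) module_scheme \<Rightarrow> ('r, 'n, 'v) module_scheme \<Rightarrow> ('m \<Rightarrow> 'n) set" where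
  "lin_map R M N = {f \<in> carrier M \<rightarrow> carrier N.
     (\<forall>x\<in>carrier M. \<forall>y\<in>carrier M. f (x \<oplus>\<^bsub>M\<^esub> y) = f x \<oplus>\<^bsub>N\<^esub> f y) \<and>
     (\<forall>r\<in>carrier R. \<forall>x\<in>carrier M. f (r \<odot>\<^bsub>M\<^esub> x) = r \<odot>\<^bsub>N\<^esub> f x)}"

text \<open>Linear maps as elements of a set of morphisms are normalised to be \<^const>\<open>undefined\<close> outside
  the carrier, so that equality of morphisms is equality of functions.\<close>

definition Hom_mod ::
  "('r, 'z) ring_scheme \<Rightarrow> ('r, 'm, 'u) module_scheme \<Rightarrow> ('r, 'n, 'v) module_scheme \<Rightarrow> ('m \<Rightarrow> 'n) set" where
  "Hom_mod R M N = lin_map R M N \<inter> extensional (carrier M)"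

definition bilin_map ::
  "('r, 'z) ring_scheme \<Rightarrow> ('r, 'm, 'u) module_scheme \<Rightarrow> ('r, 'n, 'v) module_scheme \<Rightarrow>
   ('r, 'p, 'w) module_scheme \<Rightarrow> ('m \<Rightarrow> 'n \<Rightarrow> 'p) set" where
  "bilin_map R M N P = {b.
     (\<forall>x\<in>carrier M. b x \<in> lin_map R N P) \<and> (\<forall>y\<in>carrier N. (\<lambda>x. b x y) \<in> lin_map R M P)}"

definition mod_span :: "('r, 'z) ring_scheme \<Rightarrow> ('r, 'm, 'u) module_scheme \<Rightarrow> 'm set \<Rightarrow> 'm set" where
  "mod_span R M S = \<Inter>{N. submodule N R M \<and> S \<subseteq> N}"

definition fin_gen_mod :: "('r, 'z) ring_scheme \<Rightarrow> ('r, 'm, 'u) module_scheme \<Rightarrow> bool" where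
  "fin_gen_mod R M \<longleftrightarrow> (\<exists>S\<subseteq>carrier M. finite S \<and> carrier M = mod_span R M S)"

text \<open>The ring fields of the records below that carry no ring structure are \<^const>\<open>undefined\<close>;
  a \<^locale>\<open>module\<close> does not look at them.\<close>

definition quot_mod :: "('r, 'm, 'u) module_scheme \<Rightarrow> 'm set \<Rightarrow> ('r, 'm set) module" where
  "quot_mod M N = \<lparr>carrier = a_rcosets\<^bsub>M\<^esub> N, monoid.mult = undefined, monoid.one = undefined,
     ring.zero = N, ring.add = set_add M, smult = (\<lambda>r X. \<Union>x\<in>X. N +>\<^bsub>M\<^esub> (r \<odot>\<^bsub>M\<^esub> x))\<rparr>"

definition free_mod :: "('r, 'z) ring_scheme \<Rightarrow> 'x set \<Rightarrow> ('r, 'x \<Rightarrow> 'r) module" where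
  "free_mod R X = \<lparr>carrier = {f. (\<forall>x\<in>X. f x \<in> carrier R) \<and> (\<forall>x. x \<notin> X \<longrightarrow> f x = \<zero>\<^bsub>R\<^esub>) \<and>
       finite {x. f x \<noteq> \<zero>\<^bsub>R\<^esub>}},
     monoid.mult = undefined, monoid.one = undefined, ring.zero = (\<lambda>x. \<zero>\<^bsub>R\<^esub>),
     ring.add = (\<lambda>f g x. f x \<oplus>\<^bsub>R\<^esub> g x),
     smult = (\<lambda>r f x. r \<otimes>\<^bsub>R\<^esub> f x)\<rparr>"

definition free_gen :: "('r, 'z) ring_scheme \<Rightarrow> 'x \<Rightarrow> 'x \<Rightarrow> 'r" where
  "free_gen R x = (\<lambda>y. if y = x then \<one>\<^bsub>R\<^esub> else \<zero>\<^bsub>R\<^esub>)"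

text \<open>Projective means: retract (direct summand up to isomorphism) of a free module. Bases inside
  the type of \<open>P\<close> suffice, since \<open>P\<close> is an image of the free module on \<^term>\<open>carrier P\<close>.\<close>

definition projective_mod :: "('r, 'z) ring_scheme \<Rightarrow> ('r, 'm, 'u) module_scheme \<Rightarrow> bool" where
  "projective_mod R P \<longleftrightarrow> (\<exists>X :: 'm set. \<exists>i \<in> lin_map R P (free_mod R X).
     \<exists>p \<in> lin_map R (free_mod R X) P. \<forall>x\<in>carrier P. p (i x) = x)"

definition hereditary_ring :: "('r, 'z) ring_scheme \<Rightarrow> bool" where
  "hereditary_ring R \<longleftrightarrow> (\<forall>I. ideal I R \<longrightarrow> projective_mod R ((reg_mod R)\<lparr>carrier := I\<rparr>))"


section \<open>Tensor products\<close>

definition tensor_rel ::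
  "('r, 'z) ring_scheme \<Rightarrow> ('r, 'm, 'u) module_scheme \<Rightarrow> ('r, 'n, 'v) module_scheme \<Rightarrow> ('m \<times> 'n \<Rightarrow> 'r) set" where
  "tensor_rel R M N =
    (let F = free_mod R (carrier M \<times> carrier N); e = (\<lambda>x y. free_gen R (x, y)) in
     mod_span R F
      ({e (x \<oplus>\<^bsub>M\<^esub> x') y \<ominus>\<^bsub>F\<^esub> (e x y \<oplus>\<^bsub>F\<^esub> e x' y) | x x' y.
          x \<in> carrier M \<and> x' \<in> carrier M \<and> y \<in> carrier N} \<union>
       {e x (y \<oplus>\<^bsub>N\<^esub> y') \<ominus>\<^bsub>F\<^esub> (e x y \<oplus>\<^bsub>F\<^esub> e x y') | x y y'.
          x \<in> carrier M \<and> y \<in> carrier N \<and> y' \<in> carrier N} \<union>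
       {e (r \<odot>\<^bsub>M\<^esub> x) y \<ominus>\<^bsub>F\<^esub> r \<odot>\<^bsub>F\<^esub> e x y | r x y.
          r \<in> carrier R \<and> x \<in> carrier M \<and> y \<in> carrier N} \<union>
       {e x (r \<odot>\<^bsub>N\<^esub> y) \<ominus>\<^bsub>F\<^esub> r \<odot>\<^bsub>F\<^esub> e x y | r x y.
          r \<in> carrier R \<and> x \<in> carrier M \<and> y \<in> carrier N}))"

definition tensor ::
  "('r, 'z) ring_scheme \<Rightarrow> ('r, 'm, 'u) module_scheme \<Rightarrow> ('r, 'n, 'v) module_scheme \<Rightarrow>
   ('r, ('m \<times> 'n \<Rightarrow> 'r) set) module" where
  "tensor R M N = quot_mod (free_mod R (carrier M \<times> carrier N)) (tensor_rel R M N)"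

definition ptensor ::
  "('r, 'z) ring_scheme \<Rightarrow> ('r, 'm, 'u) module_scheme \<Rightarrow> ('r, 'n, 'v) module_scheme \<Rightarrow>
   'm \<Rightarrow> 'n \<Rightarrow> ('m \<times> 'n \<Rightarrow> 'r) set" where
  "ptensor R M N x y =
     tensor_rel R M N +>\<^bsub>free_mod R (carrier M \<times> carrier N)\<^esub> free_gen R (x, y)"

text \<open>\<open>tensor_sum R P b\<close> is the linear map into \<open>P\<close> induced by a bilinear map \<open>b\<close>: it takes
  \<open>\<Sum> x\<^sub>i \<otimes> y\<^sub>i\<close> to \<open>\<Sum> b x\<^sub>i y\<^sub>i\<close>. For bilinear \<open>b\<close> the chosen representative of the
  class \<open>t\<close> does not matter.\<close>

definition tensor_sum ::
  "('r, 'z) ring_scheme \<Rightarrow> ('r, 'p, 'w) module_scheme \<Rightarrow> ('m \<Rightarrow> 'n \<Rightarrow> 'p) \<Rightarrow>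
   ('m \<times> 'n \<Rightarrow> 'r) set \<Rightarrow> 'p" where
  "tensor_sum R P b t = (let c = (SOME c. c \<in> t) in
     \<Oplus>\<^bsub>P\<^esub>q\<in>{q. c q \<noteq> \<zero>\<^bsub>R\<^esub>}. c q \<odot>\<^bsub>P\<^esub> b (fst q) (snd q))"

text \<open>\<open>tensor_map R M' N' f g\<close> is \<open>f \<otimes> g\<close> with values in \<open>M' \<otimes> N'\<close>.\<close>

definition tensor_map ::
  "('r, 'z) ring_scheme \<Rightarrow> ('r, 'm2, 'u) module_scheme \<Rightarrow> ('r, 'n2, 'v) module_scheme \<Rightarrow>
   ('m \<Rightarrow> 'm2) \<Rightarrow> ('n \<Rightarrow> 'n2) \<Rightarrow> ('m \<times> 'n \<Rightarrow> 'r) set \<Rightarrow> ('m2 \<times> 'n2 \<Rightarrow> 'r) set" where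
  "tensor_map R M' N' f g = tensor_sum R (tensor R M' N') (\<lambda>x y. ptensor R M' N' (f x) (g y))"

definition tensor_flip ::
  "('r, 'z) ring_scheme \<Rightarrow> ('r, 'm, 'u) module_scheme \<Rightarrow> ('r, 'n, 'v) module_scheme \<Rightarrow>
   ('m \<times> 'n \<Rightarrow> 'r) set \<Rightarrow> ('n \<times> 'm \<Rightarrow> 'r) set" where
  "tensor_flip R M N = tensor_sum R (tensor R N M) (\<lambda>x y. ptensor R N M y x)"

text \<open>The associativity isomorphism from \<open>(L \<otimes> M) \<otimes> N\<close> to \<open>L \<otimes> (M \<otimes> N)\<close>.\<close>

definition tensor_assoc ::
  "('r, 'z) ring_scheme \<Rightarrow> ('r, 'l, 'u) module_scheme \<Rightarrow> ('r, 'm, 'v) module_scheme \<Rightarrow>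
   ('r, 'n, 'w) module_scheme \<Rightarrow> (('l \<times> 'm \<Rightarrow> 'r) set \<times> 'n \<Rightarrow> 'r) set \<Rightarrow>
   ('l \<times> ('m \<times> 'n \<Rightarrow> 'r) set \<Rightarrow> 'r) set" where
  "tensor_assoc R L M N =
    (let MN = tensor R M N; T = tensor R L MN in
     tensor_sum R T (\<lambda>u z. tensor_sum R T (\<lambda>x y. ptensor R L MN x (ptensor R M N y z)) u))"

definition tensor_alg ::
  "('r, 'z) ring_scheme \<Rightarrow> ('r, 'a, 'u) module_scheme \<Rightarrow> ('r, 'b, 'v) module_scheme \<Rightarrow>
   ('r, ('a \<times> 'b \<Rightarrow> 'r) set) module" where
  "tensor_alg R A B = (let T = tensor R A B in
     T\<lparr>monoid.mult := (\<lambda>s t. tensor_sum R T (\<lambda>a b. tensor_sum R T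
                (\<lambda>c d. ptensor R A B (a \<otimes>\<^bsub>A\<^esub> c) (b \<otimes>\<^bsub>B\<^esub> d)) t) s),
       monoid.one := ptensor R A B \<one>\<^bsub>A\<^esub> \<one>\<^bsub>B\<^esub>\<rparr>)"


section \<open>Algebras, bialgebras and Hopf algebras\<close>

text \<open>The locale \<^locale>\<open>algebra\<close> only covers commutative algebras.\<close>

definition assoc_algebra :: "('r, 'z) ring_scheme \<Rightarrow> ('r, 'a, 'u) module_scheme \<Rightarrow> bool" where
  "assoc_algebra R A \<longleftrightarrow> module R A \<and> ring A \<and>
     (\<forall>r\<in>carrier R. \<forall>x\<in>carrier A. \<forall>y\<in>carrier A.
        (r \<odot>\<^bsub>A\<^esub> x) \<otimes>\<^bsub>A\<^esub> y = r \<odot>\<^bsub>A\<^esub> (x \<otimes>\<^bsub>A\<^esub> y) \<and>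
        x \<otimes>\<^bsub>A\<^esub> (r \<odot>\<^bsub>A\<^esub> y) = r \<odot>\<^bsub>A\<^esub> (x \<otimes>\<^bsub>A\<^esub> y))"

definition alg_hom ::
  "('r, 'z) ring_scheme \<Rightarrow> ('r, 'a, 'u) module_scheme \<Rightarrow> ('r, 'b, 'v) module_scheme \<Rightarrow> ('a \<Rightarrow> 'b) set" where
  "alg_hom R A B = ring_hom A B \<inter> lin_map R A B"

record ('r, 'a) bialg = "('r, 'a) module" +
  comult :: "'a \<Rightarrow> ('a \<times> 'a \<Rightarrow> 'r) set"
  counit :: "'a \<Rightarrow> 'r"

record ('r, 'a) hopf = "('r, 'a) bialg" +
  antipode :: "'a \<Rightarrow> 'a"

definition coalgebra :: "('r, 'z) ring_scheme \<Rightarrow> ('r, 'a, 'u) bialg_scheme \<Rightarrow> bool" where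
  "coalgebra R C \<longleftrightarrow> module R C \<and>
     comult C \<in> lin_map R C (tensor R C C) \<and> counit C \<in> lin_map R C (reg_mod R) \<and>
     (\<forall>c\<in>carrier C.
        tensor_assoc R C C C (tensor_map R (tensor R C C) C (comult C) id (comult C c)) =
          tensor_map R C (tensor R C C) id (comult C) (comult C c) \<and>
        tensor_sum R C (\<lambda>x y. counit C x \<odot>\<^bsub>C\<^esub> y) (comult C c) = c \<and>
        tensor_sum R C (\<lambda>x y. counit C y \<odot>\<^bsub>C\<^esub> x) (comult C c) = c)"

definition bialgebra :: "('r, 'z) ring_scheme \<Rightarrow> ('r, 'a, 'u) bialg_scheme \<Rightarrow> bool" where
  "bialgebra R H \<longleftrightarrow> assoc_algebra R H \<and> coalgebra R H \<and>
     comult H \<in> alg_hom R H (tensor_alg R H H) \<and> counit H \<in> alg_hom R H (reg_mod R)"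

definition hopf_algebra :: "('r, 'z) ring_scheme \<Rightarrow> ('r, 'a, 'u) hopf_scheme \<Rightarrow> bool" where
  "hopf_algebra R H \<longleftrightarrow> bialgebra R H \<and> antipode H \<in> lin_map R H H \<and>
     (\<forall>h\<in>carrier H.
        tensor_sum R H (\<lambda>x y. antipode H x \<otimes>\<^bsub>H\<^esub> y) (comult H h) = counit H h \<odot>\<^bsub>H\<^esub> \<one>\<^bsub>H\<^esub> \<and>
        tensor_sum R H (\<lambda>x y. x \<otimes>\<^bsub>H\<^esub> antipode H y) (comult H h) = counit H h \<odot>\<^bsub>H\<^esub> \<one>\<^bsub>H\<^esub>)"

definition commutative :: "('a, 'u) monoid_scheme \<Rightarrow> bool" where
  "commutative A \<longleftrightarrow> (\<forall>x\<in>carrier A. \<forall>y\<in>carrier A. x \<otimes>\<^bsub>A\<^esub> y = y \<otimes>\<^bsub>A\<^esub> x)"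

definition cocommutative :: "('r, 'z) ring_scheme \<Rightarrow> ('r, 'a, 'u) bialg_scheme \<Rightarrow> bool" where
  "cocommutative R C \<longleftrightarrow> (\<forall>c\<in>carrier C. tensor_flip R C C (comult C c) = comult C c)"

definition bialg_hom ::
  "('r, 'z) ring_scheme \<Rightarrow> ('r, 'a, 'u) bialg_scheme \<Rightarrow> ('r, 'b, 'v) bialg_scheme \<Rightarrow> ('a \<Rightarrow> 'b) set" where
  "bialg_hom R H K = {f \<in> alg_hom R H K \<inter> extensional (carrier H).
     \<forall>h\<in>carrier H. comult K (f h) = tensor_map R K K f f (comult H h) \<and>
                   counit K (f h) = counit H h}"

definition hopf_hom ::
  "('r, 'z) ring_scheme \<Rightarrow> ('r, 'a, 'u) hopf_scheme \<Rightarrow> ('r, 'b, 'v) hopf_scheme \<Rightarrow> ('a \<Rightarrow> 'b) set" where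
  "hopf_hom R H K = {f \<in> bialg_hom R H K. \<forall>h\<in>carrier H. f (antipode H h) = antipode K (f h)}"


section \<open>Duals\<close>

definition dual_mod :: "('r, 'z) ring_scheme \<Rightarrow> ('r, 'm, 'u) module_scheme \<Rightarrow> ('r, 'm \<Rightarrow> 'r) module" where
  "dual_mod R M = \<lparr>carrier = Hom_mod R M (reg_mod R), monoid.mult = undefined, monoid.one = undefined,
     ring.zero = (\<lambda>x\<in>carrier M. \<zero>\<^bsub>R\<^esub>), ring.add = (\<lambda>f g. \<lambda>x\<in>carrier M. f x \<oplus>\<^bsub>R\<^esub> g x),
     smult = (\<lambda>r f. \<lambda>x\<in>carrier M. r \<otimes>\<^bsub>R\<^esub> f x)\<rparr>"

text \<open>The dual of a coalgebra with the convolution product.\<close>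

definition conv_dual :: "('r, 'z) ring_scheme \<Rightarrow> ('r, 'a, 'u) bialg_scheme \<Rightarrow> ('r, 'a \<Rightarrow> 'r) module" where
  "conv_dual R C = (dual_mod R C)\<lparr>
     monoid.mult := (\<lambda>f g. \<lambda>x\<in>carrier C. tensor_sum R (reg_mod R) (\<lambda>a b. f a \<otimes>\<^bsub>R\<^esub> g b) (comult C x)),
     monoid.one := (\<lambda>x\<in>carrier C. counit C x)\<rparr>"

definition cofinite_ideal :: "('r, 'z) ring_scheme \<Rightarrow> ('r, 'a, 'u) module_scheme \<Rightarrow> 'a set \<Rightarrow> bool" where
  "cofinite_ideal R A I \<longleftrightarrow> ideal I A \<and> fin_gen_mod R (quot_mod A I)"

definition fin_dual_set :: "('r, 'z) ring_scheme \<Rightarrow> ('r, 'a, 'u) module_scheme \<Rightarrow> ('a \<Rightarrow> 'r) set" where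
  "fin_dual_set R A = {f \<in> Hom_mod R A (reg_mod R).
     \<exists>I. cofinite_ideal R A I \<and> (\<forall>x\<in>I. f x = \<zero>\<^bsub>R\<^esub>)}"

definition fin_dual_mod :: "('r, 'z) ring_scheme \<Rightarrow> ('r, 'a, 'u) module_scheme \<Rightarrow> ('r, 'a \<Rightarrow> 'r) module" where
  "fin_dual_mod R A = (dual_mod R A)\<lparr>carrier := fin_dual_set R A\<rparr>"

text \<open>\<open>t = \<Sum> f\<^sub>1 \<otimes> f\<^sub>2\<close> satisfies \<open>f (h h') = \<Sum> f\<^sub>1 h f\<^sub>2 h'\<close> for all \<open>h, h'\<close>.\<close>

definition is_dual_comult ::
  "('r, 'z) ring_scheme \<Rightarrow> ('r, 'a, 'u) module_scheme \<Rightarrow> ('a \<Rightarrow> 'r) \<Rightarrow>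
   (('a \<Rightarrow> 'r) \<times> ('a \<Rightarrow> 'r) \<Rightarrow> 'r) set \<Rightarrow> bool" where
  "is_dual_comult R A f t \<longleftrightarrow>
     t \<in> carrier (tensor R (fin_dual_mod R A) (fin_dual_mod R A)) \<and>
     (\<forall>h\<in>carrier A. \<forall>h'\<in>carrier A.
        f (h \<otimes>\<^bsub>A\<^esub> h') = tensor_sum R (reg_mod R) (\<lambda>p q. p h \<otimes>\<^bsub>R\<^esub> q h') t)"

text \<open>The definite description in \<open>fin_dual\<close> is meaningful if \<open>dual_comult_determined\<close> holds.\<close>

definition dual_comult_determined :: "('r, 'z) ring_scheme \<Rightarrow> ('r, 'a, 'u) module_scheme \<Rightarrow> bool" where
  "dual_comult_determined R A \<longleftrightarrow> (\<forall>f\<in>fin_dual_set R A. \<exists>!t. is_dual_comult R A f t)"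

definition fin_dual :: "('r, 'z) ring_scheme \<Rightarrow> ('r, 'a, 'u) bialg_scheme \<Rightarrow> ('r, 'a \<Rightarrow> 'r) bialg" where
  "fin_dual R H = \<lparr>carrier = fin_dual_set R H,
     monoid.mult = monoid.mult (conv_dual R H), monoid.one = monoid.one (conv_dual R H),
     ring.zero = ring.zero (conv_dual R H), ring.add = ring.add (conv_dual R H),
     smult = smult (conv_dual R H),
     comult = (\<lambda>f. THE t. is_dual_comult R H f t),
     counit = (\<lambda>f. f \<one>\<^bsub>H\<^esub>)\<rparr>"

definition hopf_dual :: "('r, 'z) ring_scheme \<Rightarrow> ('r, 'a, 'u) hopf_scheme \<Rightarrow> ('r, 'a \<Rightarrow> 'r) hopf" where
  "hopf_dual R H = bialg.extend (fin_dual R H)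
     (hopf.fields (\<lambda>f. \<lambda>h\<in>carrier H. f (antipode H h)))"

definition dual_map ::
  "('r, 'z) ring_scheme \<Rightarrow> ('r, 'a, 'u) module_scheme \<Rightarrow> ('r, 'b, 'v) module_scheme \<Rightarrow>
   ('a \<Rightarrow> 'b) \<Rightarrow> ('b \<Rightarrow> 'r) \<Rightarrow> 'a \<Rightarrow> 'r" where
  "dual_map R H K u = (\<lambda>g\<in>fin_dual_set R K. \<lambda>h\<in>carrier H. g (u h))"


section \<open>The alpha-condition and pairings\<close>

text \<open>HOL cannot quantify over all modules on all types inside a formula, so the type \<open>'m\<close> that
  carries the test modules \<open>M\<close> is an explicit parameter. Every finitely generated module is
  isomorphic to one on the type \<^typ>\<open>(nat \<Rightarrow> 'r) set\<close>, namely to a quotient of some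
  \<^term>\<open>free_mod R {..<n::nat}\<close>. An element of \<open>M \<otimes> W\<close> that is mapped to \<open>0\<close> comes from an
  element of \<open>M' \<otimes> W\<close> mapped to \<open>0\<close> for a finitely generated submodule \<open>M'\<close> of \<open>M\<close>; hence
  the condition for that type implies the condition for every type.\<close>

definition alpha_condition ::
  "'m itself \<Rightarrow> ('r, 'z) ring_scheme \<Rightarrow> ('r, 'v, 's) module_scheme \<Rightarrow> ('r, 'w, 't) module_scheme \<Rightarrow>
   ('v \<Rightarrow> 'w \<Rightarrow> 'r) \<Rightarrow> bool" where
  "alpha_condition (U :: 'm itself) R V W form \<longleftrightarrow>
     (\<forall>M :: ('r, 'm) module. module R M \<longrightarrow>
        inj_on (\<lambda>t. \<lambda>v\<in>carrier V. tensor_sum R M (\<lambda>m w. form v w \<odot>\<^bsub>M\<^esub> m) t)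
          (carrier (tensor R M W)))"

definition alpha_algebra :: "'m itself \<Rightarrow> ('r, 'z) ring_scheme \<Rightarrow> ('r, 'a, 'u) module_scheme \<Rightarrow> bool" where
  "alpha_algebra U R A \<longleftrightarrow> assoc_algebra R A \<and>
     (\<exists>I. cofinite_ideal R A I) \<and>
     (\<forall>I J. cofinite_ideal R A I \<and> cofinite_ideal R A J \<longrightarrow> cofinite_ideal R A (I \<inter> J)) \<and>
     (\<forall>I J. cofinite_ideal R A I \<and> ideal J A \<and> I \<subseteq> J \<longrightarrow> cofinite_ideal R A J) \<and>
     alpha_condition U R A (fin_dual_mod R A) (\<lambda>a f. f a)"

definition alpha_bialgebra :: "'m itself \<Rightarrow> ('r, 'z) ring_scheme \<Rightarrow> ('r, 'a, 'u) bialg_scheme \<Rightarrow> bool" where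
  "alpha_bialgebra U R H \<longleftrightarrow> bialgebra R H \<and> alpha_algebra U R H"

definition hopf_alpha_algebra :: "'m itself \<Rightarrow> ('r, 'z) ring_scheme \<Rightarrow> ('r, 'a, 'u) hopf_scheme \<Rightarrow> bool" where
  "hopf_alpha_algebra U R H \<longleftrightarrow> hopf_algebra R H \<and> alpha_algebra U R H"

definition bialgebra_alpha_pairing ::
  "'m itself \<Rightarrow> ('r, 'z) ring_scheme \<Rightarrow> ('r, 'a, 'u) bialg_scheme \<Rightarrow> ('r, 'b, 'v) bialg_scheme \<Rightarrow>
   ('a \<Rightarrow> 'b \<Rightarrow> 'r) \<Rightarrow> bool" where
  "bialgebra_alpha_pairing U R H K form \<longleftrightarrow> bialgebra R H \<and> bialgebra R K \<and>
     form \<in> bilin_map R H K (reg_mod R) \<and>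
     (\<lambda>h. \<lambda>k\<in>carrier K. form h k) \<in> alg_hom R H (conv_dual R K) \<and>
     (\<lambda>k. \<lambda>h\<in>carrier H. form h k) \<in> alg_hom R K (conv_dual R H) \<and>
     alpha_condition U R H K form"

definition hopf_alpha_pairing ::
  "'m itself \<Rightarrow> ('r, 'z) ring_scheme \<Rightarrow> ('r, 'a, 'u) hopf_scheme \<Rightarrow> ('r, 'b, 'v) hopf_scheme \<Rightarrow>
   ('a \<Rightarrow> 'b \<Rightarrow> 'r) \<Rightarrow> bool" where
  "hopf_alpha_pairing U R H K form \<longleftrightarrow> hopf_algebra R H \<and> hopf_algebra R K \<and>
     bialgebra_alpha_pairing U R H K form"


section \<open>Categories and contravariant functors\<close>

text \<open>A concrete category: the objects are structures with a carrier, the morphisms are extensional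
  functions, and identities and composition are those of functions. The carriers of all objects
  lie in one type, which plays the role of the universe. The dual of an object lives on another
  type, so a contravariant functor takes the category over one type to a category over
  another one.\<close>

record ('o, 'a) concrete_cat =
  Obj :: "'o set"
  Arr :: "'o \<Rightarrow> 'o \<Rightarrow> ('a \<Rightarrow> 'a) set"

definition Big :: "('r, 'z) ring_scheme \<Rightarrow> (('r, 'a) bialg, 'a) concrete_cat" where
  "Big R = \<lparr>Obj = {H. bialgebra R H}, Arr = bialg_hom R\<rparr>"

definition CBig :: "('r, 'z) ring_scheme \<Rightarrow> (('r, 'a) bialg, 'a) concrete_cat" where
  "CBig R = \<lparr>Obj = {H. bialgebra R H \<and> commutative H}, Arr = bialg_hom R\<rparr>"

definition CCBig :: "('r, 'z) ring_scheme \<Rightarrow> (('r, 'a) bialg, 'a) concrete_cat" where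
  "CCBig R = \<lparr>Obj = {H. bialgebra R H \<and> cocommutative R H}, Arr = bialg_hom R\<rparr>"

definition Hopf :: "('r, 'z) ring_scheme \<Rightarrow> (('r, 'a) hopf, 'a) concrete_cat" where
  "Hopf R = \<lparr>Obj = {H. hopf_algebra R H}, Arr = hopf_hom R\<rparr>"

definition CHopf :: "('r, 'z) ring_scheme \<Rightarrow> (('r, 'a) hopf, 'a) concrete_cat" where
  "CHopf R = \<lparr>Obj = {H. hopf_algebra R H \<and> commutative H}, Arr = hopf_hom R\<rparr>"

definition CCHopf :: "('r, 'z) ring_scheme \<Rightarrow> (('r, 'a) hopf, 'a) concrete_cat" where
  "CCHopf R = \<lparr>Obj = {H. hopf_algebra R H \<and> cocommutative R H}, Arr = hopf_hom R\<rparr>"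

definition contravariant_functor ::
  "(('a, 'u) partial_object_scheme, 'a) concrete_cat \<Rightarrow>
   (('b, 'v) partial_object_scheme, 'b) concrete_cat \<Rightarrow>
   (('a, 'u) partial_object_scheme \<Rightarrow> ('b, 'v) partial_object_scheme) \<Rightarrow>
   (('a, 'u) partial_object_scheme \<Rightarrow> ('a, 'u) partial_object_scheme \<Rightarrow> ('a \<Rightarrow> 'a) \<Rightarrow> 'b \<Rightarrow> 'b) \<Rightarrow> bool" where
  "contravariant_functor C D F Fm \<longleftrightarrow>
     (\<forall>H\<in>Obj C. F H \<in> Obj D) \<and>
     (\<forall>H\<in>Obj C. \<forall>K\<in>Obj C. \<forall>u\<in>Arr C H K. Fm H K u \<in> Arr D (F K) (F H)) \<and>
     (\<forall>H\<in>Obj C. Fm H H (\<lambda>x\<in>carrier H. x) = (\<lambda>y\<in>carrier (F H). y)) \<and>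
     (\<forall>H\<in>Obj C. \<forall>K\<in>Obj C. \<forall>L\<in>Obj C. \<forall>u\<in>Arr C H K. \<forall>v\<in>Arr C K L.
        Fm H L (compose (carrier H) v u) = compose (carrier (F L)) (Fm H K u) (Fm K L v))"

text \<open>Adjointness of contravariant functors \<open>F\<close> on \<open>C\<close> and \<open>G\<close> on \<open>D\<close>: a bijection between the
  morphisms \<open>H \<rightarrow> G K\<close> and \<open>K \<rightarrow> F H\<close>, natural in \<open>H\<close> and \<open>K\<close>. As \<open>H\<close> and \<open>G K\<close> live
  on different types, the two sets of morphisms are separate arguments \<open>hG\<close> and \<open>hF\<close>.\<close>

definition contravariant_adjoint ::
  "(('a, 'u) partial_object_scheme, 'a) concrete_cat \<Rightarrow>
   (('b, 'v) partial_object_scheme, 'b) concrete_cat \<Rightarrow>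
   (('a, 'u) partial_object_scheme \<Rightarrow> ('c, 'w) partial_object_scheme) \<Rightarrow>
   (('a, 'u) partial_object_scheme \<Rightarrow> ('a, 'u) partial_object_scheme \<Rightarrow> ('a \<Rightarrow> 'a) \<Rightarrow> 'c \<Rightarrow> 'c) \<Rightarrow>
   (('b, 'v) partial_object_scheme \<Rightarrow> ('d, 'x) partial_object_scheme) \<Rightarrow>
   (('b, 'v) partial_object_scheme \<Rightarrow> ('b, 'v) partial_object_scheme \<Rightarrow> ('b \<Rightarrow> 'b) \<Rightarrow> 'd \<Rightarrow> 'd) \<Rightarrow>
   (('a, 'u) partial_object_scheme \<Rightarrow> ('d, 'x) partial_object_scheme \<Rightarrow> ('a \<Rightarrow> 'd) set) \<Rightarrow>
   (('b, 'v) partial_object_scheme \<Rightarrow> ('c, 'w) partial_object_scheme \<Rightarrow> ('b \<Rightarrow> 'c) set) \<Rightarrow> bool" where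
  "contravariant_adjoint C D F Fm G Gm hG hF \<longleftrightarrow>
     (\<exists>\<Phi>. (\<forall>H\<in>Obj C. \<forall>K\<in>Obj D. bij_betw (\<Phi> H K) (hG H (G K)) (hF K (F H))) \<and>
        (\<forall>H'\<in>Obj C. \<forall>H\<in>Obj C. \<forall>K\<in>Obj D. \<forall>u\<in>Arr C H' H. \<forall>f\<in>hG H (G K).
           \<Phi> H' K (compose (carrier H') f u) = compose (carrier K) (Fm H' H u) (\<Phi> H K f)) \<and>
        (\<forall>H\<in>Obj C. \<forall>K'\<in>Obj D. \<forall>K\<in>Obj D. \<forall>v\<in>Arr D K' K. \<forall>f\<in>hG H (G K).
           \<Phi> H K' (compose (carrier H) (Gm K' K v) f) = compose (carrier K') (\<Phi> H K f) v))"

end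

theory Submission
  imports Defs
begin

text \<open>
Write \<open>H\<^sup>\<circ>\<close> for the finite dual of \<open>H\<close>. Everything rests on comparing elements of \<open>H\<^sup>\<circ> \<otimes> H\<^sup>\<circ>\<close> with
functions on \<open>H \<times> H\<close>: once a tensor in \<open>H\<^sup>\<circ> \<otimes> H\<^sup>\<circ>\<close> or \<open>H\<^sup>\<circ> \<otimes> (H\<^sup>\<circ> \<otimes> H\<^sup>\<circ>)\<close> is determined by its values, the
axioms of the dual structure are equalities of functions and follow by transposing the axioms of \<open>H\<close>.

The alpha-condition gives this comparison. It is used in a form without tensor products
(\<open>pairing_factors\<close>): if \<open>w\<^sub>1, \<dots>, w\<^sub>n \<in> W\<close> and a submodule \<open>N \<subseteq> R\<^sup>n\<close> contains all the vectors
\<open>(\<langle>v, w\<^sub>i\<rangle>)\<^sub>i\<close>, then \<open>w\<^sub>i = \<Sum>\<^sub>j c\<^sub>j(i) u\<^sub>j\<close> with \<open>c\<^sub>j \<in> N\<close> and \<open>u\<^sub>j \<in> W\<close>. The alpha-condition for the single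
module \<open>R\<^sup>n/N\<close> yields this form (\<open>alpha_condition_imp_factors\<close>). Conversely, taking for \<open>N\<close> the relations between
\<open>m\<^sub>1, \<dots>, m\<^sub>n\<close> in an arbitrary module shows that a tensor \<open>\<Sum> m\<^sub>i \<otimes> w\<^sub>i\<close> with \<open>\<Sum> \<langle>v, w\<^sub>i\<rangle> m\<^sub>i = 0\<close> for all \<open>v\<close>
vanishes (\<open>pairing_factors_zero\<close>). This is uniqueness of the comultiplication. For existence, let
\<open>f \<in> H\<^sup>\<circ>\<close> vanish on a cofinite ideal \<open>I\<close>, let \<open>s\<^sub>1, \<dots>, s\<^sub>n\<close> generate \<open>H\<close> modulo \<open>I\<close>, and apply the property to
\<open>w\<^sub>i: x \<mapsto> f(x s\<^sub>i)\<close> and to those \<open>c\<close> for which \<open>\<Sum> c\<^sub>i r\<^sub>i \<in> H\<^sup>\<circ>\<close>, where \<open>r\<^sub>i\<close> are coordinate functions for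
the \<open>s\<^sub>i\<close>; the result is \<open>f(x y) = \<Sum> u\<^sub>k(x) g\<^sub>k(y)\<close> with all \<open>u\<^sub>k, g\<^sub>k \<in> H\<^sup>\<circ>\<close> (\<open>K_decomp2\<close>).

The less obvious memberships in \<open>H\<^sup>\<circ>\<close> follow from \<open>K_memI_detect\<close>: since \<open>R\<close> is Noetherian, it is enough
that finitely many linear functionals detect for which \<open>y\<close> a functional \<open>f\<close> vanishes on \<open>H y H\<close>. Threefold decompositions \<open>f(x y z) = \<Sum> f\<^sub>1(x) f\<^sub>2(y) f\<^sub>3(z)\<close> provide such
functionals for convolution products \<open>f * g\<close>, and iterated comultiplications provide them for the
functionals \<open>h \<mapsto> f(h)(k)\<close> that belong to a morphism \<open>f: H \<rightarrow> K\<^sup>\<circ>\<close>. The latter is the point of the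
adjunction, whose bijection exchanges the two arguments of \<open>f\<close>. For the antipode one needs that
\<open>S\<close> reverses products, which holds because \<open>S(x y)\<close> is a left and \<open>S(y) S(x)\<close> a right convolution inverse of the
multiplication.

Over a hereditary Noetherian ring \<open>pairing_factors\<close> holds for every algebra: the image of \<open>H\<close> in \<open>R\<^sup>n\<close> under
\<open>(w\<^sub>1, \<dots>, w\<^sub>n)\<close> is finitely generated and projective, so it has a finite dual basis, and the \<open>w\<^sub>i\<close> factor
through it (\<open>functionals_dual_basis\<close>, \<open>hereditary_pairing_factors\<close>).
\<close>

section \<open>Finite sums along lists\<close>

text \<open>Tensors are represented by lists of pairs, and Sweedler sums are nested sums in which the inner list depends on the
outer summation variable. Lists need no bookkeeping of multiplicities, which sums over sets would require.\<close>

definition lsum :: "('b, 'u) ring_scheme \<Rightarrow> ('x \<Rightarrow> 'b) \<Rightarrow> 'x list \<Rightarrow> 'b" where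
  "lsum M f xs = foldr (\<lambda>x s. f x \<oplus>\<^bsub>M\<^esub> s) xs \<zero>\<^bsub>M\<^esub>"

lemma lsum_simps [simp]:
  "lsum M f [] = \<zero>\<^bsub>M\<^esub>" "lsum M f (x # xs) = f x \<oplus>\<^bsub>M\<^esub> lsum M f xs"
  by (simp_all add: lsum_def)

lemma lsum_cong [fundef_cong]:
  assumes "xs = ys" "\<And>x. x \<in> set ys \<Longrightarrow> f x = g x"
  shows "lsum M f xs = lsum M g ys"
proof -
  have "(\<And>x. x \<in> set ys \<Longrightarrow> f x = g x) \<Longrightarrow> lsum M f ys = lsum M g ys"
    by (induction ys) auto
  then show ?thesis using assms by simp
qed

lemma lsum_map: "lsum M f (map g xs) = lsum M (\<lambda>x. f (g x)) xs"
  by (induction xs) auto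

context abelian_monoid
begin

lemma lsum_closed [simp, intro]:
  "(\<And>x. x \<in> set xs \<Longrightarrow> f x \<in> carrier G) \<Longrightarrow> lsum G f xs \<in> carrier G"
  by (induction xs) auto

lemma lsum_append:
  assumes "\<And>x. x \<in> set xs \<Longrightarrow> f x \<in> carrier G" "\<And>x. x \<in> set ys \<Longrightarrow> f x \<in> carrier G"
  shows "lsum G f (xs @ ys) = lsum G f xs \<oplus> lsum G f ys"
  using assms by (induction xs) (auto simp: a_assoc)

lemma lsum_concat:
  assumes "\<And>x y. x \<in> set xs \<Longrightarrow> y \<in> set (g x) \<Longrightarrow> f y \<in> carrier G"
  shows "lsum G f (concat (map g xs)) = lsum G (\<lambda>x. lsum G f (g x)) xs"
  using assms
proof (induction xs)
  case (Cons a xs)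
  have "lsum G f (concat (map g xs)) = lsum G (\<lambda>x. lsum G f (g x)) xs"
    using Cons.IH Cons.prems by (metis list.set_intros(2))
  moreover have "f y \<in> carrier G" if "y \<in> set (g a)" for y
    using Cons.prems[of a] that by simp
  moreover have "f y \<in> carrier G" if "y \<in> set (concat (map g xs))" for y
    using Cons.prems that by auto
  ultimately show ?case using lsum_append[of "g a" f "concat (map g xs)"] by auto
qed simp

lemma lsum_add:
  assumes "\<And>x. x \<in> set xs \<Longrightarrow> f x \<in> carrier G" "\<And>x. x \<in> set xs \<Longrightarrow> g x \<in> carrier G"
  shows "lsum G (\<lambda>x. f x \<oplus> g x) xs = lsum G f xs \<oplus> lsum G g xs"
  using assms by (induction xs) (auto simp: a_ac)

lemma lsum_zero: "(\<And>x. x \<in> set xs \<Longrightarrow> f x = \<zero>) \<Longrightarrow> lsum G f xs = \<zero>"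
  by (induction xs) auto

lemma lsum_swap:
  assumes "\<And>x y. x \<in> set xs \<Longrightarrow> y \<in> set ys \<Longrightarrow> f x y \<in> carrier G"
  shows "lsum G (\<lambda>x. lsum G (f x) ys) xs = lsum G (\<lambda>y. lsum G (\<lambda>x. f x y) xs) ys"
  using assms by (induction xs) (auto simp: lsum_zero lsum_add)

lemma finsum_eq_lsum:
  assumes "distinct xs" "\<And>x. x \<in> set xs \<Longrightarrow> f x \<in> carrier G"
  shows "finsum G f (set xs) = lsum G f xs"
  using assms by (induction xs) (auto simp: Pi_def)

lemma lsum_filter:
  assumes "\<And>x. x \<in> set xs \<Longrightarrow> f x \<in> carrier G" "\<And>x. x \<in> set xs \<Longrightarrow> \<not> P x \<Longrightarrow> f x = \<zero>"
  shows "lsum G f (filter P xs) = lsum G f xs"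
  using assms by (induction xs) auto

lemma lsum_single:
  assumes "distinct xs" "x \<in> set xs" "f x \<in> carrier G" "\<And>y. y \<in> set xs \<Longrightarrow> y \<noteq> x \<Longrightarrow> f y = \<zero>"
  shows "lsum G f xs = f x"
  using assms
proof (induction xs)
  case (Cons a xs)
  show ?case
  proof (cases "a = x")
    case True
    then have "lsum G f xs = \<zero>" using Cons.prems by (intro lsum_zero) auto
    then show ?thesis using True Cons.prems by simp
  next
    case False
    then have "lsum G f xs = f x" using Cons by auto
    then show ?thesis using False Cons.prems by simp
  qed
qed simp

lemma lsum_rotate:
  assumes "\<And>x y z. x \<in> set xs \<Longrightarrow> y \<in> set ys \<Longrightarrow> z \<in> set zs \<Longrightarrow> f x y z \<in> carrier G"
  shows "lsum G (\<lambda>x. lsum G (\<lambda>y. lsum G (f x y) zs) ys) xs = lsum G (\<lambda>y. lsum G (\<lambda>z. lsum G (\<lambda>x. f x y z) xs) zs) ys"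
proof -
  have "lsum G (\<lambda>x. lsum G (\<lambda>y. lsum G (f x y) zs) ys) xs = lsum G (\<lambda>y. lsum G (\<lambda>x. lsum G (f x y) zs) xs) ys"
    using assms by (intro lsum_swap) auto
  also have "\<dots> = lsum G (\<lambda>y. lsum G (\<lambda>z. lsum G (\<lambda>x. f x y z) xs) zs) ys"
    using assms by (intro lsum_cong refl lsum_swap) auto
  finally show ?thesis .
qed

lemma lsum_swap_pairs:
  assumes "\<And>u v p q. u \<in> set us \<Longrightarrow> v \<in> set vs \<Longrightarrow> p \<in> set ps \<Longrightarrow> q \<in> set qs \<Longrightarrow> f u v p q \<in> carrier G"
  shows "lsum G (\<lambda>u. lsum G (\<lambda>v. lsum G (\<lambda>p. lsum G (f u v p) qs) ps) vs) us =
    lsum G (\<lambda>p. lsum G (\<lambda>q. lsum G (\<lambda>u. lsum G (\<lambda>v. f u v p q) vs) us) qs) ps"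
proof -
  have "lsum G (\<lambda>u. lsum G (\<lambda>v. lsum G (\<lambda>p. lsum G (f u v p) qs) ps) vs) us =
      lsum G (\<lambda>u. lsum G (\<lambda>p. lsum G (\<lambda>q. lsum G (\<lambda>v. f u v p q) vs) qs) ps) us"
    using assms by (intro lsum_cong refl lsum_rotate) auto
  also have "\<dots> = lsum G (\<lambda>p. lsum G (\<lambda>q. lsum G (\<lambda>u. lsum G (\<lambda>v. f u v p q) vs) us) qs) ps"
    using assms by (intro lsum_rotate) auto
  finally show ?thesis .
qed

end

lemma (in module) smult_lsum:
  assumes "a \<in> carrier R" "\<And>x. x \<in> set xs \<Longrightarrow> f x \<in> carrier M"
  shows "a \<odot>\<^bsub>M\<^esub> lsum M f xs = lsum M (\<lambda>x. a \<odot>\<^bsub>M\<^esub> f x) xs"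
  using assms by (induction xs) (auto simp: smult_r_distr)

lemma (in module) smult_left_commute:
  assumes "a \<in> carrier R" "b \<in> carrier R" "x \<in> carrier M"
  shows "a \<odot>\<^bsub>M\<^esub> (b \<odot>\<^bsub>M\<^esub> x) = b \<odot>\<^bsub>M\<^esub> (a \<odot>\<^bsub>M\<^esub> x)"
  using assms by (simp add: smult_assoc1[symmetric] m_comm)

lemma (in ring) lsum_rdistr:
  assumes "a \<in> carrier R" "\<And>x. x \<in> set xs \<Longrightarrow> f x \<in> carrier R"
  shows "a \<otimes> lsum R f xs = lsum R (\<lambda>x. a \<otimes> f x) xs"
  using assms by (induction xs) (auto simp: r_distr)

lemma (in ring) lsum_ldistr:
  assumes "a \<in> carrier R" "\<And>x. x \<in> set xs \<Longrightarrow> f x \<in> carrier R"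
  shows "lsum R f xs \<otimes> a = lsum R (\<lambda>x. f x \<otimes> a) xs"
  using assms by (induction xs) (auto simp: l_distr)


lemma (in ring) lsum_mult_lsum:
  assumes "\<And>x. x \<in> set xs \<Longrightarrow> f x \<in> carrier R" "\<And>y. y \<in> set ys \<Longrightarrow> g y \<in> carrier R"
  shows "lsum R f xs \<otimes> lsum R g ys = lsum R (\<lambda>x. lsum R (\<lambda>y. f x \<otimes> g y) ys) xs"
  using assms by (subst lsum_ldistr) (auto intro!: lsum_cong simp: lsum_rdistr)

lemma (in abelian_group) diff_zero_imp_eq:
  assumes "x \<in> carrier G" "y \<in> carrier G" "x \<ominus> y = \<zero>"
  shows "x = y"
  using assms minus_equality[of x "\<ominus> y"] by (simp add: a_minus_def)


section \<open>Linear maps\<close>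

lemma lin_mapI:
  assumes "\<And>x. x \<in> carrier M \<Longrightarrow> f x \<in> carrier N"
    "\<And>x y. x \<in> carrier M \<Longrightarrow> y \<in> carrier M \<Longrightarrow> f (x \<oplus>\<^bsub>M\<^esub> y) = f x \<oplus>\<^bsub>N\<^esub> f y"
    "\<And>r x. r \<in> carrier R \<Longrightarrow> x \<in> carrier M \<Longrightarrow> f (r \<odot>\<^bsub>M\<^esub> x) = r \<odot>\<^bsub>N\<^esub> f x"
  shows "f \<in> lin_map R M N"
  using assms by (auto simp: lin_map_def)

lemma lin_mapD:
  assumes "f \<in> lin_map R M N"
  shows lin_map_closed: "\<And>x. x \<in> carrier M \<Longrightarrow> f x \<in> carrier N"
    and lin_map_add: "\<And>x y. x \<in> carrier M \<Longrightarrow> y \<in> carrier M \<Longrightarrow> f (x \<oplus>\<^bsub>M\<^esub> y) = f x \<oplus>\<^bsub>N\<^esub> f y"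
    and lin_map_smult: "\<And>r x. r \<in> carrier R \<Longrightarrow> x \<in> carrier M \<Longrightarrow> f (r \<odot>\<^bsub>M\<^esub> x) = r \<odot>\<^bsub>N\<^esub> f x"
  using assms by (auto simp: lin_map_def)

lemma bilin_mapI:
  assumes "\<And>x. x \<in> carrier M \<Longrightarrow> b x \<in> lin_map R N P"
    "\<And>y. y \<in> carrier N \<Longrightarrow> (\<lambda>x. b x y) \<in> lin_map R M P"
  shows "b \<in> bilin_map R M N P"
  using assms by (auto simp: bilin_map_def)

lemma bilin_mapD:
  assumes "b \<in> bilin_map R M N P"
  shows bilin_map_right: "\<And>x. x \<in> carrier M \<Longrightarrow> b x \<in> lin_map R N P"
    and bilin_map_left: "\<And>y. y \<in> carrier N \<Longrightarrow> (\<lambda>x. b x y) \<in> lin_map R M P"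
    and bilin_map_closed: "\<And>x y. x \<in> carrier M \<Longrightarrow> y \<in> carrier N \<Longrightarrow> b x y \<in> carrier P"
  using assms by (auto simp: bilin_map_def lin_map_def)

lemma lin_map_zero:
  assumes "module R M" "module R N" "f \<in> lin_map R M N"
  shows "f \<zero>\<^bsub>M\<^esub> = \<zero>\<^bsub>N\<^esub>"
proof -
  interpret M: module R M by fact
  interpret N: module R N by fact
  have "f \<zero>\<^bsub>M\<^esub> = f (\<zero>\<^bsub>R\<^esub> \<odot>\<^bsub>M\<^esub> \<zero>\<^bsub>M\<^esub>)" by simp
  also have "\<dots> = \<zero>\<^bsub>N\<^esub>" using lin_mapD[OF assms(3)] by (simp del: M.smult_l_null M.smult_r_null)
  finally show ?thesis .
qed

lemma lin_map_minus:
  assumes "module R M" "module R N" "f \<in> lin_map R M N" "x \<in> carrier M"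
  shows "f (\<ominus>\<^bsub>M\<^esub> x) = \<ominus>\<^bsub>N\<^esub> f x"
proof -
  interpret M: module R M by fact
  interpret N: module R N by fact
  note f = lin_mapD[OF assms(3)]
  have "f (\<ominus>\<^bsub>M\<^esub> x) \<oplus>\<^bsub>N\<^esub> f x = f (\<ominus>\<^bsub>M\<^esub> x \<oplus>\<^bsub>M\<^esub> x)"
    using assms(4) f by simp
  also have "\<dots> = \<zero>\<^bsub>N\<^esub>" using assms lin_map_zero by (simp add: M.l_neg)
  finally show ?thesis using assms(4) f by (simp add: N.minus_equality)
qed

lemma lin_map_diff:
  assumes "module R M" "module R N" "f \<in> lin_map R M N" "x \<in> carrier M" "y \<in> carrier M"
  shows "f (x \<ominus>\<^bsub>M\<^esub> y) = f x \<ominus>\<^bsub>N\<^esub> f y"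
proof -
  interpret M: module R M by fact
  interpret N: module R N by fact
  show ?thesis using assms by (simp add: a_minus_def lin_mapD lin_map_minus)
qed

lemma lin_map_lsum:
  assumes "module R M" "module R N" "f \<in> lin_map R M N" "\<And>x. x \<in> set xs \<Longrightarrow> g x \<in> carrier M"
  shows "f (lsum M g xs) = lsum N (\<lambda>x. f (g x)) xs"
proof -
  interpret M: module R M by fact
  interpret N: module R N by fact
  show ?thesis using assms(4)
    by (induction xs) (auto simp: lin_map_zero[OF assms(1-3)] lin_mapD[OF assms(3)])
qed

lemma lin_map_comp:
  assumes "f \<in> lin_map R M N" "g \<in> lin_map R N P"
  shows "(\<lambda>x. g (f x)) \<in> lin_map R M P"
  using lin_mapD[OF assms(1)] lin_mapD[OF assms(2)] by (auto intro!: lin_mapI)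

lemma lin_map_id: "id \<in> lin_map R M M" "(\<lambda>x. x) \<in> lin_map R M M"
  by (auto intro!: lin_mapI)

lemma lin_map_cong:
  assumes "module R M" "\<And>x. x \<in> carrier M \<Longrightarrow> f x = g x"
  shows "f \<in> lin_map R M N \<longleftrightarrow> g \<in> lin_map R M N"
proof -
  interpret M: module R M by fact
  show ?thesis using assms(2) by (auto simp: lin_map_def Pi_def)
qed

lemma lin_map_lsum_fun:
  assumes "module R N" "\<And>i. i \<in> set xs \<Longrightarrow> f i \<in> lin_map R M N"
  shows "(\<lambda>x. lsum N (\<lambda>i. f i x) xs) \<in> lin_map R M N"
proof -
  interpret N: module R N by fact
  show ?thesis
  proof (rule lin_mapI)
    fix x y assume "x \<in> carrier M" "y \<in> carrier M"
    then show "lsum N (\<lambda>i. f i (x \<oplus>\<^bsub>M\<^esub> y)) xs = lsum N (\<lambda>i. f i x) xs \<oplus>\<^bsub>N\<^esub> lsum N (\<lambda>i. f i y) xs"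
      using assms(2) by (subst N.lsum_add[symmetric]) (auto intro!: lsum_cong dest: lin_mapD)
  next
    fix r x assume "r \<in> carrier R" "x \<in> carrier M"
    then show "lsum N (\<lambda>i. f i (r \<odot>\<^bsub>M\<^esub> x)) xs = r \<odot>\<^bsub>N\<^esub> lsum N (\<lambda>i. f i x) xs"
      using assms(2) by (subst N.smult_lsum) (auto intro!: lsum_cong dest: lin_mapD)
  qed (use assms(2) in \<open>auto dest: lin_mapD\<close>)
qed

lemma bilin_map_lsum_left:
  assumes "module R M" "module R P" "b \<in> bilin_map R M N P"
    "\<And>i. i \<in> set xs \<Longrightarrow> x i \<in> carrier M" "y \<in> carrier N"
  shows "b (lsum M x xs) y = lsum P (\<lambda>i. b (x i) y) xs"
  using lin_map_lsum[OF assms(1,2) bilin_map_left[OF assms(3,5)], of xs x] assms(4) by simp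

lemma bilin_map_lsum_right:
  assumes "module R N" "module R P" "b \<in> bilin_map R M N P"
    "\<And>i. i \<in> set xs \<Longrightarrow> y i \<in> carrier N" "x \<in> carrier M"
  shows "b x (lsum N y xs) = lsum P (\<lambda>i. b x (y i)) xs"
  using lin_map_lsum[OF assms(1,2) bilin_map_right[OF assms(3,5)], of xs y] assms(4) by simp


section \<open>The regular module and submodules\<close>

lemma reg_mod_simps [simp]:
  "carrier (reg_mod R) = carrier R" "\<zero>\<^bsub>reg_mod R\<^esub> = \<zero>\<^bsub>R\<^esub>" "\<one>\<^bsub>reg_mod R\<^esub> = \<one>\<^bsub>R\<^esub>"
  "x \<oplus>\<^bsub>reg_mod R\<^esub> y = x \<oplus>\<^bsub>R\<^esub> y" "x \<otimes>\<^bsub>reg_mod R\<^esub> y = x \<otimes>\<^bsub>R\<^esub> y" "x \<odot>\<^bsub>reg_mod R\<^esub> y = x \<otimes>\<^bsub>R\<^esub> y"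
  by (simp_all add: reg_mod_def)

lemma lsum_reg_mod [simp]: "lsum (reg_mod R) f xs = lsum R f xs"
  by (induction xs) auto

lemma (in cring) module_reg_mod: "module R (reg_mod R)"
proof (rule moduleI)
  show "abelian_group (reg_mod R)"
    by (rule abelian_groupI) (auto simp: a_ac intro: l_neg)
qed (auto simp: l_distr r_distr m_assoc is_cring)

lemma a_inv_reg_mod [simp]: "a_inv (reg_mod R) x = a_inv R x"
  by (simp add: a_inv_def m_inv_def)

lemma a_minus_reg_mod [simp]: "x \<ominus>\<^bsub>reg_mod R\<^esub> y = x \<ominus>\<^bsub>R\<^esub> y"
  by (simp add: a_minus_def)

text \<open>This serves quotient modules, and records that share the operations of a known module but differ
from it in type or in the ring fields.\<close>

lemma module_image:
  assumes "module R M" and surj: "p ` carrier M = carrier Q"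
    and add: "\<And>x y. x \<in> carrier M \<Longrightarrow> y \<in> carrier M \<Longrightarrow> p x \<oplus>\<^bsub>Q\<^esub> p y = p (x \<oplus>\<^bsub>M\<^esub> y)"
    and zero: "\<zero>\<^bsub>Q\<^esub> = p \<zero>\<^bsub>M\<^esub>"
    and smult: "\<And>r x. r \<in> carrier R \<Longrightarrow> x \<in> carrier M \<Longrightarrow> r \<odot>\<^bsub>Q\<^esub> p x = p (r \<odot>\<^bsub>M\<^esub> x)"
  shows "module R Q"
proof -
  interpret M: module R M by fact
  have ex: "\<exists>y\<in>carrier M. x = p y" if "x \<in> carrier Q" for x using that surj by auto
  have cl: "p x \<in> carrier Q" if "x \<in> carrier M" for x using that surj by auto
  show ?thesis
  proof (rule moduleI)
    show "abelian_group Q"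
    proof (rule abelian_groupI)
      fix x assume "x \<in> carrier Q"
      then obtain y where y: "y \<in> carrier M" "x = p y" using ex by auto
      have "p (\<ominus>\<^bsub>M\<^esub> y) \<oplus>\<^bsub>Q\<^esub> x = \<zero>\<^bsub>Q\<^esub>" using y by (simp add: add zero M.l_neg)
      then show "\<exists>y\<in>carrier Q. y \<oplus>\<^bsub>Q\<^esub> x = \<zero>\<^bsub>Q\<^esub>" using y cl by blast
    qed (use ex cl in \<open>auto simp: add zero M.a_ac dest!: ex\<close>)
  qed (use cl in \<open>auto simp: add smult M.is_cring M.smult_l_distr M.smult_r_distr M.smult_assoc1 dest!: ex\<close>)
qed

lemma submoduleD:
  assumes "submodule N R M"
  shows submodule_subset: "N \<subseteq> carrier M"
    and submodule_mem: "\<And>x. x \<in> N \<Longrightarrow> x \<in> carrier M"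
    and submodule_zero: "\<zero>\<^bsub>M\<^esub> \<in> N"
    and submodule_add: "\<And>x y. x \<in> N \<Longrightarrow> y \<in> N \<Longrightarrow> x \<oplus>\<^bsub>M\<^esub> y \<in> N"
    and submodule_minus: "\<And>x. x \<in> N \<Longrightarrow> \<ominus>\<^bsub>M\<^esub> x \<in> N"
    and submodule_smult: "\<And>r x. r \<in> carrier R \<Longrightarrow> x \<in> N \<Longrightarrow> r \<odot>\<^bsub>M\<^esub> x \<in> N"
proof -
  interpret N: submodule N R M by fact
  show "N \<subseteq> carrier M" "\<zero>\<^bsub>M\<^esub> \<in> N" "\<And>x. x \<in> N \<Longrightarrow> x \<in> carrier M"
    "\<And>x y. x \<in> N \<Longrightarrow> y \<in> N \<Longrightarrow> x \<oplus>\<^bsub>M\<^esub> y \<in> N"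
    "\<And>x. x \<in> N \<Longrightarrow> \<ominus>\<^bsub>M\<^esub> x \<in> N" "\<And>r x. r \<in> carrier R \<Longrightarrow> x \<in> N \<Longrightarrow> r \<odot>\<^bsub>M\<^esub> x \<in> N"
    using N.subset N.one_closed N.m_closed N.m_inv_closed N.smult_closed
    by (auto simp: a_inv_def)
qed

lemma submoduleI':
  assumes "module R M" "N \<subseteq> carrier M" "\<zero>\<^bsub>M\<^esub> \<in> N"
    "\<And>x y. x \<in> N \<Longrightarrow> y \<in> N \<Longrightarrow> x \<oplus>\<^bsub>M\<^esub> y \<in> N"
    "\<And>r x. r \<in> carrier R \<Longrightarrow> x \<in> N \<Longrightarrow> r \<odot>\<^bsub>M\<^esub> x \<in> N"
  shows "submodule N R M"
proof -
  interpret M: module R M by fact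
  have "\<ominus>\<^bsub>M\<^esub> a \<in> N" if "a \<in> N" for a
  proof -
    have "(\<ominus>\<^bsub>R\<^esub> \<one>\<^bsub>R\<^esub>) \<odot>\<^bsub>M\<^esub> a \<in> N" using that assms(5) by simp
    moreover have "a \<in> carrier M" using that assms(2) by auto
    ultimately show ?thesis by (simp add: M.smult_l_minus)
  qed
  then show ?thesis using assms by (intro M.submoduleI) auto
qed

lemma submodule_diff:
  assumes "submodule N R M" "x \<in> N" "y \<in> N"
  shows "x \<ominus>\<^bsub>M\<^esub> y \<in> N"
  using submoduleD[OF assms(1)] assms(2,3) by (simp add: a_minus_def)

lemma lsum_carrier_update [simp]: "lsum (M\<lparr>carrier := N\<rparr>) f xs = lsum M f xs"
  by (induction xs) auto

lemma module_submodule: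
  assumes "module R M" "submodule N R M"
  shows "module R (M\<lparr>carrier := N\<rparr>)"
  using submodule.submodule_is_module[OF assms(2,1)] .

lemma submodule_vimage:
  assumes "module R M" "module R N" "f \<in> lin_map R M N" "submodule Q R N"
  shows "submodule {x \<in> carrier M. f x \<in> Q} R M"
proof -
  interpret M: module R M by fact
  interpret N: module R N by fact
  show ?thesis
    using lin_mapD[OF assms(3)] submoduleD[OF assms(4)] lin_map_zero[OF assms(1-3)]
    by (intro submoduleI' assms(1)) auto
qed

lemma submodule_image:
  assumes "module R M" "module R N" "f \<in> lin_map R M N" "submodule Q R M"
  shows "submodule (f ` Q) R N"
proof -
  interpret M: module R M by fact
  interpret N: module R N by fact
  note f = lin_mapD[OF assms(3)] and Q = submoduleD[OF assms(4)]
  show ?thesis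
  proof (rule submoduleI'[OF assms(2)])
    show "\<zero>\<^bsub>N\<^esub> \<in> f ` Q" using Q(3) lin_map_zero[OF assms(1-3)] by (metis imageI)
    fix x y assume "x \<in> f ` Q" "y \<in> f ` Q"
    then show "x \<oplus>\<^bsub>N\<^esub> y \<in> f ` Q" using Q f by (auto simp: image_iff) metis
  next
    fix r x assume "r \<in> carrier R" "x \<in> f ` Q"
    then show "r \<odot>\<^bsub>N\<^esub> x \<in> f ` Q" using Q f by (auto simp: image_iff) metis
  qed (use Q f in auto)
qed

lemma submodule_zero_set:
  assumes "module R M" shows "submodule {\<zero>\<^bsub>M\<^esub>} R M"
proof -
  interpret M: module R M by fact
  show ?thesis by (intro submoduleI' assms) auto
qed

lemma submodule_Int:
  assumes "module R M" "submodule A R M" "submodule B R M"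
  shows "submodule (A \<inter> B) R M"
  using submoduleD[OF assms(2)] submoduleD[OF assms(3)] by (intro submoduleI' assms(1)) auto

section \<open>Quotient modules\<close>

lemma quot_mod_simps:
  "carrier (quot_mod M N) = a_rcosets\<^bsub>M\<^esub> N" "\<zero>\<^bsub>quot_mod M N\<^esub> = N"
  "X \<oplus>\<^bsub>quot_mod M N\<^esub> Y = X <+>\<^bsub>M\<^esub> Y" "r \<odot>\<^bsub>quot_mod M N\<^esub> X = (\<Union>x\<in>X. N +>\<^bsub>M\<^esub> (r \<odot>\<^bsub>M\<^esub> x))"
  by (simp_all add: quot_mod_def)

lemma abelian_subgroup_submodule:
  assumes "module R M" "submodule N R M" shows "abelian_subgroup N M"
proof -
  interpret M: module R M by fact
  interpret N: submodule N R M by fact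
  show ?thesis
    by (intro abelian_subgroupI3 additive_subgroup.intro N.subgroup_axioms M.abelian_group_axioms)
qed

context
  fixes R :: "('r, 'z) ring_scheme" and M :: "('r, 'm, 'u) module_scheme" and N
  assumes M: "module R M" and N: "submodule N R M"
begin

interpretation M: module R M by (rule M)
interpretation N: abelian_subgroup N M by (rule abelian_subgroup_submodule[OF M N])

lemma coset_eq_iff:
  assumes "x \<in> carrier M" "y \<in> carrier M"
  shows "N +>\<^bsub>M\<^esub> x = N +>\<^bsub>M\<^esub> y \<longleftrightarrow> x \<ominus>\<^bsub>M\<^esub> y \<in> N"
proof -
  have "x \<in> N +>\<^bsub>M\<^esub> y \<longleftrightarrow> x \<ominus>\<^bsub>M\<^esub> y \<in> N"
    using N.a_rcos_module[OF assms(2,1)] by (simp add: a_minus_def)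
  then show ?thesis
    using N.a_repr_independence'[of x y] N.a_rcos_self[of x] assms by metis
qed

text \<open>The product of \<open>r\<close> with a coset is defined as a union over all representatives; all members
of that union agree because \<open>N\<close> absorbs \<open>r\<close>-multiples of differences.\<close>

lemma quot_mod_smult_coset:
  assumes "r \<in> carrier R" "x \<in> carrier M"
  shows "r \<odot>\<^bsub>quot_mod M N\<^esub> (N +>\<^bsub>M\<^esub> x) = N +>\<^bsub>M\<^esub> (r \<odot>\<^bsub>M\<^esub> x)"
proof -
  have "N +>\<^bsub>M\<^esub> (r \<odot>\<^bsub>M\<^esub> y) = N +>\<^bsub>M\<^esub> (r \<odot>\<^bsub>M\<^esub> x)" if y: "y \<in> N +>\<^bsub>M\<^esub> x" for y
  proof -
    have yM: "y \<in> carrier M" using y N.a_elemrcos_carrier assms(2) by blast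
    have "y \<ominus>\<^bsub>M\<^esub> x \<in> N" using y yM assms using N.a_rcos_module by (simp add: a_minus_def)
    then have "r \<odot>\<^bsub>M\<^esub> (y \<ominus>\<^bsub>M\<^esub> x) \<in> N" using submodule_smult[OF N] assms by simp
    then have "r \<odot>\<^bsub>M\<^esub> y \<ominus>\<^bsub>M\<^esub> r \<odot>\<^bsub>M\<^esub> x \<in> N"
      using yM assms by (simp add: a_minus_def M.smult_r_distr M.smult_r_minus)
    then show ?thesis using coset_eq_iff yM assms by simp
  qed
  moreover have "x \<in> N +>\<^bsub>M\<^esub> x" using assms N.a_rcos_self by simp
  ultimately show ?thesis unfolding quot_mod_simps by blast
qed

lemma quot_mod_add_coset:
  assumes "x \<in> carrier M" "y \<in> carrier M"
  shows "(N +>\<^bsub>M\<^esub> x) \<oplus>\<^bsub>quot_mod M N\<^esub> (N +>\<^bsub>M\<^esub> y) = N +>\<^bsub>M\<^esub> (x \<oplus>\<^bsub>M\<^esub> y)"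
  using assms by (simp add: quot_mod_simps N.a_rcos_sum)

lemma coset_surj: "(\<lambda>x. N +>\<^bsub>M\<^esub> x) ` carrier M = carrier (quot_mod M N)"
  by (auto simp: quot_mod_simps A_RCOSETS_def')

lemma quot_mod_zero_coset: "\<zero>\<^bsub>quot_mod M N\<^esub> = N +>\<^bsub>M\<^esub> \<zero>\<^bsub>M\<^esub>"
  using N.a_subset by (simp add: quot_mod_simps M.a_coset_add_zero)

lemma module_quot_mod: "module R (quot_mod M N)"
  by (rule module_image[OF M coset_surj])
     (auto simp: quot_mod_add_coset quot_mod_zero_coset quot_mod_smult_coset)

lemma lin_map_coset: "(\<lambda>x. N +>\<^bsub>M\<^esub> x) \<in> lin_map R M (quot_mod M N)"
  using coset_surj by (intro lin_mapI) (auto simp: quot_mod_add_coset quot_mod_smult_coset)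

lemma coset_zero_iff: "x \<in> carrier M \<Longrightarrow> N +>\<^bsub>M\<^esub> x = \<zero>\<^bsub>quot_mod M N\<^esub> \<longleftrightarrow> x \<in> N"
  using coset_eq_iff[of x "\<zero>\<^bsub>M\<^esub>"] M.minus_equality[of "\<zero>\<^bsub>M\<^esub>" "\<zero>\<^bsub>M\<^esub>"] by (simp add: quot_mod_zero_coset a_minus_def)

end

section \<open>Free modules\<close>

lemma free_mod_simps [simp]:
  "\<zero>\<^bsub>free_mod R X\<^esub> = (\<lambda>x. \<zero>\<^bsub>R\<^esub>)" "f \<oplus>\<^bsub>free_mod R X\<^esub> g = (\<lambda>x. f x \<oplus>\<^bsub>R\<^esub> g x)"
  "r \<odot>\<^bsub>free_mod R X\<^esub> f = (\<lambda>x. r \<otimes>\<^bsub>R\<^esub> f x)"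
  by (simp_all add: free_mod_def)

lemma free_mod_carrier: "f \<in> carrier (free_mod R X) \<longleftrightarrow>
   (\<forall>x\<in>X. f x \<in> carrier R) \<and> (\<forall>x. x \<notin> X \<longrightarrow> f x = \<zero>\<^bsub>R\<^esub>) \<and> finite {x. f x \<noteq> \<zero>\<^bsub>R\<^esub>}"
  by (simp add: free_mod_def)

lemma lsum_free_mod: "lsum (free_mod R X) f xs = (\<lambda>y. lsum R (\<lambda>x. f x y) xs)"
  by (induction xs) auto

context cring
begin

lemma free_mod_closed [simp]: "f \<in> carrier (free_mod R X) \<Longrightarrow> f x \<in> carrier R"
  by (cases "x \<in> X") (auto simp: free_mod_carrier)

lemma module_free_mod: "module R (free_mod R X)"
proof (rule moduleI)
  show "abelian_group (free_mod R X)"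
  proof (rule abelian_groupI)
    fix f g assume f: "f \<in> carrier (free_mod R X)" and g: "g \<in> carrier (free_mod R X)"
    have "{x. f x \<oplus> g x \<noteq> \<zero>} \<subseteq> {x. f x \<noteq> \<zero>} \<union> {x. g x \<noteq> \<zero>}" by auto
    then show "f \<oplus>\<^bsub>free_mod R X\<^esub> g \<in> carrier (free_mod R X)"
      using f g finite_subset by (auto simp: free_mod_carrier)
  next
    fix f assume f: "f \<in> carrier (free_mod R X)"
    have "{x. \<ominus> f x \<noteq> \<zero>} \<subseteq> {x. f x \<noteq> \<zero>}" by auto
    then have "(\<lambda>x. \<ominus> f x) \<in> carrier (free_mod R X)"
      using f finite_subset by (auto simp: free_mod_carrier)
    then show "\<exists>g\<in>carrier (free_mod R X). g \<oplus>\<^bsub>free_mod R X\<^esub> f = \<zero>\<^bsub>free_mod R X\<^esub>"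
      using f by (intro bexI[of _ "\<lambda>x. \<ominus> f x"]) (auto simp: l_neg)
  next
    fix f assume f: "f \<in> carrier (free_mod R X)"
    show "\<zero>\<^bsub>free_mod R X\<^esub> \<oplus>\<^bsub>free_mod R X\<^esub> f = f" using free_mod_closed[OF f] by auto
  qed (auto simp: a_ac free_mod_carrier[of "\<lambda>x. \<zero>"])
next
  fix r f assume r: "r \<in> carrier R" and f: "f \<in> carrier (free_mod R X)"
  have "{x. r \<otimes> f x \<noteq> \<zero>} \<subseteq> {x. f x \<noteq> \<zero>}" using r by auto
  then show "r \<odot>\<^bsub>free_mod R X\<^esub> f \<in> carrier (free_mod R X)"
    using f r finite_subset by (auto simp: free_mod_carrier)
next
  fix f assume f: "f \<in> carrier (free_mod R X)"
  show "\<one> \<odot>\<^bsub>free_mod R X\<^esub> f = f" using free_mod_closed[OF f] by auto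
qed (auto simp: l_distr r_distr m_assoc is_cring)

lemma free_gen_closed: "x \<in> X \<Longrightarrow> free_gen R x \<in> carrier (free_mod R X)"
  by (auto simp: free_mod_carrier free_gen_def intro: finite_subset[of _ "{x}"])

lemma free_mod_expand:
  assumes c: "c \<in> carrier (free_mod R X)" and xs: "distinct xs" "{x. c x \<noteq> \<zero>} \<subseteq> set xs" "set xs \<subseteq> X"
  shows "c = lsum (free_mod R X) (\<lambda>x. c x \<odot>\<^bsub>free_mod R X\<^esub> free_gen R x) xs"
proof
  fix y
  show "c y = lsum (free_mod R X) (\<lambda>x. c x \<odot>\<^bsub>free_mod R X\<^esub> free_gen R x) xs y"
  proof (cases "y \<in> set xs")
    case True
    have "lsum R (\<lambda>x. c x \<otimes> free_gen R x y) xs = c y \<otimes> free_gen R y y"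
      using xs True c by (intro lsum_single) (auto simp: free_gen_def)
    then show ?thesis using c by (simp add: lsum_free_mod free_gen_def)
  next
    case False
    then have "c y = \<zero>" using xs by auto
    moreover have "lsum R (\<lambda>x. c x \<otimes> free_gen R x y) xs = \<zero>"
      using False c by (intro lsum_zero) (auto simp: free_gen_def)
    ultimately show ?thesis by (simp add: lsum_free_mod)
  qed
qed

end

text \<open>The linear extension of \<open>g\<close> to the free module. With \<open>g = (\<lambda>q. b (fst q) (snd q))\<close> this is the sum that
occurs in \<^const>\<open>tensor_sum\<close>.\<close>

definition free_ext :: "('r, 'z) ring_scheme \<Rightarrow> ('r, 'p, 'w) module_scheme \<Rightarrow> ('x \<Rightarrow> 'p) \<Rightarrow> ('x \<Rightarrow> 'r) \<Rightarrow> 'p" where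
  "free_ext R P g c = (\<Oplus>\<^bsub>P\<^esub>q\<in>{q. c q \<noteq> \<zero>\<^bsub>R\<^esub>}. c q \<odot>\<^bsub>P\<^esub> g q)"

context
  fixes R :: "('r, 'z) ring_scheme" and P :: "('r, 'p, 'w) module_scheme" and X :: "'x set" and g
  assumes P: "module R P" and g: "\<And>x. x \<in> X \<Longrightarrow> g x \<in> carrier P"
begin

interpretation P: module R P by (rule P)

lemma free_ext_lsum:
  assumes c: "c \<in> carrier (free_mod R X)" and xs: "distinct xs" "{x. c x \<noteq> \<zero>\<^bsub>R\<^esub>} \<subseteq> set xs" "set xs \<subseteq> X"
  shows "free_ext R P g c = lsum P (\<lambda>x. c x \<odot>\<^bsub>P\<^esub> g x) xs"
proof -
  let ?ys = "filter (\<lambda>x. c x \<noteq> \<zero>\<^bsub>R\<^esub>) xs"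
  have eq: "{x. c x \<noteq> \<zero>\<^bsub>R\<^esub>} = set ?ys" using xs by auto
  have "free_ext R P g c = lsum P (\<lambda>x. c x \<odot>\<^bsub>P\<^esub> g x) ?ys"
    unfolding free_ext_def eq using xs c g by (intro P.finsum_eq_lsum) auto
  also have "\<dots> = lsum P (\<lambda>x. c x \<odot>\<^bsub>P\<^esub> g x) xs"
    using xs c g by (intro P.lsum_filter) auto
  finally show ?thesis .
qed

lemma free_ext_lin: "free_ext R P g \<in> lin_map R (free_mod R X) P"
proof -
  have ex: "\<exists>xs. distinct xs \<and> {x. c x \<noteq> \<zero>\<^bsub>R\<^esub>} \<union> {x. d x \<noteq> \<zero>\<^bsub>R\<^esub>} = set xs \<and> set xs \<subseteq> X"
    if "c \<in> carrier (free_mod R X)" "d \<in> carrier (free_mod R X)" for c d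
  proof -
    have "finite ({x. c x \<noteq> \<zero>\<^bsub>R\<^esub>} \<union> {x. d x \<noteq> \<zero>\<^bsub>R\<^esub>})" using that by (simp add: free_mod_carrier)
    moreover have "{x. c x \<noteq> \<zero>\<^bsub>R\<^esub>} \<union> {x. d x \<noteq> \<zero>\<^bsub>R\<^esub>} \<subseteq> X" using that by (auto simp: free_mod_carrier)
    ultimately show ?thesis using finite_distinct_list by metis
  qed
  interpret F: module R "free_mod R X" by (rule P.module_free_mod)
  show ?thesis
  proof (rule lin_mapI)
    fix c d assume cd: "c \<in> carrier (free_mod R X)" "d \<in> carrier (free_mod R X)"
    then obtain xs where xs: "distinct xs" "{x. c x \<noteq> \<zero>\<^bsub>R\<^esub>} \<union> {x. d x \<noteq> \<zero>\<^bsub>R\<^esub>} = set xs" "set xs \<subseteq> X"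
      using ex by meson
    have s1: "{x. c x \<noteq> \<zero>\<^bsub>R\<^esub>} \<subseteq> set xs" and s2: "{x. d x \<noteq> \<zero>\<^bsub>R\<^esub>} \<subseteq> set xs" using xs(2) by auto
    have cl: "c \<oplus>\<^bsub>free_mod R X\<^esub> d \<in> carrier (free_mod R X)" using cd by blast
    have sub: "{x. (c \<oplus>\<^bsub>free_mod R X\<^esub> d) x \<noteq> \<zero>\<^bsub>R\<^esub>} \<subseteq> set xs" unfolding xs(2)[symmetric] by auto
    have "free_ext R P g (c \<oplus>\<^bsub>free_mod R X\<^esub> d) = lsum P (\<lambda>x. c x \<odot>\<^bsub>P\<^esub> g x \<oplus>\<^bsub>P\<^esub> d x \<odot>\<^bsub>P\<^esub> g x) xs"
      using cd g xs(3) by (subst free_ext_lsum[OF cl xs(1) sub xs(3)])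
        (auto intro!: lsum_cong P.smult_l_distr)
    also have "\<dots> = free_ext R P g c \<oplus>\<^bsub>P\<^esub> free_ext R P g d"
      unfolding free_ext_lsum[OF cd(1) xs(1) s1 xs(3)] free_ext_lsum[OF cd(2) xs(1) s2 xs(3)]
      using cd g xs(3) by (intro P.lsum_add) auto
    finally show "free_ext R P g (c \<oplus>\<^bsub>free_mod R X\<^esub> d) = free_ext R P g c \<oplus>\<^bsub>P\<^esub> free_ext R P g d" .
  next
    fix r c assume r: "r \<in> carrier R" and c: "c \<in> carrier (free_mod R X)"
    then obtain xs where xs: "distinct xs" "{x. c x \<noteq> \<zero>\<^bsub>R\<^esub>} = set xs" "set xs \<subseteq> X"
      using ex[OF c c] by auto
    have cl: "r \<odot>\<^bsub>free_mod R X\<^esub> c \<in> carrier (free_mod R X)" using r c by blast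
    have sub: "{x. (r \<odot>\<^bsub>free_mod R X\<^esub> c) x \<noteq> \<zero>\<^bsub>R\<^esub>} \<subseteq> set xs" unfolding xs(2)[symmetric] using r by auto
    have sub': "{x. c x \<noteq> \<zero>\<^bsub>R\<^esub>} \<subseteq> set xs" using xs by auto
    show "free_ext R P g (r \<odot>\<^bsub>free_mod R X\<^esub> c) = r \<odot>\<^bsub>P\<^esub> free_ext R P g c"
      unfolding free_ext_lsum[OF cl xs(1) sub xs(3)] free_ext_lsum[OF c xs(1) sub' xs(3)]
      using r c g xs(3) by (subst P.smult_lsum) (auto intro!: lsum_cong P.smult_assoc1)
  next
    fix c assume c: "c \<in> carrier (free_mod R X)"
    then obtain xs where xs: "distinct xs" "{x. c x \<noteq> \<zero>\<^bsub>R\<^esub>} = set xs" "set xs \<subseteq> X"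
      using ex[OF c c] by auto
    have sub': "{x. c x \<noteq> \<zero>\<^bsub>R\<^esub>} \<subseteq> set xs" using xs by auto
    show "free_ext R P g c \<in> carrier P"
      unfolding free_ext_lsum[OF c xs(1) sub' xs(3)]
      by (intro P.lsum_closed P.smult_closed g P.free_mod_closed[OF c]) (use xs in auto)
  qed
qed

lemma free_ext_gen:
  assumes "x \<in> X" shows "free_ext R P g (free_gen R x) = g x"
proof -
  have "free_ext R P g (free_gen R x) = lsum P (\<lambda>y. free_gen R x y \<odot>\<^bsub>P\<^esub> g y) [x]"
    using assms by (intro free_ext_lsum P.free_gen_closed) (auto simp: free_gen_def)
  then show ?thesis using assms g by (simp add: free_gen_def)
qed

end


section \<open>Generated submodules and tensor products\<close>

context
  fixes R :: "('r, 'z) ring_scheme" and M :: "('r, 'm, 'u) module_scheme"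
  assumes M: "module R M"
begin

interpretation M: module R M by (rule M)

lemma submodule_mod_span:
  assumes "S \<subseteq> carrier M" shows "submodule (mod_span R M S) R M"
proof (rule submoduleI'[OF M])
  show "mod_span R M S \<subseteq> carrier M"
    using assms M.carrier_is_submodule by (auto simp: mod_span_def)
qed (auto simp: mod_span_def submoduleD)

lemma mod_span_superset: "S \<subseteq> mod_span R M S"
  by (auto simp: mod_span_def)

lemma mod_span_least: "submodule N R M \<Longrightarrow> S \<subseteq> N \<Longrightarrow> mod_span R M S \<subseteq> N"
  by (auto simp: mod_span_def)

lemma mod_span_mono: "S \<subseteq> S' \<Longrightarrow> mod_span R M S \<subseteq> mod_span R M S'"
  by (auto simp: mod_span_def)

end

definition tens :: "('r, 'z) ring_scheme \<Rightarrow> ('r, 'm, 'u) module_scheme \<Rightarrow> ('r, 'n, 'v) module_scheme \<Rightarrow>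
   ('m \<times> 'n) list \<Rightarrow> ('m \<times> 'n \<Rightarrow> 'r) set" where
  "tens R M N ps = lsum (tensor R M N) (\<lambda>p. ptensor R M N (fst p) (snd p)) ps"

context
  fixes R :: "('r, 'z) ring_scheme" and M :: "('r, 'm, 'u) module_scheme" and N :: "('r, 'n, 'v) module_scheme"
  assumes M: "module R M" and N: "module R N"
begin

interpretation M: module R M by (rule M)
interpretation N: module R N by (rule N)

abbreviation (input) "FMN \<equiv> free_mod R (carrier M \<times> carrier N)"

interpretation F: module R FMN by (rule M.module_free_mod)

definition tensor_rels :: "('m \<times> 'n \<Rightarrow> 'r) set" where
  "tensor_rels = (let F = free_mod R (carrier M \<times> carrier N); e = (\<lambda>x y. free_gen R (x, y)) in
      ({e (x \<oplus>\<^bsub>M\<^esub> x') y \<ominus>\<^bsub>F\<^esub> (e x y \<oplus>\<^bsub>F\<^esub> e x' y) | x x' y.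
          x \<in> carrier M \<and> x' \<in> carrier M \<and> y \<in> carrier N} \<union>
       {e x (y \<oplus>\<^bsub>N\<^esub> y') \<ominus>\<^bsub>F\<^esub> (e x y \<oplus>\<^bsub>F\<^esub> e x y') | x y y'.
          x \<in> carrier M \<and> y \<in> carrier N \<and> y' \<in> carrier N} \<union>
       {e (r \<odot>\<^bsub>M\<^esub> x) y \<ominus>\<^bsub>F\<^esub> r \<odot>\<^bsub>F\<^esub> e x y | r x y.
          r \<in> carrier R \<and> x \<in> carrier M \<and> y \<in> carrier N} \<union>
       {e x (r \<odot>\<^bsub>N\<^esub> y) \<ominus>\<^bsub>F\<^esub> r \<odot>\<^bsub>F\<^esub> e x y | r x y.
          r \<in> carrier R \<and> x \<in> carrier M \<and> y \<in> carrier N}))"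

lemma tensor_rel_eq: "tensor_rel R M N = mod_span R FMN tensor_rels"
  by (simp only: tensor_rel_def tensor_rels_def Let_def)

lemma free_gen_pair_closed [simp]: "x \<in> carrier M \<Longrightarrow> y \<in> carrier N \<Longrightarrow> free_gen R (x, y) \<in> carrier FMN"
  by (rule M.free_gen_closed) simp

lemma tensor_rels_closed: "tensor_rels \<subseteq> carrier FMN"
  unfolding tensor_rels_def Let_def
  by (auto simp del: free_mod_simps intro!: F.minus_closed F.a_closed F.smult_closed)

lemma submodule_tensor_rel: "submodule (tensor_rel R M N) R FMN"
  unfolding tensor_rel_eq by (rule submodule_mod_span[OF F.module_axioms tensor_rels_closed])

lemma module_tensor: "module R (tensor R M N)"
  unfolding tensor_def by (rule module_quot_mod[OF F.module_axioms submodule_tensor_rel])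

interpretation T: module R "tensor R M N" by (rule module_tensor)

lemma lin_map_tensor_coset: "(\<lambda>c. tensor_rel R M N +>\<^bsub>FMN\<^esub> c) \<in> lin_map R FMN (tensor R M N)"
  unfolding tensor_def by (rule lin_map_coset[OF F.module_axioms submodule_tensor_rel])

lemma tensor_coset_eqI:
  assumes "c \<in> carrier FMN" "d \<in> carrier FMN" "c \<ominus>\<^bsub>FMN\<^esub> d \<in> tensor_rels"
  shows "tensor_rel R M N +>\<^bsub>FMN\<^esub> c = tensor_rel R M N +>\<^bsub>FMN\<^esub> d"
  using assms mod_span_superset[OF F.module_axioms, of tensor_rels]
  by (subst coset_eq_iff[OF F.module_axioms submodule_tensor_rel]) (auto simp: tensor_rel_eq)

lemma bilin_map_ptensor: "ptensor R M N \<in> bilin_map R M N (tensor R M N)"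
proof -
  note lin = lin_mapD[OF lin_map_tensor_coset]
  have cl: "ptensor R M N x y \<in> carrier (tensor R M N)" if "x \<in> carrier M" "y \<in> carrier N" for x y
    unfolding ptensor_def using that by (intro lin) simp
  have 1: "ptensor R M N (x \<oplus>\<^bsub>M\<^esub> x') y = ptensor R M N x y \<oplus>\<^bsub>tensor R M N\<^esub> ptensor R M N x' y"
    if "x \<in> carrier M" "x' \<in> carrier M" "y \<in> carrier N" for x x' y
    unfolding ptensor_def using that
    apply (subst lin(2)[symmetric]; (simp del: free_mod_simps)?)
    by (rule tensor_coset_eqI; (simp del: free_mod_simps)?) (unfold tensor_rels_def Let_def, blast)
  have 2: "ptensor R M N x (y \<oplus>\<^bsub>N\<^esub> y') = ptensor R M N x y \<oplus>\<^bsub>tensor R M N\<^esub> ptensor R M N x y'"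
    if "x \<in> carrier M" "y \<in> carrier N" "y' \<in> carrier N" for x y y'
    unfolding ptensor_def using that
    apply (subst lin(2)[symmetric]; (simp del: free_mod_simps)?)
    by (rule tensor_coset_eqI; (simp del: free_mod_simps)?) (unfold tensor_rels_def Let_def, blast)
  have 3: "ptensor R M N (r \<odot>\<^bsub>M\<^esub> x) y = r \<odot>\<^bsub>tensor R M N\<^esub> ptensor R M N x y"
    if "r \<in> carrier R" "x \<in> carrier M" "y \<in> carrier N" for r x y
    unfolding ptensor_def using that
    apply (subst lin(3)[symmetric]; (simp del: free_mod_simps)?)
    by (rule tensor_coset_eqI; (simp del: free_mod_simps)?) (unfold tensor_rels_def Let_def, blast)
  have 4: "ptensor R M N x (r \<odot>\<^bsub>N\<^esub> y) = r \<odot>\<^bsub>tensor R M N\<^esub> ptensor R M N x y"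
    if "r \<in> carrier R" "x \<in> carrier M" "y \<in> carrier N" for r x y
    unfolding ptensor_def using that
    apply (subst lin(3)[symmetric]; (simp del: free_mod_simps)?)
    by (rule tensor_coset_eqI; (simp del: free_mod_simps)?) (unfold tensor_rels_def Let_def, blast)
  show ?thesis using cl 1 2 3 4 by (intro bilin_mapI lin_mapI)
qed

lemmas ptensor_closed [simp, intro] = bilin_map_closed[OF bilin_map_ptensor]

lemma tens_closed [simp]: "set ps \<subseteq> carrier M \<times> carrier N \<Longrightarrow> tens R M N ps \<in> carrier (tensor R M N)"
  unfolding tens_def by (rule T.lsum_closed) (auto simp: mem_Times_iff)

text \<open>Coefficients of an element of the free module can be moved into the first factor of the pure tensors, so
lists of pairs without coefficients represent all tensors.\<close>

lemma tensor_cases: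
  assumes "t \<in> carrier (tensor R M N)"
  obtains ps where "set ps \<subseteq> carrier M \<times> carrier N" "t = tens R M N ps"
proof -
  from assms obtain c where c: "c \<in> carrier FMN" "t = tensor_rel R M N +>\<^bsub>FMN\<^esub> c"
    using coset_surj[OF F.module_axioms submodule_tensor_rel] unfolding tensor_def by blast
  have "finite {q. c q \<noteq> \<zero>\<^bsub>R\<^esub>}" using c by (simp add: free_mod_carrier)
  then obtain qs where qs: "distinct qs" "set qs = {q. c q \<noteq> \<zero>\<^bsub>R\<^esub>}" using finite_distinct_list by blast
  have sub: "set qs \<subseteq> carrier M \<times> carrier N" using c qs by (auto simp: free_mod_carrier)
  let ?ps = "map (\<lambda>q. (c q \<odot>\<^bsub>M\<^esub> fst q, snd q)) qs"
  have cR: "c q \<in> carrier R" for q by (rule M.free_mod_closed[OF c(1)])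
  have mem: "fst q \<in> carrier M" "snd q \<in> carrier N" if "q \<in> set qs" for q using that sub by auto
  have gen: "free_gen R q \<in> carrier FMN" if "q \<in> set qs" for q
    by (rule M.free_gen_closed) (use that sub in auto)
  have "t = tensor_rel R M N +>\<^bsub>FMN\<^esub> (lsum FMN (\<lambda>q. c q \<odot>\<^bsub>FMN\<^esub> free_gen R q) qs)"
    using M.free_mod_expand[OF c(1) qs(1) _ sub] qs c by (simp del: free_mod_simps)
  also have "\<dots> = lsum (tensor R M N) (\<lambda>q. tensor_rel R M N +>\<^bsub>FMN\<^esub> (c q \<odot>\<^bsub>FMN\<^esub> free_gen R q)) qs"
    using gen cR by (intro lin_map_lsum[OF F.module_axioms T.module_axioms lin_map_tensor_coset])
      (auto simp del: free_mod_simps)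
  also have "\<dots> = lsum (tensor R M N) (\<lambda>q. ptensor R M N (c q \<odot>\<^bsub>M\<^esub> fst q) (snd q)) qs"
  proof (rule lsum_cong[OF refl])
    fix q assume q: "q \<in> set qs"
    have "tensor_rel R M N +>\<^bsub>FMN\<^esub> (c q \<odot>\<^bsub>FMN\<^esub> free_gen R q) = c q \<odot>\<^bsub>tensor R M N\<^esub> ptensor R M N (fst q) (snd q)"
      using lin_map_smult[OF lin_map_tensor_coset cR gen[OF q], of q] by (simp add: ptensor_def)
    then show "tensor_rel R M N +>\<^bsub>FMN\<^esub> (c q \<odot>\<^bsub>FMN\<^esub> free_gen R q) = ptensor R M N (c q \<odot>\<^bsub>M\<^esub> fst q) (snd q)"
      using lin_map_smult[OF bilin_map_left[OF bilin_map_ptensor mem(2)[OF q]] cR mem(1)[OF q]] by simp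
  qed
  also have "\<dots> = tens R M N ?ps" by (simp add: tens_def lsum_map)
  finally show ?thesis using sub cR mem by (intro that[of ?ps]) auto
qed

context
  fixes P :: "('r, 'p, 'w) module_scheme" and b
  assumes P: "module R P" and b: "b \<in> bilin_map R M N P"
begin

interpretation P: module R P by (rule P)

abbreviation (input) "ext_b \<equiv> free_ext R P (\<lambda>q. b (fst q) (snd q))"

lemma lin_map_ext_b: "ext_b \<in> lin_map R FMN P"
  by (rule free_ext_lin[OF P]) (use bilin_map_closed[OF b] in auto)

lemma ext_b_gen: "x \<in> carrier M \<Longrightarrow> y \<in> carrier N \<Longrightarrow> ext_b (free_gen R (x, y)) = b x y"
  by (subst free_ext_gen[OF P, where X = "carrier M \<times> carrier N"]) (use bilin_map_closed[OF b] in auto)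

text \<open>The kernel of the extension of a bilinear map is a submodule that contains the generating relations.\<close>

lemma ext_b_rel: "c \<in> tensor_rel R M N \<Longrightarrow> ext_b c = \<zero>\<^bsub>P\<^esub>"
proof -
  note E = lin_mapD[OF lin_map_ext_b] and Ed = lin_map_diff[OF F.module_axioms P lin_map_ext_b]
  note bl = lin_mapD[OF bilin_map_left[OF b]] and br = lin_mapD[OF bilin_map_right[OF b]]
  have "tensor_rels \<subseteq> {c \<in> carrier FMN. ext_b c \<in> {\<zero>\<^bsub>P\<^esub>}}"
  proof
    fix c assume c: "c \<in> tensor_rels"
    have "ext_b c = \<zero>\<^bsub>P\<^esub>"
      using c unfolding tensor_rels_def Let_def
      by (elim UnE CollectE exE conjE)
         (simp_all add: E Ed ext_b_gen bl br bilin_map_closed[OF b] F.a_closed F.smult_closed P.r_neg a_minus_def[of P] del: free_mod_simps)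
    then show "c \<in> {c \<in> carrier FMN. ext_b c \<in> {\<zero>\<^bsub>P\<^esub>}}" using c tensor_rels_closed by auto
  qed
  then have "tensor_rel R M N \<subseteq> {c \<in> carrier FMN. ext_b c \<in> {\<zero>\<^bsub>P\<^esub>}}"
    unfolding tensor_rel_eq
    by (intro mod_span_least[OF F.module_axioms] submodule_vimage[OF F.module_axioms P lin_map_ext_b] submodule_zero_set P)
  then show "c \<in> tensor_rel R M N \<Longrightarrow> ext_b c = \<zero>\<^bsub>P\<^esub>" by auto
qed

text \<open>The representative that \<^const>\<open>tensor_sum\<close> picks differs from \<open>c\<close> by a relation, which does not change
the sum.\<close>

lemma tensor_sum_coset:
  assumes c: "c \<in> carrier FMN"
  shows "tensor_sum R P b (tensor_rel R M N +>\<^bsub>FMN\<^esub> c) = ext_b c"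
proof -
  let ?t = "tensor_rel R M N +>\<^bsub>FMN\<^esub> c"
  interpret A: abelian_subgroup "tensor_rel R M N" FMN
    by (rule abelian_subgroup_submodule[OF F.module_axioms submodule_tensor_rel])
  define d where "d = (SOME c. c \<in> ?t)"
  have d: "d \<in> ?t" unfolding d_def by (rule someI[of "\<lambda>c. c \<in> ?t", OF A.a_rcos_self[OF c]])
  then have dF: "d \<in> carrier FMN" using A.a_elemrcos_carrier c by blast
  have "d \<ominus>\<^bsub>FMN\<^esub> c \<in> tensor_rel R M N"
    using A.a_rcos_module[OF c dF] d by (simp only: a_minus_def)
  then have "ext_b d \<ominus>\<^bsub>P\<^esub> ext_b c = \<zero>\<^bsub>P\<^esub>" using ext_b_rel lin_map_diff[OF F.module_axioms P lin_map_ext_b dF c] by simp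
  then have "ext_b d = ext_b c"
    using P.diff_zero_imp_eq[OF lin_map_closed[OF lin_map_ext_b dF] lin_map_closed[OF lin_map_ext_b c]] by simp
  then show ?thesis unfolding tensor_sum_def Let_def d_def[symmetric] free_ext_def by simp
qed

lemma lin_map_tensor_sum: "tensor_sum R P b \<in> lin_map R (tensor R M N) P"
proof -
  note E = lin_mapD[OF lin_map_ext_b] and co = lin_mapD[OF lin_map_tensor_coset]
  have ex: "\<exists>c\<in>carrier FMN. t = tensor_rel R M N +>\<^bsub>FMN\<^esub> c" if "t \<in> carrier (tensor R M N)" for t
    using that coset_surj[OF F.module_axioms submodule_tensor_rel] unfolding tensor_def by blast
  show ?thesis
  proof (rule lin_mapI)
    fix t u assume "t \<in> carrier (tensor R M N)" "u \<in> carrier (tensor R M N)"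
    then obtain c d where c: "c \<in> carrier FMN" "t = tensor_rel R M N +>\<^bsub>FMN\<^esub> c"
      and d: "d \<in> carrier FMN" "u = tensor_rel R M N +>\<^bsub>FMN\<^esub> d" using ex by meson
    show "tensor_sum R P b (t \<oplus>\<^bsub>tensor R M N\<^esub> u) = tensor_sum R P b t \<oplus>\<^bsub>P\<^esub> tensor_sum R P b u"
      unfolding c(2) d(2) co(2)[OF c(1) d(1), symmetric] tensor_sum_coset[OF c(1)]
        tensor_sum_coset[OF d(1)] tensor_sum_coset[OF F.a_closed[OF c(1) d(1)]] by (rule E(2)[OF c(1) d(1)])
  next
    fix r t assume r: "r \<in> carrier R" and "t \<in> carrier (tensor R M N)"
    then obtain c where c: "c \<in> carrier FMN" "t = tensor_rel R M N +>\<^bsub>FMN\<^esub> c" using ex by meson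
    show "tensor_sum R P b (r \<odot>\<^bsub>tensor R M N\<^esub> t) = r \<odot>\<^bsub>P\<^esub> tensor_sum R P b t"
      unfolding c(2) co(3)[OF r c(1), symmetric] tensor_sum_coset[OF c(1)]
        tensor_sum_coset[OF F.smult_closed[OF r c(1)]] by (rule E(3)[OF r c(1)])
  next
    fix t assume "t \<in> carrier (tensor R M N)"
    then obtain c where c: "c \<in> carrier FMN" "t = tensor_rel R M N +>\<^bsub>FMN\<^esub> c" using ex by meson
    show "tensor_sum R P b t \<in> carrier P"
      unfolding c(2) tensor_sum_coset[OF c(1)] by (rule E(1)[OF c(1)])
  qed
qed

lemma tensor_sum_ptensor:
  assumes "x \<in> carrier M" "y \<in> carrier N"
  shows "tensor_sum R P b (ptensor R M N x y) = b x y"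
  unfolding ptensor_def using assms by (subst tensor_sum_coset) (auto simp: ext_b_gen)

lemma tensor_sum_tens:
  assumes "set ps \<subseteq> carrier M \<times> carrier N"
  shows "tensor_sum R P b (tens R M N ps) = lsum P (\<lambda>p. b (fst p) (snd p)) ps"
proof -
  have mem: "fst p \<in> carrier M" "snd p \<in> carrier N" if "p \<in> set ps" for p using assms that by auto
  show ?thesis unfolding tens_def
    using mem by (subst lin_map_lsum[OF T.module_axioms P lin_map_tensor_sum])
      (auto intro!: lsum_cong simp: tensor_sum_ptensor)
qed

end

end

section \<open>Cofinite submodules over a Noetherian ring\<close>

context
  fixes R :: "('r, 'z) ring_scheme" and M :: "('r, 'm, 'u) module_scheme"
  assumes M: "module R M"
begin

interpretation M: module R M by (rule M)

lemma mod_span_submodule: "submodule N R M \<Longrightarrow> mod_span R M N = N"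
  by (auto simp: mod_span_def)

lemma mod_span_Un:
  assumes S: "S \<subseteq> carrier M" "S' \<subseteq> carrier M" and x: "x \<in> mod_span R M (S \<union> S')"
  shows "\<exists>t\<in>mod_span R M S. \<exists>t'\<in>mod_span R M S'. x = t \<oplus>\<^bsub>M\<^esub> t'"
proof -
  let ?A = "mod_span R M S" and ?B = "mod_span R M S'"
  note A = submoduleD[OF submodule_mod_span[OF M S(1)]] and B = submoduleD[OF submodule_mod_span[OF M S(2)]]
  let ?N = "{t \<oplus>\<^bsub>M\<^esub> t' | t t'. t \<in> ?A \<and> t' \<in> ?B}"
  have "submodule ?N R M"
  proof (rule submoduleI'[OF M])
    show "?N \<subseteq> carrier M" using A(2) B(2) by auto
    show "\<zero>\<^bsub>M\<^esub> \<in> ?N" using A(3) B(3) M.l_zero[OF M.zero_closed] by (metis (mono_tags, lifting) mem_Collect_eq)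
  next
    fix x y assume "x \<in> ?N" "y \<in> ?N"
    then obtain a b c d where *: "a \<in> ?A" "b \<in> ?B" "c \<in> ?A" "d \<in> ?B" "x = a \<oplus>\<^bsub>M\<^esub> b" "y = c \<oplus>\<^bsub>M\<^esub> d" by blast
    then have "x \<oplus>\<^bsub>M\<^esub> y = (a \<oplus>\<^bsub>M\<^esub> c) \<oplus>\<^bsub>M\<^esub> (b \<oplus>\<^bsub>M\<^esub> d)" using A(2) B(2) by (simp add: M.a_ac)
    then show "x \<oplus>\<^bsub>M\<^esub> y \<in> ?N" using * A(4) B(4) by blast
  next
    fix r x assume r: "r \<in> carrier R" and "x \<in> ?N"
    then obtain a b where *: "a \<in> ?A" "b \<in> ?B" "x = a \<oplus>\<^bsub>M\<^esub> b" by blast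
    then have "r \<odot>\<^bsub>M\<^esub> x = r \<odot>\<^bsub>M\<^esub> a \<oplus>\<^bsub>M\<^esub> r \<odot>\<^bsub>M\<^esub> b" using A(2) B(2) r by (simp add: M.smult_r_distr)
    then show "r \<odot>\<^bsub>M\<^esub> x \<in> ?N" using * r A(6) B(6) by blast
  qed
  moreover have "S \<union> S' \<subseteq> ?N"
  proof
    fix s assume "s \<in> S \<union> S'"
    then show "s \<in> ?N"
    proof
      assume s: "s \<in> S"
      then have "s = s \<oplus>\<^bsub>M\<^esub> \<zero>\<^bsub>M\<^esub>" using S by auto
      then show ?thesis using s B(3) mod_span_superset[OF M, of S] by blast
    next
      assume s: "s \<in> S'"
      then have "s = \<zero>\<^bsub>M\<^esub> \<oplus>\<^bsub>M\<^esub> s" using S by auto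
      then show ?thesis using s A(3) mod_span_superset[OF M, of S'] by blast
    qed
  qed
  ultimately have "mod_span R M (S \<union> S') \<subseteq> ?N" by (rule mod_span_least[OF M])
  then show ?thesis using x by blast
qed

lemma mod_span_single:
  assumes s: "s \<in> carrier M" and x: "x \<in> mod_span R M {s}"
  shows "\<exists>r\<in>carrier R. x = r \<odot>\<^bsub>M\<^esub> s"
proof -
  let ?N = "(\<lambda>r. r \<odot>\<^bsub>M\<^esub> s) ` carrier R"
  have lin: "(\<lambda>r. r \<odot>\<^bsub>M\<^esub> s) \<in> lin_map R (reg_mod R) M"
    using s by (intro lin_mapI) (auto simp: M.smult_l_distr M.smult_assoc1)
  have "submodule ?N R M"
    using submodule_image[OF M.module_reg_mod M lin module.carrier_is_submodule[OF M.module_reg_mod]] by simp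
  moreover have "s \<in> ?N" using s by (intro image_eqI[of _ _ "\<one>\<^bsub>R\<^esub>"]) auto
  ultimately have "mod_span R M {s} \<subseteq> ?N" by (intro mod_span_least[OF M]) auto
  then show ?thesis using x by blast
qed

end

lemma mod_span_coeffs:
  assumes M: "module R M" and "set ss \<subseteq> carrier M" "distinct ss" "x \<in> mod_span R M (set ss)"
  shows "\<exists>r. (\<forall>s\<in>set ss. r s \<in> carrier R) \<and> x = lsum M (\<lambda>s. r s \<odot>\<^bsub>M\<^esub> s) ss"
  using assms(2-)
proof (induction ss arbitrary: x)
  case Nil
  then show ?case using mod_span_least[OF M submodule_zero_set[OF M], of "{}"] by auto
next
  case (Cons s ss)
  interpret M: module R M by fact
  have "x \<in> mod_span R M ({s} \<union> set ss)" using Cons.prems by simp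
  then obtain t u where tu: "t \<in> mod_span R M {s}" "u \<in> mod_span R M (set ss)" "x = t \<oplus>\<^bsub>M\<^esub> u"
    using mod_span_Un[OF M _ _ \<open>x \<in> mod_span R M ({s} \<union> set ss)\<close>] Cons.prems(1)
    by (metis empty_subsetI insert_subset list.simps(15))
  obtain q where q: "q \<in> carrier R" "t = q \<odot>\<^bsub>M\<^esub> s" using mod_span_single[OF M _ tu(1)] Cons.prems by auto
  obtain r where r: "\<forall>s\<in>set ss. r s \<in> carrier R" "u = lsum M (\<lambda>s. r s \<odot>\<^bsub>M\<^esub> s) ss"
    using Cons.IH[OF _ _ tu(2)] Cons.prems by auto
  have "lsum M (\<lambda>s'. (r(s := q)) s' \<odot>\<^bsub>M\<^esub> s') ss = u"
    unfolding r(2) using Cons.prems(2) by (intro lsum_cong) auto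
  then show ?case using r q tu(3) by (intro exI[of _ "r(s := q)"]) auto
qed

lemma ideal_submodule_reg_mod:
  assumes "cring R" "submodule J R (reg_mod R)"
  shows "ideal J R"
proof -
  interpret cring R by fact
  interpret J: submodule J R "reg_mod R" by fact
  have "subgroup J (add_monoid R)" using J.subgroup_axioms by (simp add: reg_mod_def subgroup_def m_inv_def)
  moreover have l: "x \<otimes>\<^bsub>R\<^esub> a \<in> J" if "a \<in> J" "x \<in> carrier R" for a x
    using J.smult_closed[of x a] that by simp
  moreover have "a \<otimes>\<^bsub>R\<^esub> x \<in> J" if "a \<in> J" "x \<in> carrier R" for a x
    using l[OF that] m_comm[of a x] submodule_mem[OF assms(2) that(1)] that(2) by simp
  ultimately show ?thesis by (intro idealI ring_axioms) auto
qed

text \<open>Finitely generated modules over a Noetherian ring are Noetherian; the submodule \<open>I\<close> makes this applicable to quotients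
without forming them. The induction removes a generator \<open>s\<close>: modulo
the span \<open>A\<close> of the other generators and \<open>I\<close>, an element of \<open>B\<close> is a multiple of \<open>s\<close>, and the coefficients that
occur form an ideal.\<close>

lemma noetherian_relative:
  assumes R: "cring R" "noetherian_ring R" and M: "module R M" and I: "submodule I R M"
    and "finite S" "S \<subseteq> carrier M" "submodule B R M" "B \<subseteq> mod_span R M (S \<union> I)"
  shows "\<exists>T\<subseteq>B. finite T \<and> B \<subseteq> mod_span R M (T \<union> I)"
  using assms(5-)
proof (induction S arbitrary: B rule: finite_induct)
  case empty
  then show ?case by (intro exI[of _ "{}"]) auto
next
  case (insert s S)
  interpret M: module R M by fact
  have reg: "module R (reg_mod R)" by (rule M.module_reg_mod)
  have Isub: "I \<subseteq> carrier M" using submodule_subset[OF I] .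
  have SI: "S \<union> I \<subseteq> carrier M" and s: "s \<in> carrier M" using insert.prems Isub by auto
  define A where "A = mod_span R M (S \<union> I)"
  have A: "submodule A R M" unfolding A_def by (rule submodule_mod_span[OF M SI])
  note AD = submoduleD[OF A] and BD = submoduleD[OF insert.prems(2)]
  obtain T' where T': "T' \<subseteq> B \<inter> A" "finite T'" "B \<inter> A \<subseteq> mod_span R M (T' \<union> I)"
    using insert.IH[of "B \<inter> A"] insert.prems submodule_Int[OF M insert.prems(2) A] by (auto simp: A_def)
  define J where "J B = {r \<in> carrier R. \<exists>b\<in>B. b \<ominus>\<^bsub>M\<^esub> r \<odot>\<^bsub>M\<^esub> s \<in> A}" for B
  have J: "submodule (J C) R (reg_mod R)" if C: "submodule C R M" for C
  proof (rule submoduleI'[OF reg])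
    note CD = submoduleD[OF C]
    show "J C \<subseteq> carrier (reg_mod R)" by (auto simp: J_def)
    have "\<zero>\<^bsub>M\<^esub> \<ominus>\<^bsub>M\<^esub> \<zero>\<^bsub>R\<^esub> \<odot>\<^bsub>M\<^esub> s = \<zero>\<^bsub>M\<^esub>" using s by (simp add: a_minus_def M.r_neg)
    then show "\<zero>\<^bsub>reg_mod R\<^esub> \<in> J C" using CD(3) AD(3) by (auto simp: J_def intro!: bexI[of _ "\<zero>\<^bsub>M\<^esub>"])
    fix r r' assume "r \<in> J C" "r' \<in> J C"
    then obtain b b' where b: "b \<in> C" "b \<ominus>\<^bsub>M\<^esub> r \<odot>\<^bsub>M\<^esub> s \<in> A" "b' \<in> C" "b' \<ominus>\<^bsub>M\<^esub> r' \<odot>\<^bsub>M\<^esub> s \<in> A"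
      and r: "r \<in> carrier R" "r' \<in> carrier R" by (auto simp: J_def)
    have "(b \<oplus>\<^bsub>M\<^esub> b') \<ominus>\<^bsub>M\<^esub> (r \<oplus>\<^bsub>R\<^esub> r') \<odot>\<^bsub>M\<^esub> s = (b \<ominus>\<^bsub>M\<^esub> r \<odot>\<^bsub>M\<^esub> s) \<oplus>\<^bsub>M\<^esub> (b' \<ominus>\<^bsub>M\<^esub> r' \<odot>\<^bsub>M\<^esub> s)"
      using r s CD(2)[OF b(1)] CD(2)[OF b(3)] by (simp add: a_minus_def M.smult_l_distr M.minus_add M.a_ac)
    then show "r \<oplus>\<^bsub>reg_mod R\<^esub> r' \<in> J C"
      using b r CD(4)[OF b(1,3)] AD(4)[OF b(2,4)] by (auto simp: J_def intro!: bexI[of _ "b \<oplus>\<^bsub>M\<^esub> b'"])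
  next
    note CD = submoduleD[OF C]
    fix q r assume q: "q \<in> carrier R" and "r \<in> J C"
    then obtain b where b: "b \<in> C" "b \<ominus>\<^bsub>M\<^esub> r \<odot>\<^bsub>M\<^esub> s \<in> A" and r: "r \<in> carrier R" by (auto simp: J_def)
    have "q \<odot>\<^bsub>M\<^esub> b \<ominus>\<^bsub>M\<^esub> (q \<otimes>\<^bsub>R\<^esub> r) \<odot>\<^bsub>M\<^esub> s = q \<odot>\<^bsub>M\<^esub> (b \<ominus>\<^bsub>M\<^esub> r \<odot>\<^bsub>M\<^esub> s)"
      using q r s CD(2)[OF b(1)] by (simp add: a_minus_def M.smult_r_distr M.smult_r_minus M.smult_assoc1)
    then show "q \<odot>\<^bsub>reg_mod R\<^esub> r \<in> J C"
      using b q r CD(6)[OF q b(1)] AD(6)[OF q b(2)] by (auto simp: J_def intro!: bexI[of _ "q \<odot>\<^bsub>M\<^esub> b"])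
  qed
  obtain G where G: "G \<subseteq> carrier R" "finite G" "J B = Idl\<^bsub>R\<^esub> G"
    using noetherian_ring.finetely_gen[OF R(2) ideal_submodule_reg_mod[OF R(1) J[OF insert.prems(2)]]] by blast
  have GJ: "G \<subseteq> J B" using G M.genideal_self by blast
  then have "\<forall>g\<in>G. \<exists>b\<in>B. b \<ominus>\<^bsub>M\<^esub> g \<odot>\<^bsub>M\<^esub> s \<in> A" by (auto simp: J_def)
  then obtain \<beta> where \<beta>: "\<And>g. g \<in> G \<Longrightarrow> \<beta> g \<in> B" "\<And>g. g \<in> G \<Longrightarrow> \<beta> g \<ominus>\<^bsub>M\<^esub> g \<odot>\<^bsub>M\<^esub> s \<in> A" by metis
  \<comment> \<open>The elements \<open>\<beta> g\<close> of \<open>B\<close> realise the generators of the coefficient ideal, so they realise all of it.\<close>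
  define C where "C = mod_span R M (\<beta> ` G)"
  have CB: "C \<subseteq> B" unfolding C_def by (rule mod_span_least[OF M insert.prems(2)]) (use \<beta> in auto)
  have C: "submodule C R M" unfolding C_def by (rule submodule_mod_span[OF M]) (use \<beta> BD in auto)
  have "\<beta> g \<in> C" if "g \<in> G" for g using mod_span_superset[OF M, of "\<beta> ` G"] that by (auto simp: C_def)
  then have "G \<subseteq> J C" using \<beta> G by (auto simp: J_def)
  then have JB: "J B \<subseteq> J C"
    unfolding G(3) by (intro M.genideal_minimal ideal_submodule_reg_mod[OF R(1) J[OF C]])
  let ?T = "T' \<union> \<beta> ` G"
  have sub: "?T \<union> I \<subseteq> carrier M" using T' \<beta> BD(1) Isub by blast
  note TD = submoduleD[OF submodule_mod_span[OF M sub]]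
  have "b \<in> mod_span R M (?T \<union> I)" if b: "b \<in> B" for b
  proof -
    have bM: "b \<in> carrier M" using BD(2)[OF b] .
    have "b \<in> mod_span R M ({s} \<union> (S \<union> I))" using insert.prems(3) b by auto
    then obtain t a where ta: "t \<in> mod_span R M {s}" "a \<in> A" "b = t \<oplus>\<^bsub>M\<^esub> a"
      using mod_span_Un[OF M _ SI, of "{s}"] s unfolding A_def by blast
    then obtain r where r: "r \<in> carrier R" "t = r \<odot>\<^bsub>M\<^esub> s" using mod_span_single[OF M s] by blast
    have aM: "a \<in> carrier M" using AD(2) ta by blast
    have bra: "b \<ominus>\<^bsub>M\<^esub> r \<odot>\<^bsub>M\<^esub> s = a"
      using aM r s unfolding ta(3) r(2) a_minus_def by (simp add: M.a_assoc M.a_comm[of a] M.r_neg2)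
    then have "b \<ominus>\<^bsub>M\<^esub> r \<odot>\<^bsub>M\<^esub> s \<in> A" using ta(2) by simp
    then have "r \<in> J B" using r(1) b unfolding J_def by blast
    then obtain c where c: "c \<in> C" "c \<ominus>\<^bsub>M\<^esub> r \<odot>\<^bsub>M\<^esub> s \<in> A" using JB by (auto simp: J_def)
    have cM: "c \<in> carrier M" using submodule_mem[OF C c(1)] .
    \<comment> \<open>\<open>b\<close> and \<open>c\<close> have the same coefficient of \<open>s\<close>, so their difference is in \<open>B \<inter> A\<close>.\<close>
    have "b \<ominus>\<^bsub>M\<^esub> c = (b \<ominus>\<^bsub>M\<^esub> r \<odot>\<^bsub>M\<^esub> s) \<ominus>\<^bsub>M\<^esub> (c \<ominus>\<^bsub>M\<^esub> r \<odot>\<^bsub>M\<^esub> s)"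
    proof -
      have "b \<ominus>\<^bsub>M\<^esub> r \<odot>\<^bsub>M\<^esub> s \<ominus>\<^bsub>M\<^esub> (c \<ominus>\<^bsub>M\<^esub> r \<odot>\<^bsub>M\<^esub> s)
        = b \<oplus>\<^bsub>M\<^esub> (\<ominus>\<^bsub>M\<^esub> c \<oplus>\<^bsub>M\<^esub> (r \<odot>\<^bsub>M\<^esub> s \<oplus>\<^bsub>M\<^esub> \<ominus>\<^bsub>M\<^esub> (r \<odot>\<^bsub>M\<^esub> s)))"
        using bM cM r s by (simp add: a_minus_def M.minus_add M.a_ac del: M.r_neg)
      then show ?thesis using bM cM r s by (simp add: a_minus_def M.r_neg)
    qed
    also have "\<dots> \<in> A" using bra ta c submodule_diff[OF A] by simp
    finally have "b \<ominus>\<^bsub>M\<^esub> c \<in> B \<inter> A" using submodule_diff[OF insert.prems(2) b] c CB by blast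
    then have "b \<ominus>\<^bsub>M\<^esub> c \<in> mod_span R M (?T \<union> I)"
      using T'(3) mod_span_mono[OF M, of "T' \<union> I" "?T \<union> I"] by blast
    moreover have "c \<in> mod_span R M (?T \<union> I)"
      using c mod_span_mono[OF M, of "\<beta> ` G" "?T \<union> I"] unfolding C_def by blast
    ultimately have "(b \<ominus>\<^bsub>M\<^esub> c) \<oplus>\<^bsub>M\<^esub> c \<in> mod_span R M (?T \<union> I)" by (rule TD(4))
    moreover have "(b \<ominus>\<^bsub>M\<^esub> c) \<oplus>\<^bsub>M\<^esub> c = b" using bM cM by (simp add: a_minus_def M.a_assoc M.l_neg)
    ultimately show ?thesis by simp
  qed
  moreover have "?T \<subseteq> B" "finite ?T" using T' G \<beta> by auto
  ultimately show ?case by (intro exI[of _ ?T]) auto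
qed

text \<open>Finite generation of the quotient by \<open>N\<close>, expressed inside \<open>M\<close> to avoid calculations with cosets.\<close>

definition cofinite_sub :: "('r, 'z) ring_scheme \<Rightarrow> ('r, 'm, 'u) module_scheme \<Rightarrow> 'm set \<Rightarrow> bool" where
  "cofinite_sub R M N \<longleftrightarrow> submodule N R M \<and>
     (\<exists>S\<subseteq>carrier M. finite S \<and> carrier M \<subseteq> mod_span R M (S \<union> N))"

lemma fin_gen_quot_mod_iff:
  assumes M: "module R M" and N: "submodule N R M"
  shows "fin_gen_mod R (quot_mod M N) \<longleftrightarrow> cofinite_sub R M N"
proof -
  interpret M: module R M by fact
  let ?Q = "quot_mod M N" and ?\<pi> = "\<lambda>x. N +>\<^bsub>M\<^esub> x"
  have Q: "module R ?Q" by (rule module_quot_mod[OF M N])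
  have lin: "?\<pi> \<in> lin_map R M ?Q" by (rule lin_map_coset[OF M N])
  have surj: "?\<pi> ` carrier M = carrier ?Q" by (rule coset_surj[OF M N])
  show ?thesis
  proof
    assume "fin_gen_mod R ?Q"
    then obtain S' where S': "S' \<subseteq> carrier ?Q" "finite S'" "carrier ?Q = mod_span R ?Q S'"
      by (auto simp: fin_gen_mod_def)
    then obtain S where S: "S \<subseteq> carrier M" "finite S" "S' = ?\<pi> ` S"
      using finite_subset_image[of S' ?\<pi> "carrier M"] surj by auto
    have SN: "S \<union> N \<subseteq> carrier M" using S submodule_subset[OF N] by auto
    note sp = submodule_mod_span[OF M SN]
    have "x \<in> mod_span R M (S \<union> N)" if x: "x \<in> carrier M" for x
    proof -
      have "mod_span R ?Q S' \<subseteq> ?\<pi> ` mod_span R M (S \<union> N)"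
        using mod_span_superset[OF M, of "S \<union> N"] unfolding S(3)
        by (intro mod_span_least[OF Q] submodule_image[OF M Q lin sp]) auto
      then have "?\<pi> x \<in> ?\<pi> ` mod_span R M (S \<union> N)"
        using lin_map_closed[OF lin x] S'(3) by (metis subsetD)
      then obtain y where y: "y \<in> mod_span R M (S \<union> N)" "?\<pi> x = ?\<pi> y" by (elim imageE)
      have yM: "y \<in> carrier M" using submodule_mem[OF sp y(1)] .
      have "x \<ominus>\<^bsub>M\<^esub> y \<in> N" using y(2) coset_eq_iff[OF M N x yM] by simp
      then have "x \<ominus>\<^bsub>M\<^esub> y \<in> mod_span R M (S \<union> N)" using mod_span_superset[OF M, of "S \<union> N"] by blast
      from submodule_add[OF sp this y(1)] show ?thesis
        using x yM by (simp add: a_minus_def M.a_assoc M.l_neg)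
    qed
    then show "cofinite_sub R M N" unfolding cofinite_sub_def using S N by blast
  next
    assume "cofinite_sub R M N"
    then obtain S where S: "S \<subseteq> carrier M" "finite S" "carrier M \<subseteq> mod_span R M (S \<union> N)"
      by (auto simp: cofinite_sub_def)
    have S'Q: "?\<pi> ` S \<subseteq> carrier ?Q" using S lin_map_closed[OF lin] by auto
    note sp = submodule_mod_span[OF Q S'Q]
    have "mod_span R M (S \<union> N) \<subseteq> {x \<in> carrier M. ?\<pi> x \<in> mod_span R ?Q (?\<pi> ` S)}"
    proof (rule mod_span_least[OF M submodule_vimage[OF M Q lin sp]])
      have "?\<pi> x \<in> mod_span R ?Q (?\<pi> ` S)" if "x \<in> N" for x
        using coset_zero_iff[OF M N, of x] that submodule_mem[OF N that] submodule_zero[OF sp] by simp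
      then show "S \<union> N \<subseteq> {x \<in> carrier M. ?\<pi> x \<in> mod_span R ?Q (?\<pi> ` S)}"
        using S submodule_subset[OF N] mod_span_superset[OF Q, of "?\<pi> ` S"] by auto
    qed
    then have "?\<pi> ` carrier M \<subseteq> mod_span R ?Q (?\<pi> ` S)" using S by auto
    then have "carrier ?Q \<subseteq> mod_span R ?Q (?\<pi> ` S)" unfolding surj .
    then show "fin_gen_mod R ?Q"
      unfolding fin_gen_mod_def using S S'Q submodule_subset[OF sp] by (intro exI[of _ "?\<pi> ` S"]) auto
  qed
qed

lemma cofinite_sub_mono:
  assumes "module R M" "cofinite_sub R M N" "submodule N' R M" "N \<subseteq> N'"
  shows "cofinite_sub R M N'"
proof -
  obtain S where S: "S \<subseteq> carrier M" "finite S" "carrier M \<subseteq> mod_span R M (S \<union> N)"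
    using assms(2) by (auto simp: cofinite_sub_def)
  have "mod_span R M (S \<union> N) \<subseteq> mod_span R M (S \<union> N')"
    using assms(4) by (intro mod_span_mono[OF assms(1)]) auto
  then show ?thesis using S assms(3) by (auto simp: cofinite_sub_def)
qed

lemma cofinite_sub_carrier:
  assumes "module R M" shows "cofinite_sub R M (carrier M)"
  unfolding cofinite_sub_def
  using module.carrier_is_submodule[OF assms] mod_span_superset[OF assms, of "carrier M"]
  by (intro conjI exI[of _ "{}"]) auto

context
  fixes R :: "('r, 'z) ring_scheme"
  assumes R: "cring R" and noeth: "noetherian_ring R"
begin

text \<open>The quotient by the preimage embeds into the quotient by \<open>Q\<close>, which is a Noetherian module.\<close>

lemma cofinite_sub_vimage:
  assumes A: "module R A" and P: "module R P" and lin: "\<phi> \<in> lin_map R A P" and Q: "cofinite_sub R P Q"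
  shows "cofinite_sub R A {x \<in> carrier A. \<phi> x \<in> Q}"
proof -
  interpret A: module R A by fact
  interpret P: module R P by fact
  obtain S where S: "S \<subseteq> carrier P" "finite S" "carrier P \<subseteq> mod_span R P (S \<union> Q)" and Qs: "submodule Q R P"
    using Q by (auto simp: cofinite_sub_def)
  let ?N = "{x \<in> carrier A. \<phi> x \<in> Q}" and ?B = "\<phi> ` carrier A"
  have N: "submodule ?N R A" by (rule submodule_vimage[OF A P lin Qs])
  have B: "submodule ?B R P" by (rule submodule_image[OF A P lin A.carrier_is_submodule])
  obtain T where T: "T \<subseteq> ?B" "finite T" "?B \<subseteq> mod_span R P (T \<union> Q)"
    using noetherian_relative[OF R noeth P Qs S(2,1) B] S(3) submodule_subset[OF B] by blast
  obtain T0 where T0: "T0 \<subseteq> carrier A" "finite T0" "T = \<phi> ` T0"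
    using finite_subset_image[OF T(2,1)] by auto
  note sp = submodule_mod_span[OF A T0(1)]
  have TP: "T \<subseteq> carrier P" using T submodule_subset[OF B] by blast
  have "mod_span R P T \<subseteq> \<phi> ` mod_span R A T0"
    unfolding T0(3) using mod_span_superset[OF A, of T0]
    by (intro mod_span_least[OF P submodule_image[OF A P lin sp]]) auto
  have "a \<in> mod_span R A (T0 \<union> ?N)" if a: "a \<in> carrier A" for a
  proof -
    have "\<phi> a \<in> mod_span R P (T \<union> Q)" using T a by blast
    then obtain t q where tq: "t \<in> mod_span R P T" "q \<in> Q" "\<phi> a = t \<oplus>\<^bsub>P\<^esub> q"
      using mod_span_Un[OF P TP submodule_subset[OF Qs]] mod_span_submodule[OF P Qs] by metis
    then obtain u where u: "u \<in> mod_span R A T0" "t = \<phi> u"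
      using \<open>mod_span R P T \<subseteq> \<phi> ` mod_span R A T0\<close> by blast
    have uA: "u \<in> carrier A" using submodule_mem[OF sp u(1)] .
    have "\<phi> (a \<ominus>\<^bsub>A\<^esub> u) = q"
      using lin_map_diff[OF A P lin a uA] tq u(2) submodule_mem[OF Qs tq(2)] lin_map_closed[OF lin uA]
      by (simp add: a_minus_def P.a_assoc P.a_comm[of q] P.r_neg2)
    then have "a \<ominus>\<^bsub>A\<^esub> u \<in> ?N" using tq a uA by simp
    then have 1: "a \<ominus>\<^bsub>A\<^esub> u \<in> mod_span R A (T0 \<union> ?N)" using mod_span_superset[OF A, of "T0 \<union> ?N"] by blast
    have 2: "u \<in> mod_span R A (T0 \<union> ?N)" using u mod_span_mono[OF A, of T0 "T0 \<union> ?N"] by blast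
    have sub: "T0 \<union> ?N \<subseteq> carrier A" using T0 by auto
    show ?thesis using submodule_add[OF submodule_mod_span[OF A sub] 1 2] a uA
      by (simp add: a_minus_def A.a_assoc A.l_neg)
  qed
  then show ?thesis unfolding cofinite_sub_def using N T0 by blast
qed

text \<open>\<open>I \<inter> J\<close> is cofinite in \<open>J\<close>, as the preimage of \<open>I\<close> under the inclusion of \<open>J\<close>, and \<open>J\<close> is cofinite in \<open>A\<close>.\<close>

lemma cofinite_sub_Int:
  assumes A: "module R A" and I: "cofinite_sub R A I" and J: "cofinite_sub R A J"
  shows "cofinite_sub R A (I \<inter> J)"
proof -
  have Is: "submodule I R A" and Js: "submodule J R A" using I J by (auto simp: cofinite_sub_def)
  obtain S where S: "S \<subseteq> carrier A" "finite S" "carrier A \<subseteq> mod_span R A (S \<union> J)"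
    using J by (auto simp: cofinite_sub_def)
  let ?AJ = "A\<lparr>carrier := J\<rparr>"
  have AJ: "module R ?AJ" by (rule module_submodule[OF A Js])
  have lin: "(\<lambda>x. x) \<in> lin_map R ?AJ A" using submodule_mem[OF Js] by (auto intro!: lin_mapI)
  have IJ: "{x \<in> J. x \<in> I} = I \<inter> J" by auto
  have "cofinite_sub R ?AJ (I \<inter> J)" using cofinite_sub_vimage[OF AJ A lin I] by (simp add: IJ)
  then obtain T where T: "T \<subseteq> J" "finite T" "J \<subseteq> mod_span R ?AJ (T \<union> (I \<inter> J))"
    by (auto simp: cofinite_sub_def)
  have sub: "(S \<union> T) \<union> (I \<inter> J) \<subseteq> carrier A" using S T submodule_subset[OF Js] by auto
  let ?N = "mod_span R A ((S \<union> T) \<union> (I \<inter> J))"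
  have N: "submodule ?N R A" by (rule submodule_mod_span[OF A sub])
  have sup: "(S \<union> T) \<union> (I \<inter> J) \<subseteq> ?N" by (rule mod_span_superset[OF A])
  have "J \<subseteq> ?N"
  proof -
    have "submodule {x \<in> carrier ?AJ. x \<in> ?N} R ?AJ" by (rule submodule_vimage[OF AJ A lin N])
    then have "mod_span R ?AJ (T \<union> (I \<inter> J)) \<subseteq> {x \<in> carrier ?AJ. x \<in> ?N}"
      using T sup by (intro mod_span_least[OF AJ]) auto
    then show ?thesis using T by auto
  qed
  then have "mod_span R A (S \<union> J) \<subseteq> ?N" using sup by (intro mod_span_least[OF A N]) auto
  then show ?thesis
    unfolding cofinite_sub_def using S T submodule_subset[OF Js] submodule_Int[OF A Is Js]
    by (intro conjI exI[of _ "S \<union> T"]) auto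
qed

lemma cofinite_sub_zero_reg_mod: "cofinite_sub R (reg_mod R) {\<zero>\<^bsub>R\<^esub>}"
proof -
  interpret cring R by (rule R)
  have sub: "{\<one>\<^bsub>R\<^esub>} \<union> {\<zero>\<^bsub>R\<^esub>} \<subseteq> carrier (reg_mod R)" by auto
  note sp = submoduleD[OF submodule_mod_span[OF module_reg_mod sub]]
  have "r \<in> mod_span R (reg_mod R) ({\<one>\<^bsub>R\<^esub>} \<union> {\<zero>\<^bsub>R\<^esub>})" if "r \<in> carrier R" for r
    using sp(6)[OF that, of "\<one>\<^bsub>R\<^esub>"] mod_span_superset[OF module_reg_mod, of "{\<one>\<^bsub>R\<^esub>} \<union> {\<zero>\<^bsub>R\<^esub>}"] that by simp
  then show ?thesis
    unfolding cofinite_sub_def using submodule_zero_set[OF module_reg_mod]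
    by (intro conjI exI[of _ "{\<one>\<^bsub>R\<^esub>}"]) auto
qed

lemma cofinite_sub_kernels:
  assumes A: "module R A" and "\<And>k. k \<in> set ks \<Longrightarrow> k \<in> lin_map R A (reg_mod R)"
  shows "cofinite_sub R A {x \<in> carrier A. \<forall>k\<in>set ks. k x = \<zero>\<^bsub>R\<^esub>}"
  using assms(2)
proof (induction ks)
  case Nil
  then show ?case using cofinite_sub_carrier[OF A] by simp
next
  case (Cons k ks)
  have "cofinite_sub R A {x \<in> carrier A. k x \<in> {\<zero>\<^bsub>R\<^esub>}}"
    using Cons.prems by (intro cofinite_sub_vimage[OF A cring.module_reg_mod[OF R] _ cofinite_sub_zero_reg_mod]) auto
  from cofinite_sub_Int[OF A this Cons.IH] Cons.prems
  have "cofinite_sub R A ({x \<in> carrier A. k x \<in> {\<zero>\<^bsub>R\<^esub>}} \<inter> {x \<in> carrier A. \<forall>k\<in>set ks. k x = \<zero>\<^bsub>R\<^esub>})" by simp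
  moreover have "{x \<in> carrier A. k x \<in> {\<zero>\<^bsub>R\<^esub>}} \<inter> {x \<in> carrier A. \<forall>k\<in>set ks. k x = \<zero>\<^bsub>R\<^esub>}
    = {x \<in> carrier A. \<forall>k\<in>set (k # ks). k x = \<zero>\<^bsub>R\<^esub>}" by auto
  ultimately show ?case by simp
qed

end

section \<open>Modules of functions and dual modules\<close>

text \<open>Its elements are \<^const>\<open>undefined\<close> off \<open>X\<close>, in accordance with \<^const>\<open>dual_mod\<close>, whose operations are those of
\<open>fun_mod (carrier M) (reg_mod R)\<close>.\<close>

definition fun_mod :: "'x set \<Rightarrow> ('r, 'm, 'u) module_scheme \<Rightarrow> ('r, 'x \<Rightarrow> 'm) module" where
  "fun_mod X W = \<lparr>carrier = (X \<rightarrow>\<^sub>E carrier W), monoid.mult = undefined, monoid.one = undefined,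
     ring.zero = (\<lambda>x\<in>X. \<zero>\<^bsub>W\<^esub>), ring.add = (\<lambda>f g. \<lambda>x\<in>X. f x \<oplus>\<^bsub>W\<^esub> g x),
     smult = (\<lambda>r f. \<lambda>x\<in>X. r \<odot>\<^bsub>W\<^esub> f x)\<rparr>"

lemma fun_mod_simps [simp]:
  "carrier (fun_mod X W) = (X \<rightarrow>\<^sub>E carrier W)"
  "\<zero>\<^bsub>fun_mod X W\<^esub> = (\<lambda>x\<in>X. \<zero>\<^bsub>W\<^esub>)" "f \<oplus>\<^bsub>fun_mod X W\<^esub> g = (\<lambda>x\<in>X. f x \<oplus>\<^bsub>W\<^esub> g x)"
  "r \<odot>\<^bsub>fun_mod X W\<^esub> f = (\<lambda>x\<in>X. r \<odot>\<^bsub>W\<^esub> f x)"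
  by (simp_all add: fun_mod_def)

lemma module_fun_mod:
  assumes "module R W" shows "module R (fun_mod X W)"
proof -
  interpret W: module R W by fact
  show ?thesis
  proof (rule moduleI)
    show "abelian_group (fun_mod X W)"
    proof (rule abelian_groupI)
      fix f assume f: "f \<in> carrier (fun_mod X W)"
      then show "\<exists>g\<in>carrier (fun_mod X W). g \<oplus>\<^bsub>fun_mod X W\<^esub> f = \<zero>\<^bsub>fun_mod X W\<^esub>"
        by (intro bexI[of _ "\<lambda>x\<in>X. \<ominus>\<^bsub>W\<^esub> f x"])
           (auto simp: PiE_iff W.l_neg restrict_def fun_eq_iff extensional_def)
    qed (auto simp: PiE_iff W.a_ac restrict_def fun_eq_iff extensional_def)
  qed (auto simp: PiE_iff W.is_cring W.smult_l_distr W.smult_r_distr W.smult_assoc1 restrict_def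
        fun_eq_iff extensional_def)
qed

lemma lsum_fun_mod: "lsum (fun_mod X W) f xs = (\<lambda>x\<in>X. lsum W (\<lambda>i. f i x) xs)"
  by (induction xs) auto

lemma submodule_Hom_mod:
  assumes "module R M"
  shows "submodule (Hom_mod R M (reg_mod R)) R (fun_mod (carrier M) (reg_mod R))"
proof -
  interpret M: module R M by fact
  show ?thesis
    by (rule submoduleI'[OF module_fun_mod[OF M.module_reg_mod]])
       (auto simp: Hom_mod_def lin_map_def PiE_iff Pi_iff M.R.a_ac M.r_distr M.m_lcomm extensional_def)
qed

section \<open>The alpha-condition in terms of elements\<close>

lemma quotient_lift:
  assumes M: "module R M" and N: "submodule N R M" and P: "module R P" and f: "f \<in> lin_map R M P"
    and ker: "\<And>x. x \<in> N \<Longrightarrow> f x = \<zero>\<^bsub>P\<^esub>"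
  shows "\<exists>g\<in>lin_map R (quot_mod M N) P. \<forall>x\<in>carrier M. g (N +>\<^bsub>M\<^esub> x) = f x"
proof -
  interpret M: module R M by fact
  interpret P: module R P by fact
  let ?\<pi> = "\<lambda>x. N +>\<^bsub>M\<^esub> x"
  define g where "g X = f (SOME x. x \<in> carrier M \<and> ?\<pi> x = X)" for X
  have g: "g (?\<pi> x) = f x" if x: "x \<in> carrier M" for x
  proof -
    define y where "y = (SOME y. y \<in> carrier M \<and> ?\<pi> y = ?\<pi> x)"
    have "y \<in> carrier M \<and> ?\<pi> y = ?\<pi> x"
      unfolding y_def by (rule someI[of "\<lambda>y. y \<in> carrier M \<and> ?\<pi> y = ?\<pi> x" x]) (use x in simp)
    then have y: "y \<in> carrier M" "y \<ominus>\<^bsub>M\<^esub> x \<in> N" using coset_eq_iff[OF M N _ x] by auto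
    have "f y \<ominus>\<^bsub>P\<^esub> f x = \<zero>\<^bsub>P\<^esub>" using ker[OF y(2)] lin_map_diff[OF M P f y(1) x] by simp
    then have "f y = f x" by (rule P.diff_zero_imp_eq[OF lin_map_closed[OF f y(1)] lin_map_closed[OF f x]])
    then show ?thesis by (simp add: g_def y_def)
  qed
  have ex: "\<exists>x\<in>carrier M. X = ?\<pi> x" if "X \<in> carrier (quot_mod M N)" for X
    using that coset_surj[OF M N] by (metis imageE)
  note \<pi> = lin_mapD[OF lin_map_coset[OF M N]] and fD = lin_mapD[OF f]
  have "g \<in> lin_map R (quot_mod M N) P"
  proof (rule lin_mapI)
    fix X Y assume "X \<in> carrier (quot_mod M N)" "Y \<in> carrier (quot_mod M N)"
    then obtain x y where x: "x \<in> carrier M" "X = ?\<pi> x" and y: "y \<in> carrier M" "Y = ?\<pi> y" using ex by meson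
    show "g (X \<oplus>\<^bsub>quot_mod M N\<^esub> Y) = g X \<oplus>\<^bsub>P\<^esub> g Y"
      unfolding x(2) y(2) \<pi>(2)[OF x(1) y(1), symmetric] g[OF x(1)] g[OF y(1)] g[OF M.a_closed[OF x(1) y(1)]]
      by (rule fD(2)[OF x(1) y(1)])
  next
    fix r X assume r: "r \<in> carrier R" and "X \<in> carrier (quot_mod M N)"
    then obtain x where x: "x \<in> carrier M" "X = ?\<pi> x" using ex by meson
    show "g (r \<odot>\<^bsub>quot_mod M N\<^esub> X) = r \<odot>\<^bsub>P\<^esub> g X"
      unfolding x(2) \<pi>(3)[OF r x(1), symmetric] g[OF x(1)] g[OF M.smult_closed[OF r x(1)]]
      by (rule fD(3)[OF r x(1)])
  next
    fix X assume "X \<in> carrier (quot_mod M N)"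
    then obtain x where x: "x \<in> carrier M" "X = ?\<pi> x" using ex by meson
    show "g X \<in> carrier P" unfolding x(2) g[OF x(1)] by (rule fD(1)[OF x(1)])
  qed
  then show ?thesis using g by blast
qed

text \<open>The alpha-condition without tensor products. If every vector \<open>(\<langle>v, w\<^sub>i\<rangle>)\<^sub>i\<close> lies in \<open>N\<close>, then \<open>(w\<^sub>i)\<^sub>i\<close>, viewed as
an element of \<open>W\<^sup>n = R\<^sup>n \<otimes> W\<close>, comes from \<open>N \<otimes> W\<close>. Elements of \<open>R\<^sup>n\<close> are functions on \<^typ>\<open>nat\<close> that vanish from \<open>n\<close> on.
No modules are quantified over, so the property does not depend on a choice of type.\<close>

definition pairing_factors ::
  "('r, 'z) ring_scheme \<Rightarrow> ('r, 'v, 's) module_scheme \<Rightarrow> ('r, 'w, 't) module_scheme \<Rightarrow>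
   ('v \<Rightarrow> 'w \<Rightarrow> 'r) \<Rightarrow> bool" where
  "pairing_factors R V W form \<longleftrightarrow>
     (\<forall>n w N. (\<forall>i<n. w i \<in> carrier W) \<longrightarrow> submodule N R (free_mod R {..<n::nat}) \<longrightarrow>
        (\<forall>v\<in>carrier V. (\<lambda>i. if i < n then form v (w i) else \<zero>\<^bsub>R\<^esub>) \<in> N) \<longrightarrow>
        (\<exists>cs. set cs \<subseteq> N \<times> carrier W \<and> (\<forall>i<n. w i = lsum W (\<lambda>p. fst p i \<odot>\<^bsub>W\<^esub> snd p) cs)))"

lemma pairing_factorsD:
  assumes "pairing_factors R V W form" "\<And>i. i < n \<Longrightarrow> w i \<in> carrier W"
    "submodule N R (free_mod R {..<n::nat})"
    "\<And>v. v \<in> carrier V \<Longrightarrow> (\<lambda>i. if i < n then form v (w i) else \<zero>\<^bsub>R\<^esub>) \<in> N"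
  obtains cs where "set cs \<subseteq> N \<times> carrier W" "\<And>i. i < n \<Longrightarrow> w i = lsum W (\<lambda>p. fst p i \<odot>\<^bsub>W\<^esub> snd p) cs"
  using assms unfolding pairing_factors_def by blast

context
  fixes R :: "('r, 'z) ring_scheme" and V :: "('r, 'v, 's) module_scheme"
    and W :: "('r, 'w, 't) module_scheme" and form
  assumes W: "module R W" and form: "\<And>v. v \<in> carrier V \<Longrightarrow> form v \<in> lin_map R W (reg_mod R)"
begin

interpretation W: module R W by (rule W)

lemma form_bilin:
  assumes M: "module R M" and v: "v \<in> carrier V"
  shows "(\<lambda>m w. form v w \<odot>\<^bsub>M\<^esub> m) \<in> bilin_map R M W M"
proof -
  interpret M: module R M by fact
  show ?thesis using lin_mapD[OF form[OF v]]
    by (intro bilin_mapI lin_mapI)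
       (auto simp: M.smult_l_distr M.smult_r_distr M.smult_assoc1 M.smult_left_commute)
qed

text \<open>Let \<open>e\<^sub>i\<close> be the basis vectors of \<open>R\<^sup>n\<close>. The tensor \<open>\<Sum> [e\<^sub>i] \<otimes> w\<^sub>i\<close> in \<open>R\<^sup>n/N \<otimes> W\<close> evaluates at \<open>v\<close> to the class
of \<open>(\<langle>v, w\<^sub>i\<rangle>)\<^sub>i\<close>, which is zero, so the tensor vanishes by the alpha-condition. The map
\<open>([c], u) \<mapsto> [(c\<^sub>i u)\<^sub>i]\<close> into \<open>W\<^sup>n/N W\<close> sends it to the class of \<open>(w\<^sub>i)\<^sub>i\<close>, which therefore lies in \<open>N W\<close>.\<close>

lemma alpha_condition_imp_factors:
  assumes alpha: "alpha_condition TYPE((nat \<Rightarrow> 'r) set) R V W form"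
  shows "pairing_factors R V W form"
  unfolding pairing_factors_def
proof (intro allI impI)
  fix n :: nat and w N
  assume w: "\<forall>i<n. w i \<in> carrier W" and N: "submodule N R (free_mod R {..<n})"
    and vals: "\<forall>v\<in>carrier V. (\<lambda>i. if i < n then form v (w i) else \<zero>\<^bsub>R\<^esub>) \<in> N"
  let ?F = "free_mod R {..<n}"
  let ?M = "quot_mod ?F N" and ?W = "fun_mod {..<n} W"
  let ?T = "tensor R ?M W" and ?\<pi> = "\<lambda>c. N +>\<^bsub>?F\<^esub> c"
  have F: "module R ?F" by (rule W.module_free_mod)
  have M: "module R ?M" by (rule module_quot_mod[OF F N])
  have T: "module R ?T" by (rule module_tensor[OF M W])
  interpret F: module R ?F by (rule F)
  interpret M: module R ?M by (rule M)
  interpret T: module R ?T by (rule T)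
  have lin_\<pi>: "?\<pi> \<in> lin_map R ?F ?M" by (rule lin_map_coset[OF F N])
  have e: "free_gen R i \<in> carrier ?F" if "i < n" for i using W.free_gen_closed[of i] that by simp
  have e\<pi>: "?\<pi> (free_gen R i) \<in> carrier ?M" if "i < n" for i by (rule lin_map_closed[OF lin_\<pi> e[OF that]])
  have cR: "c i \<in> carrier R" if "c \<in> carrier ?F" for c i by (rule W.free_mod_closed[OF that])
  define ps where "ps = map (\<lambda>i. (?\<pi> (free_gen R i), w i)) [0..<n]"
  have ps: "set ps \<subseteq> carrier ?M \<times> carrier W" using e\<pi> w by (auto simp: ps_def)
  define t where "t = tens R ?M W ps"
  have t: "t \<in> carrier ?T" unfolding t_def by (rule tens_closed[OF M W ps])
  have "tensor_sum R ?M (\<lambda>m w. form v w \<odot>\<^bsub>?M\<^esub> m) t = tensor_sum R ?M (\<lambda>m w. form v w \<odot>\<^bsub>?M\<^esub> m) \<zero>\<^bsub>?T\<^esub>"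
    if v: "v \<in> carrier V" for v
  proof -
    note fb = form_bilin[OF M v]
    define c where "c = (\<lambda>i. if i < n then form v (w i) else \<zero>\<^bsub>R\<^esub>)"
    have cN: "c \<in> N" using vals v by (simp add: c_def)
    then have cF: "c \<in> carrier ?F" using submodule_mem[OF N] by blast
    have "tensor_sum R ?M (\<lambda>m w. form v w \<odot>\<^bsub>?M\<^esub> m) t = lsum ?M (\<lambda>i. form v (w i) \<odot>\<^bsub>?M\<^esub> ?\<pi> (free_gen R i)) [0..<n]"
      unfolding t_def tensor_sum_tens[OF M W M fb ps] by (simp add: ps_def lsum_map)
    also have "\<dots> = lsum ?M (\<lambda>i. ?\<pi> (c i \<odot>\<^bsub>?F\<^esub> free_gen R i)) [0..<n]"
    proof (rule lsum_cong[OF refl])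
      fix i assume "i \<in> set [0..<n]"
      then have i: "i < n" by simp
      show "form v (w i) \<odot>\<^bsub>?M\<^esub> ?\<pi> (free_gen R i) = ?\<pi> (c i \<odot>\<^bsub>?F\<^esub> free_gen R i)"
        unfolding lin_map_smult[OF lin_\<pi> cR[OF cF] e[OF i]] using i by (simp add: c_def)
    qed
    also have "\<dots> = ?\<pi> (lsum ?F (\<lambda>i. c i \<odot>\<^bsub>?F\<^esub> free_gen R i) [0..<n])"
      by (rule lin_map_lsum[OF F M lin_\<pi>, symmetric]) (intro F.smult_closed cR[OF cF] e, simp)
    also have "lsum ?F (\<lambda>i. c i \<odot>\<^bsub>?F\<^esub> free_gen R i) [0..<n] = c"
      by (rule W.free_mod_expand[OF cF, symmetric]) (auto simp: c_def)
    also have "?\<pi> c = \<zero>\<^bsub>?M\<^esub>" using coset_zero_iff[OF F N cF] cN by simp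
    also have "\<dots> = tensor_sum R ?M (\<lambda>m w. form v w \<odot>\<^bsub>?M\<^esub> m) \<zero>\<^bsub>?T\<^esub>"
      by (rule lin_map_zero[OF T M lin_map_tensor_sum[OF M W M fb], symmetric])
    finally show ?thesis .
  qed
  then have "(\<lambda>v\<in>carrier V. tensor_sum R ?M (\<lambda>m w. form v w \<odot>\<^bsub>?M\<^esub> m) t) =
      (\<lambda>v\<in>carrier V. tensor_sum R ?M (\<lambda>m w. form v w \<odot>\<^bsub>?M\<^esub> m) \<zero>\<^bsub>?T\<^esub>)"
    by (intro restrict_ext) auto
  moreover have "inj_on (\<lambda>t. \<lambda>v\<in>carrier V. tensor_sum R ?M (\<lambda>m w. form v w \<odot>\<^bsub>?M\<^esub> m) t) (carrier ?T)"
    using alpha M unfolding alpha_condition_def by blast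
  ultimately have t0: "t = \<zero>\<^bsub>?T\<^esub>" using t T.zero_closed by (simp add: inj_on_def)

  \<comment> \<open>\<open>NW\<close> is the submodule \<open>N W\<close> of \<open>W\<^sup>n\<close>; \<open>?\<rho>\<close> below is the projection to the quotient by it.\<close>
  define comb where "comb cs = (\<lambda>i\<in>{..<n}. lsum W (\<lambda>p. fst p i \<odot>\<^bsub>W\<^esub> snd p) cs)" for cs :: "((nat \<Rightarrow> 'r) \<times> 'w) list"
  define NW where "NW = {comb cs | cs. set cs \<subseteq> N \<times> carrier W}"
  have FW: "module R ?W" by (rule module_fun_mod[OF W])
  have NR: "c i \<in> carrier R" if "c \<in> N" for c i using cR submodule_mem[OF N that] by blast
  have mem: "fst p i \<in> carrier R" "snd p \<in> carrier W" if "set cs \<subseteq> N \<times> carrier W" "p \<in> set cs" for p cs i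
    using that NR by auto
  have comb_cl: "comb cs \<in> carrier ?W" if "set cs \<subseteq> N \<times> carrier W" for cs
    unfolding comb_def fun_mod_simps restrict_PiE_iff
    by (intro ballI W.lsum_closed W.smult_closed mem[OF that])
  have NW: "submodule NW R ?W"
  proof (rule submoduleI'[OF FW])
    show "NW \<subseteq> carrier ?W" using comb_cl by (auto simp: NW_def)
    show "\<zero>\<^bsub>?W\<^esub> \<in> NW" unfolding NW_def by (auto simp: comb_def intro!: exI[of _ "[]"])
  next
    fix x y assume "x \<in> NW" "y \<in> NW"
    then obtain cs ds where *: "set cs \<subseteq> N \<times> carrier W" "x = comb cs" "set ds \<subseteq> N \<times> carrier W" "y = comb ds"
      by (auto simp: NW_def)
    have "x \<oplus>\<^bsub>?W\<^esub> y = comb (cs @ ds)"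
      unfolding comb_def * fun_mod_simps
      by (rule restrict_ext, subst W.lsum_append) (use mem[OF *(1)] mem[OF *(3)] in auto)
    then show "x \<oplus>\<^bsub>?W\<^esub> y \<in> NW" using * unfolding NW_def by (auto intro!: exI[of _ "cs @ ds"])
  next
    fix r x assume r: "r \<in> carrier R" and "x \<in> NW"
    then obtain cs where *: "set cs \<subseteq> N \<times> carrier W" "x = comb cs" by (auto simp: NW_def)
    let ?ds = "map (\<lambda>p. (fst p, r \<odot>\<^bsub>W\<^esub> snd p)) cs"
    have "r \<odot>\<^bsub>?W\<^esub> x = comb ?ds"
      unfolding comb_def * fun_mod_simps lsum_map fst_conv snd_conv
    proof (rule restrict_ext)
      fix i assume i: "i \<in> {..<n}"
      have "r \<odot>\<^bsub>W\<^esub> lsum W (\<lambda>p. fst p i \<odot>\<^bsub>W\<^esub> snd p) cs = lsum W (\<lambda>p. r \<odot>\<^bsub>W\<^esub> (fst p i \<odot>\<^bsub>W\<^esub> snd p)) cs"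
        using r mem[OF *(1)] by (intro W.smult_lsum) auto
      also have "\<dots> = lsum W (\<lambda>p. fst p i \<odot>\<^bsub>W\<^esub> (r \<odot>\<^bsub>W\<^esub> snd p)) cs"
        by (intro lsum_cong refl, use r mem[OF *(1)] in \<open>simp add: W.smult_assoc1[symmetric] W.m_comm\<close>)
      finally show "r \<odot>\<^bsub>W\<^esub> (\<lambda>i\<in>{..<n}. lsum W (\<lambda>p. fst p i \<odot>\<^bsub>W\<^esub> snd p) cs) i =
        lsum W (\<lambda>x. fst x i \<odot>\<^bsub>W\<^esub> (r \<odot>\<^bsub>W\<^esub> snd x)) cs" using i by simp
    qed
    moreover have "set ?ds \<subseteq> N \<times> carrier W" using * r by auto
    ultimately show "r \<odot>\<^bsub>?W\<^esub> x \<in> NW" unfolding NW_def by blast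
  qed
  let ?P = "quot_mod ?W NW" and ?\<rho> = "\<lambda>x. NW +>\<^bsub>?W\<^esub> x"
  have P: "module R ?P" by (rule module_quot_mod[OF FW NW])
  interpret P: module R ?P by (rule P)
  have lin_\<rho>: "?\<rho> \<in> lin_map R ?W ?P" by (rule lin_map_coset[OF FW NW])
  define vec where "vec c u = (\<lambda>i\<in>{..<n}. c i \<odot>\<^bsub>W\<^esub> u)" for c :: "nat \<Rightarrow> 'r" and u
  have vec: "vec \<in> bilin_map R ?F W ?W"
    using cR by (intro bilin_mapI lin_mapI)
      (auto simp: vec_def W.smult_l_distr W.smult_r_distr W.smult_assoc1 W.smult_left_commute
        intro!: restrict_ext)
  have "\<exists>g\<in>lin_map R ?M ?P. \<forall>c\<in>carrier ?F. g (?\<pi> c) = ?\<rho> (vec c u)" if u: "u \<in> carrier W" for u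
  proof (rule quotient_lift[OF F N P])
    show "(\<lambda>c. ?\<rho> (vec c u)) \<in> lin_map R ?F ?P" by (rule lin_map_comp[OF bilin_map_left[OF vec u] lin_\<rho>])
    fix c assume c: "c \<in> N"
    have "vec c u = comb [(c, u)]" using u NR[OF c] by (auto simp: vec_def comb_def)
    then have "vec c u \<in> NW" using c u by (auto simp: NW_def intro!: exI[of _ "[(c, u)]"])
    then show "?\<rho> (vec c u) = \<zero>\<^bsub>?P\<^esub>"
      using coset_zero_iff[OF FW NW bilin_map_closed[OF vec submodule_mem[OF N c] u]] by simp
  qed
  then obtain g where g: "\<And>u. u \<in> carrier W \<Longrightarrow> g u \<in> lin_map R ?M ?P"
    "\<And>u c. u \<in> carrier W \<Longrightarrow> c \<in> carrier ?F \<Longrightarrow> g u (?\<pi> c) = ?\<rho> (vec c u)" by metis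
  have ex: "\<exists>c\<in>carrier ?F. X = ?\<pi> c" if "X \<in> carrier ?M" for X
    using that coset_surj[OF F N] by (metis imageE)
  have b: "(\<lambda>X u. g u X) \<in> bilin_map R ?M W ?P"
  proof (rule bilin_mapI)
    fix X assume "X \<in> carrier ?M"
    then obtain c where c: "c \<in> carrier ?F" "X = ?\<pi> c" using ex by blast
    have "(\<lambda>u. ?\<rho> (vec c u)) \<in> lin_map R W ?P" by (rule lin_map_comp[OF bilin_map_right[OF vec c(1)] lin_\<rho>])
    then show "(\<lambda>u. g u X) \<in> lin_map R W ?P"
      by (subst lin_map_cong[OF W]) (use g(2)[OF _ c(1)] c(2) in simp)+
  qed (rule g(1))
  let ?w = "\<lambda>i\<in>{..<n}. w i"
  have wW: "?w \<in> carrier ?W" using w by auto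
  have "\<zero>\<^bsub>?P\<^esub> = tensor_sum R ?P (\<lambda>X u. g u X) t"
    unfolding t0 by (rule lin_map_zero[OF T P lin_map_tensor_sum[OF M W P b], symmetric])
  also have "\<dots> = lsum ?P (\<lambda>i. g (w i) (?\<pi> (free_gen R i))) [0..<n]"
    unfolding t_def tensor_sum_tens[OF M W P b ps] by (simp add: ps_def lsum_map)
  also have "\<dots> = lsum ?P (\<lambda>i. ?\<rho> (vec (free_gen R i) (w i))) [0..<n]"
    using g(2) w e by (intro lsum_cong) auto
  also have "\<dots> = ?\<rho> (lsum ?W (\<lambda>i. vec (free_gen R i) (w i)) [0..<n])"
    by (rule lin_map_lsum[OF FW P lin_\<rho>, symmetric]) (rule bilin_map_closed[OF vec e], use w in auto)
  also have "lsum ?W (\<lambda>i. vec (free_gen R i) (w i)) [0..<n] = ?w"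
    unfolding lsum_fun_mod
  proof (rule restrict_ext)
    fix j assume "j \<in> {..<n}"
    then have j: "j < n" by simp
    have "lsum W (\<lambda>i. vec (free_gen R i) (w i) j) [0..<n] = vec (free_gen R j) (w j) j"
      using j w by (intro W.lsum_single) (auto simp: vec_def free_gen_def)
    then show "lsum W (\<lambda>i. vec (free_gen R i) (w i) j) [0..<n] = w j"
      using j w by (simp add: vec_def free_gen_def)
  qed
  finally have "\<zero>\<^bsub>?P\<^esub> = ?\<rho> ?w" .
  from iffD1[OF coset_zero_iff[OF FW NW wW] this[symmetric]] have "?w \<in> NW" .
  then obtain cs where cs: "set cs \<subseteq> N \<times> carrier W" "?w = comb cs" by (auto simp: NW_def)
  have "w i = lsum W (\<lambda>p. fst p i \<odot>\<^bsub>W\<^esub> snd p) cs" if "i < n" for i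
    using fun_cong[OF cs(2), of i] that by (simp add: comb_def)
  then show "\<exists>cs. set cs \<subseteq> N \<times> carrier W \<and> (\<forall>i<n. w i = lsum W (\<lambda>p. fst p i \<odot>\<^bsub>W\<^esub> snd p) cs)"
    using cs(1) by blast
qed

text \<open>Apply the factorisation to the \<open>w\<^sub>i\<close> and to the module \<open>N\<close> of linear relations between the \<open>m\<^sub>i\<close>. Then
\<open>\<Sum> b m\<^sub>i w\<^sub>i = \<Sum>\<^sub>j b (\<Sum>\<^sub>i c\<^sub>j(i) m\<^sub>i) u\<^sub>j\<close>, where the inner sums vanish. A general \<open>b\<close> is allowed so that tensors with
the factor \<open>W\<close> on either side are covered.\<close>

lemma pairing_factors_zero:
  assumes fac: "pairing_factors R V W form" and M: "module R M" and P: "module R P"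
    and b: "b \<in> bilin_map R M W P" and qs: "set qs \<subseteq> carrier M \<times> carrier W"
    and zero: "\<And>v. v \<in> carrier V \<Longrightarrow> lsum M (\<lambda>q. form v (snd q) \<odot>\<^bsub>M\<^esub> fst q) qs = \<zero>\<^bsub>M\<^esub>"
  shows "lsum P (\<lambda>q. b (fst q) (snd q)) qs = \<zero>\<^bsub>P\<^esub>"
proof -
  interpret M: module R M by fact
  interpret P: module R P by fact
  define n where "n = length qs"
  define m where "m i = fst (qs ! i)" for i
  define w where "w i = snd (qs ! i)" for i
  let ?F = "free_mod R {..<n}"
  have mw: "m i \<in> carrier M" "w i \<in> carrier W" if "i < n" for i
    using subsetD[OF qs nth_mem[of i qs]] that by (auto simp: m_def w_def n_def mem_Times_iff)
  have re: "lsum A (\<lambda>q. g (fst q) (snd q)) qs = lsum A (\<lambda>i. g (m i) (w i)) [0..<n]" for A g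
    by (subst map_nth[of qs, symmetric], subst lsum_map) (simp add: m_def w_def n_def)
  have reP: "lsum P (\<lambda>q. b (fst q) (snd q)) qs = lsum P (\<lambda>i. b (m i) (w i)) [0..<n]"
    by (subst map_nth[of qs, symmetric], subst lsum_map) (simp add: m_def w_def n_def)
  have F: "module R ?F" by (rule W.module_free_mod)
  have cR: "c i \<in> carrier R" if "c \<in> carrier ?F" for c i by (rule W.free_mod_closed[OF that])
  define L where "L c = lsum M (\<lambda>i. c i \<odot>\<^bsub>M\<^esub> m i) [0..<n]" for c
  have L: "L \<in> lin_map R ?F M"
    unfolding L_def using mw cR
    by (intro lin_map_lsum_fun[OF M] lin_mapI) (auto simp: M.smult_l_distr M.smult_assoc1)
  let ?N = "{c \<in> carrier ?F. L c \<in> {\<zero>\<^bsub>M\<^esub>}}"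
  have N: "submodule ?N R ?F" by (rule submodule_vimage[OF F M L submodule_zero_set[OF M]])
  have vals: "(\<lambda>i. if i < n then form v (w i) else \<zero>\<^bsub>R\<^esub>) \<in> ?N" if v: "v \<in> carrier V" for v
  proof -
    have "{i. i < n \<and> form v (w i) \<noteq> \<zero>\<^bsub>R\<^esub>} \<subseteq> {..<n}" by auto
    then have "finite {i. i < n \<and> form v (w i) \<noteq> \<zero>\<^bsub>R\<^esub>}" using finite_subset by blast
    then have "(\<lambda>i. if i < n then form v (w i) else \<zero>\<^bsub>R\<^esub>) \<in> carrier ?F"
      using lin_map_closed[OF form[OF v]] mw by (auto simp: free_mod_carrier)
    moreover have "L (\<lambda>i. if i < n then form v (w i) else \<zero>\<^bsub>R\<^esub>) = lsum M (\<lambda>i. form v (w i) \<odot>\<^bsub>M\<^esub> m i) [0..<n]"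
      unfolding L_def by (intro lsum_cong) auto
    ultimately show ?thesis using zero[OF v] re[of M "\<lambda>m w. form v w \<odot>\<^bsub>M\<^esub> m"] by simp
  qed
  obtain cs where cs: "set cs \<subseteq> ?N \<times> carrier W"
    and wc: "\<And>i. i < n \<Longrightarrow> w i = lsum W (\<lambda>p. fst p i \<odot>\<^bsub>W\<^esub> snd p) cs"
    using pairing_factorsD[OF fac mw(2) N vals] by blast
  have csN: "fst p \<in> carrier ?F" "L (fst p) = \<zero>\<^bsub>M\<^esub>" "snd p \<in> carrier W" if "p \<in> set cs" for p
    using cs that by auto
  have csR: "fst p i \<in> carrier R" if "p \<in> set cs" for p i using cR csN that by blast
  note bl = lin_mapD[OF bilin_map_left[OF b]] and br = lin_mapD[OF bilin_map_right[OF b]]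
  have "lsum P (\<lambda>i. b (m i) (w i)) [0..<n] =
        lsum P (\<lambda>i. lsum P (\<lambda>p. b (fst p i \<odot>\<^bsub>M\<^esub> m i) (snd p)) cs) [0..<n]"
  proof (rule lsum_cong[OF refl])
    fix i assume "i \<in> set [0..<n]"
    then have i: "i < n" by simp
    have "b (m i) (w i) = lsum P (\<lambda>p. b (m i) (fst p i \<odot>\<^bsub>W\<^esub> snd p)) cs"
      unfolding wc[OF i] by (rule bilin_map_lsum_right[OF W P b _ mw(1)[OF i]]) (use csN csR in auto)
    also have "\<dots> = lsum P (\<lambda>p. b (fst p i \<odot>\<^bsub>M\<^esub> m i) (snd p)) cs"
      using csN csR mw(1)[OF i] by (intro lsum_cong) (auto simp: bl br)
    finally show "b (m i) (w i) = lsum P (\<lambda>p. b (fst p i \<odot>\<^bsub>M\<^esub> m i) (snd p)) cs" .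
  qed
  also have "\<dots> = lsum P (\<lambda>p. lsum P (\<lambda>i. b (fst p i \<odot>\<^bsub>M\<^esub> m i) (snd p)) [0..<n]) cs"
    by (rule P.lsum_swap) (use csN csR mw in \<open>auto intro!: bl(1)\<close>)
  also have "\<dots> = lsum P (\<lambda>p. \<zero>\<^bsub>P\<^esub>) cs"
  proof (rule lsum_cong[OF refl])
    fix p assume p: "p \<in> set cs"
    have "lsum P (\<lambda>i. b (fst p i \<odot>\<^bsub>M\<^esub> m i) (snd p)) [0..<n] = b (L (fst p)) (snd p)"
      unfolding L_def by (rule bilin_map_lsum_left[OF M P b _ csN(3)[OF p], symmetric]) (use csR[OF p] mw in auto)
    also have "\<dots> = \<zero>\<^bsub>P\<^esub>"
      unfolding csN(2)[OF p] by (rule lin_map_zero[OF M P bilin_map_left[OF b csN(3)[OF p]]])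
    finally show "lsum P (\<lambda>i. b (fst p i \<odot>\<^bsub>M\<^esub> m i) (snd p)) [0..<n] = \<zero>\<^bsub>P\<^esub>" .
  qed
  also have "\<dots> = \<zero>\<^bsub>P\<^esub>" by (rule P.lsum_zero) simp
  finally show ?thesis unfolding reP .
qed

lemma pairing_factors_imp_alpha:
  assumes fac: "pairing_factors R V W form"
  shows "alpha_condition TYPE('m) R V W form"
  unfolding alpha_condition_def
proof (intro allI impI inj_onI)
  fix M :: "('r, 'm) module" and t u
  assume M: "module R M" and t: "t \<in> carrier (tensor R M W)" and u: "u \<in> carrier (tensor R M W)"
    and eq: "(\<lambda>v\<in>carrier V. tensor_sum R M (\<lambda>m w. form v w \<odot>\<^bsub>M\<^esub> m) t) =
      (\<lambda>v\<in>carrier V. tensor_sum R M (\<lambda>m w. form v w \<odot>\<^bsub>M\<^esub> m) u)"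
  let ?T = "tensor R M W"
  have T: "module R ?T" by (rule module_tensor[OF M W])
  interpret M: module R M by (rule M)
  interpret T: module R ?T by (rule T)
  obtain qs where qs: "set qs \<subseteq> carrier M \<times> carrier W" "t \<ominus>\<^bsub>?T\<^esub> u = tens R M W qs"
    using tensor_cases[OF M W T.minus_closed[OF t u]] by blast
  have "tens R M W qs = \<zero>\<^bsub>?T\<^esub>"
    unfolding tens_def
  proof (rule pairing_factors_zero[OF fac M T bilin_map_ptensor[OF M W] qs(1)])
    fix v assume v: "v \<in> carrier V"
    note fb = form_bilin[OF M v]
    have "lsum M (\<lambda>q. form v (snd q) \<odot>\<^bsub>M\<^esub> fst q) qs =
        tensor_sum R M (\<lambda>m w. form v w \<odot>\<^bsub>M\<^esub> m) (t \<ominus>\<^bsub>?T\<^esub> u)"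
      unfolding qs(2) tensor_sum_tens[OF M W M fb qs(1)] ..
    also have "\<dots> = \<zero>\<^bsub>M\<^esub>"
      unfolding lin_map_diff[OF T M lin_map_tensor_sum[OF M W M fb] t u]
      using fun_cong[OF eq, of v] v lin_map_closed[OF lin_map_tensor_sum[OF M W M fb] u]
      by (simp add: a_minus_def M.r_neg)
    finally show "lsum M (\<lambda>q. form v (snd q) \<odot>\<^bsub>M\<^esub> fst q) qs = \<zero>\<^bsub>M\<^esub>" .
  qed
  then show "t = u" using T.diff_zero_imp_eq[OF t u] qs(2) by simp
qed

end

section \<open>The finite dual of an algebra\<close>

lemma tensor_cong:
  assumes "carrier M = carrier M'" "ring.add M = ring.add M'" "smult M = smult M'"
    "carrier N = carrier N'" "ring.add N = ring.add N'" "smult N = smult N'"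
  shows "tensor R M N = tensor R M' N'"
  by (simp only: tensor_def tensor_rel_def assms)

text \<open>\<open>K\<close> is the finite dual of \<open>A\<close>, fixed only through its module operations. So the results hold for
\<^const>\<open>fin_dual_mod\<close>, \<^const>\<open>fin_dual\<close> and \<^const>\<open>hopf_dual\<close>, which are records of different types.\<close>

locale finite_dual =
  fixes R :: "('r, 'z) ring_scheme" and A :: "('r, 'a, 'u) module_scheme"
    and K :: "('r, 'a \<Rightarrow> 'r, 'k) module_scheme"
  assumes cring_R: "cring R" and noeth_R: "noetherian_ring R" and alg: "assoc_algebra R A"
    and K_carrier: "carrier K = fin_dual_set R A"
    and K_zero: "\<zero>\<^bsub>K\<^esub> = (\<lambda>x\<in>carrier A. \<zero>\<^bsub>R\<^esub>)"
    and K_add: "ring.add K = (\<lambda>f g. \<lambda>x\<in>carrier A. f x \<oplus>\<^bsub>R\<^esub> g x)"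
    and K_smult: "smult K = (\<lambda>r f. \<lambda>x\<in>carrier A. r \<otimes>\<^bsub>R\<^esub> f x)"
begin

sublocale AR: ring A using alg by (simp add: assoc_algebra_def)
sublocale AM: module R A using alg by (simp add: assoc_algebra_def)

lemma module_A: "module R A" by (rule AM.module_axioms)
lemma module_R: "module R (reg_mod R)" by (rule AM.module_reg_mod)

lemma alg_smult:
  assumes "r \<in> carrier R" "x \<in> carrier A" "y \<in> carrier A"
  shows "(r \<odot>\<^bsub>A\<^esub> x) \<otimes>\<^bsub>A\<^esub> y = r \<odot>\<^bsub>A\<^esub> (x \<otimes>\<^bsub>A\<^esub> y)" "x \<otimes>\<^bsub>A\<^esub> (r \<odot>\<^bsub>A\<^esub> y) = r \<odot>\<^bsub>A\<^esub> (x \<otimes>\<^bsub>A\<^esub> y)"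
  using alg assms by (auto simp: assoc_algebra_def)

lemma submodule_ideal:
  assumes "ideal I A" shows "submodule I R A"
proof -
  interpret I: ideal I A by fact
  show ?thesis
  proof (rule submoduleI'[OF module_A])
    fix r x assume r: "r \<in> carrier R" and x: "x \<in> I"
    have "r \<odot>\<^bsub>A\<^esub> x = (r \<odot>\<^bsub>A\<^esub> \<one>\<^bsub>A\<^esub>) \<otimes>\<^bsub>A\<^esub> x" using r x I.a_subset by (simp add: alg_smult subset_iff)
    then show "r \<odot>\<^bsub>A\<^esub> x \<in> I" using I.I_l_closed[OF x] r by simp
  qed (auto simp: I.a_subset)
qed

lemma cofinite_ideal_iff: "cofinite_ideal R A I \<longleftrightarrow> ideal I A \<and> cofinite_sub R A I"
  using fin_gen_quot_mod_iff[OF module_A submodule_ideal] by (auto simp: cofinite_ideal_def)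

lemma K_mem_iff: "f \<in> carrier K \<longleftrightarrow> f \<in> lin_map R A (reg_mod R) \<and> f \<in> extensional (carrier A) \<and>
    (\<exists>I. ideal I A \<and> cofinite_sub R A I \<and> (\<forall>x\<in>I. f x = \<zero>\<^bsub>R\<^esub>))"
  unfolding K_carrier fin_dual_set_def cofinite_ideal_iff by (auto simp: Hom_mod_def)

lemma K_lin: "f \<in> carrier K \<Longrightarrow> f \<in> lin_map R A (reg_mod R)"
  and K_ext: "f \<in> carrier K \<Longrightarrow> f \<in> extensional (carrier A)"
  by (auto simp: K_mem_iff)

lemma K_closed [simp, intro]: "f \<in> carrier K \<Longrightarrow> x \<in> carrier A \<Longrightarrow> f x \<in> carrier R"
  using lin_map_closed[OF K_lin] by simp

lemma K_apply_add [simp]: "f \<in> carrier K \<Longrightarrow> x \<in> carrier A \<Longrightarrow> y \<in> carrier A \<Longrightarrow> f (x \<oplus>\<^bsub>A\<^esub> y) = f x \<oplus>\<^bsub>R\<^esub> f y"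
  using lin_map_add[OF K_lin] by simp

lemma K_apply_smult [simp]: "f \<in> carrier K \<Longrightarrow> r \<in> carrier R \<Longrightarrow> x \<in> carrier A \<Longrightarrow> f (r \<odot>\<^bsub>A\<^esub> x) = r \<otimes>\<^bsub>R\<^esub> f x"
  using lin_map_smult[OF K_lin] by simp

lemma K_ext_eqI:
  assumes "f \<in> carrier K" "g \<in> carrier K" "\<And>x. x \<in> carrier A \<Longrightarrow> f x = g x"
  shows "f = g"
  using K_ext[OF assms(1)] K_ext[OF assms(2)] assms(3) by (rule extensionalityI)

lemma K_restrict_lin:
  assumes "f \<in> lin_map R A (reg_mod R)"
  shows "(\<lambda>x\<in>carrier A. f x) \<in> lin_map R A (reg_mod R)"
  using assms by (subst lin_map_cong[OF module_A, where g = f]) auto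

text \<open>The largest ideal on which \<open>f\<close> vanishes consists of the \<open>y\<close> with \<open>f (x y z) = 0\<close> for all \<open>x\<close> and \<open>z\<close>. It contains the
common kernel of the detecting functionals, which is cofinite because it is the kernel of a map to
a finitely generated module.\<close>

lemma K_memI_detect:
  assumes f: "f \<in> lin_map R A (reg_mod R)" "f \<in> extensional (carrier A)"
    and ks: "\<And>k. k \<in> set ks \<Longrightarrow> k \<in> lin_map R A (reg_mod R)"
    and detect: "\<And>x y z. x \<in> carrier A \<Longrightarrow> y \<in> carrier A \<Longrightarrow> z \<in> carrier A \<Longrightarrow>
      (\<And>k. k \<in> set ks \<Longrightarrow> k y = \<zero>\<^bsub>R\<^esub>) \<Longrightarrow> f (x \<otimes>\<^bsub>A\<^esub> y \<otimes>\<^bsub>A\<^esub> z) = \<zero>\<^bsub>R\<^esub>"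
  shows "f \<in> carrier K"
proof -
  define I where "I = {y \<in> carrier A. \<forall>x\<in>carrier A. \<forall>z\<in>carrier A. f (x \<otimes>\<^bsub>A\<^esub> y \<otimes>\<^bsub>A\<^esub> z) = \<zero>\<^bsub>R\<^esub>}"
  note fD = lin_mapD[OF f(1), simplified]
  have sub: "submodule I R A"
    unfolding I_def
    by (intro submoduleI'[OF module_A])
       (auto simp: AR.l_distr AR.r_distr fD alg_smult lin_map_zero[OF module_A module_R f(1), simplified])
  have mult: "a \<otimes>\<^bsub>A\<^esub> y \<in> I" "y \<otimes>\<^bsub>A\<^esub> a \<in> I" if "y \<in> I" "a \<in> carrier A" for a y
  proof -
    have y: "y \<in> carrier A" and *: "\<And>x z. x \<in> carrier A \<Longrightarrow> z \<in> carrier A \<Longrightarrow> f (x \<otimes>\<^bsub>A\<^esub> y \<otimes>\<^bsub>A\<^esub> z) = \<zero>\<^bsub>R\<^esub>"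
      using that by (auto simp: I_def)
    have "f (x \<otimes>\<^bsub>A\<^esub> (a \<otimes>\<^bsub>A\<^esub> y) \<otimes>\<^bsub>A\<^esub> z) = \<zero>\<^bsub>R\<^esub>" "f (x \<otimes>\<^bsub>A\<^esub> (y \<otimes>\<^bsub>A\<^esub> a) \<otimes>\<^bsub>A\<^esub> z) = \<zero>\<^bsub>R\<^esub>"
      if "x \<in> carrier A" "z \<in> carrier A" for x z
      using *[of "x \<otimes>\<^bsub>A\<^esub> a" z] *[of x "a \<otimes>\<^bsub>A\<^esub> z"] that y \<open>a \<in> carrier A\<close> by (auto simp: AR.m_assoc)
    then show "a \<otimes>\<^bsub>A\<^esub> y \<in> I" "y \<otimes>\<^bsub>A\<^esub> a \<in> I" using y that by (auto simp: I_def)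
  qed
  have I: "ideal I A"
    using mult submodule.axioms(1)[OF sub] by (intro idealI AR.ring_axioms) auto
  have "cofinite_sub R A I"
    by (rule cofinite_sub_mono[OF module_A cofinite_sub_kernels[OF cring_R noeth_R module_A ks] sub])
       (auto simp: I_def intro!: detect)
  moreover have "f y = \<zero>\<^bsub>R\<^esub>" if "y \<in> I" for y
  proof -
    have "y \<in> carrier A" "f (\<one>\<^bsub>A\<^esub> \<otimes>\<^bsub>A\<^esub> y \<otimes>\<^bsub>A\<^esub> \<one>\<^bsub>A\<^esub>) = \<zero>\<^bsub>R\<^esub>"
      using that AR.one_closed unfolding I_def by blast+
    then show ?thesis by simp
  qed
  ultimately show ?thesis using I f by (auto simp: K_mem_iff)
qed

lemma submodule_fin_dual_set: "submodule (fin_dual_set R A) R (fun_mod (carrier A) (reg_mod R))"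
proof (rule submoduleI'[OF module_fun_mod[OF module_R]])
  let ?F = "fun_mod (carrier A) (reg_mod R)"
  note H = submoduleD[OF submodule_Hom_mod[OF module_A]]
  have mem: "f \<in> fin_dual_set R A \<longleftrightarrow> f \<in> Hom_mod R A (reg_mod R) \<and>
      (\<exists>I. ideal I A \<and> cofinite_sub R A I \<and> (\<forall>x\<in>I. f x = \<zero>\<^bsub>R\<^esub>))" for f
    by (auto simp: fin_dual_set_def cofinite_ideal_iff)
  show "fin_dual_set R A \<subseteq> carrier ?F" using H(1) by (auto simp: mem)
  show "\<zero>\<^bsub>?F\<^esub> \<in> fin_dual_set R A"
    unfolding mem using H(3) AR.oneideal cofinite_sub_carrier[OF module_A] by (auto intro!: exI[of _ "carrier A"])
  fix f g assume "f \<in> fin_dual_set R A" "g \<in> fin_dual_set R A"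
  then obtain I J where f: "f \<in> Hom_mod R A (reg_mod R)" "ideal I A" "cofinite_sub R A I" "\<forall>x\<in>I. f x = \<zero>\<^bsub>R\<^esub>"
    and g: "g \<in> Hom_mod R A (reg_mod R)" "ideal J A" "cofinite_sub R A J" "\<forall>x\<in>J. g x = \<zero>\<^bsub>R\<^esub>"
    by (auto simp: mem)
  show "f \<oplus>\<^bsub>?F\<^esub> g \<in> fin_dual_set R A"
    unfolding mem using f g H(4)[OF f(1) g(1)] AR.i_intersect[OF f(2) g(2)]
      cofinite_sub_Int[OF cring_R noeth_R module_A f(3) g(3)] submodule_mem[OF submodule_ideal[OF f(2)]]
    by (intro conjI exI[of _ "I \<inter> J"]) auto
next
  let ?F = "fun_mod (carrier A) (reg_mod R)"
  note H = submoduleD[OF submodule_Hom_mod[OF module_A]]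
  have mem: "f \<in> fin_dual_set R A \<longleftrightarrow> f \<in> Hom_mod R A (reg_mod R) \<and>
      (\<exists>I. ideal I A \<and> cofinite_sub R A I \<and> (\<forall>x\<in>I. f x = \<zero>\<^bsub>R\<^esub>))" for f
    by (auto simp: fin_dual_set_def cofinite_ideal_iff)
  fix r f assume r: "r \<in> carrier R" and "f \<in> fin_dual_set R A"
  then obtain I where f: "f \<in> Hom_mod R A (reg_mod R)" "ideal I A" "cofinite_sub R A I" "\<forall>x\<in>I. f x = \<zero>\<^bsub>R\<^esub>"
    by (auto simp: mem)
  show "r \<odot>\<^bsub>?F\<^esub> f \<in> fin_dual_set R A"
    unfolding mem using r f H(6)[OF r f(1)] submodule_mem[OF submodule_ideal[OF f(2)]]
    by (intro conjI exI[of _ I]) auto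
qed

lemma module_K: "module R K"
proof -
  let ?F = "(fun_mod (carrier A) (reg_mod R))\<lparr>carrier := fin_dual_set R A\<rparr>"
  have "module R ?F" by (rule module_submodule[OF module_fun_mod[OF module_R] submodule_fin_dual_set])
  then show ?thesis by (rule module_image[where p = id]) (auto simp: K_carrier K_zero K_add K_smult)
qed

sublocale KM: module R K by (rule module_K)

lemma K_zero_apply [simp]: "x \<in> carrier A \<Longrightarrow> \<zero>\<^bsub>K\<^esub> x = \<zero>\<^bsub>R\<^esub>"
  and K_add_apply [simp]: "x \<in> carrier A \<Longrightarrow> (f \<oplus>\<^bsub>K\<^esub> g) x = f x \<oplus>\<^bsub>R\<^esub> g x"
  and K_smult_apply [simp]: "x \<in> carrier A \<Longrightarrow> (r \<odot>\<^bsub>K\<^esub> f) x = r \<otimes>\<^bsub>R\<^esub> f x"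
  by (auto simp: K_zero K_add K_smult)

lemma K_lsum_apply [simp]: "x \<in> carrier A \<Longrightarrow> lsum K f xs x = lsum R (\<lambda>i. f i x) xs"
  by (induction xs) auto

lemma eval_lin: "a \<in> carrier A \<Longrightarrow> (\<lambda>f. f a) \<in> lin_map R K (reg_mod R)"
  by (intro lin_mapI) auto

lemma cofinite_ideal_kills_list:
  assumes "set fs \<subseteq> carrier K"
  shows "\<exists>I. ideal I A \<and> cofinite_sub R A I \<and> (\<forall>f\<in>set fs. \<forall>x\<in>I. f x = \<zero>\<^bsub>R\<^esub>)"
  using assms
proof (induction fs)
  case Nil
  then show ?case using AR.oneideal cofinite_sub_carrier[OF module_A] by auto
next
  case (Cons f fs)
  then obtain I J where "ideal I A" "cofinite_sub R A I" "\<forall>f\<in>set fs. \<forall>x\<in>I. f x = \<zero>\<^bsub>R\<^esub>"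
    "ideal J A" "cofinite_sub R A J" "\<forall>x\<in>J. f x = \<zero>\<^bsub>R\<^esub>" by (auto simp: K_mem_iff)
  then show ?case using AR.i_intersect[of I J] cofinite_sub_Int[OF cring_R noeth_R module_A, of I J]
    by (intro exI[of _ "I \<inter> J"]) auto
qed

lemma K_translate:
  assumes f: "f \<in> carrier K" and a: "a \<in> carrier A"
  shows "(\<lambda>x\<in>carrier A. f (x \<otimes>\<^bsub>A\<^esub> a)) \<in> carrier K" "(\<lambda>x\<in>carrier A. f (a \<otimes>\<^bsub>A\<^esub> x)) \<in> carrier K"
proof -
  obtain I where I: "ideal I A" "cofinite_sub R A I" "\<forall>x\<in>I. f x = \<zero>\<^bsub>R\<^esub>" using f by (auto simp: K_mem_iff)
  interpret I: ideal I A by (rule I(1))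
  have "(\<lambda>x\<in>carrier A. f (x \<otimes>\<^bsub>A\<^esub> a)) \<in> lin_map R A (reg_mod R)"
    using f a by (intro K_restrict_lin lin_mapI) (auto simp: AR.l_distr alg_smult)
  then show "(\<lambda>x\<in>carrier A. f (x \<otimes>\<^bsub>A\<^esub> a)) \<in> carrier K"
    unfolding K_mem_iff using I a I.I_r_closed I.a_subset by (auto intro!: exI[of _ I])
  have "(\<lambda>x\<in>carrier A. f (a \<otimes>\<^bsub>A\<^esub> x)) \<in> lin_map R A (reg_mod R)"
    using f a by (intro K_restrict_lin lin_mapI) (auto simp: AR.r_distr alg_smult)
  then show "(\<lambda>x\<in>carrier A. f (a \<otimes>\<^bsub>A\<^esub> x)) \<in> carrier K"
    unfolding K_mem_iff using I a I.I_l_closed I.a_subset by (auto intro!: exI[of _ I])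
qed

end

locale finite_dual_alpha = finite_dual +
  assumes factors: "pairing_factors R A K (\<lambda>a f. f a)"
begin

abbreviation (input) KK where "KK \<equiv> tensor R K K"

lemma module_KK: "module R KK" by (rule module_tensor[OF module_K module_K])
sublocale KK: module R KK by (rule module_KK)

lemma eval2_bilin:
  assumes "x \<in> carrier A" "y \<in> carrier A"
  shows "(\<lambda>p q. p x \<otimes>\<^bsub>R\<^esub> q y) \<in> bilin_map R K K (reg_mod R)"
  using assms by (intro bilin_mapI lin_mapI) (auto simp: AM.l_distr AM.r_distr AM.m_assoc AM.m_lcomm)

definition eval2 where
  "eval2 x y = tensor_sum R (reg_mod R) (\<lambda>p q. p x \<otimes>\<^bsub>R\<^esub> q y)"

lemma eval2_lin: "x \<in> carrier A \<Longrightarrow> y \<in> carrier A \<Longrightarrow> eval2 x y \<in> lin_map R KK (reg_mod R)"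
  unfolding eval2_def by (rule lin_map_tensor_sum[OF module_K module_K module_R eval2_bilin])

lemma eval2_tens:
  assumes "set ps \<subseteq> carrier K \<times> carrier K" "x \<in> carrier A" "y \<in> carrier A"
  shows "eval2 x y (tens R K K ps) = lsum R (\<lambda>p. fst p x \<otimes>\<^bsub>R\<^esub> snd p y) ps"
  unfolding eval2_def using tensor_sum_tens[OF module_K module_K module_R eval2_bilin] assms by simp

lemma eval2_ptensor:
  assumes "p \<in> carrier K" "q \<in> carrier K" "x \<in> carrier A" "y \<in> carrier A"
  shows "eval2 x y (ptensor R K K p q) = p x \<otimes>\<^bsub>R\<^esub> q y"
  unfolding eval2_def using tensor_sum_ptensor[OF module_K module_K module_R eval2_bilin] assms by simp

text \<open>The alpha-condition is applied to the module \<open>K\<close> itself: if \<open>\<Sum> p\<^sub>i x q\<^sub>i y = 0\<close> for all \<open>x\<close> then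
\<open>\<Sum> q\<^sub>i y p\<^sub>i = 0\<close> in \<open>K\<close>, for every \<open>y\<close>.\<close>

lemma KK_eqI:
  assumes s: "s \<in> carrier KK" and t: "t \<in> carrier KK"
    and eq: "\<And>x y. x \<in> carrier A \<Longrightarrow> y \<in> carrier A \<Longrightarrow> eval2 x y s = eval2 x y t"
  shows "s = t"
proof -
  obtain qs where qs: "set qs \<subseteq> carrier K \<times> carrier K" "s \<ominus>\<^bsub>KK\<^esub> t = tens R K K qs"
    using tensor_cases[OF module_K module_K KK.minus_closed[OF s t]] by blast
  have mem: "fst q \<in> carrier K" "snd q \<in> carrier K" if "q \<in> set qs" for q using qs that by auto
  have "tens R K K qs = \<zero>\<^bsub>KK\<^esub>"
    unfolding tens_def
  proof (rule pairing_factors_zero[OF module_K eval_lin factors module_K module_KK bilin_map_ptensor[OF module_K module_K] qs(1)])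
    fix y assume y: "y \<in> carrier A"
    show "lsum K (\<lambda>q. snd q y \<odot>\<^bsub>K\<^esub> fst q) qs = \<zero>\<^bsub>K\<^esub>"
    proof (rule K_ext_eqI)
      fix x assume x: "x \<in> carrier A"
      have "lsum K (\<lambda>q. snd q y \<odot>\<^bsub>K\<^esub> fst q) qs x = lsum R (\<lambda>q. fst q x \<otimes>\<^bsub>R\<^esub> snd q y) qs"
        using x y mem by (auto intro!: lsum_cong simp: AM.m_comm)
      also have "\<dots> = eval2 x y s \<ominus>\<^bsub>R\<^esub> eval2 x y t"
        using eval2_tens[OF qs(1) x y] lin_map_diff[OF module_KK module_R eval2_lin[OF x y] s t]
        by (simp add: qs(2))
      also have "\<dots> = \<zero>\<^bsub>R\<^esub>"
        using eq[OF x y] lin_map_closed[OF eval2_lin[OF x y] t] by (simp add: a_minus_def AM.R.r_neg)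
      finally show "lsum K (\<lambda>q. snd q y \<odot>\<^bsub>K\<^esub> fst q) qs x = \<zero>\<^bsub>K\<^esub> x" using x by simp
    qed (use mem y in auto)
  qed auto
  then show ?thesis using KK.diff_zero_imp_eq[OF s t] qs(2) by simp
qed

abbreviation (input) KKK where "KKK \<equiv> tensor R K (tensor R K K)"

lemma module_KKK: "module R KKK" by (rule module_tensor[OF module_K module_KK])
sublocale KKK: module R KKK by (rule module_KKK)

definition eval3 where
  "eval3 x y z = tensor_sum R (reg_mod R) (\<lambda>p u. p x \<otimes>\<^bsub>R\<^esub> eval2 y z u)"

lemma eval3_bilin:
  assumes "x \<in> carrier A" "y \<in> carrier A" "z \<in> carrier A"
  shows "(\<lambda>p u. p x \<otimes>\<^bsub>R\<^esub> eval2 y z u) \<in> bilin_map R K KK (reg_mod R)"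
  using assms lin_mapD[OF eval2_lin[OF assms(2,3)]]
  by (intro bilin_mapI lin_mapI) (auto simp: AM.l_distr AM.r_distr AM.m_assoc AM.m_lcomm)

lemma eval3_lin:
  assumes "x \<in> carrier A" "y \<in> carrier A" "z \<in> carrier A"
  shows "eval3 x y z \<in> lin_map R KKK (reg_mod R)"
  unfolding eval3_def by (rule lin_map_tensor_sum[OF module_K module_KK module_R eval3_bilin[OF assms]])

lemma eval3_ptensor:
  assumes "p \<in> carrier K" "u \<in> carrier KK" "x \<in> carrier A" "y \<in> carrier A" "z \<in> carrier A"
  shows "eval3 x y z (ptensor R K KK p u) = p x \<otimes>\<^bsub>R\<^esub> eval2 y z u"
  unfolding eval3_def using tensor_sum_ptensor[OF module_K module_KK module_R eval3_bilin] assms by simp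

text \<open>Here the alpha-condition is applied to the module \<open>K \<otimes> K\<close>, with the single factor \<open>K\<close> on the left, where
the sums \<open>\<Sum> p\<^sub>i x u\<^sub>i\<close> vanish by the previous criterion.\<close>

lemma KKK_eqI:
  assumes s: "s \<in> carrier KKK" and t: "t \<in> carrier KKK"
    and eq: "\<And>x y z. x \<in> carrier A \<Longrightarrow> y \<in> carrier A \<Longrightarrow> z \<in> carrier A \<Longrightarrow> eval3 x y z s = eval3 x y z t"
  shows "s = t"
proof -
  obtain qs where qs: "set qs \<subseteq> carrier K \<times> carrier KK" "s \<ominus>\<^bsub>KKK\<^esub> t = tens R K KK qs"
    using tensor_cases[OF module_K module_KK KKK.minus_closed[OF s t]] by blast
  have mem: "fst q \<in> carrier K" "snd q \<in> carrier KK" if "q \<in> set qs" for q using qs that by auto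
  define qs' where "qs' = map (\<lambda>q. (snd q, fst q)) qs"
  have qs': "set qs' \<subseteq> carrier KK \<times> carrier K" using mem by (auto simp: qs'_def)
  have flip: "(\<lambda>u p. ptensor R K KK p u) \<in> bilin_map R KK K KKK"
    using bilin_mapD[OF bilin_map_ptensor[OF module_K module_KK]] by (auto simp: bilin_map_def)
  have "lsum KKK (\<lambda>q. ptensor R K KK (snd q) (fst q)) qs' = \<zero>\<^bsub>KKK\<^esub>"
  proof (rule pairing_factors_zero[OF module_K eval_lin factors module_KK module_KKK flip qs'])
    fix x assume x: "x \<in> carrier A"
    have cl: "fst q x \<odot>\<^bsub>KK\<^esub> snd q \<in> carrier KK" if "q \<in> set qs" for q using mem[OF that] x by auto
    have "lsum KK (\<lambda>q. fst q x \<odot>\<^bsub>KK\<^esub> snd q) qs = \<zero>\<^bsub>KK\<^esub>"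
    proof (rule KK_eqI)
      show "lsum KK (\<lambda>q. fst q x \<odot>\<^bsub>KK\<^esub> snd q) qs \<in> carrier KK" by (rule KK.lsum_closed[OF cl])
      fix y z assume y: "y \<in> carrier A" and z: "z \<in> carrier A"
      have "eval2 y z (lsum KK (\<lambda>q. fst q x \<odot>\<^bsub>KK\<^esub> snd q) qs) = lsum R (\<lambda>q. eval2 y z (fst q x \<odot>\<^bsub>KK\<^esub> snd q)) qs"
        using lin_map_lsum[OF module_KK module_R eval2_lin[OF y z], of qs "\<lambda>q. fst q x \<odot>\<^bsub>KK\<^esub> snd q"] cl by simp
      also have "\<dots> = lsum R (\<lambda>q. fst q x \<otimes>\<^bsub>R\<^esub> eval2 y z (snd q)) qs"
        by (intro lsum_cong refl) (use lin_map_smult[OF eval2_lin[OF y z]] mem x in auto)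
      also have "\<dots> = eval3 x y z (s \<ominus>\<^bsub>KKK\<^esub> t)"
        unfolding qs(2) eval3_def tensor_sum_tens[OF module_K module_KK module_R eval3_bilin[OF x y z] qs(1)] by simp
      also have "\<dots> = eval3 x y z s \<ominus>\<^bsub>R\<^esub> eval3 x y z t"
        using lin_map_diff[OF module_KKK module_R eval3_lin[OF x y z] s t] by simp
      also have "\<dots> = \<zero>\<^bsub>R\<^esub>"
        using eq[OF x y z] lin_map_closed[OF eval3_lin[OF x y z] t] by (simp add: a_minus_def AM.R.r_neg)
      also have "\<dots> = eval2 y z \<zero>\<^bsub>KK\<^esub>" using lin_map_zero[OF module_KK module_R eval2_lin[OF y z]] by simp
      finally show "eval2 y z (lsum KK (\<lambda>q. fst q x \<odot>\<^bsub>KK\<^esub> snd q) qs) = eval2 y z \<zero>\<^bsub>KK\<^esub>" .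
    qed simp
    then show "lsum KK (\<lambda>q. snd q x \<odot>\<^bsub>KK\<^esub> fst q) qs' = \<zero>\<^bsub>KK\<^esub>" by (simp add: qs'_def lsum_map)
  qed auto
  then have "tens R K KK qs = \<zero>\<^bsub>KKK\<^esub>" by (simp add: qs'_def lsum_map tens_def)
  then show ?thesis using KKK.diff_zero_imp_eq[OF s t] qs(2) by simp
qed

text \<open>
Let the cofinite ideal \<open>I\<close> kill \<open>f\<close> and let the \<open>s\<^sub>i\<close> generate \<open>A\<close> modulo \<open>I\<close>, with chosen coordinate functions
\<open>\<rho>\<^sub>i\<close>, which need not be linear. Then \<open>f (x y) = \<Sum> \<rho>\<^sub>i y f (x s\<^sub>i)\<close>, and the vectors \<open>(f (x s\<^sub>i))\<^sub>i\<close>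
  lie in the submodule of those \<open>c\<close> for which \<open>\<Sum> c\<^sub>i \<rho>\<^sub>i\<close> is in the finite dual.\<close>

lemma K_decomp2:
  assumes f: "f \<in> carrier K"
  obtains ps where "set ps \<subseteq> carrier K \<times> carrier K"
    "\<And>x y. x \<in> carrier A \<Longrightarrow> y \<in> carrier A \<Longrightarrow> f (x \<otimes>\<^bsub>A\<^esub> y) = lsum R (\<lambda>p. fst p x \<otimes>\<^bsub>R\<^esub> snd p y) ps"
proof -
  obtain I where I: "ideal I A" "cofinite_sub R A I" "\<forall>x\<in>I. f x = \<zero>\<^bsub>R\<^esub>" using f by (auto simp: K_mem_iff)
  interpret I: ideal I A by (rule I(1))
  note Is = submodule_ideal[OF I(1)]
  obtain S where S: "S \<subseteq> carrier A" "finite S" "carrier A \<subseteq> mod_span R A (S \<union> I)"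
    using I(2) by (auto simp: cofinite_sub_def)
  obtain ss where ss: "set ss = S" "distinct ss" using finite_distinct_list[OF S(2)] by blast
  have ssA: "s \<in> carrier A" if "s \<in> set ss" for s using that S ss by auto
  have "\<exists>r. (\<forall>s\<in>set ss. r s \<in> carrier R) \<and> y \<ominus>\<^bsub>A\<^esub> lsum A (\<lambda>s. r s \<odot>\<^bsub>A\<^esub> s) ss \<in> I" if y: "y \<in> carrier A" for y
  proof -
    have "y \<in> mod_span R A (S \<union> I)" using S(3) y by blast
    then obtain t i where t: "t \<in> mod_span R A S" and i: "i \<in> mod_span R A I" and y': "y = t \<oplus>\<^bsub>A\<^esub> i"
      using mod_span_Un[OF module_A S(1) submodule_subset[OF Is]] by blast
    have iI: "i \<in> I" using i mod_span_submodule[OF module_A Is] by simp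
    have tA: "t \<in> carrier A" using submodule_mem[OF submodule_mod_span[OF module_A S(1)] t] .
    have "y \<ominus>\<^bsub>A\<^esub> t = i"
      using tA submodule_mem[OF Is iI] unfolding y' a_minus_def by (simp add: AR.a_assoc AR.a_comm[of i] AR.r_neg2)
    moreover obtain r where "\<forall>s\<in>set ss. r s \<in> carrier R" "t = lsum A (\<lambda>s. r s \<odot>\<^bsub>A\<^esub> s) ss"
      using mod_span_coeffs[OF module_A _ ss(2), of t] t S(1) ss(1) by auto
    ultimately show ?thesis using iI by blast
  qed
  then obtain r where r: "\<And>y s. y \<in> carrier A \<Longrightarrow> s \<in> set ss \<Longrightarrow> r y s \<in> carrier R"
    and rI: "\<And>y. y \<in> carrier A \<Longrightarrow> y \<ominus>\<^bsub>A\<^esub> lsum A (\<lambda>s. r y s \<odot>\<^bsub>A\<^esub> s) ss \<in> I" by metis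
  define n where "n = length ss"
  define w where "w i = (\<lambda>x\<in>carrier A. f (x \<otimes>\<^bsub>A\<^esub> ss ! i))" for i
  define \<rho> where "\<rho> i = (\<lambda>y\<in>carrier A. r y (ss ! i))" for i
  have sA: "ss ! i \<in> carrier A" "ss ! i \<in> set ss" if "i < n" for i using ssA that by (auto simp: n_def)
  have w: "w i \<in> carrier K" if "i < n" for i unfolding w_def by (rule K_translate(1)[OF f sA(1)[OF that]])
  have \<rho>: "\<rho> i y \<in> carrier R" if "i < n" "y \<in> carrier A" for i y using that r sA by (simp add: \<rho>_def)
  have key: "f (x \<otimes>\<^bsub>A\<^esub> y) = lsum R (\<lambda>i. w i x \<otimes>\<^bsub>R\<^esub> \<rho> i y) [0..<n]" if x: "x \<in> carrier A" and y: "y \<in> carrier A" for x y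
  proof -
    let ?t = "lsum A (\<lambda>s. r y s \<odot>\<^bsub>A\<^esub> s) ss"
    have tA: "?t \<in> carrier A" using r[OF y] ssA by auto
    have "x \<otimes>\<^bsub>A\<^esub> y = x \<otimes>\<^bsub>A\<^esub> ?t \<oplus>\<^bsub>A\<^esub> x \<otimes>\<^bsub>A\<^esub> (y \<ominus>\<^bsub>A\<^esub> ?t)"
      using x y tA by (simp add: AR.r_distr[symmetric] a_minus_def AR.a_comm[of y] AR.r_neg2)
    moreover have "f (x \<otimes>\<^bsub>A\<^esub> (y \<ominus>\<^bsub>A\<^esub> ?t)) = \<zero>\<^bsub>R\<^esub>" using I(3) I.I_l_closed[OF rI[OF y] x] by blast
    ultimately have "f (x \<otimes>\<^bsub>A\<^esub> y) = f (x \<otimes>\<^bsub>A\<^esub> ?t)" using f x y tA by simp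
    also have "x \<otimes>\<^bsub>A\<^esub> ?t = lsum A (\<lambda>s. r y s \<odot>\<^bsub>A\<^esub> (x \<otimes>\<^bsub>A\<^esub> s)) ss"
      using r[OF y] ssA x by (subst AR.lsum_rdistr) (auto intro!: lsum_cong simp: alg_smult)
    also have "f \<dots> = lsum R (\<lambda>s. f (x \<otimes>\<^bsub>A\<^esub> s) \<otimes>\<^bsub>R\<^esub> r y s) ss"
      using r[OF y] ssA x f by (subst lin_map_lsum[OF module_A module_R K_lin[OF f]])
        (auto intro!: lsum_cong simp: AM.m_comm)
    also have "\<dots> = lsum R (\<lambda>i. w i x \<otimes>\<^bsub>R\<^esub> \<rho> i y) [0..<n]"
      using x y by (subst map_nth[of ss, symmetric], subst lsum_map) (simp add: n_def w_def \<rho>_def)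
    finally show ?thesis .
  qed
  let ?F = "free_mod R {..<n}" and ?D = "fun_mod (carrier A) (reg_mod R)"
  have F: "module R ?F" by (rule AM.module_free_mod)
  have D: "module R ?D" by (rule module_fun_mod[OF module_R])
  have cR: "c i \<in> carrier R" if "c \<in> carrier ?F" for c i by (rule AM.free_mod_closed[OF that])
  define L where "L c = lsum ?D (\<lambda>i. c i \<odot>\<^bsub>?D\<^esub> \<rho> i) [0..<n]" for c
  have L_lin: "L \<in> lin_map R ?F ?D"
    unfolding L_def
  proof (rule lin_map_lsum_fun[OF D])
    fix i assume "i \<in> set [0..<n]"
    then have i: "i < n" by simp
    show "(\<lambda>c. c i \<odot>\<^bsub>?D\<^esub> \<rho> i) \<in> lin_map R ?F ?D"
      using cR \<rho>[OF i] by (intro lin_mapI) (auto simp: AM.l_distr AM.m_assoc intro!: restrict_ext)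
  qed
  have L_apply: "L c y = lsum R (\<lambda>i. c i \<otimes>\<^bsub>R\<^esub> \<rho> i y) [0..<n]" if "y \<in> carrier A" for c y
    using that by (simp add: L_def lsum_fun_mod)
  let ?N = "{c \<in> carrier ?F. L c \<in> fin_dual_set R A}"
  have N: "submodule ?N R ?F" by (rule submodule_vimage[OF F D L_lin submodule_fin_dual_set])
  have vals: "(\<lambda>i. if i < n then w i x else \<zero>\<^bsub>R\<^esub>) \<in> ?N" (is "?c \<in> ?N") if x: "x \<in> carrier A" for x
  proof -
    have "{i. i < n \<and> w i x \<noteq> \<zero>\<^bsub>R\<^esub>} \<subseteq> {..<n}" by auto
    then have "finite {i. i < n \<and> w i x \<noteq> \<zero>\<^bsub>R\<^esub>}" using finite_subset by blast
    then have c: "?c \<in> carrier ?F" using w x by (auto simp: free_mod_carrier)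
    have "L ?c = (\<lambda>y\<in>carrier A. f (x \<otimes>\<^bsub>A\<^esub> y))"
    proof (rule extensionalityI)
      show "L ?c \<in> extensional (carrier A)" using lin_map_closed[OF L_lin c] by (auto simp: PiE_def)
      fix y assume y: "y \<in> carrier A"
      have "L ?c y = lsum R (\<lambda>i. w i x \<otimes>\<^bsub>R\<^esub> \<rho> i y) [0..<n]"
        unfolding L_apply[OF y] by (intro lsum_cong) auto
      then show "L ?c y = (\<lambda>y\<in>carrier A. f (x \<otimes>\<^bsub>A\<^esub> y)) y" using key[OF x y] y by simp
    qed simp
    then show ?thesis using c K_translate(2)[OF f x] by (simp add: K_carrier)
  qed
  obtain cs where cs: "set cs \<subseteq> ?N \<times> carrier K" and wc: "\<And>i. i < n \<Longrightarrow> w i = lsum K (\<lambda>p. fst p i \<odot>\<^bsub>K\<^esub> snd p) cs"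
    using pairing_factorsD[where w = w and n = n and form = "\<lambda>a f. f a", OF factors w N vals] by blast
  have csN: "fst p \<in> carrier ?F" "L (fst p) \<in> carrier K" "snd p \<in> carrier K" if "p \<in> set cs" for p
    using cs that by (auto simp: K_carrier)
  have csR: "fst p i \<in> carrier R" if "p \<in> set cs" for p i by (rule cR[OF csN(1)[OF that]])
  let ?ps = "map (\<lambda>p. (snd p, L (fst p))) cs"
  have "f (x \<otimes>\<^bsub>A\<^esub> y) = lsum R (\<lambda>p. fst p x \<otimes>\<^bsub>R\<^esub> snd p y) ?ps" if x: "x \<in> carrier A" and y: "y \<in> carrier A" for x y
  proof -
    have "f (x \<otimes>\<^bsub>A\<^esub> y) = lsum R (\<lambda>i. lsum R (\<lambda>p. snd p x \<otimes>\<^bsub>R\<^esub> (fst p i \<otimes>\<^bsub>R\<^esub> \<rho> i y)) cs) [0..<n]"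
      unfolding key[OF x y]
    proof (rule lsum_cong[OF refl])
      fix i assume "i \<in> set [0..<n]"
      then have i: "i < n" by simp
      have "w i x \<otimes>\<^bsub>R\<^esub> \<rho> i y = lsum R (\<lambda>p. fst p i \<otimes>\<^bsub>R\<^esub> snd p x) cs \<otimes>\<^bsub>R\<^esub> \<rho> i y"
        unfolding wc[OF i] using x by simp
      also have "\<dots> = lsum R (\<lambda>p. snd p x \<otimes>\<^bsub>R\<^esub> (fst p i \<otimes>\<^bsub>R\<^esub> \<rho> i y)) cs"
        using csR csN x \<rho>[OF i y] by (subst AM.lsum_ldistr) (auto intro!: lsum_cong simp: AM.m_assoc AM.m_lcomm)
      finally show "w i x \<otimes>\<^bsub>R\<^esub> \<rho> i y = lsum R (\<lambda>p. snd p x \<otimes>\<^bsub>R\<^esub> (fst p i \<otimes>\<^bsub>R\<^esub> \<rho> i y)) cs" .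
    qed
    also have "\<dots> = lsum R (\<lambda>p. lsum R (\<lambda>i. snd p x \<otimes>\<^bsub>R\<^esub> (fst p i \<otimes>\<^bsub>R\<^esub> \<rho> i y)) [0..<n]) cs"
      by (rule AM.R.lsum_swap) (use csR csN x \<rho> y in auto)
    also have "\<dots> = lsum R (\<lambda>p. snd p x \<otimes>\<^bsub>R\<^esub> L (fst p) y) cs"
      unfolding L_apply[OF y]
      by (intro lsum_cong refl AM.lsum_rdistr[symmetric]) (use csR csN x \<rho> y in auto)
    finally show ?thesis by (simp add: lsum_map)
  qed
  then show ?thesis using csN by (intro that[of ?ps]) auto
qed

text \<open>Apply the decomposition once more to the first factors.\<close>

lemma K_decomp3:
  assumes f: "f \<in> carrier K"
  obtains ts where "set ts \<subseteq> carrier K \<times> carrier K \<times> carrier K"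
    "\<And>x y z. x \<in> carrier A \<Longrightarrow> y \<in> carrier A \<Longrightarrow> z \<in> carrier A \<Longrightarrow>
      f (x \<otimes>\<^bsub>A\<^esub> y \<otimes>\<^bsub>A\<^esub> z) = lsum R (\<lambda>t. fst t x \<otimes>\<^bsub>R\<^esub> fst (snd t) y \<otimes>\<^bsub>R\<^esub> snd (snd t) z) ts"
proof -
  obtain ps where ps: "set ps \<subseteq> carrier K \<times> carrier K"
    "\<And>x y. x \<in> carrier A \<Longrightarrow> y \<in> carrier A \<Longrightarrow> f (x \<otimes>\<^bsub>A\<^esub> y) = lsum R (\<lambda>p. fst p x \<otimes>\<^bsub>R\<^esub> snd p y) ps"
    using K_decomp2[OF f] by blast
  have mem: "fst p \<in> carrier K" "snd p \<in> carrier K" if "p \<in> set ps" for p using ps that by auto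
  have "\<forall>g\<in>carrier K. \<exists>qs. set qs \<subseteq> carrier K \<times> carrier K \<and> (\<forall>x\<in>carrier A. \<forall>y\<in>carrier A.
      g (x \<otimes>\<^bsub>A\<^esub> y) = lsum R (\<lambda>q. fst q x \<otimes>\<^bsub>R\<^esub> snd q y) qs)"
    by (intro ballI, erule K_decomp2) blast
  from bchoice[OF this] obtain D where D0: "\<forall>g\<in>carrier K. set (D g) \<subseteq> carrier K \<times> carrier K \<and>
      (\<forall>x\<in>carrier A. \<forall>y\<in>carrier A. g (x \<otimes>\<^bsub>A\<^esub> y) = lsum R (\<lambda>q. fst q x \<otimes>\<^bsub>R\<^esub> snd q y) (D g))" ..
  have D: "set (D g) \<subseteq> carrier K \<times> carrier K" "x \<in> carrier A \<Longrightarrow> y \<in> carrier A \<Longrightarrow>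
      g (x \<otimes>\<^bsub>A\<^esub> y) = lsum R (\<lambda>q. fst q x \<otimes>\<^bsub>R\<^esub> snd q y) (D g)" if "g \<in> carrier K" for g x y
    using D0 that by auto
  have Dm: "fst q \<in> carrier K" "snd q \<in> carrier K" if "q \<in> set (D g)" "g \<in> carrier K" for q g using D(1) that by force+
  let ?ts = "concat (map (\<lambda>p. map (\<lambda>q. (fst q, snd q, snd p)) (D (fst p))) ps)"
  have "f (x \<otimes>\<^bsub>A\<^esub> y \<otimes>\<^bsub>A\<^esub> z) = lsum R (\<lambda>t. fst t x \<otimes>\<^bsub>R\<^esub> fst (snd t) y \<otimes>\<^bsub>R\<^esub> snd (snd t) z) ?ts"
    if xyz: "x \<in> carrier A" "y \<in> carrier A" "z \<in> carrier A" for x y z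
  proof -
    have "f (x \<otimes>\<^bsub>A\<^esub> y \<otimes>\<^bsub>A\<^esub> z) = lsum R (\<lambda>p. fst p (x \<otimes>\<^bsub>A\<^esub> y) \<otimes>\<^bsub>R\<^esub> snd p z) ps" using xyz ps(2) by simp
    also have "\<dots> = lsum R (\<lambda>p. lsum R (\<lambda>q. fst q x \<otimes>\<^bsub>R\<^esub> snd q y \<otimes>\<^bsub>R\<^esub> snd p z) (D (fst p))) ps"
      by (intro lsum_cong refl) (use mem Dm xyz in \<open>simp add: D(2) AM.lsum_ldistr\<close>)
    also have "\<dots> = lsum R (\<lambda>t. fst t x \<otimes>\<^bsub>R\<^esub> fst (snd t) y \<otimes>\<^bsub>R\<^esub> snd (snd t) z) ?ts"
      using mem Dm xyz by (subst AM.R.lsum_concat) (auto simp: lsum_map)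
    finally show ?thesis .
  qed
  moreover have "set ?ts \<subseteq> carrier K \<times> carrier K \<times> carrier K" using mem Dm by auto
  ultimately show ?thesis using that by blast
qed

lemma tensor_fin_dual_mod: "tensor R (fin_dual_mod R A) (fin_dual_mod R A) = KK"
  by (rule tensor_cong) (simp_all add: fin_dual_mod_def K_carrier K_add K_smult dual_mod_def)

lemma is_dual_comult_iff: "is_dual_comult R A f t \<longleftrightarrow>
    t \<in> carrier KK \<and> (\<forall>h\<in>carrier A. \<forall>h'\<in>carrier A. f (h \<otimes>\<^bsub>A\<^esub> h') = eval2 h h' t)"
  by (simp only: is_dual_comult_def tensor_fin_dual_mod eval2_def)

lemma ex1_dual_comult:
  assumes f: "f \<in> carrier K" shows "\<exists>!t. is_dual_comult R A f t"
proof -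
  obtain ps where ps: "set ps \<subseteq> carrier K \<times> carrier K"
    "\<And>x y. x \<in> carrier A \<Longrightarrow> y \<in> carrier A \<Longrightarrow> f (x \<otimes>\<^bsub>A\<^esub> y) = lsum R (\<lambda>p. fst p x \<otimes>\<^bsub>R\<^esub> snd p y) ps"
    using K_decomp2[OF f] by blast
  have "is_dual_comult R A f (tens R K K ps)"
    unfolding is_dual_comult_iff using tens_closed[OF module_K module_K ps(1)] ps(2) eval2_tens[OF ps(1)] by simp
  moreover have "t = u" if "is_dual_comult R A f t" "is_dual_comult R A f u" for t u
    using that unfolding is_dual_comult_iff by (intro KK_eqI) auto
  ultimately show ?thesis by blast
qed

lemma dual_comult_determined: "dual_comult_determined R A"
  unfolding dual_comult_determined_def using ex1_dual_comult by (simp add: K_carrier)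

end

section \<open>Hereditary rings\<close>

text \<open>As a projective module, \<open>J\<close> is a retract of a free module. Since \<open>J\<close> is finitely generated, its image there
involves only finitely many basis vectors; these and their coordinate functions give the dual basis.\<close>

lemma ideal_dual_basis:
  assumes R: "cring R" "noetherian_ring R" and her: "hereditary_ring R" and J: "submodule J R (reg_mod R)"
  obtains bs where "set bs \<subseteq> J \<times> lin_map R ((reg_mod R)\<lparr>carrier := J\<rparr>) (reg_mod R)"
    "\<And>l. l \<in> J \<Longrightarrow> l = lsum R (\<lambda>p. snd p l \<otimes>\<^bsub>R\<^esub> fst p) bs"
proof -
  interpret cring R by fact
  let ?J = "(reg_mod R)\<lparr>carrier := J\<rparr>"
  have I: "ideal J R" by (rule ideal_submodule_reg_mod[OF R(1) J])
  have mJ: "module R ?J" by (rule module_submodule[OF module_reg_mod J])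
  have "projective_mod R ?J" using her I by (simp add: hereditary_ring_def)
  then obtain X :: "'a set" and i p where i: "i \<in> lin_map R ?J (free_mod R X)"
    and p: "p \<in> lin_map R (free_mod R X) ?J" and pi: "\<forall>x\<in>carrier ?J. p (i x) = x"
    unfolding projective_mod_def by (elim exE bexE) (rule that)
  let ?F = "free_mod R X"
  have F: "module R ?F" by (rule module_free_mod)
  obtain G where G: "G \<subseteq> carrier R" "finite G" "J = Idl\<^bsub>R\<^esub> G"
    using noetherian_ring.finetely_gen[OF R(2) I] by blast
  have GJ: "G \<subseteq> J" using G genideal_self by blast
  have iF: "i l \<in> carrier ?F" if "l \<in> J" for l using lin_map_closed[OF i, of l] that by simp
  define Y where "Y = (\<Union>g\<in>G. {x. i g x \<noteq> \<zero>\<^bsub>R\<^esub>})"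
  have Yf: "finite Y" unfolding Y_def using G(2) iF GJ by (auto simp: free_mod_carrier)
  have YX: "Y \<subseteq> X" unfolding Y_def using iF GJ by (fastforce simp: free_mod_carrier)
  have supp: "{x. i l x \<noteq> \<zero>\<^bsub>R\<^esub>} \<subseteq> Y" if l: "l \<in> J" for l
  proof -
    let ?E = "{l \<in> J. \<forall>x. x \<notin> Y \<longrightarrow> i l x = \<zero>\<^bsub>R\<^esub>}"
    have "submodule ?E R (reg_mod R)"
    proof (rule submoduleI'[OF module_reg_mod])
      show "?E \<subseteq> carrier (reg_mod R)" using submodule_subset[OF J] by auto
      have "i \<zero>\<^bsub>R\<^esub> = (\<lambda>x. \<zero>\<^bsub>R\<^esub>)" using lin_map_zero[OF mJ F i] by simp
      then show "\<zero>\<^bsub>reg_mod R\<^esub> \<in> ?E" using submodule_zero[OF J] by simp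
      fix x y assume "x \<in> ?E" "y \<in> ?E"
      then show "x \<oplus>\<^bsub>reg_mod R\<^esub> y \<in> ?E" using submodule_add[OF J, of x y] lin_map_add[OF i, of x y] by simp
    next
      fix r x assume "r \<in> carrier R" "x \<in> ?E"
      then show "r \<odot>\<^bsub>reg_mod R\<^esub> x \<in> ?E" using submodule_smult[OF J, of r x] lin_map_smult[OF i, of r x] by simp
    qed
    then have "ideal ?E R" by (rule ideal_submodule_reg_mod[OF R(1)])
    moreover have "G \<subseteq> ?E" using GJ by (auto simp: Y_def)
    ultimately have "J \<subseteq> ?E" unfolding G(3) by (rule genideal_minimal)
    then show ?thesis using l by auto
  qed
  obtain ys where ys: "set ys = Y" "distinct ys" using finite_distinct_list[OF Yf] by blast
  have gen: "free_gen R y \<in> carrier ?F" if "y \<in> set ys" for y using that ys YX by (intro free_gen_closed) auto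
  have pgen: "p (free_gen R y) \<in> J" if "y \<in> set ys" for y using lin_map_closed[OF p gen[OF that]] by simp
  let ?bs = "map (\<lambda>y. (p (free_gen R y), \<lambda>l. i l y)) ys"
  have "(\<lambda>l. i l y) \<in> lin_map R ?J (reg_mod R)" for y
    using lin_mapD[OF i] free_mod_closed[OF iF] by (intro lin_mapI) auto
  moreover have "l = lsum R (\<lambda>p. snd p l \<otimes>\<^bsub>R\<^esub> fst p) ?bs" if l: "l \<in> J" for l
  proof -
    have iR: "i l y \<in> carrier R" for y by (rule free_mod_closed[OF iF[OF l]])
    have "l = p (i l)" using pi l by simp
    also have "i l = lsum ?F (\<lambda>y. i l y \<odot>\<^bsub>?F\<^esub> free_gen R y) ys"
      by (rule free_mod_expand[OF iF[OF l] ys(2)]) (use supp[OF l] ys YX in auto)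
    also have "p \<dots> = lsum ?J (\<lambda>y. p (i l y \<odot>\<^bsub>?F\<^esub> free_gen R y)) ys"
      by (rule lin_map_lsum[OF F mJ p]) (intro module.smult_closed[OF F] iR gen)
    also have "\<dots> = lsum ?J (\<lambda>y. i l y \<otimes>\<^bsub>R\<^esub> p (free_gen R y)) ys"
      by (rule lsum_cong[OF refl]) (subst lin_map_smult[OF p iR gen], auto)
    finally show ?thesis by (simp add: lsum_map)
  qed
  ultimately show ?thesis using pgen by (intro that[of ?bs]) auto
qed

text \<open>This is a dual basis of the image of \<open>V\<close> in \<open>R\<^sup>n\<close> under the functionals \<open>ws\<close>, pulled back to \<open>V\<close>. For the induction,
a dual basis of the ideal \<open>w V\<close> yields an endomorphism \<open>P\<close> of \<open>V\<close> with values in the kernel of \<open>w\<close> which fixes that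
kernel, and the remaining functionals are treated after composition with \<open>P\<close>.\<close>

lemma functionals_dual_basis:
  assumes R: "cring R" "noetherian_ring R" and her: "hereditary_ring R" and V: "module R V"
    and "set ws \<subseteq> lin_map R V (reg_mod R)"
  shows "\<exists>vus. set vus \<subseteq> carrier V \<times> lin_map R V (reg_mod R) \<and>
    (\<forall>w\<in>set ws. \<forall>v\<in>carrier V. w v = lsum R (\<lambda>p. snd p v \<otimes>\<^bsub>R\<^esub> w (fst p)) vus) \<and>
    (\<forall>p\<in>set vus. \<forall>v\<in>carrier V. (\<forall>w\<in>set ws. w v = \<zero>\<^bsub>R\<^esub>) \<longrightarrow> snd p v = \<zero>\<^bsub>R\<^esub>)"
  using assms(5)
proof (induction "length ws" arbitrary: ws)
  case 0
  then show ?case by (intro exI[of _ "[]"]) auto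
next
  case (Suc n ws0)
  then obtain w ws where ws0: "ws0 = w # ws" and n: "n = length ws" by (cases ws0) auto
  interpret V: module R V by fact
  have Rm: "module R (reg_mod R)" by (rule V.module_reg_mod)
  have w: "w \<in> lin_map R V (reg_mod R)" and ws: "set ws \<subseteq> lin_map R V (reg_mod R)" using Suc.prems ws0 by auto
  let ?J = "w ` carrier V"
  have J: "submodule ?J R (reg_mod R)" by (rule submodule_image[OF V Rm w V.carrier_is_submodule])
  obtain bs where bs: "set bs \<subseteq> ?J \<times> lin_map R ((reg_mod R)\<lparr>carrier := ?J\<rparr>) (reg_mod R)"
    and exp: "\<And>l. l \<in> ?J \<Longrightarrow> l = lsum R (\<lambda>p. snd p l \<otimes>\<^bsub>R\<^esub> fst p) bs"
    using ideal_dual_basis[OF R her J] by blast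
  define g where "g c = (SOME v. v \<in> carrier V \<and> w v = c)" for c
  have g: "g c \<in> carrier V" "w (g c) = c" if "c \<in> ?J" for c
  proof -
    have "\<exists>v. v \<in> carrier V \<and> w v = c" using that by auto
    then have "g c \<in> carrier V \<and> w (g c) = c" unfolding g_def by (rule someI_ex)
    then show "g c \<in> carrier V" "w (g c) = c" by auto
  qed
  have bsm: "g (fst p) \<in> carrier V" "w (g (fst p)) = fst p" "fst p \<in> carrier R"
      "(\<lambda>v. snd p (w v)) \<in> lin_map R V (reg_mod R)" if "p \<in> set bs" for p
  proof -
    have c: "fst p \<in> ?J" and \<phi>: "snd p \<in> lin_map R ((reg_mod R)\<lparr>carrier := ?J\<rparr>) (reg_mod R)" using bs that by auto
    show "g (fst p) \<in> carrier V" "w (g (fst p)) = fst p" using g[OF c] .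
    show "fst p \<in> carrier R" using submodule_mem[OF J c] by simp
    have "w \<in> lin_map R V ((reg_mod R)\<lparr>carrier := ?J\<rparr>)" using lin_mapD[OF w] by (intro lin_mapI) auto
    then show "(\<lambda>v. snd p (w v)) \<in> lin_map R V (reg_mod R)" using \<phi> by (rule lin_map_comp)
  qed
  note \<phi>R = lin_map_closed[OF bsm(4), simplified]
  \<comment> \<open>\<open>Q\<close> lifts \<open>w\<close> along itself: \<open>w (Q v) = w v\<close>.\<close>
  define Q where "Q v = lsum V (\<lambda>p. snd p (w v) \<odot>\<^bsub>V\<^esub> g (fst p)) bs" for v
  have Q: "Q \<in> lin_map R V V"
    unfolding Q_def
  proof (rule lin_map_lsum_fun[OF V])
    fix p assume p: "p \<in> set bs"
    show "(\<lambda>v. snd p (w v) \<odot>\<^bsub>V\<^esub> g (fst p)) \<in> lin_map R V V"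
      using lin_mapD[OF bsm(4)[OF p]] bsm(1)[OF p]
      by (intro lin_mapI) (auto simp: V.smult_l_distr V.smult_assoc1)
  qed
  have Q_app: "w' (Q v) = lsum R (\<lambda>p. snd p (w v) \<otimes>\<^bsub>R\<^esub> w' (g (fst p))) bs"
    if "w' \<in> lin_map R V (reg_mod R)" "v \<in> carrier V" for w' v
    unfolding Q_def using that bsm \<phi>R
    by (subst lin_map_lsum[OF V Rm that(1)]) (auto intro!: lsum_cong simp: lin_map_smult[OF that(1)])
  have wQ: "w (Q v) = w v" if v: "v \<in> carrier V" for v
  proof -
    have "w (Q v) = lsum R (\<lambda>p. snd p (w v) \<otimes>\<^bsub>R\<^esub> fst p) bs"
      unfolding Q_app[OF w v] using bsm(2) by (intro lsum_cong) auto
    then show ?thesis using exp[of "w v"] v by simp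
  qed
  define P where "P v = v \<ominus>\<^bsub>V\<^esub> Q v" for v
  note QD = lin_mapD[OF Q]
  have P: "P \<in> lin_map R V V"
    unfolding P_def using QD
    by (intro lin_mapI) (auto simp: a_minus_def V.minus_add V.M.a_ac V.smult_r_distr V.smult_r_minus)
  have P_app: "w' (P v) = w' v \<ominus>\<^bsub>R\<^esub> w' (Q v)" if "w' \<in> lin_map R V (reg_mod R)" "v \<in> carrier V" for w' v
    unfolding P_def using lin_map_diff[OF V Rm that(1) that(2) QD(1)[OF that(2)]] by simp
  have IHset: "set (map (\<lambda>w' v. w' (P v)) ws) \<subseteq> lin_map R V (reg_mod R)"
    using lin_map_comp[OF P] ws by auto
  have "\<exists>vus. set vus \<subseteq> carrier V \<times> lin_map R V (reg_mod R) \<and>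
    (\<forall>w'\<in>set ws. \<forall>v\<in>carrier V. w' (P v) = lsum R (\<lambda>p. snd p v \<otimes>\<^bsub>R\<^esub> w' (P (fst p))) vus) \<and>
    (\<forall>p\<in>set vus. \<forall>v\<in>carrier V. (\<forall>w'\<in>set ws. w' (P v) = \<zero>\<^bsub>R\<^esub>) \<longrightarrow> snd p v = \<zero>\<^bsub>R\<^esub>)"
    using Suc.hyps(1)[OF _ IHset] n by simp
  then obtain vus where vus: "set vus \<subseteq> carrier V \<times> lin_map R V (reg_mod R)"
    and vexp: "\<And>w' v. w' \<in> set ws \<Longrightarrow> v \<in> carrier V \<Longrightarrow> w' (P v) = lsum R (\<lambda>p. snd p v \<otimes>\<^bsub>R\<^esub> w' (P (fst p))) vus"
    and van: "\<And>p v. p \<in> set vus \<Longrightarrow> v \<in> carrier V \<Longrightarrow> (\<And>w'. w' \<in> set ws \<Longrightarrow> w' (P v) = \<zero>\<^bsub>R\<^esub>) \<Longrightarrow> snd p v = \<zero>\<^bsub>R\<^esub>"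
    by meson
  let ?vus = "map (\<lambda>p. (g (fst p), \<lambda>v. snd p (w v))) bs @ map (\<lambda>p. (P (fst p), snd p)) vus"
  have vm: "fst p \<in> carrier V" "snd p \<in> lin_map R V (reg_mod R)" if "p \<in> set vus" for p using vus that by auto
  note uR = lin_map_closed[OF vm(2), simplified] and PD = lin_mapD[OF P]
  have wP: "w (P v) = \<zero>\<^bsub>R\<^esub>" if "v \<in> carrier V" for v
    using P_app[OF w that] wQ[OF that] lin_map_closed[OF w that] by (simp add: a_minus_def V.R.r_neg)
  have exp_all: "w' v = lsum R (\<lambda>p. snd p v \<otimes>\<^bsub>R\<^esub> w' (fst p)) ?vus"
    if w': "w' \<in> set ws0" and v: "v \<in> carrier V" for w' v
  proof -
    have lw: "w' \<in> lin_map R V (reg_mod R)" using w' Suc.prems by auto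
    note wR = lin_map_closed[OF lw, simplified]
    have tail: "lsum R (\<lambda>p. snd p v \<otimes>\<^bsub>R\<^esub> w' (P (fst p))) vus = w' (P v)"
    proof (cases "w' = w")
      case True
      have "lsum R (\<lambda>p. snd p v \<otimes>\<^bsub>R\<^esub> w' (P (fst p))) vus = \<zero>\<^bsub>R\<^esub>"
        using True wP vm uR v by (intro V.R.lsum_zero) auto
      then show ?thesis using True wP v by simp
    next
      case False
      then show ?thesis using vexp[of w' v] w' ws0 v by simp
    qed
    have "lsum R (\<lambda>p. snd p v \<otimes>\<^bsub>R\<^esub> w' (fst p)) ?vus = w' (Q v) \<oplus>\<^bsub>R\<^esub> w' (P v)"
      using v vm uR \<phi>R bsm(1) wR PD(1) by (subst V.R.lsum_append) (auto simp: lsum_map Q_app[OF lw v] tail)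
    also have "\<dots> = w' v" using wR[OF v] wR[OF QD(1)[OF v]]
      by (simp add: P_app[OF lw v] a_minus_def V.R.a_comm[of "w' v"] V.R.r_neg2)
    finally show ?thesis by simp
  qed
  moreover have "snd p v = \<zero>\<^bsub>R\<^esub>" if p: "p \<in> set ?vus" and v: "v \<in> carrier V" and van0: "\<forall>w\<in>set ws0. w v = \<zero>\<^bsub>R\<^esub>" for p v
  proof -
    have wv: "w v = \<zero>\<^bsub>R\<^esub>" using van0 ws0 by simp
    have \<phi>0: "snd q (w v) = \<zero>\<^bsub>R\<^esub>" if q: "q \<in> set bs" for q
      using lin_map_zero[OF V Rm bsm(4)[OF q]] lin_map_zero[OF V Rm w] wv by simp
    have "Q v = \<zero>\<^bsub>V\<^esub>" unfolding Q_def using \<phi>0 bsm(1) by (intro V.M.lsum_zero) auto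
    then have Pv: "P v = v" using v V.M.minus_equality[of "\<zero>\<^bsub>V\<^esub>" "\<zero>\<^bsub>V\<^esub>"] by (simp add: P_def a_minus_def)
    show ?thesis using p \<phi>0 van[OF _ v] Pv van0 ws0 by auto
  qed
  moreover have "set ?vus \<subseteq> carrier V \<times> lin_map R V (reg_mod R)" using bsm vm PD(1) by auto
  ultimately show ?case by (intro exI[of _ ?vus] conjI ballI impI)
qed

text \<open>The vectors \<open>c\<^sub>j\<close> can be taken to be values \<open>(w\<^sub>i (v\<^sub>j))\<^sub>i\<close>, which are in \<open>N\<close> by assumption, and the functionals
\<open>u\<^sub>j\<close> are in the finite dual because they vanish wherever all \<open>w\<^sub>i\<close> vanish.\<close>

lemma (in finite_dual) hereditary_pairing_factors:
  assumes her: "hereditary_ring R"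
  shows "pairing_factors R A K (\<lambda>a f. f a)"
  unfolding pairing_factors_def
proof (intro allI impI)
  fix n :: nat and w N
  assume w: "\<forall>i<n. w i \<in> carrier K" and N: "submodule N R (free_mod R {..<n})"
    and vals: "\<forall>v\<in>carrier A. (\<lambda>i. if i < n then w i v else \<zero>\<^bsub>R\<^esub>) \<in> N"
  define ws where "ws = map w [0..<n]"
  have wsK: "set ws \<subseteq> carrier K" using w by (auto simp: ws_def)
  then have "set ws \<subseteq> lin_map R A (reg_mod R)" using K_lin by auto
  then obtain vus where vus: "set vus \<subseteq> carrier A \<times> lin_map R A (reg_mod R)"
    and vexp: "\<forall>w\<in>set ws. \<forall>v\<in>carrier A. w v = lsum R (\<lambda>p. snd p v \<otimes>\<^bsub>R\<^esub> w (fst p)) vus"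
    and van: "\<forall>p\<in>set vus. \<forall>v\<in>carrier A. (\<forall>w\<in>set ws. w v = \<zero>\<^bsub>R\<^esub>) \<longrightarrow> snd p v = \<zero>\<^bsub>R\<^esub>"
    using functionals_dual_basis[OF cring_R noeth_R her module_A] by meson
  obtain I where I: "ideal I A" "cofinite_sub R A I" "\<forall>f\<in>set ws. \<forall>x\<in>I. f x = \<zero>\<^bsub>R\<^esub>"
    using cofinite_ideal_kills_list[OF wsK] by blast
  have IA: "x \<in> carrier A" if "x \<in> I" for x using submodule_mem[OF submodule_ideal[OF I(1)] that] .
  have uK: "restrict (snd p) (carrier A) \<in> carrier K" if p: "p \<in> set vus" for p
  proof -
    have "snd p \<in> lin_map R A (reg_mod R)" using vus p by auto
    moreover have "\<forall>x\<in>I. restrict (snd p) (carrier A) x = \<zero>\<^bsub>R\<^esub>" using van p I(3) IA by auto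
    ultimately show ?thesis unfolding K_mem_iff using I(1,2) K_restrict_lin[of "snd p"]
      by (intro conjI exI[of _ I]) auto
  qed
  have vA: "fst p \<in> carrier A" "snd p \<in> lin_map R A (reg_mod R)" if "p \<in> set vus" for p using vus that by auto
  let ?cs = "map (\<lambda>p. (\<lambda>i. if i < n then w i (fst p) else \<zero>\<^bsub>R\<^esub>, restrict (snd p) (carrier A))) vus"
  have "w i = lsum K (\<lambda>p. fst p i \<odot>\<^bsub>K\<^esub> snd p) ?cs" if i: "i < n" for i
  proof (rule K_ext_eqI)
    show "w i \<in> carrier K" using w i by simp
    show "lsum K (\<lambda>p. fst p i \<odot>\<^bsub>K\<^esub> snd p) ?cs \<in> carrier K"
      using i w vA uK unfolding lsum_map by (intro KM.lsum_closed) auto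
    fix x assume x: "x \<in> carrier A"
    have "w i x = lsum R (\<lambda>p. snd p x \<otimes>\<^bsub>R\<^esub> w i (fst p)) vus" using vexp i x by (auto simp: ws_def)
    also have "\<dots> = lsum R (\<lambda>p. w i (fst p) \<otimes>\<^bsub>R\<^esub> snd p x) vus"
      using w i vA x lin_map_closed[OF vA(2)] by (intro lsum_cong refl AM.m_comm) auto
    finally show "w i x = lsum K (\<lambda>p. fst p i \<odot>\<^bsub>K\<^esub> snd p) ?cs x" using x i by (simp add: lsum_map)
  qed
  moreover have "set ?cs \<subseteq> N \<times> carrier K" using vals vA(1) uK by auto
  ultimately show "\<exists>cs. set cs \<subseteq> N \<times> carrier K \<and> (\<forall>i<n. w i = lsum K (\<lambda>p. fst p i \<odot>\<^bsub>K\<^esub> snd p) cs)"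
    by blast
qed

section \<open>Sweedler calculus\<close>

lemma bilin_map_flip: "b \<in> bilin_map R M N P \<Longrightarrow> (\<lambda>y x. b x y) \<in> bilin_map R N M P"
  by (auto simp: bilin_map_def)

text \<open>Together with its mirror image, this reduces multilinear maps on iterated tensor products to multilinear maps on
the factors.\<close>

lemma bilin_map_tensor_sum_right:
  assumes L: "module R L" and M: "module R M" and N: "module R N" and P: "module R P"
    and b: "\<And>x. x \<in> carrier L \<Longrightarrow> b x \<in> bilin_map R M N P"
    and b': "\<And>y z. y \<in> carrier M \<Longrightarrow> z \<in> carrier N \<Longrightarrow> (\<lambda>x. b x y z) \<in> lin_map R L P"
  shows "(\<lambda>x u. tensor_sum R P (b x) u) \<in> bilin_map R L (tensor R M N) P"
proof (rule bilin_mapI)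
  fix x assume "x \<in> carrier L"
  then show "tensor_sum R P (b x) \<in> lin_map R (tensor R M N) P"
    by (intro lin_map_tensor_sum[OF M N P] b)
next
  fix u assume "u \<in> carrier (tensor R M N)"
  then obtain ps where ps: "set ps \<subseteq> carrier M \<times> carrier N" "u = tens R M N ps"
    using tensor_cases[OF M N] by blast
  have mem: "fst p \<in> carrier M" "snd p \<in> carrier N" if "p \<in> set ps" for p using ps that by auto
  have "(\<lambda>x. lsum P (\<lambda>p. b x (fst p) (snd p)) ps) \<in> lin_map R L P"
    using mem b' by (intro lin_map_lsum_fun[OF P]) auto
  then show "(\<lambda>x. tensor_sum R P (b x) u) \<in> lin_map R L P"
    by (subst lin_map_cong[OF L, where g = "\<lambda>x. lsum P (\<lambda>p. b x (fst p) (snd p)) ps"])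
       (simp_all add: ps(2) tensor_sum_tens[OF M N P b ps(1)])
qed

lemma bilin_map_tensor_sum_left:
  assumes L: "module R L" and M: "module R M" and N: "module R N" and P: "module R P"
    and b: "\<And>z. z \<in> carrier L \<Longrightarrow> (\<lambda>x y. b x y z) \<in> bilin_map R M N P"
    and b': "\<And>x y. x \<in> carrier M \<Longrightarrow> y \<in> carrier N \<Longrightarrow> b x y \<in> lin_map R L P"
  shows "(\<lambda>u z. tensor_sum R P (\<lambda>x y. b x y z) u) \<in> bilin_map R (tensor R M N) L P"
  by (rule bilin_map_flip[OF bilin_map_tensor_sum_right[OF L M N P]]) (use b b' in auto)

lemma bilin_map_comp:
  assumes "b \<in> bilin_map R M N P" "f \<in> lin_map R M' M" "g \<in> lin_map R N' N"
  shows "(\<lambda>x y. b (f x) (g y)) \<in> bilin_map R M' N' P"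
  using lin_mapD[OF assms(2)] lin_mapD[OF assms(3)] bilin_mapD[OF assms(1)]
  by (intro bilin_mapI lin_mapI)
     (auto simp: lin_mapD[OF bilin_map_right[OF assms(1)]] lin_mapD[OF bilin_map_left[OF assms(1)]])

lemma tensor_map_tens:
  assumes M: "module R M" and N: "module R N" and M': "module R M'" and N': "module R N'"
    and f: "f \<in> lin_map R M M'" and g: "g \<in> lin_map R N N'" and ps: "set ps \<subseteq> carrier M \<times> carrier N"
  shows "tensor_map R M' N' f g (tens R M N ps) = lsum (tensor R M' N') (\<lambda>p. ptensor R M' N' (f (fst p)) (g (snd p))) ps"
  unfolding tensor_map_def
  by (rule tensor_sum_tens[OF M N module_tensor[OF M' N'] bilin_map_comp[OF bilin_map_ptensor[OF M' N'] f g] ps])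

definition trilin_map where
  "trilin_map R C P = {b. (\<forall>x\<in>carrier C. b x \<in> bilin_map R C C P) \<and>
     (\<forall>y\<in>carrier C. \<forall>z\<in>carrier C. (\<lambda>x. b x y z) \<in> lin_map R C P)}"

lemma trilin_mapI:
  assumes "\<And>x y. x \<in> carrier C \<Longrightarrow> y \<in> carrier C \<Longrightarrow> b x y \<in> lin_map R C P"
    "\<And>x z. x \<in> carrier C \<Longrightarrow> z \<in> carrier C \<Longrightarrow> (\<lambda>y. b x y z) \<in> lin_map R C P"
    "\<And>y z. y \<in> carrier C \<Longrightarrow> z \<in> carrier C \<Longrightarrow> (\<lambda>x. b x y z) \<in> lin_map R C P"
  shows "b \<in> trilin_map R C P"
  using assms by (auto simp: trilin_map_def bilin_map_def)

lemma trilin_mapD: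
  assumes "b \<in> trilin_map R C P"
  shows "\<And>x. x \<in> carrier C \<Longrightarrow> b x \<in> bilin_map R C C P"
    "\<And>z. z \<in> carrier C \<Longrightarrow> (\<lambda>x y. b x y z) \<in> bilin_map R C C P"
    "\<And>y z. y \<in> carrier C \<Longrightarrow> z \<in> carrier C \<Longrightarrow> (\<lambda>x. b x y z) \<in> lin_map R C P"
    "\<And>x y. x \<in> carrier C \<Longrightarrow> y \<in> carrier C \<Longrightarrow> b x y \<in> lin_map R C P"
    "\<And>x y z. x \<in> carrier C \<Longrightarrow> y \<in> carrier C \<Longrightarrow> z \<in> carrier C \<Longrightarrow> b x y z \<in> carrier P"
proof -
  show *: "b x \<in> bilin_map R C C P" if "x \<in> carrier C" for x using assms that by (auto simp: trilin_map_def)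
  show "b x y z \<in> carrier P" if "x \<in> carrier C" "y \<in> carrier C" "z \<in> carrier C" for x y z
    by (rule bilin_map_closed[OF *[OF that(1)] that(2,3)])
qed (use assms in \<open>auto simp: trilin_map_def bilin_map_def\<close>)

text \<open>A comultiplication without axioms: coassociativity for the finite dual is proved by calculating in this
locale.\<close>

locale comultiplication =
  fixes R :: "('r, 'z) ring_scheme" and C :: "('r, 'a, 'u) bialg_scheme"
  assumes module_C: "module R C" and comult_lin: "comult C \<in> lin_map R C (tensor R C C)"
begin

sublocale CM: module R C by (rule module_C)

abbreviation (input) CC where "CC \<equiv> tensor R C C"
abbreviation (input) CCC where "CCC \<equiv> tensor R C (tensor R C C)"

lemma module_CC: "module R CC" by (rule module_tensor[OF module_C module_C])
lemma module_CCC: "module R CCC" by (rule module_tensor[OF module_C module_CC])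

lemma comult_closed [simp]: "c \<in> carrier C \<Longrightarrow> comult C c \<in> carrier CC"
  by (rule lin_map_closed[OF comult_lin])

text \<open>A chosen list of pairs whose pure tensors add up to the comultiplication of \<open>c\<close>. A sum over \<open>p\<close> in \<open>\<Delta> c\<close> is
a Sweedler sum with \<open>c\<^sub>1 = fst p\<close> and \<open>c\<^sub>2 = snd p\<close>; its value does not depend on the choice if the summand
is bilinear.\<close>

definition \<Delta> :: "'a \<Rightarrow> ('a \<times> 'a) list" where
  "\<Delta> c = (SOME ps. set ps \<subseteq> carrier C \<times> carrier C \<and> comult C c = tens R C C ps)"

lemma \<Delta>:
  assumes "c \<in> carrier C"
  shows \<Delta>_sub: "set (\<Delta> c) \<subseteq> carrier C \<times> carrier C" and comult_\<Delta>: "comult C c = tens R C C (\<Delta> c)"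
proof -
  have "\<exists>ps. set ps \<subseteq> carrier C \<times> carrier C \<and> comult C c = tens R C C ps"
    by (rule tensor_cases[OF module_C module_C comult_closed[OF assms]]) blast
  from someI_ex[OF this] show "set (\<Delta> c) \<subseteq> carrier C \<times> carrier C" "comult C c = tens R C C (\<Delta> c)"
    by (auto simp: \<Delta>_def)
qed

lemma \<Delta>_mem:
  assumes "p \<in> set (\<Delta> c)" "c \<in> carrier C"
  shows "fst p \<in> carrier C" "snd p \<in> carrier C"
  using \<Delta>_sub[OF assms(2)] assms(1) by auto

lemma tensor_sum_comult:
  assumes "module R P" "b \<in> bilin_map R C C P" "c \<in> carrier C"
  shows "tensor_sum R P b (comult C c) = lsum P (\<lambda>p. b (fst p) (snd p)) (\<Delta> c)"
  unfolding comult_\<Delta>[OF assms(3)] by (rule tensor_sum_tens[OF module_C module_C assms(1,2) \<Delta>_sub[OF assms(3)]])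

lemma lin_map_\<Delta>:
  assumes "module R P" "b \<in> bilin_map R C C P"
  shows "(\<lambda>c. lsum P (\<lambda>p. b (fst p) (snd p)) (\<Delta> c)) \<in> lin_map R C P"
  using lin_map_comp[OF comult_lin lin_map_tensor_sum[OF module_C module_C assms]]
  by (subst lin_map_cong[OF module_C, where g = "\<lambda>c. tensor_sum R P b (comult C c)"])
     (simp_all add: tensor_sum_comult[OF assms])

text \<open>The two sides of the coassociativity law are calculated as explicit sums, both to use the law for \<open>H\<close> and to verify
it for the finite dual.\<close>

lemma coassoc_left:
  assumes c: "c \<in> carrier C"
  shows "tensor_assoc R C C C (tensor_map R (tensor R C C) C (comult C) id (comult C c)) =
    lsum CCC (\<lambda>p. lsum CCC (\<lambda>q. ptensor R C CC (fst q) (ptensor R C C (snd q) (snd p))) (\<Delta> (fst p))) (\<Delta> c)"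
proof -
  have CCm: "module R (tensor R CC C)" by (rule module_tensor[OF module_CC module_C])
  note pt = bilin_map_ptensor[OF module_C module_C] and pt3 = bilin_map_ptensor[OF module_C module_CC]
  have b1: "(\<lambda>x y. ptensor R C CC x (ptensor R C C y z)) \<in> bilin_map R C C CCC" if "z \<in> carrier C" for z
    by (rule bilin_map_comp[OF pt3 lin_map_id(2) bilin_map_left[OF pt that]])
  have b2: "(\<lambda>z. ptensor R C CC x (ptensor R C C y z)) \<in> lin_map R C CCC" if "x \<in> carrier C" "y \<in> carrier C" for x y
    by (rule lin_map_comp[OF bilin_map_right[OF pt that(2)] bilin_map_right[OF pt3 that(1)]])
  have b3: "(\<lambda>u z. tensor_sum R CCC (\<lambda>x y. ptensor R C CC x (ptensor R C C y z)) u) \<in> bilin_map R CC C CCC"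
    by (rule bilin_map_tensor_sum_left[OF module_C module_C module_C module_CCC b1 b2])
  have "tensor_map R CC C (comult C) id (comult C c) = tens R CC C (map (\<lambda>p. (comult C (fst p), snd p)) (\<Delta> c))"
    unfolding comult_\<Delta>[OF c] tensor_map_tens[OF module_C module_C module_CC module_C comult_lin lin_map_id(1) \<Delta>_sub[OF c]]
    by (simp add: tens_def lsum_map)
  moreover have "set (map (\<lambda>p. (comult C (fst p), snd p)) (\<Delta> c)) \<subseteq> carrier CC \<times> carrier C"
    using \<Delta>_mem[OF _ c] by auto
  ultimately show ?thesis
    unfolding tensor_assoc_def Let_def
    using tensor_sum_tens[OF module_CC module_C module_CCC b3] \<Delta>_mem[OF _ c]
    by (auto simp: lsum_map intro!: lsum_cong tensor_sum_comult[OF module_CCC b1])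
qed

lemma coassoc_right:
  assumes c: "c \<in> carrier C"
  shows "tensor_map R C (tensor R C C) id (comult C) (comult C c) =
    lsum CCC (\<lambda>p. ptensor R C CC (fst p) (comult C (snd p))) (\<Delta> c)"
  unfolding comult_\<Delta>[OF c] tensor_map_tens[OF module_C module_C module_C module_CC lin_map_id(1) comult_lin \<Delta>_sub[OF c]]
  by simp

end

locale coalg = comultiplication +
  assumes coalg: "coalgebra R C"
begin

lemma counit_lin: "counit C \<in> lin_map R C (reg_mod R)"
  using coalg by (simp add: coalgebra_def)

lemma counit_closed [simp]: "c \<in> carrier C \<Longrightarrow> counit C c \<in> carrier R"
  using lin_map_closed[OF counit_lin] by simp

text \<open>Apply to both sides of the coassociativity law the linear map on \<open>C \<otimes> (C \<otimes> C)\<close> that \<open>b\<close> induces.\<close>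

lemma coassoc:
  assumes P: "module R P" and b: "b \<in> trilin_map R C P" and c: "c \<in> carrier C"
  shows "lsum P (\<lambda>p. lsum P (\<lambda>q. b (fst q) (snd q) (snd p)) (\<Delta> (fst p))) (\<Delta> c) =
    lsum P (\<lambda>p. lsum P (\<lambda>q. b (fst p) (fst q) (snd q)) (\<Delta> (snd p))) (\<Delta> c)"
proof -
  interpret P: module R P by fact
  note bD = trilin_mapD[OF b]
  note pt = bilin_map_ptensor[OF module_C module_C] and pt3 = bilin_map_ptensor[OF module_C module_CC]
  have b3: "(\<lambda>x u. tensor_sum R P (b x) u) \<in> bilin_map R C CC P"
    by (rule bilin_map_tensor_sum_right[OF module_C module_C module_C P bD(1) bD(3)])
  let ?B = "tensor_sum R P (\<lambda>x u. tensor_sum R P (b x) u)"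
  have B: "?B \<in> lin_map R CCC P" by (rule lin_map_tensor_sum[OF module_C module_CC P b3])
  have Bp: "?B (ptensor R C CC x u) = tensor_sum R P (b x) u" if "x \<in> carrier C" "u \<in> carrier CC" for x u
    by (rule tensor_sum_ptensor[OF module_C module_CC P b3 that])
  have cl: "ptensor R C C y z \<in> carrier CC" if "y \<in> carrier C" "z \<in> carrier C" for y z by (rule bilin_map_closed[OF pt that])
  have cl3: "ptensor R C CC x u \<in> carrier CCC" if "x \<in> carrier C" "u \<in> carrier CC" for x u by (rule bilin_map_closed[OF pt3 that])
  interpret CCC: module R CCC by (rule module_CCC)
  have "?B (tensor_assoc R C C C (tensor_map R (tensor R C C) C (comult C) id (comult C c))) =
     lsum P (\<lambda>p. ?B (lsum CCC (\<lambda>q. ptensor R C CC (fst q) (ptensor R C C (snd q) (snd p))) (\<Delta> (fst p)))) (\<Delta> c)"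
    unfolding coassoc_left[OF c]
    by (intro lin_map_lsum[OF module_CCC P B] CCC.lsum_closed cl3 cl \<Delta>_mem(1)[OF _ \<Delta>_mem(1)[OF _ c]]
      \<Delta>_mem(2)[OF _ \<Delta>_mem(1)[OF _ c]] \<Delta>_mem(2)[OF _ c])
  also have "\<dots> = lsum P (\<lambda>p. lsum P (\<lambda>q. b (fst q) (snd q) (snd p)) (\<Delta> (fst p))) (\<Delta> c)"
  proof (rule lsum_cong[OF refl])
    fix p assume p: "p \<in> set (\<Delta> c)"
    note pm = \<Delta>_mem[OF p c]
    have "?B (lsum CCC (\<lambda>q. ptensor R C CC (fst q) (ptensor R C C (snd q) (snd p))) (\<Delta> (fst p))) =
      lsum P (\<lambda>q. ?B (ptensor R C CC (fst q) (ptensor R C C (snd q) (snd p)))) (\<Delta> (fst p))"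
      by (intro lin_map_lsum[OF module_CCC P B] cl3 cl \<Delta>_mem(1)[OF _ pm(1)] \<Delta>_mem(2)[OF _ pm(1)] pm(2))
    also have "\<dots> = lsum P (\<lambda>q. b (fst q) (snd q) (snd p)) (\<Delta> (fst p))"
      using \<Delta>_mem[OF _ pm(1)] pm cl
      by (intro lsum_cong refl) (simp add: Bp tensor_sum_ptensor[OF module_C module_C P bD(1)])
    finally show "?B (lsum CCC (\<lambda>q. ptensor R C CC (fst q) (ptensor R C C (snd q) (snd p))) (\<Delta> (fst p))) =
      lsum P (\<lambda>q. b (fst q) (snd q) (snd p)) (\<Delta> (fst p))" .
  qed
  also have "tensor_assoc R C C C (tensor_map R (tensor R C C) C (comult C) id (comult C c)) =
      tensor_map R C (tensor R C C) id (comult C) (comult C c)"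
    using coalg c by (simp add: coalgebra_def)
  also have "?B \<dots> = lsum P (\<lambda>p. ?B (ptensor R C CC (fst p) (comult C (snd p)))) (\<Delta> c)"
    unfolding coassoc_right[OF c]
    by (intro lin_map_lsum[OF module_CCC P B] cl3 comult_closed \<Delta>_mem[OF _ c])
  also have "\<dots> = lsum P (\<lambda>p. lsum P (\<lambda>q. b (fst p) (fst q) (snd q)) (\<Delta> (snd p))) (\<Delta> c)"
    using \<Delta>_mem[OF _ c] by (intro lsum_cong refl) (simp add: Bp tensor_sum_comult[OF P bD(1)])
  finally show ?thesis by simp
qed

lemma counit_left:
  assumes c: "c \<in> carrier C" shows "lsum C (\<lambda>p. counit C (fst p) \<odot>\<^bsub>C\<^esub> snd p) (\<Delta> c) = c"
proof -
  have "(\<lambda>x y. counit C x \<odot>\<^bsub>C\<^esub> y) \<in> bilin_map R C C C"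
    using lin_mapD[OF counit_lin]
    by (intro bilin_mapI lin_mapI) (auto simp: CM.smult_l_distr CM.smult_r_distr CM.smult_assoc1 CM.smult_left_commute)
  from tensor_sum_comult[OF module_C this c] show ?thesis using coalg c by (simp add: coalgebra_def)
qed

lemma counit_right:
  assumes c: "c \<in> carrier C" shows "lsum C (\<lambda>p. counit C (snd p) \<odot>\<^bsub>C\<^esub> fst p) (\<Delta> c) = c"
proof -
  have "(\<lambda>x y. counit C y \<odot>\<^bsub>C\<^esub> x) \<in> bilin_map R C C C"
    using lin_mapD[OF counit_lin]
    by (intro bilin_mapI lin_mapI) (auto simp: CM.smult_l_distr CM.smult_r_distr CM.smult_assoc1 CM.smult_left_commute)
  from tensor_sum_comult[OF module_C this c] show ?thesis using coalg c by (simp add: coalgebra_def)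
qed

lemma counit_left_lin:
  assumes f: "f \<in> lin_map R C P" "module R P" and c: "c \<in> carrier C"
  shows "lsum P (\<lambda>p. counit C (fst p) \<odot>\<^bsub>P\<^esub> f (snd p)) (\<Delta> c) = f c"
proof -
  have "f (lsum C (\<lambda>p. counit C (fst p) \<odot>\<^bsub>C\<^esub> snd p) (\<Delta> c)) = lsum P (\<lambda>p. f (counit C (fst p) \<odot>\<^bsub>C\<^esub> snd p)) (\<Delta> c)"
    using \<Delta>_mem[OF _ c] by (intro lin_map_lsum[OF module_C f(2,1)]) auto
  also have "\<dots> = lsum P (\<lambda>p. counit C (fst p) \<odot>\<^bsub>P\<^esub> f (snd p)) (\<Delta> c)"
    using \<Delta>_mem[OF _ c] by (intro lsum_cong refl lin_map_smult[OF f(1)]) auto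
  finally show ?thesis unfolding counit_left[OF c] ..
qed

lemma counit_right_lin:
  assumes f: "f \<in> lin_map R C P" "module R P" and c: "c \<in> carrier C"
  shows "lsum P (\<lambda>p. counit C (snd p) \<odot>\<^bsub>P\<^esub> f (fst p)) (\<Delta> c) = f c"
proof -
  have "f (lsum C (\<lambda>p. counit C (snd p) \<odot>\<^bsub>C\<^esub> fst p) (\<Delta> c)) = lsum P (\<lambda>p. f (counit C (snd p) \<odot>\<^bsub>C\<^esub> fst p)) (\<Delta> c)"
    using \<Delta>_mem[OF _ c] by (intro lin_map_lsum[OF module_C f(2,1)]) auto
  also have "\<dots> = lsum P (\<lambda>p. counit C (snd p) \<odot>\<^bsub>P\<^esub> f (fst p)) (\<Delta> c)"
    using \<Delta>_mem[OF _ c] by (intro lsum_cong refl lin_map_smult[OF f(1)]) auto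
  finally show ?thesis unfolding counit_right[OF c] ..
qed

end

lemma coalg_intro: "coalgebra R C \<Longrightarrow> coalg R C"
  by (auto simp: coalg_def comultiplication_def coalg_axioms_def coalgebra_def)

section \<open>The tensor square of an algebra\<close>

lemma mult_bilin:
  assumes "assoc_algebra R A" shows "(\<otimes>\<^bsub>A\<^esub>) \<in> bilin_map R A A A"
proof -
  interpret AR: ring A using assms by (simp add: assoc_algebra_def)
  show ?thesis using assms by (intro bilin_mapI lin_mapI) (auto simp: AR.l_distr AR.r_distr assoc_algebra_def)
qed

lemma tensor_alg_mult:
  assumes A: "assoc_algebra R A" and ps: "set ps \<subseteq> carrier A \<times> carrier A" and qs: "set qs \<subseteq> carrier A \<times> carrier A"
  shows "tens R A A ps \<otimes>\<^bsub>tensor_alg R A A\<^esub> tens R A A qs =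
    lsum (tensor R A A) (\<lambda>p. lsum (tensor R A A) (\<lambda>q. ptensor R A A (fst p \<otimes>\<^bsub>A\<^esub> fst q) (snd p \<otimes>\<^bsub>A\<^esub> snd q)) qs) ps"
proof -
  have M: "module R A" using A by (simp add: assoc_algebra_def)
  have T: "module R (tensor R A A)" by (rule module_tensor[OF M M])
  note mb = mult_bilin[OF A] and pt = bilin_map_ptensor[OF M M]
  have mem: "fst q \<in> carrier A" "snd q \<in> carrier A" if "q \<in> set qs" for q using qs that by auto
  have memp: "fst q \<in> carrier A" "snd q \<in> carrier A" if "q \<in> set ps" for q using ps that by auto
  have b1: "(\<lambda>c d. ptensor R A A (a \<otimes>\<^bsub>A\<^esub> c) (b \<otimes>\<^bsub>A\<^esub> d)) \<in> bilin_map R A A (tensor R A A)"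
    if "a \<in> carrier A" "b \<in> carrier A" for a b
    by (rule bilin_map_comp[OF pt bilin_map_right[OF mb that(1)] bilin_map_right[OF mb that(2)]])
  have b2: "(\<lambda>a b. ptensor R A A (a \<otimes>\<^bsub>A\<^esub> c) (b \<otimes>\<^bsub>A\<^esub> d)) \<in> bilin_map R A A (tensor R A A)"
    if "c \<in> carrier A" "d \<in> carrier A" for c d
    by (rule bilin_map_comp[OF pt bilin_map_left[OF mb that(1)] bilin_map_left[OF mb that(2)]])
  have inner: "tensor_sum R (tensor R A A) (\<lambda>c d. ptensor R A A (a \<otimes>\<^bsub>A\<^esub> c) (b \<otimes>\<^bsub>A\<^esub> d)) (tens R A A qs) =
      lsum (tensor R A A) (\<lambda>q. ptensor R A A (a \<otimes>\<^bsub>A\<^esub> fst q) (b \<otimes>\<^bsub>A\<^esub> snd q)) qs"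
    if "a \<in> carrier A" "b \<in> carrier A" for a b
    by (rule tensor_sum_tens[OF M M T b1[OF that] qs])
  have b3: "(\<lambda>a b. tensor_sum R (tensor R A A) (\<lambda>c d. ptensor R A A (a \<otimes>\<^bsub>A\<^esub> c) (b \<otimes>\<^bsub>A\<^esub> d)) (tens R A A qs))
      \<in> bilin_map R A A (tensor R A A)"
  proof (rule bilin_mapI)
    fix a assume a: "a \<in> carrier A"
    have "(\<lambda>b. lsum (tensor R A A) (\<lambda>q. ptensor R A A (a \<otimes>\<^bsub>A\<^esub> fst q) (b \<otimes>\<^bsub>A\<^esub> snd q)) qs) \<in> lin_map R A (tensor R A A)"
      using a mem by (intro lin_map_lsum_fun[OF T] bilin_map_right[OF b2]) auto
    then show "(\<lambda>b. tensor_sum R (tensor R A A) (\<lambda>c d. ptensor R A A (a \<otimes>\<^bsub>A\<^esub> c) (b \<otimes>\<^bsub>A\<^esub> d)) (tens R A A qs)) \<in> lin_map R A (tensor R A A)"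
      by (subst lin_map_cong[OF M]) (simp_all add: inner a)
  next
    fix b assume b: "b \<in> carrier A"
    have "(\<lambda>a. lsum (tensor R A A) (\<lambda>q. ptensor R A A (a \<otimes>\<^bsub>A\<^esub> fst q) (b \<otimes>\<^bsub>A\<^esub> snd q)) qs) \<in> lin_map R A (tensor R A A)"
      using b mem by (intro lin_map_lsum_fun[OF T] bilin_map_left[OF b2]) auto
    then show "(\<lambda>a. tensor_sum R (tensor R A A) (\<lambda>c d. ptensor R A A (a \<otimes>\<^bsub>A\<^esub> c) (b \<otimes>\<^bsub>A\<^esub> d)) (tens R A A qs)) \<in> lin_map R A (tensor R A A)"
      by (subst lin_map_cong[OF M]) (simp_all add: inner b)
  qed
  have "tens R A A ps \<otimes>\<^bsub>tensor_alg R A A\<^esub> tens R A A qs =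
     tensor_sum R (tensor R A A) (\<lambda>a b. tensor_sum R (tensor R A A)
       (\<lambda>c d. ptensor R A A (a \<otimes>\<^bsub>A\<^esub> c) (b \<otimes>\<^bsub>A\<^esub> d)) (tens R A A qs)) (tens R A A ps)"
    by (simp add: tensor_alg_def Let_def)
  also have "\<dots> = lsum (tensor R A A) (\<lambda>p. tensor_sum R (tensor R A A)
       (\<lambda>c d. ptensor R A A (fst p \<otimes>\<^bsub>A\<^esub> c) (snd p \<otimes>\<^bsub>A\<^esub> d)) (tens R A A qs)) ps"
    by (rule tensor_sum_tens[OF M M T b3 ps])
  also have "\<dots> = lsum (tensor R A A) (\<lambda>p. lsum (tensor R A A) (\<lambda>q. ptensor R A A (fst p \<otimes>\<^bsub>A\<^esub> fst q) (snd p \<otimes>\<^bsub>A\<^esub> snd q)) qs) ps"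
    by (intro lsum_cong refl inner memp)
  finally show ?thesis .
qed

locale bialgebra_struct =
  fixes R :: "('r, 'z) ring_scheme" and C :: "('r, 'a, 'u) bialg_scheme"
  assumes bialg: "bialgebra R C"
begin

sublocale coalg R C using bialg by (intro coalg_intro) (simp add: bialgebra_def)

lemma assoc_alg: "assoc_algebra R C" using bialg by (simp add: bialgebra_def)

sublocale CR: ring C using assoc_alg by (simp add: assoc_algebra_def)

lemma smult_mult:
  assumes "r \<in> carrier R" "x \<in> carrier C" "y \<in> carrier C"
  shows "(r \<odot>\<^bsub>C\<^esub> x) \<otimes>\<^bsub>C\<^esub> y = r \<odot>\<^bsub>C\<^esub> (x \<otimes>\<^bsub>C\<^esub> y)" "x \<otimes>\<^bsub>C\<^esub> (r \<odot>\<^bsub>C\<^esub> y) = r \<odot>\<^bsub>C\<^esub> (x \<otimes>\<^bsub>C\<^esub> y)"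
  using assoc_alg assms by (auto simp: assoc_algebra_def)

lemma counit_mult: "x \<in> carrier C \<Longrightarrow> y \<in> carrier C \<Longrightarrow> counit C (x \<otimes>\<^bsub>C\<^esub> y) = counit C x \<otimes>\<^bsub>R\<^esub> counit C y"
  and counit_one: "counit C \<one>\<^bsub>C\<^esub> = \<one>\<^bsub>R\<^esub>"
  using bialg by (auto simp: bialgebra_def alg_hom_def ring_hom_def)

lemma comult_mult: "x \<in> carrier C \<Longrightarrow> y \<in> carrier C \<Longrightarrow> comult C (x \<otimes>\<^bsub>C\<^esub> y) = comult C x \<otimes>\<^bsub>tensor_alg R C C\<^esub> comult C y"
  and comult_one: "comult C \<one>\<^bsub>C\<^esub> = ptensor R C C \<one>\<^bsub>C\<^esub> \<one>\<^bsub>C\<^esub>"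
  using bialg by (auto simp: bialgebra_def alg_hom_def ring_hom_def tensor_alg_def Let_def)

lemma \<Delta>_mult:
  assumes P: "module R P" and b: "b \<in> bilin_map R C C P" and x: "x \<in> carrier C" and y: "y \<in> carrier C"
  shows "lsum P (\<lambda>p. b (fst p) (snd p)) (\<Delta> (x \<otimes>\<^bsub>C\<^esub> y)) =
    lsum P (\<lambda>p. lsum P (\<lambda>q. b (fst p \<otimes>\<^bsub>C\<^esub> fst q) (snd p \<otimes>\<^bsub>C\<^esub> snd q)) (\<Delta> y)) (\<Delta> x)"
proof -
  interpret P: module R P by fact
  interpret T: module R CC by (rule module_CC)
  note L = lin_map_tensor_sum[OF module_C module_C P b]
  have cl: "ptensor R C C (fst p \<otimes>\<^bsub>C\<^esub> fst q) (snd p \<otimes>\<^bsub>C\<^esub> snd q) \<in> carrier CC" if "p \<in> set (\<Delta> x)" "q \<in> set (\<Delta> y)" for p q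
    using \<Delta>_mem[OF that(1) x] \<Delta>_mem[OF that(2) y] by (intro ptensor_closed[OF module_C module_C]) auto
  have "lsum P (\<lambda>p. b (fst p) (snd p)) (\<Delta> (x \<otimes>\<^bsub>C\<^esub> y)) = tensor_sum R P b (comult C (x \<otimes>\<^bsub>C\<^esub> y))"
    using tensor_sum_comult[OF P b] x y by simp
  also have "comult C (x \<otimes>\<^bsub>C\<^esub> y) = lsum CC (\<lambda>p. lsum CC (\<lambda>q. ptensor R C C (fst p \<otimes>\<^bsub>C\<^esub> fst q) (snd p \<otimes>\<^bsub>C\<^esub> snd q)) (\<Delta> y)) (\<Delta> x)"
    unfolding comult_mult[OF x y] comult_\<Delta>[OF x] comult_\<Delta>[OF y]
    by (rule tensor_alg_mult[OF assoc_alg \<Delta>_sub[OF x] \<Delta>_sub[OF y]])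
  also have "tensor_sum R P b \<dots> = lsum P (\<lambda>p. tensor_sum R P b (lsum CC (\<lambda>q. ptensor R C C (fst p \<otimes>\<^bsub>C\<^esub> fst q) (snd p \<otimes>\<^bsub>C\<^esub> snd q)) (\<Delta> y))) (\<Delta> x)"
    by (intro lin_map_lsum[OF module_CC P L] T.lsum_closed cl)
  also have "\<dots> = lsum P (\<lambda>p. lsum P (\<lambda>q. b (fst p \<otimes>\<^bsub>C\<^esub> fst q) (snd p \<otimes>\<^bsub>C\<^esub> snd q)) (\<Delta> y)) (\<Delta> x)"
  proof (rule lsum_cong[OF refl])
    fix p assume p: "p \<in> set (\<Delta> x)"
    have "tensor_sum R P b (lsum CC (\<lambda>q. ptensor R C C (fst p \<otimes>\<^bsub>C\<^esub> fst q) (snd p \<otimes>\<^bsub>C\<^esub> snd q)) (\<Delta> y)) =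
      lsum P (\<lambda>q. tensor_sum R P b (ptensor R C C (fst p \<otimes>\<^bsub>C\<^esub> fst q) (snd p \<otimes>\<^bsub>C\<^esub> snd q))) (\<Delta> y)"
      by (intro lin_map_lsum[OF module_CC P L] cl p)
    also have "\<dots> = lsum P (\<lambda>q. b (fst p \<otimes>\<^bsub>C\<^esub> fst q) (snd p \<otimes>\<^bsub>C\<^esub> snd q)) (\<Delta> y)"
      using \<Delta>_mem[OF p x] \<Delta>_mem[OF _ y] by (intro lsum_cong refl tensor_sum_ptensor[OF module_C module_C P b]) auto
    finally show "tensor_sum R P b (lsum CC (\<lambda>q. ptensor R C C (fst p \<otimes>\<^bsub>C\<^esub> fst q) (snd p \<otimes>\<^bsub>C\<^esub> snd q)) (\<Delta> y)) =
      lsum P (\<lambda>q. b (fst p \<otimes>\<^bsub>C\<^esub> fst q) (snd p \<otimes>\<^bsub>C\<^esub> snd q)) (\<Delta> y)" .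
  qed
  finally show ?thesis .
qed

lemma \<Delta>_one:
  assumes P: "module R P" and b: "b \<in> bilin_map R C C P"
  shows "lsum P (\<lambda>p. b (fst p) (snd p)) (\<Delta> \<one>\<^bsub>C\<^esub>) = b \<one>\<^bsub>C\<^esub> \<one>\<^bsub>C\<^esub>"
proof -
  have "lsum P (\<lambda>p. b (fst p) (snd p)) (\<Delta> \<one>\<^bsub>C\<^esub>) = tensor_sum R P b (comult C \<one>\<^bsub>C\<^esub>)"
    using tensor_sum_comult[OF P b] by simp
  then show ?thesis using tensor_sum_ptensor[OF module_C module_C P b] by (simp add: comult_one)
qed

end

section \<open>The antipode reverses products\<close>

context bialgebra_struct
begin

lemma lin_mult_const:
  assumes "f \<in> lin_map R M C" "k \<in> carrier C"
  shows "(\<lambda>x. f x \<otimes>\<^bsub>C\<^esub> k) \<in> lin_map R M C" "(\<lambda>x. k \<otimes>\<^bsub>C\<^esub> f x) \<in> lin_map R M C"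
  using lin_map_comp[OF assms(1) bilin_map_left[OF mult_bilin[OF assoc_alg] assms(2)]]
    lin_map_comp[OF assms(1) bilin_map_right[OF mult_bilin[OF assoc_alg] assms(2)]] by auto

text \<open>The convolution product of the linear maps \<open>C \<otimes> C \<rightarrow> C\<close>, given as bilinear maps.\<close>

definition conv2 :: "('a \<Rightarrow> 'a \<Rightarrow> 'a) \<Rightarrow> ('a \<Rightarrow> 'a \<Rightarrow> 'a) \<Rightarrow> 'a \<Rightarrow> 'a \<Rightarrow> 'a" where
  "conv2 P Q x y = lsum C (\<lambda>p. lsum C (\<lambda>q. P (fst p) (fst q) \<otimes>\<^bsub>C\<^esub> Q (snd p) (snd q)) (\<Delta> y)) (\<Delta> x)"

text \<open>Both sides are sums over threefold comultiplications of \<open>x\<close> and of \<open>y\<close>; coassociativity is applied to \<open>y\<close> for fixed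
factors of \<open>x\<close>, and then to \<open>x\<close>.\<close>

lemma conv2_assoc:
  assumes P: "P \<in> bilin_map R C C C" and Q: "Q \<in> bilin_map R C C C" and T: "T \<in> bilin_map R C C C"
    and x: "x \<in> carrier C" and y: "y \<in> carrier C"
  shows "conv2 (conv2 P Q) T x y = conv2 P (conv2 Q T) x y"
proof -
  define g where "g a b c a' b' c' = P a a' \<otimes>\<^bsub>C\<^esub> (Q b b' \<otimes>\<^bsub>C\<^esub> T c c')" for a b c a' b' c'
  note cl = bilin_map_closed[OF P] bilin_map_closed[OF Q] bilin_map_closed[OF T]
  have g_cl: "g a b c a' b' c' \<in> carrier C"
    if "a \<in> carrier C" "b \<in> carrier C" "c \<in> carrier C" "a' \<in> carrier C" "b' \<in> carrier C" "c' \<in> carrier C" for a b c a' b' c'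
    using that cl by (simp add: g_def)
  have g1: "(\<lambda>a. g a b c a' b' c') \<in> lin_map R C C"
    if "b \<in> carrier C" "c \<in> carrier C" "a' \<in> carrier C" "b' \<in> carrier C" "c' \<in> carrier C" for b c a' b' c'
    unfolding g_def by (intro lin_mult_const(1)[OF bilin_map_left[OF P]] CR.m_closed cl that)
  have g2: "(\<lambda>b. g a b c a' b' c') \<in> lin_map R C C"
    if "a \<in> carrier C" "c \<in> carrier C" "a' \<in> carrier C" "b' \<in> carrier C" "c' \<in> carrier C" for a c a' b' c'
    unfolding g_def by (intro lin_mult_const(2)[OF lin_mult_const(1)[OF bilin_map_left[OF Q]]] CR.m_closed cl that)
  have g3: "(\<lambda>c. g a b c a' b' c') \<in> lin_map R C C"
    if "a \<in> carrier C" "b \<in> carrier C" "a' \<in> carrier C" "b' \<in> carrier C" "c' \<in> carrier C" for a b a' b' c'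
    unfolding g_def by (intro lin_mult_const(2)[OF lin_mult_const(2)[OF bilin_map_left[OF T]]] CR.m_closed cl that)
  have g4: "(\<lambda>a'. g a b c a' b' c') \<in> lin_map R C C"
    if "a \<in> carrier C" "b \<in> carrier C" "c \<in> carrier C" "b' \<in> carrier C" "c' \<in> carrier C" for a b c b' c'
    unfolding g_def by (intro lin_mult_const(1)[OF bilin_map_right[OF P]] CR.m_closed cl that)
  have g5: "(\<lambda>b'. g a b c a' b' c') \<in> lin_map R C C"
    if "a \<in> carrier C" "b \<in> carrier C" "c \<in> carrier C" "a' \<in> carrier C" "c' \<in> carrier C" for a b c a' c'
    unfolding g_def by (intro lin_mult_const(2)[OF lin_mult_const(1)[OF bilin_map_right[OF Q]]] CR.m_closed cl that)
  have g6: "(\<lambda>c'. g a b c a' b' c') \<in> lin_map R C C"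
    if "a \<in> carrier C" "b \<in> carrier C" "c \<in> carrier C" "a' \<in> carrier C" "b' \<in> carrier C" for a b c a' b'
    unfolding g_def by (intro lin_mult_const(2)[OF lin_mult_const(2)[OF bilin_map_right[OF T]]] CR.m_closed cl that)
  note m = \<Delta>_mem
  note xm = m[OF _ x] and ym = m[OF _ y]
  define G where "G a b c = lsum C (\<lambda>q. lsum C (\<lambda>q'. g a b c (fst q') (snd q') (snd q)) (\<Delta> (fst q))) (\<Delta> y)" for a b c
  have G: "G \<in> trilin_map R C C"
    unfolding G_def
    by (intro trilin_mapI lin_map_lsum_fun[OF module_C])
       (assumption | rule g1 g2 g3 | erule ym m[OF _ ym(1)])+
  have G': "G a b c = lsum C (\<lambda>q. lsum C (\<lambda>q'. g a b c (fst q) (fst q') (snd q')) (\<Delta> (snd q))) (\<Delta> y)"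
    if "a \<in> carrier C" "b \<in> carrier C" "c \<in> carrier C" for a b c
    unfolding G_def using that
    by (intro coassoc[OF module_C _ y, of "\<lambda>a' b' c'. g a b c a' b' c'"] trilin_mapI)
       (assumption | rule g4 g5 g6)+
  have "conv2 (conv2 P Q) T x y = lsum C (\<lambda>p. lsum C (\<lambda>q. lsum C (\<lambda>p'. lsum C (\<lambda>q'.
      g (fst p') (snd p') (snd p) (fst q') (snd q') (snd q)) (\<Delta> (fst q))) (\<Delta> (fst p))) (\<Delta> y)) (\<Delta> x)"
    unfolding conv2_def
  proof (intro lsum_cong refl)
    fix p q assume p: "p \<in> set (\<Delta> x)" and q: "q \<in> set (\<Delta> y)"
    show "lsum C (\<lambda>p. lsum C (\<lambda>q. P (fst p) (fst q) \<otimes>\<^bsub>C\<^esub> Q (snd p) (snd q)) (\<Delta> (fst q))) (\<Delta> (fst p)) \<otimes>\<^bsub>C\<^esub> T (snd p) (snd q) =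
      lsum C (\<lambda>p'. lsum C (\<lambda>q'. g (fst p') (snd p') (snd p) (fst q') (snd q') (snd q)) (\<Delta> (fst q))) (\<Delta> (fst p))"
      using xm[OF p] ym[OF q] m[OF _ xm(1)[OF p]] m[OF _ ym(1)[OF q]] cl
      by (subst CR.lsum_ldistr; (intro lsum_cong refl)?) (auto simp: CR.lsum_ldistr g_def CR.m_assoc intro!: lsum_cong)
  qed
  also have "\<dots> = lsum C (\<lambda>p. lsum C (\<lambda>p'. G (fst p') (snd p') (snd p)) (\<Delta> (fst p))) (\<Delta> x)"
    unfolding G_def
    by (intro lsum_cong refl CM.lsum_swap CM.lsum_closed g_cl) (use xm ym m[OF _ xm(1)] m[OF _ ym(1)] in auto)
  also have "\<dots> = lsum C (\<lambda>p. lsum C (\<lambda>p'. G (fst p) (fst p') (snd p')) (\<Delta> (snd p))) (\<Delta> x)"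
    by (rule coassoc[OF module_C G x])
  also have "\<dots> = lsum C (\<lambda>p. lsum C (\<lambda>p'. lsum C (\<lambda>q. lsum C (\<lambda>q'.
      g (fst p) (fst p') (snd p') (fst q) (fst q') (snd q')) (\<Delta> (snd q))) (\<Delta> y)) (\<Delta> (snd p))) (\<Delta> x)"
    by (intro lsum_cong refl G') (use xm m[OF _ xm(2)] in auto)
  also have "\<dots> = lsum C (\<lambda>p. lsum C (\<lambda>q. lsum C (\<lambda>p'. lsum C (\<lambda>q'.
      g (fst p) (fst p') (snd p') (fst q) (fst q') (snd q')) (\<Delta> (snd q))) (\<Delta> (snd p))) (\<Delta> y)) (\<Delta> x)"
    by (intro lsum_cong refl CM.lsum_swap CM.lsum_closed g_cl) (use xm ym m[OF _ xm(2)] m[OF _ ym(2)] in auto)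
  also have "\<dots> = conv2 P (conv2 Q T) x y"
    unfolding conv2_def
  proof (intro lsum_cong refl)
    fix p q assume p: "p \<in> set (\<Delta> x)" and q: "q \<in> set (\<Delta> y)"
    show "lsum C (\<lambda>p'. lsum C (\<lambda>q'. g (fst p) (fst p') (snd p') (fst q) (fst q') (snd q')) (\<Delta> (snd q))) (\<Delta> (snd p)) =
      P (fst p) (fst q) \<otimes>\<^bsub>C\<^esub> lsum C (\<lambda>p. lsum C (\<lambda>q. Q (fst p) (fst q) \<otimes>\<^bsub>C\<^esub> T (snd p) (snd q)) (\<Delta> (snd q))) (\<Delta> (snd p))"
      using xm[OF p] ym[OF q] m[OF _ xm(2)[OF p]] m[OF _ ym(2)[OF q]] cl
      by (subst CR.lsum_rdistr; (intro lsum_cong refl)?) (auto simp: CR.lsum_rdistr g_def intro!: lsum_cong)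
  qed
  finally show ?thesis .
qed

definition unit2 :: "'a \<Rightarrow> 'a \<Rightarrow> 'a" where
  "unit2 x y = (counit C x \<otimes>\<^bsub>R\<^esub> counit C y) \<odot>\<^bsub>C\<^esub> \<one>\<^bsub>C\<^esub>"

lemma conv2_unit2_right:
  assumes P: "P \<in> bilin_map R C C C" and x: "x \<in> carrier C" and y: "y \<in> carrier C"
  shows "conv2 P unit2 x y = P x y"
proof -
  note xm = \<Delta>_mem[OF _ x] and ym = \<Delta>_mem[OF _ y] and cl = bilin_map_closed[OF P]
  have "conv2 P unit2 x y = lsum C (\<lambda>p. counit C (snd p) \<odot>\<^bsub>C\<^esub> lsum C (\<lambda>q. counit C (snd q) \<odot>\<^bsub>C\<^esub> P (fst p) (fst q)) (\<Delta> y)) (\<Delta> x)"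
    unfolding conv2_def unit2_def
  proof (intro lsum_cong refl)
    fix p assume p: "p \<in> set (\<Delta> x)"
    show "lsum C (\<lambda>q. P (fst p) (fst q) \<otimes>\<^bsub>C\<^esub> ((counit C (snd p) \<otimes>\<^bsub>R\<^esub> counit C (snd q)) \<odot>\<^bsub>C\<^esub> \<one>\<^bsub>C\<^esub>)) (\<Delta> y) =
      counit C (snd p) \<odot>\<^bsub>C\<^esub> lsum C (\<lambda>q. counit C (snd q) \<odot>\<^bsub>C\<^esub> P (fst p) (fst q)) (\<Delta> y)"
      using xm[OF p] ym cl
      by (subst CM.smult_lsum) (auto intro!: lsum_cong simp: smult_mult CM.smult_assoc1)
  qed
  also have "\<dots> = lsum C (\<lambda>p. counit C (snd p) \<odot>\<^bsub>C\<^esub> P (fst p) y) (\<Delta> x)"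
    by (intro lsum_cong refl) (use xm in \<open>simp add: counit_right_lin[OF bilin_map_right[OF P] module_C y]\<close>)
  also have "\<dots> = P x y" by (rule counit_right_lin[OF bilin_map_left[OF P y] module_C x])
  finally show ?thesis .
qed

lemma conv2_unit2_left:
  assumes P: "P \<in> bilin_map R C C C" and x: "x \<in> carrier C" and y: "y \<in> carrier C"
  shows "conv2 unit2 P x y = P x y"
proof -
  note xm = \<Delta>_mem[OF _ x] and ym = \<Delta>_mem[OF _ y] and cl = bilin_map_closed[OF P]
  have "conv2 unit2 P x y = lsum C (\<lambda>p. counit C (fst p) \<odot>\<^bsub>C\<^esub> lsum C (\<lambda>q. counit C (fst q) \<odot>\<^bsub>C\<^esub> P (snd p) (snd q)) (\<Delta> y)) (\<Delta> x)"
    unfolding conv2_def unit2_def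
  proof (intro lsum_cong refl)
    fix p assume p: "p \<in> set (\<Delta> x)"
    show "lsum C (\<lambda>q. ((counit C (fst p) \<otimes>\<^bsub>R\<^esub> counit C (fst q)) \<odot>\<^bsub>C\<^esub> \<one>\<^bsub>C\<^esub>) \<otimes>\<^bsub>C\<^esub> P (snd p) (snd q)) (\<Delta> y) =
      counit C (fst p) \<odot>\<^bsub>C\<^esub> lsum C (\<lambda>q. counit C (fst q) \<odot>\<^bsub>C\<^esub> P (snd p) (snd q)) (\<Delta> y)"
      using xm[OF p] ym cl
      by (subst CM.smult_lsum) (auto intro!: lsum_cong simp: smult_mult CM.smult_assoc1)
  qed
  also have "\<dots> = lsum C (\<lambda>p. counit C (fst p) \<odot>\<^bsub>C\<^esub> P (snd p) y) (\<Delta> x)"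
    by (intro lsum_cong refl) (use xm in \<open>simp add: counit_left_lin[OF bilin_map_right[OF P] module_C y]\<close>)
  also have "\<dots> = P x y" by (rule counit_left_lin[OF bilin_map_left[OF P y] module_C x])
  finally show ?thesis .
qed

lemma conv2_cong:
  assumes "\<And>x y. x \<in> carrier C \<Longrightarrow> y \<in> carrier C \<Longrightarrow> P x y = P' x y"
    "\<And>x y. x \<in> carrier C \<Longrightarrow> y \<in> carrier C \<Longrightarrow> Q x y = Q' x y" and x: "x \<in> carrier C" and y: "y \<in> carrier C"
  shows "conv2 P Q x y = conv2 P' Q' x y"
  unfolding conv2_def using \<Delta>_mem[OF _ x] \<Delta>_mem[OF _ y] assms(1,2) by (intro lsum_cong refl) auto

end

locale hopf_struct = bialgebra_struct R C for R :: "('r, 'z) ring_scheme" and C :: "('r, 'a, 'u) hopf_scheme" +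
  assumes hopf: "hopf_algebra R C"
begin

abbreviation (input) S where "S \<equiv> antipode C"

lemma S_lin: "S \<in> lin_map R C C" using hopf by (simp add: hopf_algebra_def)
lemma S_closed [simp]: "x \<in> carrier C \<Longrightarrow> S x \<in> carrier C" by (rule lin_map_closed[OF S_lin])

lemma S_left_bilin: "(\<lambda>x y. S x \<otimes>\<^bsub>C\<^esub> y) \<in> bilin_map R C C C"
  using bilin_map_comp[OF mult_bilin[OF assoc_alg] S_lin lin_map_id(2)] .

lemma S_right_bilin: "(\<lambda>x y. x \<otimes>\<^bsub>C\<^esub> S y) \<in> bilin_map R C C C"
  using bilin_map_comp[OF mult_bilin[OF assoc_alg] lin_map_id(2) S_lin] .

lemma antipode_left:
  assumes "x \<in> carrier C"
  shows "lsum C (\<lambda>p. S (fst p) \<otimes>\<^bsub>C\<^esub> snd p) (\<Delta> x) = counit C x \<odot>\<^bsub>C\<^esub> \<one>\<^bsub>C\<^esub>"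
  using hopf assms tensor_sum_comult[OF module_C S_left_bilin assms] by (simp add: hopf_algebra_def)

lemma antipode_right:
  assumes "x \<in> carrier C"
  shows "lsum C (\<lambda>p. fst p \<otimes>\<^bsub>C\<^esub> S (snd p)) (\<Delta> x) = counit C x \<odot>\<^bsub>C\<^esub> \<one>\<^bsub>C\<^esub>"
  using hopf assms tensor_sum_comult[OF module_C S_right_bilin assms] by (simp add: hopf_algebra_def)

text \<open>\<open>S (x y)\<close> is a left and \<open>S y S x\<close> a right convolution inverse of the multiplication of \<open>C\<close>.\<close>

lemma antipode_mult:
  assumes x: "x \<in> carrier C" and y: "y \<in> carrier C"
  shows "S (x \<otimes>\<^bsub>C\<^esub> y) = S y \<otimes>\<^bsub>C\<^esub> S x"
proof -
  let ?L = "\<lambda>x y. S (x \<otimes>\<^bsub>C\<^esub> y)" and ?M = "(\<otimes>\<^bsub>C\<^esub>)" and ?Q = "\<lambda>x y. S y \<otimes>\<^bsub>C\<^esub> S x"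
  have M: "?M \<in> bilin_map R C C C" by (rule mult_bilin[OF assoc_alg])
  have L: "?L \<in> bilin_map R C C C"
    by (intro bilin_mapI lin_map_comp[OF bilin_map_right[OF M] S_lin] lin_map_comp[OF bilin_map_left[OF M] S_lin])
  have Q: "?Q \<in> bilin_map R C C C"
    by (rule bilin_map_flip) (rule bilin_map_comp[OF M S_lin S_lin])
  have LM: "conv2 ?L ?M a b = unit2 a b" if a: "a \<in> carrier C" and b: "b \<in> carrier C" for a b
    using \<Delta>_mult[OF module_C S_left_bilin a b] antipode_left[of "a \<otimes>\<^bsub>C\<^esub> b"] a b
    by (simp add: conv2_def unit2_def counit_mult)
  have MQ: "conv2 ?M ?Q a b = unit2 a b" if a: "a \<in> carrier C" and b: "b \<in> carrier C" for a b
  proof -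
    note am = \<Delta>_mem[OF _ a] and bm = \<Delta>_mem[OF _ b]
    have "conv2 ?M ?Q a b = lsum C (\<lambda>p. counit C b \<odot>\<^bsub>C\<^esub> (fst p \<otimes>\<^bsub>C\<^esub> S (snd p))) (\<Delta> a)"
      unfolding conv2_def
    proof (intro lsum_cong refl)
      fix p assume p: "p \<in> set (\<Delta> a)"
      note pm = am[OF p]
      have "lsum C (\<lambda>q. fst p \<otimes>\<^bsub>C\<^esub> fst q \<otimes>\<^bsub>C\<^esub> (S (snd q) \<otimes>\<^bsub>C\<^esub> S (snd p))) (\<Delta> b) =
        lsum C (\<lambda>q. fst p \<otimes>\<^bsub>C\<^esub> (fst q \<otimes>\<^bsub>C\<^esub> S (snd q)) \<otimes>\<^bsub>C\<^esub> S (snd p)) (\<Delta> b)"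
        using pm bm by (intro lsum_cong refl) (simp add: CR.m_assoc)
      also have "\<dots> = fst p \<otimes>\<^bsub>C\<^esub> lsum C (\<lambda>q. fst q \<otimes>\<^bsub>C\<^esub> S (snd q)) (\<Delta> b) \<otimes>\<^bsub>C\<^esub> S (snd p)"
        using pm bm by (simp add: CR.lsum_ldistr CR.lsum_rdistr)
      also have "\<dots> = counit C b \<odot>\<^bsub>C\<^esub> (fst p \<otimes>\<^bsub>C\<^esub> S (snd p))"
        using pm b by (simp add: antipode_right smult_mult)
      finally show "lsum C (\<lambda>q. fst p \<otimes>\<^bsub>C\<^esub> fst q \<otimes>\<^bsub>C\<^esub> (S (snd q) \<otimes>\<^bsub>C\<^esub> S (snd p))) (\<Delta> b) =
        counit C b \<odot>\<^bsub>C\<^esub> (fst p \<otimes>\<^bsub>C\<^esub> S (snd p))" .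
    qed
    also have "\<dots> = counit C b \<odot>\<^bsub>C\<^esub> lsum C (\<lambda>p. fst p \<otimes>\<^bsub>C\<^esub> S (snd p)) (\<Delta> a)"
      using am b by (intro CM.smult_lsum[symmetric]) auto
    also have "\<dots> = unit2 a b"
      using a b by (simp add: antipode_right unit2_def CM.smult_assoc1[symmetric] CM.m_comm)
    finally show ?thesis .
  qed
  have "?L x y = conv2 ?L unit2 x y" using conv2_unit2_right[OF L x y] by simp
  also have "\<dots> = conv2 ?L (conv2 ?M ?Q) x y" by (rule conv2_cong[OF _ _ x y]) (simp_all add: MQ)
  also have "\<dots> = conv2 (conv2 ?L ?M) ?Q x y" by (rule conv2_assoc[OF L M Q x y, symmetric])
  also have "\<dots> = conv2 unit2 ?Q x y" by (rule conv2_cong[OF _ _ x y]) (simp_all add: LM)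
  also have "\<dots> = ?Q x y" by (rule conv2_unit2_left[OF Q x y])
  finally show ?thesis .
qed

end

section \<open>The convolution product\<close>

context bialgebra_struct
begin

definition conv :: "('a \<Rightarrow> 'r) \<Rightarrow> ('a \<Rightarrow> 'r) \<Rightarrow> 'a \<Rightarrow> 'r" where
  "conv f g x = lsum R (\<lambda>p. f (fst p) \<otimes>\<^bsub>R\<^esub> g (snd p)) (\<Delta> x)"

lemma form_mult_bilin:
  assumes f: "f \<in> lin_map R M (reg_mod R)" and g: "g \<in> lin_map R N (reg_mod R)"
  shows "(\<lambda>x y. f x \<otimes>\<^bsub>R\<^esub> g y) \<in> bilin_map R M N (reg_mod R)"
  using lin_mapD[OF f] lin_mapD[OF g]
  by (intro bilin_mapI lin_mapI) (auto simp: CM.R.l_distr CM.R.r_distr CM.R.m_assoc CM.R.m_lcomm)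

lemma conv_tensor_sum:
  assumes f: "f \<in> lin_map R C (reg_mod R)" and g: "g \<in> lin_map R C (reg_mod R)" and x: "x \<in> carrier C"
  shows "tensor_sum R (reg_mod R) (\<lambda>a b. f a \<otimes>\<^bsub>R\<^esub> g b) (comult C x) = conv f g x"
  unfolding conv_def using tensor_sum_comult[OF CM.module_reg_mod form_mult_bilin[OF f g] x] by simp

lemma conv_dual_mult:
  assumes f: "f \<in> lin_map R C (reg_mod R)" and g: "g \<in> lin_map R C (reg_mod R)"
  shows "f \<otimes>\<^bsub>conv_dual R C\<^esub> g = (\<lambda>x\<in>carrier C. conv f g x)"
  by (simp add: conv_dual_def conv_tensor_sum[OF f g] cong: restrict_cong)

lemma conv_lin:
  assumes f: "f \<in> lin_map R C (reg_mod R)" and g: "g \<in> lin_map R C (reg_mod R)"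
  shows "conv f g \<in> lin_map R C (reg_mod R)"
  using lin_map_\<Delta>[OF CM.module_reg_mod form_mult_bilin[OF f g]] by (simp add: conv_def[abs_def])

lemma conv_mult:
  assumes f: "f \<in> lin_map R C (reg_mod R)" and g: "g \<in> lin_map R C (reg_mod R)"
    and x: "x \<in> carrier C" and y: "y \<in> carrier C"
  shows "conv f g (x \<otimes>\<^bsub>C\<^esub> y) = lsum R (\<lambda>p. lsum R (\<lambda>q. f (fst p \<otimes>\<^bsub>C\<^esub> fst q) \<otimes>\<^bsub>R\<^esub> g (snd p \<otimes>\<^bsub>C\<^esub> snd q)) (\<Delta> y)) (\<Delta> x)"
  unfolding conv_def using \<Delta>_mult[OF CM.module_reg_mod form_mult_bilin[OF f g] x y] by simp

lemma conv_one:
  assumes f: "f \<in> lin_map R C (reg_mod R)" and g: "g \<in> lin_map R C (reg_mod R)"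
  shows "conv f g \<one>\<^bsub>C\<^esub> = f \<one>\<^bsub>C\<^esub> \<otimes>\<^bsub>R\<^esub> g \<one>\<^bsub>C\<^esub>"
  unfolding conv_def using \<Delta>_one[OF CM.module_reg_mod form_mult_bilin[OF f g]] by simp

lemma conv_cong:
  assumes "\<And>x. x \<in> carrier C \<Longrightarrow> f x = f' x" "\<And>x. x \<in> carrier C \<Longrightarrow> g x = g' x" "x \<in> carrier C"
  shows "conv f g x = conv f' g' x"
  unfolding conv_def using \<Delta>_mem[OF _ assms(3)] assms(1,2) by (intro lsum_cong refl) auto

lemma conv_assoc:
  assumes f: "f \<in> lin_map R C (reg_mod R)" and g: "g \<in> lin_map R C (reg_mod R)"
    and h: "h \<in> lin_map R C (reg_mod R)" and x: "x \<in> carrier C"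
  shows "conv (conv f g) h x = conv f (conv g h) x"
proof -
  note cl = lin_map_closed[OF f, simplified] lin_map_closed[OF g, simplified] lin_map_closed[OF h, simplified]
  note xm = \<Delta>_mem[OF _ x]
  have tri: "(\<lambda>a b c. f a \<otimes>\<^bsub>R\<^esub> (g b \<otimes>\<^bsub>R\<^esub> h c)) \<in> trilin_map R C (reg_mod R)"
    using lin_mapD[OF f] lin_mapD[OF g] lin_mapD[OF h]
    by (intro trilin_mapI lin_mapI) (auto simp: CM.R.l_distr CM.R.r_distr CM.R.m_assoc CM.R.m_lcomm)
  have "conv (conv f g) h x = lsum R (\<lambda>p. lsum R (\<lambda>q. f (fst q) \<otimes>\<^bsub>R\<^esub> (g (snd q) \<otimes>\<^bsub>R\<^esub> h (snd p))) (\<Delta> (fst p))) (\<Delta> x)"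
    unfolding conv_def
  proof (intro lsum_cong refl)
    fix p assume p: "p \<in> set (\<Delta> x)"
    show "lsum R (\<lambda>p. f (fst p) \<otimes>\<^bsub>R\<^esub> g (snd p)) (\<Delta> (fst p)) \<otimes>\<^bsub>R\<^esub> h (snd p) =
      lsum R (\<lambda>q. f (fst q) \<otimes>\<^bsub>R\<^esub> (g (snd q) \<otimes>\<^bsub>R\<^esub> h (snd p))) (\<Delta> (fst p))"
      using xm[OF p] \<Delta>_mem[OF _ xm(1)[OF p]] cl
      by (subst CM.R.lsum_ldistr) (auto intro!: lsum_cong simp: CM.R.m_assoc)
  qed
  also have "\<dots> = lsum R (\<lambda>p. lsum R (\<lambda>q. f (fst p) \<otimes>\<^bsub>R\<^esub> (g (fst q) \<otimes>\<^bsub>R\<^esub> h (snd q))) (\<Delta> (snd p))) (\<Delta> x)"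
    using coassoc[OF CM.module_reg_mod tri x] by simp
  also have "\<dots> = conv f (conv g h) x"
    unfolding conv_def using xm \<Delta>_mem[OF _ xm(2)] cl
    by (intro lsum_cong refl) (auto simp: CM.R.lsum_rdistr)
  finally show ?thesis .
qed

lemma conv_counit:
  assumes f: "f \<in> lin_map R C (reg_mod R)" and x: "x \<in> carrier C"
  shows "conv (counit C) f x = f x" "conv f (counit C) x = f x"
proof -
  show "conv (counit C) f x = f x"
    unfolding conv_def using counit_left_lin[OF f CM.module_reg_mod x] by simp
  have "conv f (counit C) x = lsum R (\<lambda>p. counit C (snd p) \<otimes>\<^bsub>R\<^esub> f (fst p)) (\<Delta> x)"
    unfolding conv_def using \<Delta>_mem[OF _ x] lin_map_closed[OF f]
    by (intro lsum_cong refl CM.R.m_comm) auto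
  then show "conv f (counit C) x = f x" using counit_right_lin[OF f CM.module_reg_mod x] by simp
qed

lemma conv_add:
  assumes f: "f \<in> lin_map R C (reg_mod R)" and g: "g \<in> lin_map R C (reg_mod R)"
    and h: "h \<in> lin_map R C (reg_mod R)" and x: "x \<in> carrier C"
  shows "conv (\<lambda>x. f x \<oplus>\<^bsub>R\<^esub> g x) h x = conv f h x \<oplus>\<^bsub>R\<^esub> conv g h x"
    "conv h (\<lambda>x. f x \<oplus>\<^bsub>R\<^esub> g x) x = conv h f x \<oplus>\<^bsub>R\<^esub> conv h g x"
  unfolding conv_def
  using \<Delta>_mem[OF _ x] lin_map_closed[OF f] lin_map_closed[OF g] lin_map_closed[OF h]
  by (subst CM.R.lsum_add[symmetric]; auto intro!: lsum_cong simp: CM.R.l_distr CM.R.r_distr)+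

lemma conv_smult:
  assumes r: "r \<in> carrier R" and g: "g \<in> lin_map R C (reg_mod R)"
    and h: "h \<in> lin_map R C (reg_mod R)" and x: "x \<in> carrier C"
  shows "conv (\<lambda>x. r \<otimes>\<^bsub>R\<^esub> g x) h x = r \<otimes>\<^bsub>R\<^esub> conv g h x"
    "conv h (\<lambda>x. r \<otimes>\<^bsub>R\<^esub> g x) x = r \<otimes>\<^bsub>R\<^esub> conv h g x"
  unfolding conv_def
  using \<Delta>_mem[OF _ x] lin_map_closed[OF g] lin_map_closed[OF h] r
  by (subst CM.R.lsum_rdistr; auto intro!: lsum_cong simp: CM.R.m_assoc CM.R.m_lcomm)+

end

section \<open>The finite dual of a bialgebra\<close>

text \<open>As before, \<open>K\<close> is determined through its operations, to cover both \<^const>\<open>fin_dual\<close> and the underlying bialgebra of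
\<^const>\<open>hopf_dual\<close>.\<close>

locale fin_dual_bialg = finite_dual_alpha R H K + H: bialgebra_struct R H
  for R :: "('r, 'z) ring_scheme" and H :: "('r, 'a, 'u) bialg_scheme"
    and K :: "('r, 'a \<Rightarrow> 'r, 'k) bialg_scheme" +
  assumes K_mult: "monoid.mult K = monoid.mult (conv_dual R H)"
    and K_one: "monoid.one K = monoid.one (conv_dual R H)"
    and K_comult: "comult K = (\<lambda>f. THE t. is_dual_comult R H f t)"
    and K_counit: "counit K = (\<lambda>f. f \<one>\<^bsub>H\<^esub>)"
begin

lemma K_one_eq: "\<one>\<^bsub>K\<^esub> = (\<lambda>x\<in>carrier H. counit H x)"
  by (simp add: K_one conv_dual_def)

lemma K_mult_eq:
  assumes f: "f \<in> lin_map R H (reg_mod R)" and g: "g \<in> lin_map R H (reg_mod R)"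
  shows "f \<otimes>\<^bsub>K\<^esub> g = (\<lambda>x\<in>carrier H. H.conv f g x)"
  using H.conv_dual_mult[OF f g] by (simp add: K_mult)

lemma K_mult_apply [simp]:
  assumes "f \<in> carrier K" "g \<in> carrier K" "x \<in> carrier H"
  shows "(f \<otimes>\<^bsub>K\<^esub> g) x = H.conv f g x"
  using K_mult_eq[OF K_lin[OF assms(1)] K_lin[OF assms(2)]] assms(3) by simp

lemma K_one_apply [simp]: "x \<in> carrier H \<Longrightarrow> \<one>\<^bsub>K\<^esub> x = counit H x"
  by (simp add: K_one_eq)

text \<open>If \<open>f (x y z) = \<Sum> f\<^sub>1 x f\<^sub>2 y f\<^sub>3 z\<close> and similarly for \<open>g\<close>, then the functionals
  \<open>f\<^sub>2 * g\<^sub>2\<close> detect whether \<open>f * g\<close> vanishes on \<open>H y H\<close>.\<close>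

lemma K_mult_closed:
  assumes f: "f \<in> carrier K" and g: "g \<in> carrier K"
  shows "f \<otimes>\<^bsub>K\<^esub> g \<in> carrier K"
proof -
  obtain ts where ts: "set ts \<subseteq> carrier K \<times> carrier K \<times> carrier K"
    "\<And>x y z. x \<in> carrier H \<Longrightarrow> y \<in> carrier H \<Longrightarrow> z \<in> carrier H \<Longrightarrow>
      f (x \<otimes>\<^bsub>H\<^esub> y \<otimes>\<^bsub>H\<^esub> z) = lsum R (\<lambda>t. fst t x \<otimes>\<^bsub>R\<^esub> fst (snd t) y \<otimes>\<^bsub>R\<^esub> snd (snd t) z) ts"
    using K_decomp3[OF f] by blast
  obtain ss where ss: "set ss \<subseteq> carrier K \<times> carrier K \<times> carrier K"
    "\<And>x y z. x \<in> carrier H \<Longrightarrow> y \<in> carrier H \<Longrightarrow> z \<in> carrier H \<Longrightarrow>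
      g (x \<otimes>\<^bsub>H\<^esub> y \<otimes>\<^bsub>H\<^esub> z) = lsum R (\<lambda>t. fst t x \<otimes>\<^bsub>R\<^esub> fst (snd t) y \<otimes>\<^bsub>R\<^esub> snd (snd t) z) ss"
    using K_decomp3[OF g] by blast
  have tm: "fst t \<in> carrier K" "fst (snd t) \<in> carrier K" "snd (snd t) \<in> carrier K" if "t \<in> set ts" for t using ts(1) that by auto
  have sm: "fst t \<in> carrier K" "fst (snd t) \<in> carrier K" "snd (snd t) \<in> carrier K" if "t \<in> set ss" for t using ss(1) that by auto
  let ?ks = "concat (map (\<lambda>t. map (\<lambda>s. H.conv (fst (snd t)) (fst (snd s))) ss) ts)"
  have ks: "k \<in> lin_map R H (reg_mod R)" if k: "k \<in> set ?ks" for k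
  proof -
    obtain t s where "t \<in> set ts" "s \<in> set ss" "k = H.conv (fst (snd t)) (fst (snd s))"
      using k unfolding set_concat set_map image_image by blast
    then show ?thesis using H.conv_lin[OF K_lin[OF tm(2)] K_lin[OF sm(2)]] by simp
  qed
  note fg = H.conv_lin[OF K_lin[OF f] K_lin[OF g]]
  show ?thesis
    unfolding K_mult_eq[OF K_lin[OF f] K_lin[OF g]]
  proof (rule K_memI_detect[OF K_restrict_lin[OF fg] restrict_extensional ks])
    fix x y z assume x: "x \<in> carrier H" and y: "y \<in> carrier H" and z: "z \<in> carrier H"
      and van: "\<And>k. k \<in> set ?ks \<Longrightarrow> k y = \<zero>\<^bsub>R\<^esub>"
    note xm = H.\<Delta>_mem[OF _ x] and ym = H.\<Delta>_mem[OF _ y] and zm = H.\<Delta>_mem[OF _ z]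
    have key: "lsum R (\<lambda>q. f (fst p \<otimes>\<^bsub>H\<^esub> fst q \<otimes>\<^bsub>H\<^esub> fst r) \<otimes>\<^bsub>R\<^esub> g (snd p \<otimes>\<^bsub>H\<^esub> snd q \<otimes>\<^bsub>H\<^esub> snd r)) (H.\<Delta> y) = \<zero>\<^bsub>R\<^esub>"
      if p: "p \<in> set (H.\<Delta> x)" and r: "r \<in> set (H.\<Delta> z)" for p r
    proof -
      let ?c = "\<lambda>t s. (fst t (fst p) \<otimes>\<^bsub>R\<^esub> snd (snd t) (fst r)) \<otimes>\<^bsub>R\<^esub> (fst s (snd p) \<otimes>\<^bsub>R\<^esub> snd (snd s) (snd r))"
      let ?d = "\<lambda>t s q. fst (snd t) (fst q) \<otimes>\<^bsub>R\<^esub> fst (snd s) (snd q)"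
      note pm = xm[OF p] and rm = zm[OF r]
      have c: "?c t s \<in> carrier R" if "t \<in> set ts" "s \<in> set ss" for t s
        using tm[OF that(1)] sm[OF that(2)] pm rm by simp
      have d: "?d t s q \<in> carrier R" if "t \<in> set ts" "s \<in> set ss" "q \<in> set (H.\<Delta> y)" for t s q
        using tm[OF that(1)] sm[OF that(2)] ym[OF that(3)] by simp
      have "lsum R (\<lambda>q. f (fst p \<otimes>\<^bsub>H\<^esub> fst q \<otimes>\<^bsub>H\<^esub> fst r) \<otimes>\<^bsub>R\<^esub> g (snd p \<otimes>\<^bsub>H\<^esub> snd q \<otimes>\<^bsub>H\<^esub> snd r)) (H.\<Delta> y) =
        lsum R (\<lambda>q. lsum R (\<lambda>t. lsum R (\<lambda>s. ?c t s \<otimes>\<^bsub>R\<^esub> ?d t s q) ss) ts) (H.\<Delta> y)"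
      proof (rule lsum_cong[OF refl])
        fix q assume q: "q \<in> set (H.\<Delta> y)"
        note qm = ym[OF q]
        show "f (fst p \<otimes>\<^bsub>H\<^esub> fst q \<otimes>\<^bsub>H\<^esub> fst r) \<otimes>\<^bsub>R\<^esub> g (snd p \<otimes>\<^bsub>H\<^esub> snd q \<otimes>\<^bsub>H\<^esub> snd r) =
          lsum R (\<lambda>t. lsum R (\<lambda>s. ?c t s \<otimes>\<^bsub>R\<^esub> ?d t s q) ss) ts"
          unfolding ts(2)[OF pm(1) qm(1) rm(1)] ss(2)[OF pm(2) qm(2) rm(2)]
          using tm sm pm qm rm
          by (subst AM.lsum_mult_lsum) (auto intro!: lsum_cong simp: AM.m_ac)
      qed
      also have "\<dots> = lsum R (\<lambda>t. lsum R (\<lambda>s. lsum R (\<lambda>q. ?c t s \<otimes>\<^bsub>R\<^esub> ?d t s q) (H.\<Delta> y)) ss) ts"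
        using c d by (intro AM.R.lsum_rotate) auto
      also have "\<dots> = lsum R (\<lambda>t. lsum R (\<lambda>s. ?c t s \<otimes>\<^bsub>R\<^esub> H.conv (fst (snd t)) (fst (snd s)) y) ss) ts"
        unfolding H.conv_def using c d by (intro lsum_cong refl AM.lsum_rdistr[symmetric]) auto
      also have "\<dots> = \<zero>\<^bsub>R\<^esub>"
      proof (intro AM.R.lsum_zero)
        fix t s assume ts: "t \<in> set ts" "s \<in> set ss"
        then have "H.conv (fst (snd t)) (fst (snd s)) \<in> set ?ks" by auto
        from van[OF this] show "?c t s \<otimes>\<^bsub>R\<^esub> H.conv (fst (snd t)) (fst (snd s)) y = \<zero>\<^bsub>R\<^esub>"
          using c[OF ts] by simp
      qed
      finally show ?thesis .
    qed
    have fgcl: "f (fst p \<otimes>\<^bsub>H\<^esub> fst q \<otimes>\<^bsub>H\<^esub> fst r) \<otimes>\<^bsub>R\<^esub> g (snd p \<otimes>\<^bsub>H\<^esub> snd q \<otimes>\<^bsub>H\<^esub> snd r) \<in> carrier R"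
      if "p \<in> set (H.\<Delta> x)" "q \<in> set (H.\<Delta> y)" "r \<in> set (H.\<Delta> z)" for p q r
      using f g xm[OF that(1)] ym[OF that(2)] zm[OF that(3)] by simp
    \<comment> \<open>Summing over the comultiplication of \<open>z\<close> first leaves a bilinear form, evaluated at the comultiplication of \<open>x y\<close>.\<close>
    define b where "b u v = lsum R (\<lambda>r. f (u \<otimes>\<^bsub>H\<^esub> fst r) \<otimes>\<^bsub>R\<^esub> g (v \<otimes>\<^bsub>H\<^esub> snd r)) (H.\<Delta> z)" for u v
    have b: "b \<in> bilin_map R H H (reg_mod R)"
      unfolding b_def using f g zm
      by (intro bilin_mapI lin_map_lsum_fun[OF module_R, simplified] lin_mapI)
         (auto simp: AR.l_distr alg_smult AM.l_distr AM.r_distr AM.m_assoc AM.m_lcomm)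
    have "H.conv f g (x \<otimes>\<^bsub>H\<^esub> y \<otimes>\<^bsub>H\<^esub> z) = lsum R (\<lambda>u. b (fst u) (snd u)) (H.\<Delta> (x \<otimes>\<^bsub>H\<^esub> y))"
      unfolding b_def using x y z by (intro H.conv_mult[OF K_lin[OF f] K_lin[OF g]]) auto
    also have "\<dots> = lsum R (\<lambda>p. lsum R (\<lambda>q. b (fst p \<otimes>\<^bsub>H\<^esub> fst q) (snd p \<otimes>\<^bsub>H\<^esub> snd q)) (H.\<Delta> y)) (H.\<Delta> x)"
      using H.\<Delta>_mult[OF module_R b x y] by simp
    also have "\<dots> = \<zero>\<^bsub>R\<^esub>"
    proof (rule AM.R.lsum_zero)
      fix p assume p: "p \<in> set (H.\<Delta> x)"
      have "lsum R (\<lambda>q. b (fst p \<otimes>\<^bsub>H\<^esub> fst q) (snd p \<otimes>\<^bsub>H\<^esub> snd q)) (H.\<Delta> y) =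
        lsum R (\<lambda>r. lsum R (\<lambda>q. f (fst p \<otimes>\<^bsub>H\<^esub> fst q \<otimes>\<^bsub>H\<^esub> fst r) \<otimes>\<^bsub>R\<^esub> g (snd p \<otimes>\<^bsub>H\<^esub> snd q \<otimes>\<^bsub>H\<^esub> snd r)) (H.\<Delta> y)) (H.\<Delta> z)"
        unfolding b_def by (intro AM.R.lsum_swap fgcl p)
      also have "\<dots> = \<zero>\<^bsub>R\<^esub>" by (rule AM.R.lsum_zero) (rule key[OF p])
      finally show "lsum R (\<lambda>q. b (fst p \<otimes>\<^bsub>H\<^esub> fst q) (snd p \<otimes>\<^bsub>H\<^esub> snd q)) (H.\<Delta> y) = \<zero>\<^bsub>R\<^esub>" .
    qed
    finally show "(\<lambda>x\<in>carrier H. H.conv f g x) (x \<otimes>\<^bsub>H\<^esub> y \<otimes>\<^bsub>H\<^esub> z) = \<zero>\<^bsub>R\<^esub>" using x y z by simp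
  qed
qed

lemma K_one_closed: "\<one>\<^bsub>K\<^esub> \<in> carrier K"
  unfolding K_one_eq
proof (rule K_memI_detect[where ks = "[counit H]", OF K_restrict_lin[OF H.counit_lin] restrict_extensional])
  fix x y z assume "x \<in> carrier H" "y \<in> carrier H" "z \<in> carrier H" "\<And>k. k \<in> set [counit H] \<Longrightarrow> k y = \<zero>\<^bsub>R\<^esub>"
  then show "(\<lambda>x\<in>carrier H. counit H x) (x \<otimes>\<^bsub>H\<^esub> y \<otimes>\<^bsub>H\<^esub> z) = \<zero>\<^bsub>R\<^esub>" by (simp add: H.counit_mult)
qed (use H.counit_lin in simp)

lemma K_mult_conv_cong:
  assumes "f \<in> carrier K" "g \<in> carrier K" "h \<in> carrier K" "x \<in> carrier H"
  shows "H.conv (f \<otimes>\<^bsub>K\<^esub> g) h x = H.conv (H.conv f g) h x" "H.conv h (f \<otimes>\<^bsub>K\<^esub> g) x = H.conv h (H.conv f g) x"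
    "H.conv (f \<oplus>\<^bsub>K\<^esub> g) h x = H.conv (\<lambda>x. f x \<oplus>\<^bsub>R\<^esub> g x) h x" "H.conv h (f \<oplus>\<^bsub>K\<^esub> g) x = H.conv h (\<lambda>x. f x \<oplus>\<^bsub>R\<^esub> g x) x"
  using assms by (auto intro!: H.conv_cong)

lemma ring_K: "ring K"
proof (rule ringI)
  show "abelian_group K" by (rule KM.abelian_group_axioms)
  show "Group.monoid K"
  proof (rule monoidI)
    fix f g h assume fgh: "f \<in> carrier K" "g \<in> carrier K" "h \<in> carrier K"
    show "f \<otimes>\<^bsub>K\<^esub> g \<otimes>\<^bsub>K\<^esub> h = f \<otimes>\<^bsub>K\<^esub> (g \<otimes>\<^bsub>K\<^esub> h)"
      using fgh by (intro K_ext_eqI K_mult_closed)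
        (auto simp: K_mult_closed K_mult_conv_cong H.conv_assoc K_lin)
  next
    fix f assume f: "f \<in> carrier K"
    have 1: "H.conv \<one>\<^bsub>K\<^esub> f x = f x" "H.conv f \<one>\<^bsub>K\<^esub> x = f x" if x: "x \<in> carrier H" for x
      using H.conv_counit[OF K_lin[OF f] x] H.conv_cong[of "\<one>\<^bsub>K\<^esub>" "counit H" f f x] H.conv_cong[of f f "\<one>\<^bsub>K\<^esub>" "counit H" x] x
      by auto
    show "\<one>\<^bsub>K\<^esub> \<otimes>\<^bsub>K\<^esub> f = f" "f \<otimes>\<^bsub>K\<^esub> \<one>\<^bsub>K\<^esub> = f"
      using f by (auto intro!: K_ext_eqI K_mult_closed K_one_closed simp: K_one_closed 1)
  qed (auto intro: K_mult_closed K_one_closed)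
  fix f g h assume fgh: "f \<in> carrier K" "g \<in> carrier K" "h \<in> carrier K"
  show "(f \<oplus>\<^bsub>K\<^esub> g) \<otimes>\<^bsub>K\<^esub> h = f \<otimes>\<^bsub>K\<^esub> h \<oplus>\<^bsub>K\<^esub> g \<otimes>\<^bsub>K\<^esub> h" "h \<otimes>\<^bsub>K\<^esub> (f \<oplus>\<^bsub>K\<^esub> g) = h \<otimes>\<^bsub>K\<^esub> f \<oplus>\<^bsub>K\<^esub> h \<otimes>\<^bsub>K\<^esub> g"
    using fgh by (intro K_ext_eqI K_mult_closed KM.a_closed; auto simp: K_mult_closed K_mult_conv_cong H.conv_add K_lin)+
qed

lemma assoc_algebra_K: "assoc_algebra R K"
  unfolding assoc_algebra_def
proof (intro conjI ballI module_K ring_K)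
  fix r f g assume r: "r \<in> carrier R" and fg: "f \<in> carrier K" "g \<in> carrier K"
  have 1: "H.conv (r \<odot>\<^bsub>K\<^esub> f) g x = r \<otimes>\<^bsub>R\<^esub> H.conv f g x" "H.conv f (r \<odot>\<^bsub>K\<^esub> g) x = r \<otimes>\<^bsub>R\<^esub> H.conv f g x"
    if x: "x \<in> carrier H" for x
    using H.conv_smult[OF r K_lin[OF fg(1)] K_lin[OF fg(2)] x] H.conv_smult[OF r K_lin[OF fg(2)] K_lin[OF fg(1)] x]
      H.conv_cong[of "r \<odot>\<^bsub>K\<^esub> f" "\<lambda>x. r \<otimes>\<^bsub>R\<^esub> f x" g g x] H.conv_cong[of f f "r \<odot>\<^bsub>K\<^esub> g" "\<lambda>x. r \<otimes>\<^bsub>R\<^esub> g x" x] x by auto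
  show "(r \<odot>\<^bsub>K\<^esub> f) \<otimes>\<^bsub>K\<^esub> g = r \<odot>\<^bsub>K\<^esub> (f \<otimes>\<^bsub>K\<^esub> g)" "f \<otimes>\<^bsub>K\<^esub> (r \<odot>\<^bsub>K\<^esub> g) = r \<odot>\<^bsub>K\<^esub> (f \<otimes>\<^bsub>K\<^esub> g)"
    using r fg by (intro K_ext_eqI K_mult_closed KM.smult_closed; auto simp: K_mult_closed 1)+
qed

lemma comult_K:
  assumes "f \<in> carrier K"
  shows comult_K_closed: "comult K f \<in> carrier KK"
    and eval2_comult_K: "\<And>x y. x \<in> carrier H \<Longrightarrow> y \<in> carrier H \<Longrightarrow> eval2 x y (comult K f) = f (x \<otimes>\<^bsub>H\<^esub> y)"
  using theI'[OF ex1_dual_comult[OF assms]] by (auto simp: K_comult is_dual_comult_iff)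

lemma comult_K_lin: "comult K \<in> lin_map R K KK"
proof (rule lin_mapI)
  fix f g assume fg: "f \<in> carrier K" "g \<in> carrier K"
  show "comult K (f \<oplus>\<^bsub>K\<^esub> g) = comult K f \<oplus>\<^bsub>KK\<^esub> comult K g"
    using fg by (intro KK_eqI) (auto simp: comult_K lin_map_add[OF eval2_lin])
next
  fix r f assume rf: "r \<in> carrier R" "f \<in> carrier K"
  show "comult K (r \<odot>\<^bsub>K\<^esub> f) = r \<odot>\<^bsub>KK\<^esub> comult K f"
    using rf by (intro KK_eqI) (auto simp: comult_K lin_map_smult[OF eval2_lin])
qed (rule comult_K_closed)

sublocale KC: comultiplication R K
  by (intro comultiplication.intro module_K comult_K_lin)

lemma \<Delta>_K:
  assumes f: "f \<in> carrier K" and "x \<in> carrier H" "y \<in> carrier H"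
  shows "f (x \<otimes>\<^bsub>H\<^esub> y) = lsum R (\<lambda>p. fst p x \<otimes>\<^bsub>R\<^esub> snd p y) (KC.\<Delta> f)"
  using eval2_comult_K[OF assms] eval2_tens[OF KC.\<Delta>_sub[OF f] assms(2,3)] KC.comult_\<Delta>[OF f] by simp

lemma coalgebra_K: "coalgebra R K"
  unfolding coalgebra_def
proof (intro conjI ballI module_K comult_K_lin)
  show "counit K \<in> lin_map R K (reg_mod R)" unfolding K_counit by (rule eval_lin) simp
  fix f assume f: "f \<in> carrier K"
  note fm = KC.\<Delta>_mem[OF _ f]
  have pt3: "ptensor R K KK p u \<in> carrier KKK" if "p \<in> carrier K" "u \<in> carrier KK" for p u
    by (rule ptensor_closed[OF module_K module_KK that])
  have pt: "ptensor R K K p q \<in> carrier KK" if "p \<in> carrier K" "q \<in> carrier K" for p q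
    by (rule ptensor_closed[OF module_K module_K that])
  show "tensor_assoc R K K K (tensor_map R KK K (comult K) id (comult K f)) = tensor_map R K KK id (comult K) (comult K f)"
    unfolding KC.coassoc_left[OF f] KC.coassoc_right[OF f]
  proof (rule KKK_eqI)
    show cl: "lsum KKK (\<lambda>p. lsum KKK (\<lambda>q. ptensor R K KK (fst q) (ptensor R K K (snd q) (snd p))) (KC.\<Delta> (fst p))) (KC.\<Delta> f) \<in> carrier KKK"
      by (intro KKK.lsum_closed pt3 pt; (erule KC.\<Delta>_mem, erule fm | erule fm))
    show "lsum KKK (\<lambda>p. ptensor R K KK (fst p) (comult K (snd p))) (KC.\<Delta> f) \<in> carrier KKK"
      by (intro KKK.lsum_closed pt3 comult_K_closed; erule fm)
    fix x y z assume x: "x \<in> carrier H" and y: "y \<in> carrier H" and z: "z \<in> carrier H"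
    note e3 = eval3_lin[OF x y z]
    have "eval3 x y z (lsum KKK (\<lambda>p. lsum KKK (\<lambda>q. ptensor R K KK (fst q) (ptensor R K K (snd q) (snd p))) (KC.\<Delta> (fst p))) (KC.\<Delta> f)) =
      lsum R (\<lambda>p. eval3 x y z (lsum KKK (\<lambda>q. ptensor R K KK (fst q) (ptensor R K K (snd q) (snd p))) (KC.\<Delta> (fst p)))) (KC.\<Delta> f)"
      by (subst lin_map_lsum[OF module_KKK module_R e3])
         (simp_all add: KKK.lsum_closed pt3 pt fm KC.\<Delta>_mem[OF _ fm(1)])
    also have "\<dots> = lsum R (\<lambda>p. fst p (x \<otimes>\<^bsub>H\<^esub> y) \<otimes>\<^bsub>R\<^esub> snd p z) (KC.\<Delta> f)"
    proof (rule lsum_cong[OF refl])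
      fix p assume p: "p \<in> set (KC.\<Delta> f)"
      note pm = fm[OF p] and qm = KC.\<Delta>_mem[OF _ fm(1)[OF p]]
      have "eval3 x y z (lsum KKK (\<lambda>q. ptensor R K KK (fst q) (ptensor R K K (snd q) (snd p))) (KC.\<Delta> (fst p))) =
        lsum R (\<lambda>q. eval3 x y z (ptensor R K KK (fst q) (ptensor R K K (snd q) (snd p)))) (KC.\<Delta> (fst p))"
        by (subst lin_map_lsum[OF module_KKK module_R e3]) (simp_all add: pt3 pt pm qm)
      also have "\<dots> = lsum R (\<lambda>q. fst q x \<otimes>\<^bsub>R\<^esub> snd q y \<otimes>\<^bsub>R\<^esub> snd p z) (KC.\<Delta> (fst p))"
        using pm qm x y z by (intro lsum_cong refl) (simp add: eval3_ptensor pt eval2_ptensor AM.m_assoc)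
      also have "\<dots> = fst p (x \<otimes>\<^bsub>H\<^esub> y) \<otimes>\<^bsub>R\<^esub> snd p z"
        unfolding \<Delta>_K[OF pm(1) x y] using pm qm x y z by (intro AM.lsum_ldistr[symmetric]) auto
      finally show "eval3 x y z (lsum KKK (\<lambda>q. ptensor R K KK (fst q) (ptensor R K K (snd q) (snd p))) (KC.\<Delta> (fst p))) =
        fst p (x \<otimes>\<^bsub>H\<^esub> y) \<otimes>\<^bsub>R\<^esub> snd p z" .
    qed
    also have "\<dots> = f (x \<otimes>\<^bsub>H\<^esub> y \<otimes>\<^bsub>H\<^esub> z)" using \<Delta>_K[OF f] x y z by simp
    also have "\<dots> = lsum R (\<lambda>p. fst p x \<otimes>\<^bsub>R\<^esub> snd p (y \<otimes>\<^bsub>H\<^esub> z)) (KC.\<Delta> f)" using \<Delta>_K[OF f] x y z by (simp add: AR.m_assoc)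
    also have "\<dots> = lsum R (\<lambda>p. eval3 x y z (ptensor R K KK (fst p) (comult K (snd p)))) (KC.\<Delta> f)"
      using fm x y z by (intro lsum_cong refl) (simp add: eval3_ptensor comult_K)
    also have "\<dots> = eval3 x y z (lsum KKK (\<lambda>p. ptensor R K KK (fst p) (comult K (snd p))) (KC.\<Delta> f))"
      by (subst lin_map_lsum[OF module_KKK module_R e3]) (simp_all add: pt3 fm comult_K_closed)
    finally show "eval3 x y z (lsum KKK (\<lambda>p. lsum KKK (\<lambda>q. ptensor R K KK (fst q) (ptensor R K K (snd q) (snd p))) (KC.\<Delta> (fst p))) (KC.\<Delta> f)) =
      eval3 x y z (lsum KKK (\<lambda>p. ptensor R K KK (fst p) (comult K (snd p))) (KC.\<Delta> f))" .
  qed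
  note e1 = lin_mapD[OF eval_lin[OF AR.one_closed]]
  have b: "(\<lambda>p q. counit K p \<odot>\<^bsub>K\<^esub> q) \<in> bilin_map R K K K" "(\<lambda>p q. counit K q \<odot>\<^bsub>K\<^esub> p) \<in> bilin_map R K K K"
    unfolding K_counit
    by (intro bilin_mapI lin_mapI; auto simp: KM.smult_l_distr KM.smult_r_distr KM.smult_assoc1 KM.smult_left_commute)+
  show "tensor_sum R K (\<lambda>p q. counit K p \<odot>\<^bsub>K\<^esub> q) (comult K f) = f"
    unfolding KC.tensor_sum_comult[OF module_K b(1) f]
  proof (rule K_ext_eqI)
    show "lsum K (\<lambda>p. counit K (fst p) \<odot>\<^bsub>K\<^esub> snd p) (KC.\<Delta> f) \<in> carrier K" using fm by (auto simp: K_counit)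
    fix x assume x: "x \<in> carrier H"
    show "lsum K (\<lambda>p. counit K (fst p) \<odot>\<^bsub>K\<^esub> snd p) (KC.\<Delta> f) x = f x"
      using \<Delta>_K[OF f AR.one_closed x] x by (simp add: K_counit)
  qed (rule f)
  show "tensor_sum R K (\<lambda>p q. counit K q \<odot>\<^bsub>K\<^esub> p) (comult K f) = f"
    unfolding KC.tensor_sum_comult[OF module_K b(2) f]
  proof (rule K_ext_eqI)
    show "lsum K (\<lambda>p. counit K (snd p) \<odot>\<^bsub>K\<^esub> fst p) (KC.\<Delta> f) \<in> carrier K" using fm by (auto simp: K_counit)
    fix x assume x: "x \<in> carrier H"
    have "lsum K (\<lambda>p. counit K (snd p) \<odot>\<^bsub>K\<^esub> fst p) (KC.\<Delta> f) x = lsum R (\<lambda>p. fst p x \<otimes>\<^bsub>R\<^esub> snd p \<one>\<^bsub>H\<^esub>) (KC.\<Delta> f)"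
      using x fm by (auto simp: K_counit intro!: lsum_cong AM.m_comm)
    then show "lsum K (\<lambda>p. counit K (snd p) \<odot>\<^bsub>K\<^esub> fst p) (KC.\<Delta> f) x = f x"
      using \<Delta>_K[OF f x AR.one_closed] x by simp
  qed (rule f)
qed

text \<open>Transposing that the comultiplication of \<open>H\<close> is multiplicative yields that the comultiplication of \<open>K\<close> is.\<close>

lemma K_conv_mult_eval:
  assumes f: "f \<in> carrier K" and g: "g \<in> carrier K" and x: "x \<in> carrier H" and y: "y \<in> carrier H"
  shows "H.conv f g (x \<otimes>\<^bsub>H\<^esub> y) =
    lsum R (\<lambda>p. lsum R (\<lambda>q. H.conv (fst p) (fst q) x \<otimes>\<^bsub>R\<^esub> H.conv (snd p) (snd q) y) (KC.\<Delta> g)) (KC.\<Delta> f)"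
proof -
  note fm = KC.\<Delta>_mem[OF _ f] and gm = KC.\<Delta>_mem[OF _ g] and xm = H.\<Delta>_mem[OF _ x] and ym = H.\<Delta>_mem[OF _ y]
  let ?t = "\<lambda>u v p q. (fst p (fst u) \<otimes>\<^bsub>R\<^esub> fst q (snd u)) \<otimes>\<^bsub>R\<^esub> (snd p (fst v) \<otimes>\<^bsub>R\<^esub> snd q (snd v))"
  have "H.conv f g (x \<otimes>\<^bsub>H\<^esub> y) = lsum R (\<lambda>u. lsum R (\<lambda>v. lsum R (\<lambda>p. lsum R (?t u v p) (KC.\<Delta> g)) (KC.\<Delta> f)) (H.\<Delta> y)) (H.\<Delta> x)"
    unfolding H.conv_mult[OF K_lin[OF f] K_lin[OF g] x y]
  proof (intro lsum_cong refl)
    fix u v assume u: "u \<in> set (H.\<Delta> x)" and v: "v \<in> set (H.\<Delta> y)"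
    show "f (fst u \<otimes>\<^bsub>H\<^esub> fst v) \<otimes>\<^bsub>R\<^esub> g (snd u \<otimes>\<^bsub>H\<^esub> snd v) = lsum R (\<lambda>p. lsum R (?t u v p) (KC.\<Delta> g)) (KC.\<Delta> f)"
      unfolding \<Delta>_K[OF f xm(1)[OF u] ym(1)[OF v]] \<Delta>_K[OF g xm(2)[OF u] ym(2)[OF v]]
      using fm gm xm[OF u] ym[OF v]
      by (subst AM.lsum_mult_lsum) (auto intro!: lsum_cong simp: AM.m_ac)
  qed
  also have "\<dots> = lsum R (\<lambda>p. lsum R (\<lambda>q. lsum R (\<lambda>u. lsum R (\<lambda>v. ?t u v p q) (H.\<Delta> y)) (H.\<Delta> x)) (KC.\<Delta> g)) (KC.\<Delta> f)"
    using fm gm xm ym by (intro AM.R.lsum_swap_pairs) auto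
  also have "\<dots> = lsum R (\<lambda>p. lsum R (\<lambda>q. H.conv (fst p) (fst q) x \<otimes>\<^bsub>R\<^esub> H.conv (snd p) (snd q) y) (KC.\<Delta> g)) (KC.\<Delta> f)"
    unfolding H.conv_def using fm gm xm ym
    by (intro lsum_cong refl AM.lsum_mult_lsum[symmetric]) auto
  finally show ?thesis .
qed

lemma bialgebra_K: "bialgebra R K"
  unfolding bialgebra_def
proof (intro conjI assoc_algebra_K coalgebra_K)
  have pt: "ptensor R K K p q \<in> carrier KK" if "p \<in> carrier K" "q \<in> carrier K" for p q
    by (rule ptensor_closed[OF module_K module_K that])
  have simps: "carrier (tensor_alg R K K) = carrier KK" "\<one>\<^bsub>tensor_alg R K K\<^esub> = ptensor R K K \<one>\<^bsub>K\<^esub> \<one>\<^bsub>K\<^esub>"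
    "ring.add (tensor_alg R K K) = ring.add KK" "smult (tensor_alg R K K) = smult KK"
    by (simp_all add: tensor_alg_def Let_def)
  have mult: "comult K (f \<otimes>\<^bsub>K\<^esub> g) = comult K f \<otimes>\<^bsub>tensor_alg R K K\<^esub> comult K g" if f: "f \<in> carrier K" and g: "g \<in> carrier K" for f g
  proof -
    note fm = KC.\<Delta>_mem[OF _ f] and gm = KC.\<Delta>_mem[OF _ g]
    let ?s = "\<lambda>p q. ptensor R K K (fst p \<otimes>\<^bsub>K\<^esub> fst q) (snd p \<otimes>\<^bsub>K\<^esub> snd q)"
    have scl: "?s p q \<in> carrier KK" if "p \<in> set (KC.\<Delta> f)" "q \<in> set (KC.\<Delta> g)" for p q
      using fm[OF that(1)] gm[OF that(2)] by (intro pt K_mult_closed)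
    have "comult K f \<otimes>\<^bsub>tensor_alg R K K\<^esub> comult K g = lsum KK (\<lambda>p. lsum KK (?s p) (KC.\<Delta> g)) (KC.\<Delta> f)"
      unfolding KC.comult_\<Delta>[OF f] KC.comult_\<Delta>[OF g]
      by (rule tensor_alg_mult[OF assoc_algebra_K KC.\<Delta>_sub[OF f] KC.\<Delta>_sub[OF g]])
    moreover have "comult K (f \<otimes>\<^bsub>K\<^esub> g) = lsum KK (\<lambda>p. lsum KK (?s p) (KC.\<Delta> g)) (KC.\<Delta> f)"
    proof (rule KK_eqI)
      show "comult K (f \<otimes>\<^bsub>K\<^esub> g) \<in> carrier KK" using f g by (intro comult_K_closed K_mult_closed)
      show "lsum KK (\<lambda>p. lsum KK (?s p) (KC.\<Delta> g)) (KC.\<Delta> f) \<in> carrier KK" by (intro KK.lsum_closed scl)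
      fix x y assume x: "x \<in> carrier H" and y: "y \<in> carrier H"
      have "eval2 x y (lsum KK (\<lambda>p. lsum KK (?s p) (KC.\<Delta> g)) (KC.\<Delta> f)) =
        lsum R (\<lambda>p. eval2 x y (lsum KK (?s p) (KC.\<Delta> g))) (KC.\<Delta> f)"
        using lin_map_lsum[OF module_KK module_R eval2_lin[OF x y], of "KC.\<Delta> f" "\<lambda>p. lsum KK (?s p) (KC.\<Delta> g)"] scl
        by (simp add: KK.lsum_closed)
      also have "\<dots> = lsum R (\<lambda>p. lsum R (\<lambda>q. eval2 x y (?s p q)) (KC.\<Delta> g)) (KC.\<Delta> f)"
        using lin_map_lsum[OF module_KK module_R eval2_lin[OF x y], of "KC.\<Delta> g"] scl
        by (intro lsum_cong refl) simp
      also have "\<dots> = lsum R (\<lambda>p. lsum R (\<lambda>q. H.conv (fst p) (fst q) x \<otimes>\<^bsub>R\<^esub> H.conv (snd p) (snd q) y) (KC.\<Delta> g)) (KC.\<Delta> f)"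
        using fm gm x y by (intro lsum_cong refl) (simp add: eval2_ptensor K_mult_closed)
      also have "\<dots> = eval2 x y (comult K (f \<otimes>\<^bsub>K\<^esub> g))"
        using K_conv_mult_eval[OF f g x y] f g x y by (simp add: comult_K K_mult_closed)
      finally show "eval2 x y (comult K (f \<otimes>\<^bsub>K\<^esub> g)) = eval2 x y (lsum KK (\<lambda>p. lsum KK (?s p) (KC.\<Delta> g)) (KC.\<Delta> f))" ..
    qed
    ultimately show ?thesis by simp
  qed
  have one: "comult K \<one>\<^bsub>K\<^esub> = ptensor R K K \<one>\<^bsub>K\<^esub> \<one>\<^bsub>K\<^esub>"
    by (rule KK_eqI) (auto simp: comult_K K_one_closed pt eval2_ptensor H.counit_mult)
  interpret KR: ring K by (rule ring_K)
  show "comult K \<in> alg_hom R K (tensor_alg R K K)"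
    unfolding alg_hom_def
  proof (intro IntI ring_hom_memI)
    show "comult K \<in> lin_map R K (tensor_alg R K K)"
      using lin_mapD[OF comult_K_lin] by (intro lin_mapI) (auto simp: simps)
  qed (simp_all add: simps comult_K_closed mult one lin_map_add[OF comult_K_lin])
  show "counit K \<in> alg_hom R K (reg_mod R)"
    unfolding alg_hom_def K_counit
    by (intro IntI ring_hom_memI eval_lin)
       (auto simp: H.conv_one K_lin H.counit_one K_mult_closed)
qed

lemma cocommutative_K:
  assumes "commutative H" shows "cocommutative R K"
  unfolding cocommutative_def
proof
  fix f assume f: "f \<in> carrier K"
  note fm = KC.\<Delta>_mem[OF _ f]
  have flip: "(\<lambda>p q. ptensor R K K q p) \<in> bilin_map R K K KK"
    by (rule bilin_map_flip[OF bilin_map_ptensor[OF module_K module_K]])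
  have eq: "tensor_flip R K K (comult K f) = lsum KK (\<lambda>p. ptensor R K K (snd p) (fst p)) (KC.\<Delta> f)"
    unfolding tensor_flip_def by (rule KC.tensor_sum_comult[OF module_KK flip f])
  have pt: "ptensor R K K (snd p) (fst p) \<in> carrier KK" if "p \<in> set (KC.\<Delta> f)" for p
    by (rule ptensor_closed[OF module_K module_K fm(2)[OF that] fm(1)[OF that]])
  show "tensor_flip R K K (comult K f) = comult K f"
    unfolding eq
  proof (rule KK_eqI)
    fix x y assume x: "x \<in> carrier H" and y: "y \<in> carrier H"
    have "eval2 x y (lsum KK (\<lambda>p. ptensor R K K (snd p) (fst p)) (KC.\<Delta> f)) =
      lsum R (\<lambda>p. eval2 x y (ptensor R K K (snd p) (fst p))) (KC.\<Delta> f)"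
      using lin_map_lsum[OF module_KK module_R eval2_lin[OF x y] pt] by simp
    also have "\<dots> = lsum R (\<lambda>p. fst p y \<otimes>\<^bsub>R\<^esub> snd p x) (KC.\<Delta> f)"
      using fm x y by (intro lsum_cong refl) (simp add: eval2_ptensor AM.m_comm)
    also have "\<dots> = f (x \<otimes>\<^bsub>H\<^esub> y)" using \<Delta>_K[OF f y x] assms x y by (simp add: commutative_def)
    finally show "eval2 x y (lsum KK (\<lambda>p. ptensor R K K (snd p) (fst p)) (KC.\<Delta> f)) = eval2 x y (comult K f)"
      using f x y by (simp add: comult_K)
  qed (use pt f in \<open>auto simp: comult_K_closed\<close>)
qed

lemma commutative_K:
  assumes "cocommutative R H" shows "commutative K"
  unfolding commutative_def
proof (intro ballI)
  fix f g assume f: "f \<in> carrier K" and g: "g \<in> carrier K"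
  have "H.conv f g x = H.conv g f x" if x: "x \<in> carrier H" for x
  proof -
    note xm = H.\<Delta>_mem[OF _ x]
    note fb = H.form_mult_bilin[OF K_lin[OF f] K_lin[OF g]]
    note HH = module_tensor[OF module_A module_A]
    have flip: "(\<lambda>p q. ptensor R H H q p) \<in> bilin_map R H H (tensor R H H)"
      by (rule bilin_map_flip[OF bilin_map_ptensor[OF module_A module_A]])
    have "comult H x = tensor_flip R H H (comult H x)" using assms x by (simp add: cocommutative_def)
    also have "\<dots> = lsum (tensor R H H) (\<lambda>p. ptensor R H H (snd p) (fst p)) (H.\<Delta> x)"
      unfolding tensor_flip_def by (rule H.tensor_sum_comult[OF HH flip x])
    finally have eq: "comult H x = tens R H H (map (\<lambda>p. (snd p, fst p)) (H.\<Delta> x))" by (simp add: tens_def lsum_map)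
    have "H.conv f g x = tensor_sum R (reg_mod R) (\<lambda>a b. f a \<otimes>\<^bsub>R\<^esub> g b) (comult H x)"
      by (rule H.conv_tensor_sum[OF K_lin[OF f] K_lin[OF g] x, symmetric])
    also have "\<dots> = lsum R (\<lambda>p. f (snd p) \<otimes>\<^bsub>R\<^esub> g (fst p)) (H.\<Delta> x)"
      unfolding eq using xm by (subst tensor_sum_tens[OF module_A module_A module_R fb]) (auto simp: lsum_map)
    also have "\<dots> = H.conv g f x"
      unfolding H.conv_def using xm f g by (intro lsum_cong refl AM.m_comm) auto
    finally show ?thesis .
  qed
  then show "f \<otimes>\<^bsub>K\<^esub> g = g \<otimes>\<^bsub>K\<^esub> f"
    using f g by (intro K_ext_eqI K_mult_closed) auto
qed

lemma bialgebra_alpha_pairing_K: "bialgebra_alpha_pairing TYPE('m) R H K (\<lambda>h f. f h)"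
  unfolding bialgebra_alpha_pairing_def
proof (intro conjI H.bialg bialgebra_K)
  show "(\<lambda>h f. f h) \<in> bilin_map R H K (reg_mod R)"
    by (intro bilin_mapI eval_lin) (auto intro: K_lin)
  show "alpha_condition TYPE('m) R H K (\<lambda>h f. f h)"
    by (rule pairing_factors_imp_alpha[OF module_K eval_lin factors])
  have dual: "carrier (conv_dual R D) = Hom_mod R D (reg_mod R)"
    "ring.add (conv_dual R D) = (\<lambda>f g. \<lambda>x\<in>carrier D. f x \<oplus>\<^bsub>R\<^esub> g x)"
    "smult (conv_dual R D) = (\<lambda>r f. \<lambda>x\<in>carrier D. r \<otimes>\<^bsub>R\<^esub> f x)" for D :: "('r, 'd, 'e) bialg_scheme"
    by (simp_all add: conv_dual_def dual_mod_def)
  interpret KB: bialgebra_struct R K by (intro bialgebra_struct.intro bialgebra_K)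
  let ?e = "\<lambda>h. \<lambda>k\<in>carrier K. k h"
  have e: "?e h \<in> lin_map R K (reg_mod R)" if h: "h \<in> carrier H" for h
    using eval_lin[OF h] by (subst lin_map_cong[OF module_K, where g = "\<lambda>k. k h"]) auto
  show "?e \<in> alg_hom R H (conv_dual R K)"
    unfolding alg_hom_def
  proof (intro IntI ring_hom_memI lin_mapI)
    fix x y assume x: "x \<in> carrier H" and y: "y \<in> carrier H"
    show "?e (x \<otimes>\<^bsub>H\<^esub> y) = ?e x \<otimes>\<^bsub>conv_dual R K\<^esub> ?e y"
    proof -
      have "?e x \<otimes>\<^bsub>conv_dual R K\<^esub> ?e y = (\<lambda>f\<in>carrier K. KB.conv (?e x) (?e y) f)"
        by (rule KB.conv_dual_mult[OF e[OF x] e[OF y]])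
      also have "\<dots> = ?e (x \<otimes>\<^bsub>H\<^esub> y)"
      proof (rule restrict_ext)
        fix f assume f: "f \<in> carrier K"
        show "KB.conv (?e x) (?e y) f = f (x \<otimes>\<^bsub>H\<^esub> y)"
          unfolding KB.conv_def \<Delta>_K[OF f x y] using KC.\<Delta>_mem[OF _ f] by (intro lsum_cong refl) auto
      qed
      finally show ?thesis ..
    qed
  next
    show "?e \<one>\<^bsub>H\<^esub> = \<one>\<^bsub>conv_dual R K\<^esub>" by (simp add: conv_dual_def K_counit)
  qed (auto simp: dual Hom_mod_def e intro!: restrict_ext)
  let ?d = "\<lambda>k. \<lambda>h\<in>carrier H. k h"
  have d: "?d k = k" if "k \<in> carrier K" for k
    using K_ext[OF that] by (intro extensionalityI[of _ "carrier H"]) auto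
  interpret KR: ring K by (rule ring_K)
  show "?d \<in> alg_hom R K (conv_dual R H)"
    unfolding alg_hom_def
  proof (intro IntI ring_hom_memI lin_mapI)
    show "?d \<one>\<^bsub>K\<^esub> = \<one>\<^bsub>conv_dual R H\<^esub>" using d[OF K_one_closed] by (simp add: K_one)
    fix x y assume x: "x \<in> carrier K" and y: "y \<in> carrier K"
    show "?d (x \<otimes>\<^bsub>K\<^esub> y) = ?d x \<otimes>\<^bsub>conv_dual R H\<^esub> ?d y"
      unfolding d[OF K_mult_closed[OF x y]] d[OF x] d[OF y] by (simp only: K_mult)
  qed (auto simp: d K_mult_closed dual Hom_mod_def K_lin K_ext K_add K_smult intro!: restrict_ext)
qed

end

section \<open>The finite dual of a Hopf algebra\<close>

locale fin_dual_hopf = fin_dual_bialg R H K + H: hopf_struct R H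
  for R :: "('r, 'z) ring_scheme" and H :: "('r, 'a, 'u) hopf_scheme"
    and K :: "('r, 'a \<Rightarrow> 'r, 'k) hopf_scheme" +
  assumes K_antipode: "antipode K = (\<lambda>f. \<lambda>h\<in>carrier H. f (antipode H h))"
begin

lemma antipode_K_apply [simp]: "h \<in> carrier H \<Longrightarrow> antipode K f h = f (antipode H h)"
  by (simp add: K_antipode)

text \<open>If \<open>f\<close> vanishes on the ideal \<open>I\<close> then \<open>f \<circ> S\<close> vanishes on the preimage of \<open>I\<close> under \<open>S\<close>, which is an
ideal because \<open>S\<close> reverses products.\<close>

lemma antipode_K_closed:
  assumes f: "f \<in> carrier K" shows "antipode K f \<in> carrier K"
proof -
  obtain I where I: "ideal I H" "cofinite_sub R H I" "\<forall>x\<in>I. f x = \<zero>\<^bsub>R\<^esub>" using f by (auto simp: K_mem_iff)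
  interpret I: ideal I H by (rule I(1))
  let ?J = "{x \<in> carrier H. antipode H x \<in> I}"
  have cof: "cofinite_sub R H ?J"
    by (rule cofinite_sub_vimage[OF cring_R noeth_R module_A module_A H.S_lin I(2)])
  have sub: "submodule ?J R H" using cof by (simp add: cofinite_sub_def)
  have J: "ideal ?J H"
    using submodule.axioms(1)[OF sub] I.I_l_closed I.I_r_closed
    by (intro idealI AR.ring_axioms) (auto simp: H.antipode_mult)
  have "(\<lambda>h\<in>carrier H. f (antipode H h)) \<in> lin_map R H (reg_mod R)"
    by (intro K_restrict_lin lin_map_comp[OF H.S_lin K_lin[OF f]])
  then show ?thesis
    unfolding K_antipode K_mem_iff using J cof I(3) by (intro conjI exI[of _ ?J]) auto
qed

lemma antipode_K_lin: "antipode K \<in> lin_map R K K"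
  by (intro lin_mapI antipode_K_closed K_ext_eqI KM.a_closed KM.smult_closed) auto

text \<open>Both antipode laws of \<open>K\<close> are values of \<open>f\<close> on the corresponding law of \<open>H\<close>: take for one of \<open>\<alpha>\<close>, \<open>\<beta>\<close> the antipode and
for the other the identity.\<close>

lemma \<Delta>_K_antipode:
  assumes f: "f \<in> carrier K" and h: "h \<in> carrier H"
    and \<alpha>: "\<alpha> \<in> lin_map R H H" "\<alpha>' \<in> lin_map R K K" "\<And>p h. p \<in> carrier K \<Longrightarrow> h \<in> carrier H \<Longrightarrow> \<alpha>' p h = p (\<alpha> h)"
    and \<beta>: "\<beta> \<in> lin_map R H H" "\<beta>' \<in> lin_map R K K" "\<And>p h. p \<in> carrier K \<Longrightarrow> h \<in> carrier H \<Longrightarrow> \<beta>' p h = p (\<beta> h)"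
  shows "lsum K (\<lambda>p. \<alpha>' (fst p) \<otimes>\<^bsub>K\<^esub> \<beta>' (snd p)) (KC.\<Delta> f) h =
    f (lsum H (\<lambda>u. \<alpha> (fst u) \<otimes>\<^bsub>H\<^esub> \<beta> (snd u)) (H.\<Delta> h))"
proof -
  note fm = KC.\<Delta>_mem[OF _ f] and hm = H.\<Delta>_mem[OF _ h]
  note cl = lin_map_closed[OF \<alpha>(1)] lin_map_closed[OF \<alpha>(2)] lin_map_closed[OF \<beta>(1)] lin_map_closed[OF \<beta>(2)]
  have "lsum K (\<lambda>p. \<alpha>' (fst p) \<otimes>\<^bsub>K\<^esub> \<beta>' (snd p)) (KC.\<Delta> f) h =
    lsum R (\<lambda>p. lsum R (\<lambda>u. fst p (\<alpha> (fst u)) \<otimes>\<^bsub>R\<^esub> snd p (\<beta> (snd u))) (H.\<Delta> h)) (KC.\<Delta> f)"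
    using h fm hm cl by (auto intro!: lsum_cong simp: H.conv_def \<alpha>(3) \<beta>(3))
  also have "\<dots> = lsum R (\<lambda>u. lsum R (\<lambda>p. fst p (\<alpha> (fst u)) \<otimes>\<^bsub>R\<^esub> snd p (\<beta> (snd u))) (KC.\<Delta> f)) (H.\<Delta> h)"
    using fm hm cl by (intro AM.R.lsum_swap) auto
  also have "\<dots> = lsum R (\<lambda>u. f (\<alpha> (fst u) \<otimes>\<^bsub>H\<^esub> \<beta> (snd u))) (H.\<Delta> h)"
    using hm cl by (intro lsum_cong refl) (simp add: \<Delta>_K[OF f])
  also have "\<dots> = f (lsum H (\<lambda>u. \<alpha> (fst u) \<otimes>\<^bsub>H\<^esub> \<beta> (snd u)) (H.\<Delta> h))"
    using lin_map_lsum[OF module_A module_R K_lin[OF f], of "H.\<Delta> h" "\<lambda>u. \<alpha> (fst u) \<otimes>\<^bsub>H\<^esub> \<beta> (snd u)"] hm cl by simp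
  finally show ?thesis .
qed

lemma hopf_algebra_K: "hopf_algebra R K"
  unfolding hopf_algebra_def
proof (intro conjI ballI bialgebra_K antipode_K_lin)
  fix f assume f: "f \<in> carrier K"
  note fm = KC.\<Delta>_mem[OF _ f] and mb = mult_bilin[OF assoc_algebra_K]
  have b: "(\<lambda>p q. antipode K p \<otimes>\<^bsub>K\<^esub> q) \<in> bilin_map R K K K" "(\<lambda>p q. p \<otimes>\<^bsub>K\<^esub> antipode K q) \<in> bilin_map R K K K"
    by (rule bilin_map_comp[OF mb antipode_K_lin lin_map_id(2)] bilin_map_comp[OF mb lin_map_id(2) antipode_K_lin])+
  have rcl: "counit K f \<in> carrier R" using f by (simp add: K_counit)
  show "tensor_sum R K (\<lambda>p q. antipode K p \<otimes>\<^bsub>K\<^esub> q) (comult K f) = counit K f \<odot>\<^bsub>K\<^esub> \<one>\<^bsub>K\<^esub>"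
    unfolding KC.tensor_sum_comult[OF module_K b(1) f]
  proof (rule K_ext_eqI)
    fix h assume h: "h \<in> carrier H"
    show "lsum K (\<lambda>p. antipode K (fst p) \<otimes>\<^bsub>K\<^esub> snd p) (KC.\<Delta> f) h = (counit K f \<odot>\<^bsub>K\<^esub> \<one>\<^bsub>K\<^esub>) h"
      using \<Delta>_K_antipode[where \<alpha>' = "antipode K" and \<beta>' = "\<lambda>q. q", OF f h H.S_lin antipode_K_lin _ lin_map_id(2) lin_map_id(2)] f h
      by (simp add: H.antipode_left K_counit AM.m_comm del: K_lsum_apply)
  qed (use fm rcl in \<open>auto intro!: KM.lsum_closed K_mult_closed antipode_K_closed K_one_closed\<close>)
  show "tensor_sum R K (\<lambda>p q. p \<otimes>\<^bsub>K\<^esub> antipode K q) (comult K f) = counit K f \<odot>\<^bsub>K\<^esub> \<one>\<^bsub>K\<^esub>"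
    unfolding KC.tensor_sum_comult[OF module_K b(2) f]
  proof (rule K_ext_eqI)
    fix h assume h: "h \<in> carrier H"
    show "lsum K (\<lambda>p. fst p \<otimes>\<^bsub>K\<^esub> antipode K (snd p)) (KC.\<Delta> f) h = (counit K f \<odot>\<^bsub>K\<^esub> \<one>\<^bsub>K\<^esub>) h"
      using \<Delta>_K_antipode[where \<alpha>' = "\<lambda>p. p" and \<beta>' = "antipode K", OF f h lin_map_id(2) lin_map_id(2) _ H.S_lin antipode_K_lin] f h
      by (simp add: H.antipode_right K_counit AM.m_comm del: K_lsum_apply)
  qed (use fm rcl in \<open>auto intro!: KM.lsum_closed K_mult_closed antipode_K_closed K_one_closed\<close>)
qed

end

section \<open>Functoriality and adjointness\<close>

text \<open>Evaluate the linear map induced by \<open>b\<close> at both sides of the compatibility of \<open>u\<close> with the comultiplications.\<close>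

lemma comult_hom_sum:
  assumes C: "comultiplication R C" and D: "comultiplication R D" and u: "u \<in> lin_map R C D"
    and hom: "comult D (u c) = tensor_map R D D u u (comult C c)"
    and P: "module R P" and b: "b \<in> bilin_map R D D P" and c: "c \<in> carrier C"
  shows "lsum P (\<lambda>p. b (fst p) (snd p)) (comultiplication.\<Delta> R D (u c)) =
    lsum P (\<lambda>p. b (u (fst p)) (u (snd p))) (comultiplication.\<Delta> R C c)"
proof -
  interpret C: comultiplication R C by fact
  interpret D: comultiplication R D by fact
  note L = lin_map_tensor_sum[OF D.module_C D.module_C P b]
  note cm = C.\<Delta>_mem[OF _ c] and uc = lin_map_closed[OF u]
  have "lsum P (\<lambda>p. b (fst p) (snd p)) (D.\<Delta> (u c)) = tensor_sum R P b (tensor_map R D D u u (comult C c))"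
    using D.tensor_sum_comult[OF P b uc[OF c]] hom by simp
  also have "tensor_map R D D u u (comult C c) = lsum (tensor R D D) (\<lambda>p. ptensor R D D (u (fst p)) (u (snd p))) (C.\<Delta> c)"
    unfolding C.comult_\<Delta>[OF c] by (rule tensor_map_tens[OF C.module_C C.module_C D.module_C D.module_C u u C.\<Delta>_sub[OF c]])
  also have "tensor_sum R P b \<dots> = lsum P (\<lambda>p. tensor_sum R P b (ptensor R D D (u (fst p)) (u (snd p)))) (C.\<Delta> c)"
    by (rule lin_map_lsum[OF D.module_CC P L]) (intro ptensor_closed[OF D.module_C D.module_C] uc; erule cm)
  also have "\<dots> = lsum P (\<lambda>p. b (u (fst p)) (u (snd p))) (C.\<Delta> c)"
    by (intro lsum_cong refl tensor_sum_ptensor[OF D.module_C D.module_C P b] uc; erule cm)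
  finally show ?thesis .
qed

lemma bialg_homD:
  assumes "u \<in> bialg_hom R H L"
  shows "u \<in> lin_map R H L" "u \<in> extensional (carrier H)"
    "\<And>x y. x \<in> carrier H \<Longrightarrow> y \<in> carrier H \<Longrightarrow> u (x \<otimes>\<^bsub>H\<^esub> y) = u x \<otimes>\<^bsub>L\<^esub> u y"
    "u \<one>\<^bsub>H\<^esub> = \<one>\<^bsub>L\<^esub>"
    "\<And>h. h \<in> carrier H \<Longrightarrow> comult L (u h) = tensor_map R L L u u (comult H h)"
    "\<And>h. h \<in> carrier H \<Longrightarrow> counit L (u h) = counit H h"
  using assms by (auto simp: bialg_hom_def alg_hom_def ring_hom_def)

lemma bialg_homI:
  assumes "u \<in> lin_map R H L" "u \<in> extensional (carrier H)"
    "\<And>x y. x \<in> carrier H \<Longrightarrow> y \<in> carrier H \<Longrightarrow> u (x \<otimes>\<^bsub>H\<^esub> y) = u x \<otimes>\<^bsub>L\<^esub> u y"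
    "u \<one>\<^bsub>H\<^esub> = \<one>\<^bsub>L\<^esub>"
    "\<And>h. h \<in> carrier H \<Longrightarrow> comult L (u h) = tensor_map R L L u u (comult H h)"
    "\<And>h. h \<in> carrier H \<Longrightarrow> counit L (u h) = counit H h"
  shows "u \<in> bialg_hom R H L"
  using assms by (auto simp: bialg_hom_def alg_hom_def ring_hom_def lin_map_def)

lemma bialg_hom_funcset: "u \<in> bialg_hom R H L \<Longrightarrow> u \<in> carrier H \<rightarrow> carrier L"
  by (rule funcsetI) (rule lin_map_closed[OF bialg_homD(1)])

text \<open>The bijection of the adjunction: a map \<open>H \<rightarrow> K\<^sup>\<circ>\<close> is a form on \<open>H \<times> K\<close>, and so is a map \<open>K \<rightarrow> H\<^sup>\<circ>\<close>.\<close>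

definition swap_args :: "'a set \<Rightarrow> 'b set \<Rightarrow> ('a \<Rightarrow> 'b \<Rightarrow> 'r) \<Rightarrow> 'b \<Rightarrow> 'a \<Rightarrow> 'r" where
  "swap_args A B f = (\<lambda>k\<in>B. \<lambda>h\<in>A. f h k)"

locale two_duals = H: fin_dual_bialg R H H' + L: fin_dual_bialg R L L'
  for R :: "('r, 'z) ring_scheme" and H :: "('r, 'a, 'u) bialg_scheme"
    and H' :: "('r, 'a \<Rightarrow> 'r, 'k) bialg_scheme" and L :: "('r, 'b, 'v) bialg_scheme"
    and L' :: "('r, 'b \<Rightarrow> 'r, 'l) bialg_scheme"
begin

lemma dual_map_apply:
  assumes "g \<in> carrier L'" "h \<in> carrier H" shows "dual_map R H L u g h = g (u h)"
  using assms by (simp add: dual_map_def L.K_carrier)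

lemma dual_map_closed:
  assumes u: "u \<in> bialg_hom R H L" and g: "g \<in> carrier L'"
  shows "dual_map R H L u g \<in> carrier H'"
proof -
  note uD = bialg_homD[OF u]
  note uc = lin_map_closed[OF uD(1)]
  obtain I where I: "ideal I L" "cofinite_sub R L I" "\<forall>x\<in>I. g x = \<zero>\<^bsub>R\<^esub>" using g by (auto simp: L.K_mem_iff)
  interpret I: ideal I L by (rule I(1))
  let ?J = "{x \<in> carrier H. u x \<in> I}"
  have cof: "cofinite_sub R H ?J"
    by (rule cofinite_sub_vimage[OF H.cring_R H.noeth_R H.module_A L.module_A uD(1) I(2)])
  have sub: "submodule ?J R H" using cof by (simp add: cofinite_sub_def)
  have J: "ideal ?J H"
    using submodule.axioms(1)[OF sub] I.I_l_closed I.I_r_closed uc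
    by (intro idealI H.AR.ring_axioms) (auto simp: uD(3))
  have eq: "dual_map R H L u g = (\<lambda>h\<in>carrier H. g (u h))" using g by (simp add: dual_map_def L.K_carrier)
  have "(\<lambda>h\<in>carrier H. g (u h)) \<in> lin_map R H (reg_mod R)"
    by (intro H.K_restrict_lin lin_map_comp[OF uD(1) L.K_lin[OF g]])
  then show ?thesis
    unfolding eq H.K_mem_iff using J cof I(3) by (intro conjI exI[of _ ?J]) auto
qed

lemma dual_map_hom:
  assumes u: "u \<in> bialg_hom R H L"
  shows "dual_map R H L u \<in> bialg_hom R L' H'"
proof -
  note uD = bialg_homD[OF u]
  note uc = lin_map_closed[OF uD(1)] and dc = dual_map_closed[OF u]
  let ?d = "dual_map R H L u"
  have lin: "?d \<in> lin_map R L' H'"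
    by (intro lin_mapI dc H.K_ext_eqI H.KM.a_closed H.KM.smult_closed L.KM.a_closed L.KM.smult_closed)
       (auto simp: dual_map_apply uc)
  show ?thesis
  proof (rule bialg_homI[OF lin])
    show "?d \<in> extensional (carrier L')" by (simp add: dual_map_def L.K_carrier)
  next
    fix f g assume f: "f \<in> carrier L'" and g: "g \<in> carrier L'"
    show "?d (f \<otimes>\<^bsub>L'\<^esub> g) = ?d f \<otimes>\<^bsub>H'\<^esub> ?d g"
    proof (rule H.K_ext_eqI)
      fix h assume h: "h \<in> carrier H"
      note hm = H.H.\<Delta>_mem[OF _ h]
      have "?d (f \<otimes>\<^bsub>L'\<^esub> g) h = L.H.conv f g (u h)"
        using f g h uc by (simp add: dual_map_apply L.K_mult_closed)
      also have "\<dots> = lsum R (\<lambda>p. f (u (fst p)) \<otimes>\<^bsub>R\<^esub> g (u (snd p))) (H.H.\<Delta> h)"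
        unfolding L.H.conv_def
        using comult_hom_sum[OF H.H.comultiplication_axioms L.H.comultiplication_axioms uD(1) uD(5)[OF h] L.module_R
          L.H.form_mult_bilin[OF L.K_lin[OF f] L.K_lin[OF g]] h] by simp
      also have "\<dots> = H.H.conv (?d f) (?d g) h"
        unfolding H.H.conv_def using hm f g by (intro lsum_cong refl) (simp add: dual_map_apply)
      finally show "?d (f \<otimes>\<^bsub>L'\<^esub> g) h = (?d f \<otimes>\<^bsub>H'\<^esub> ?d g) h" using f g h dc by simp
    qed (use f g dc in \<open>auto intro!: L.K_mult_closed H.K_mult_closed\<close>)
  next
    show "?d \<one>\<^bsub>L'\<^esub> = \<one>\<^bsub>H'\<^esub>"
      by (rule H.K_ext_eqI) (auto simp: dual_map_apply L.K_one_closed H.K_one_closed dc uc uD(6))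
  next
    fix g assume g: "g \<in> carrier L'"
    note gm = L.KC.\<Delta>_mem[OF _ g]
    have eq: "tensor_map R H' H' ?d ?d (comult L' g) = lsum (tensor R H' H') (\<lambda>p. ptensor R H' H' (?d (fst p)) (?d (snd p))) (L.KC.\<Delta> g)"
      unfolding L.KC.comult_\<Delta>[OF g]
      by (rule tensor_map_tens[OF L.module_K L.module_K H.module_K H.module_K lin lin L.KC.\<Delta>_sub[OF g]])
    have pt: "ptensor R H' H' (?d (fst p)) (?d (snd p)) \<in> carrier (tensor R H' H')" if "p \<in> set (L.KC.\<Delta> g)" for p
      by (rule ptensor_closed[OF H.module_K H.module_K dc[OF gm(1)[OF that]] dc[OF gm(2)[OF that]]])
    show "comult H' (?d g) = tensor_map R H' H' ?d ?d (comult L' g)"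
      unfolding eq
    proof (rule H.KK_eqI)
      fix x y assume x: "x \<in> carrier H" and y: "y \<in> carrier H"
      have "H.eval2 x y (lsum (tensor R H' H') (\<lambda>p. ptensor R H' H' (?d (fst p)) (?d (snd p))) (L.KC.\<Delta> g)) =
        lsum R (\<lambda>p. H.eval2 x y (ptensor R H' H' (?d (fst p)) (?d (snd p)))) (L.KC.\<Delta> g)"
        using lin_map_lsum[OF H.module_KK H.module_R H.eval2_lin[OF x y] pt] by simp
      also have "\<dots> = lsum R (\<lambda>p. fst p (u x) \<otimes>\<^bsub>R\<^esub> snd p (u y)) (L.KC.\<Delta> g)"
        using gm dc x y by (intro lsum_cong refl) (simp add: H.eval2_ptensor dual_map_apply)
      also have "\<dots> = g (u x \<otimes>\<^bsub>L\<^esub> u y)" by (rule L.\<Delta>_K[OF g uc[OF x] uc[OF y], symmetric])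
      also have "\<dots> = H.eval2 x y (comult H' (?d g))"
        using g x y dc by (simp add: H.comult_K dual_map_apply uD(3))
      finally show "H.eval2 x y (comult H' (?d g)) =
        H.eval2 x y (lsum (tensor R H' H') (\<lambda>p. ptensor R H' H' (?d (fst p)) (?d (snd p))) (L.KC.\<Delta> g))" ..
    qed (use pt dc g in \<open>auto simp: H.comult_K_closed intro!: H.KK.lsum_closed\<close>)
    show "counit H' (?d g) = counit L' g"
      using g by (simp add: H.K_counit L.K_counit dual_map_apply uD(4))
  qed
qed

text \<open>Writing \<open>f\<close> for a bialgebra morphism \<open>H \<rightarrow> L\<^sup>\<circ>\<close>, the value \<open>f (x y z) k\<close> is
  \<open>\<Sum> f x k\<^sub>1 f y k\<^sub>2 f z k\<^sub>3\<close>, so the functionals \<open>y \<mapsto> f y k\<^sub>2\<close> show that \<open>h \<mapsto> f h k\<close> lies in the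
  finite dual of \<open>H\<close>.\<close>

lemma swap_closed:
  assumes f: "f \<in> bialg_hom R H L'" and k: "k \<in> carrier L"
  shows "swap_args (carrier H) (carrier L) f k \<in> carrier H'"
proof -
  note fD = bialg_homD[OF f]
  note fc = lin_map_closed[OF fD(1)] and km = L.H.\<Delta>_mem[OF _ k]
  have ev: "(\<lambda>h. f h l) \<in> lin_map R H (reg_mod R)" if "l \<in> carrier L" for l
    by (rule lin_map_comp[OF fD(1) L.eval_lin[OF that]])
  let ?ks = "concat (map (\<lambda>p. map (\<lambda>q y. f y (snd q)) (L.H.\<Delta> (fst p))) (L.H.\<Delta> k))"
  have ks: "\<kappa> \<in> lin_map R H (reg_mod R)" if \<kappa>: "\<kappa> \<in> set ?ks" for \<kappa>
  proof -
    obtain p q where pq: "p \<in> set (L.H.\<Delta> k)" "q \<in> set (L.H.\<Delta> (fst p))" "\<kappa> = (\<lambda>y. f y (snd q))"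
      using \<kappa> unfolding set_concat set_map image_image by blast
    show ?thesis unfolding pq(3) by (rule ev[OF L.H.\<Delta>_mem(2)[OF pq(2) km(1)[OF pq(1)]]])
  qed
  have eq: "swap_args (carrier H) (carrier L) f k = (\<lambda>h\<in>carrier H. f h k)" using k by (simp add: swap_args_def)
  show ?thesis
    unfolding eq
  proof (rule H.K_memI_detect[OF H.K_restrict_lin[OF ev[OF k]] restrict_extensional ks])
    fix x y z assume x: "x \<in> carrier H" and y: "y \<in> carrier H" and z: "z \<in> carrier H"
      and van: "\<And>\<kappa>. \<kappa> \<in> set ?ks \<Longrightarrow> \<kappa> y = \<zero>\<^bsub>R\<^esub>"
    have "f (x \<otimes>\<^bsub>H\<^esub> y \<otimes>\<^bsub>H\<^esub> z) k = L.H.conv (f x \<otimes>\<^bsub>L'\<^esub> f y) (f z) k"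
      using x y z k fc by (simp add: fD(3) L.K_mult_closed)
    also have "\<dots> = \<zero>\<^bsub>R\<^esub>"
      unfolding L.H.conv_def
    proof (rule H.AM.R.lsum_zero)
      fix p assume p: "p \<in> set (L.H.\<Delta> k)"
      have "(f x \<otimes>\<^bsub>L'\<^esub> f y) (fst p) = L.H.conv (f x) (f y) (fst p)" using x y fc km[OF p] by simp
      also have "\<dots> = \<zero>\<^bsub>R\<^esub>"
        unfolding L.H.conv_def
      proof (rule H.AM.R.lsum_zero)
        fix q assume q: "q \<in> set (L.H.\<Delta> (fst p))"
        have "(\<lambda>y. f y (snd q)) \<in> set ?ks" unfolding set_concat set_map image_image using p q by blast
        from van[OF this] show "f x (fst q) \<otimes>\<^bsub>R\<^esub> f y (snd q) = \<zero>\<^bsub>R\<^esub>"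
          using L.H.\<Delta>_mem[OF q km(1)[OF p]] fc x by simp
      qed
      finally show "(f x \<otimes>\<^bsub>L'\<^esub> f y) (fst p) \<otimes>\<^bsub>R\<^esub> f z (snd p) = \<zero>\<^bsub>R\<^esub>" using fc z km[OF p] by simp
    qed
    finally show "(\<lambda>h\<in>carrier H. f h k) (x \<otimes>\<^bsub>H\<^esub> y \<otimes>\<^bsub>H\<^esub> z) = \<zero>\<^bsub>R\<^esub>" using x y z by simp
  qed
qed

text \<open>The laws for \<open>k \<mapsto> (h \<mapsto> f h k)\<close> are those for \<open>f\<close> with the roles exchanged: it is multiplicative because \<open>f\<close> respects the
comultiplication, and it respects the comultiplication because \<open>f\<close> is multiplicative.\<close>

lemma swap_hom:
  assumes f: "f \<in> bialg_hom R H L'"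
  shows "swap_args (carrier H) (carrier L) f \<in> bialg_hom R L H'"
proof -
  note fD = bialg_homD[OF f]
  note fc = lin_map_closed[OF fD(1)]
  let ?s = "swap_args (carrier H) (carrier L) f"
  note sc = swap_closed[OF f]
  have sa: "?s k h = f h k" if "k \<in> carrier L" "h \<in> carrier H" for k h using that by (simp add: swap_args_def)
  have lin: "?s \<in> lin_map R L H'"
    by (intro lin_mapI sc H.K_ext_eqI H.KM.a_closed H.KM.smult_closed) (auto simp: sa fc)
  show ?thesis
  proof (rule bialg_homI[OF lin])
    show "?s \<in> extensional (carrier L)" by (simp add: swap_args_def)
  next
    fix k l assume k: "k \<in> carrier L" and l: "l \<in> carrier L"
    show "?s (k \<otimes>\<^bsub>L\<^esub> l) = ?s k \<otimes>\<^bsub>H'\<^esub> ?s l"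
    proof (rule H.K_ext_eqI)
      fix h assume h: "h \<in> carrier H"
      have b: "(\<lambda>p q. p k \<otimes>\<^bsub>R\<^esub> q l) \<in> bilin_map R L' L' (reg_mod R)" by (rule L.eval2_bilin[OF k l])
      have "?s (k \<otimes>\<^bsub>L\<^esub> l) h = lsum R (\<lambda>p. fst p k \<otimes>\<^bsub>R\<^esub> snd p l) (L.KC.\<Delta> (f h))"
        using h k l by (simp add: sa L.\<Delta>_K[OF fc])
      also have "\<dots> = lsum R (\<lambda>p. f (fst p) k \<otimes>\<^bsub>R\<^esub> f (snd p) l) (H.H.\<Delta> h)"
        using comult_hom_sum[OF H.H.comultiplication_axioms L.KC.comultiplication_axioms fD(1) fD(5)[OF h] L.module_R b h]
        by simp
      also have "\<dots> = H.H.conv (?s k) (?s l) h"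
        unfolding H.H.conv_def using H.H.\<Delta>_mem[OF _ h] k l by (intro lsum_cong refl) (simp add: sa)
      finally show "?s (k \<otimes>\<^bsub>L\<^esub> l) h = (?s k \<otimes>\<^bsub>H'\<^esub> ?s l) h" using h k l sc by simp
    qed (use k l sc in \<open>auto intro!: H.K_mult_closed\<close>)
  next
    show "?s \<one>\<^bsub>L\<^esub> = \<one>\<^bsub>H'\<^esub>"
      using fD(6) by (intro H.K_ext_eqI) (auto simp: sa sc H.K_one_closed L.K_counit)
  next
    fix k assume k: "k \<in> carrier L"
    note km = L.H.\<Delta>_mem[OF _ k]
    have eq: "tensor_map R H' H' ?s ?s (comult L k) = lsum (tensor R H' H') (\<lambda>p. ptensor R H' H' (?s (fst p)) (?s (snd p))) (L.H.\<Delta> k)"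
      unfolding L.H.comult_\<Delta>[OF k]
      by (rule tensor_map_tens[OF L.module_A L.module_A H.module_K H.module_K lin lin L.H.\<Delta>_sub[OF k]])
    have pt: "ptensor R H' H' (?s (fst p)) (?s (snd p)) \<in> carrier (tensor R H' H')" if "p \<in> set (L.H.\<Delta> k)" for p
      by (rule ptensor_closed[OF H.module_K H.module_K sc[OF km(1)[OF that]] sc[OF km(2)[OF that]]])
    show "comult H' (?s k) = tensor_map R H' H' ?s ?s (comult L k)"
      unfolding eq
    proof (rule H.KK_eqI)
      fix x y assume x: "x \<in> carrier H" and y: "y \<in> carrier H"
      have "H.eval2 x y (lsum (tensor R H' H') (\<lambda>p. ptensor R H' H' (?s (fst p)) (?s (snd p))) (L.H.\<Delta> k)) =
        lsum R (\<lambda>p. H.eval2 x y (ptensor R H' H' (?s (fst p)) (?s (snd p)))) (L.H.\<Delta> k)"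
        using lin_map_lsum[OF H.module_KK H.module_R H.eval2_lin[OF x y] pt] by simp
      also have "\<dots> = L.H.conv (f x) (f y) k"
        unfolding L.H.conv_def using km sc x y by (intro lsum_cong refl) (simp add: H.eval2_ptensor sa)
      also have "\<dots> = H.eval2 x y (comult H' (?s k))"
        using k x y sc fc by (simp add: H.comult_K sa fD(3))
      finally show "H.eval2 x y (comult H' (?s k)) =
        H.eval2 x y (lsum (tensor R H' H') (\<lambda>p. ptensor R H' H' (?s (fst p)) (?s (snd p))) (L.H.\<Delta> k))" ..
    qed (use pt sc k in \<open>auto simp: H.comult_K_closed intro!: H.KK.lsum_closed\<close>)
    show "counit H' (?s k) = counit L k"
      using k by (simp add: H.K_counit sa fD(4))
  qed
qed

lemma swap_swap:
  assumes f: "f \<in> bialg_hom R H L'"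
  shows "swap_args (carrier L) (carrier H) (swap_args (carrier H) (carrier L) f) = f"
proof (rule extensionalityI[of _ "carrier H"])
  show "swap_args (carrier L) (carrier H) (swap_args (carrier H) (carrier L) f) \<in> extensional (carrier H)"
    by (simp add: swap_args_def)
  show "f \<in> extensional (carrier H)" by (rule bialg_homD(2)[OF f])
  fix h assume h: "h \<in> carrier H"
  then have "f h \<in> extensional (carrier L)" using lin_map_closed[OF bialg_homD(1)[OF f]] L.K_ext by blast
  then have "restrict (f h) (carrier L) = f h" by (rule extensional_restrict)
  then show "swap_args (carrier L) (carrier H) (swap_args (carrier H) (carrier L) f) h = f h"
    using h by (simp add: swap_args_def cong: restrict_cong)
qed

lemma swap_args_dual_map:
  assumes v: "u \<in> carrier G \<rightarrow> carrier H" and f: "f \<in> bialg_hom R H L'"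
  shows "swap_args (carrier G) (carrier L) (compose (carrier G) f u) =
    compose (carrier L) (dual_map R G H u) (swap_args (carrier H) (carrier L) f)"
proof (rule extensionalityI[of _ "carrier L"])
  fix k assume k: "k \<in> carrier L"
  then have "swap_args (carrier H) (carrier L) f k \<in> fin_dual_set R H"
    using swap_closed[OF f] by (simp add: H.K_carrier)
  then have "dual_map R G H u (swap_args (carrier H) (carrier L) f k) = (\<lambda>h\<in>carrier G. f (u h) k)"
    using v k by (auto simp: dual_map_def swap_args_def intro!: restrict_ext)
  then show "swap_args (carrier G) (carrier L) (compose (carrier G) f u) k =
      compose (carrier L) (dual_map R G H u) (swap_args (carrier H) (carrier L) f) k"
    using k by (auto simp: swap_args_def compose_def intro!: restrict_ext)
qed (simp_all add: swap_args_def compose_def)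

lemma dual_map_swap_args:
  assumes v: "v \<in> carrier G \<rightarrow> carrier L" and f: "f \<in> bialg_hom R H L'"
  shows "swap_args (carrier H) (carrier G) (compose (carrier H) (dual_map R G L v) f) =
    compose (carrier G) (swap_args (carrier H) (carrier L) f) v"
proof (rule extensionalityI[of _ "carrier G"])
  fix k assume k: "k \<in> carrier G"
  have "f h \<in> fin_dual_set R L" if "h \<in> carrier H" for h
    using lin_map_closed[OF bialg_homD(1)[OF f] that] by (simp add: L.K_carrier)
  then show "swap_args (carrier H) (carrier G) (compose (carrier H) (dual_map R G L v) f) k =
      compose (carrier G) (swap_args (carrier H) (carrier L) f) v k"
    using k v by (auto simp: swap_args_def compose_def dual_map_def intro!: restrict_ext)
qed (simp_all add: swap_args_def compose_def)

end

locale two_hopf_duals = H: fin_dual_hopf R H H' + L: fin_dual_hopf R L L'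
  for R :: "('r, 'z) ring_scheme" and H :: "('r, 'a, 'u) hopf_scheme"
    and H' :: "('r, 'a \<Rightarrow> 'r, 'k) hopf_scheme" and L :: "('r, 'b, 'v) hopf_scheme"
    and L' :: "('r, 'b \<Rightarrow> 'r, 'l) hopf_scheme"
begin

sublocale two_duals R H H' L L' ..

lemma dual_map_hopf_hom:
  assumes u: "u \<in> hopf_hom R H L"
  shows "dual_map R H L u \<in> hopf_hom R L' H'"
proof -
  have ub: "u \<in> bialg_hom R H L" and uS: "\<And>h. h \<in> carrier H \<Longrightarrow> u (antipode H h) = antipode L (u h)"
    using u by (auto simp: hopf_hom_def)
  note uc = lin_map_closed[OF bialg_homD(1)[OF ub]]
  have "dual_map R H L u (antipode L' g) = antipode H' (dual_map R H L u g)" if g: "g \<in> carrier L'" for g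
    using g uc uS
    by (intro H.K_ext_eqI dual_map_closed[OF ub] H.antipode_K_closed L.antipode_K_closed)
       (auto simp: dual_map_apply L.antipode_K_closed)
  then show ?thesis using dual_map_hom[OF ub] by (simp add: hopf_hom_def)
qed

lemma swap_hopf_hom:
  assumes f: "f \<in> hopf_hom R H L'"
  shows "swap_args (carrier H) (carrier L) f \<in> hopf_hom R L H'"
proof -
  have fb: "f \<in> bialg_hom R H L'" and fS: "\<And>h. h \<in> carrier H \<Longrightarrow> f (antipode H h) = antipode L' (f h)"
    using f by (auto simp: hopf_hom_def)
  have "swap_args (carrier H) (carrier L) f (antipode L k) = antipode H' (swap_args (carrier H) (carrier L) f k)"
    if k: "k \<in> carrier L" for k
    using k fS
    by (intro H.K_ext_eqI swap_closed[OF fb] H.antipode_K_closed) (auto simp: swap_args_def)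
  then show ?thesis using swap_hom[OF fb] by (simp add: hopf_hom_def)
qed

end

section \<open>The dual functors\<close>

lemma pairing_factors_cong:
  assumes "carrier W = carrier W'" "\<zero>\<^bsub>W\<^esub> = \<zero>\<^bsub>W'\<^esub>" "ring.add W = ring.add W'" "smult W = smult W'"
  shows "pairing_factors R V W form = pairing_factors R V W' form"
  by (simp only: pairing_factors_def lsum_def assms)

context
  fixes R :: "('r, 'z) ring_scheme"
  assumes R: "cring R" "noetherian_ring R"
begin

lemma finite_dual_fin_dual_mod: "assoc_algebra R A \<Longrightarrow> finite_dual R A (fin_dual_mod R A)"
  using R by (simp add: finite_dual_def fin_dual_mod_def dual_mod_def)

lemma finite_dual_fin_dual: "bialgebra R H \<Longrightarrow> finite_dual R H (fin_dual R H)"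
  using R by (simp add: finite_dual_def fin_dual_def conv_dual_def dual_mod_def bialgebra_def)

lemma hopf_dual_simps [simp]:
  "carrier (hopf_dual R H) = carrier (fin_dual R H)" "\<zero>\<^bsub>hopf_dual R H\<^esub> = \<zero>\<^bsub>fin_dual R H\<^esub>"
  "ring.add (hopf_dual R H) = ring.add (fin_dual R H)" "smult (hopf_dual R H) = smult (fin_dual R H)"
  "monoid.mult (hopf_dual R H) = monoid.mult (fin_dual R H)" "\<one>\<^bsub>hopf_dual R H\<^esub> = \<one>\<^bsub>fin_dual R H\<^esub>"
  "comult (hopf_dual R H) = comult (fin_dual R H)" "counit (hopf_dual R H) = counit (fin_dual R H)"
  "antipode (hopf_dual R H) = (\<lambda>f. \<lambda>h\<in>carrier H. f (antipode H h))"
  by (simp_all add: hopf_dual_def bialg.extend_def hopf.fields_def)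

lemma pairing_factors_alpha:
  assumes "alpha_algebra TYPE((nat \<Rightarrow> 'r) set) R A"
  shows "pairing_factors R A (fin_dual_mod R A) (\<lambda>a f. f a)"
proof -
  interpret finite_dual R A "fin_dual_mod R A"
    using assms by (intro finite_dual_fin_dual_mod) (simp add: alpha_algebra_def)
  show ?thesis
    using assms by (intro alpha_condition_imp_factors module_K eval_lin) (simp_all add: alpha_algebra_def)
qed

lemma pairing_factors_hereditary:
  assumes "hereditary_ring R" "assoc_algebra R A"
  shows "pairing_factors R A (fin_dual_mod R A) (\<lambda>a f. f a)"
  by (rule finite_dual.hereditary_pairing_factors[OF finite_dual_fin_dual_mod[OF assms(2)] assms(1)])

lemma fin_dual_bialg_fin_dual:
  assumes H: "bialgebra R H" and fac: "pairing_factors R H (fin_dual_mod R H) (\<lambda>a f. f a)"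
  shows "fin_dual_bialg R H (fin_dual R H)"
proof -
  have "pairing_factors R H (fin_dual R H) (\<lambda>a f. f a)"
    using fac by (subst pairing_factors_cong[where W' = "fin_dual_mod R H"])
      (simp_all add: fin_dual_def fin_dual_mod_def conv_dual_def dual_mod_def)
  then show ?thesis
    using finite_dual_fin_dual[OF H] H
    by (simp add: fin_dual_bialg_def finite_dual_alpha_def finite_dual_alpha_axioms_def bialgebra_struct_def
        fin_dual_bialg_axioms_def fin_dual_def)
qed

lemma fin_dual_hopf_hopf_dual:
  assumes H: "hopf_algebra R H" and fac: "pairing_factors R H (fin_dual_mod R H) (\<lambda>a f. f a)"
  shows "fin_dual_hopf R H (hopf_dual R H)"
proof -
  have b: "bialgebra R H" using H by (simp add: hopf_algebra_def)
  have fd: "finite_dual R H (hopf_dual R H)"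
    using finite_dual_fin_dual[OF b] by (simp add: finite_dual_def)
  have "pairing_factors R H (hopf_dual R H) (\<lambda>a f. f a)"
    using fac by (subst pairing_factors_cong[where W' = "fin_dual_mod R H"])
      (simp_all add: fin_dual_def fin_dual_mod_def conv_dual_def dual_mod_def)
  then have "fin_dual_bialg R H (hopf_dual R H)"
    using fd b
    by (simp add: fin_dual_bialg_def finite_dual_alpha_def finite_dual_alpha_axioms_def bialgebra_struct_def
        fin_dual_bialg_axioms_def fin_dual_def)
  then show ?thesis
    using H b by (simp add: fin_dual_hopf_def hopf_struct_def hopf_struct_axioms_def bialgebra_struct_def fin_dual_hopf_axioms_def)
qed

lemma dual_map_id:
  "dual_map R H H (\<lambda>x\<in>carrier H. x) = (\<lambda>g\<in>fin_dual_set R H. g)"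
  unfolding dual_map_def
proof (rule restrict_ext)
  fix g assume "g \<in> fin_dual_set R H"
  then have "g \<in> extensional (carrier H)" by (simp add: fin_dual_set_def Hom_mod_def)
  from extensional_restrict[OF this] show "(\<lambda>h\<in>carrier H. g ((\<lambda>x\<in>carrier H. x) h)) = g"
    by (simp cong: restrict_cong)
qed

lemma dual_map_compose:
  assumes u: "u \<in> carrier H \<rightarrow> carrier K" and d: "dual_map R K L v \<in> fin_dual_set R L \<rightarrow> fin_dual_set R K"
  shows "dual_map R H L (compose (carrier H) v u) = compose (fin_dual_set R L) (dual_map R H K u) (dual_map R K L v)"
proof (rule extensionalityI[of _ "fin_dual_set R L"])
  fix g assume g: "g \<in> fin_dual_set R L"
  then have "dual_map R K L v g \<in> fin_dual_set R K" using d by auto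
  then show "dual_map R H L (compose (carrier H) v u) g =
      compose (fin_dual_set R L) (dual_map R H K u) (dual_map R K L v) g"
    using g u by (auto simp: dual_map_def compose_def intro!: restrict_ext)
qed (simp_all add: dual_map_def compose_def)

text \<open>The categories are left open so that one proof serves bialgebras and Hopf algebras, commutative or
cocommutative ones included.\<close>

lemma functor_dual_map:
  fixes C :: "(('r, 'a, 'u) bialg_scheme, 'a) concrete_cat"
    and D :: "(('r, 'a \<Rightarrow> 'r, 'v) bialg_scheme, 'a \<Rightarrow> 'r) concrete_cat"
  assumes C: "\<And>H. H \<in> Obj C \<Longrightarrow> fin_dual_bialg R H (F H)" and D: "\<And>H. H \<in> Obj C \<Longrightarrow> F H \<in> Obj D"
    and Arr: "\<And>H K u. u \<in> Arr C H K \<Longrightarrow> u \<in> bialg_hom R H K"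
    and hom: "\<And>H K u. H \<in> Obj C \<Longrightarrow> K \<in> Obj C \<Longrightarrow> u \<in> Arr C H K \<Longrightarrow> dual_map R H K u \<in> Arr D (F K) (F H)"
  shows "contravariant_functor C D F (dual_map R)"
proof -
  have car: "carrier (F H) = fin_dual_set R H" if "H \<in> Obj C" for H
    using C[OF that] by (simp add: fin_dual_bialg_def finite_dual_alpha_def finite_dual_def)
  show ?thesis
    unfolding contravariant_functor_def
  proof (intro conjI ballI)
    fix H K L u v assume H: "H \<in> Obj C" and K: "K \<in> Obj C" and L: "L \<in> Obj C"
      and u: "u \<in> Arr C H K" and v: "v \<in> Arr C K L"
    have "dual_map R K L v \<in> fin_dual_set R L \<rightarrow> fin_dual_set R K"
      using bialg_hom_funcset[OF two_duals.dual_map_hom[OF two_duals.intro[OF C[OF K] C[OF L]] Arr[OF v]]]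
      by (simp add: car K L)
    then show "dual_map R H L (compose (carrier H) v u) = compose (carrier (F L)) (dual_map R H K u) (dual_map R K L v)"
      unfolding car[OF L] using bialg_hom_funcset[OF Arr[OF u]] by (intro dual_map_compose)
  next
    fix H assume "H \<in> Obj C"
    then show "dual_map R H H (\<lambda>x\<in>carrier H. x) = (\<lambda>y\<in>carrier (F H). y)" by (simp only: car dual_map_id)
  qed (simp_all add: D hom)
qed

lemma adjoint_dual_map:
  fixes C :: "(('r, 'a, 'u) bialg_scheme, 'a) concrete_cat" and D :: "(('r, 'b, 'v) bialg_scheme, 'b) concrete_cat"
    and F :: "('r, 'a, 'u) bialg_scheme \<Rightarrow> ('r, 'a \<Rightarrow> 'r, 'w) bialg_scheme"
    and G :: "('r, 'b, 'v) bialg_scheme \<Rightarrow> ('r, 'b \<Rightarrow> 'r, 'x) bialg_scheme"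
  assumes C: "\<And>H. H \<in> Obj C \<Longrightarrow> fin_dual_bialg R H (F H)" and D: "\<And>K. K \<in> Obj D \<Longrightarrow> fin_dual_bialg R K (G K)"
    and Arr: "\<And>H H' u. u \<in> Arr C H' H \<Longrightarrow> u \<in> bialg_hom R H' H" "\<And>K K' v. v \<in> Arr D K' K \<Longrightarrow> v \<in> bialg_hom R K' K"
    and hG: "\<And>H K f. f \<in> hG H (G K) \<Longrightarrow> f \<in> bialg_hom R H (G K)"
      "\<And>H K f. H \<in> Obj C \<Longrightarrow> K \<in> Obj D \<Longrightarrow> f \<in> hG H (G K) \<Longrightarrow> swap_args (carrier H) (carrier K) f \<in> hF K (F H)"
    and hF: "\<And>H K f. f \<in> hF K (F H) \<Longrightarrow> f \<in> bialg_hom R K (F H)"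
      "\<And>H K f. H \<in> Obj C \<Longrightarrow> K \<in> Obj D \<Longrightarrow> f \<in> hF K (F H) \<Longrightarrow> swap_args (carrier K) (carrier H) f \<in> hG H (G K)"
  shows "contravariant_adjoint C D F (dual_map R) G (dual_map R) hG hF"
proof -
  have td: "two_duals R H (F H) K (G K)" "two_duals R K (G K) H (F H)" if "H \<in> Obj C" "K \<in> Obj D" for H K
    by (intro two_duals.intro C D that)+
  let ?\<Phi> = "\<lambda>H K. swap_args (carrier H) (carrier K)"
  show ?thesis
    unfolding contravariant_adjoint_def
  proof (rule exI[of _ ?\<Phi>], intro conjI ballI)
    fix H K assume HK: "H \<in> Obj C" "K \<in> Obj D"
    show "bij_betw (?\<Phi> H K) (hG H (G K)) (hF K (F H))"
      by (rule bij_betw_byWitness[where f' = "?\<Phi> K H"])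
         (use HK hG hF two_duals.swap_swap[OF td(1)[OF HK]] two_duals.swap_swap[OF td(2)[OF HK]] in auto)
  next
    fix H' H K u f assume "H' \<in> Obj C" and HK: "H \<in> Obj C" "K \<in> Obj D" and u: "u \<in> Arr C H' H" and f: "f \<in> hG H (G K)"
    show "?\<Phi> H' K (compose (carrier H') f u) = compose (carrier K) (dual_map R H' H u) (?\<Phi> H K f)"
      by (rule two_duals.swap_args_dual_map[OF td(1)[OF HK] bialg_hom_funcset[OF Arr(1)[OF u]] hG(1)[OF f]])
  next
    fix H K' K v f assume "K' \<in> Obj D" and HK: "H \<in> Obj C" "K \<in> Obj D" and v: "v \<in> Arr D K' K" and f: "f \<in> hG H (G K)"
    show "?\<Phi> H K' (compose (carrier H) (dual_map R K' K v) f) = compose (carrier K') (?\<Phi> H K f) v"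
      by (rule two_duals.dual_map_swap_args[OF td(1)[OF HK] bialg_hom_funcset[OF Arr(2)[OF v]] hG(1)[OF f]])
  qed
qed

end

lemma hopf_hom_bialg_hom: "u \<in> hopf_hom R H K \<Longrightarrow> u \<in> bialg_hom R H K"
  by (simp add: hopf_hom_def)

lemma fin_dual_bialg_hereditary:
  assumes "cring R" "noetherian_ring R" "hereditary_ring R" "bialgebra R H"
  shows "fin_dual_bialg R H (fin_dual R H)"
  using assms by (intro fin_dual_bialg_fin_dual pairing_factors_hereditary) (simp_all add: bialgebra_def)

lemma fin_dual_hopf_hereditary:
  assumes "cring R" "noetherian_ring R" "hereditary_ring R" "hopf_algebra R H"
  shows "fin_dual_hopf R H (hopf_dual R H)"
  using assms by (intro fin_dual_hopf_hopf_dual pairing_factors_hereditary) (simp_all add: hopf_algebra_def bialgebra_def)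

lemma alpha_bialgebra_dual:
  fixes R :: "('r, 'z) ring_scheme" and H :: "('r, 'a) bialg"
  assumes R: "cring R" "noetherian_ring R" and H: "alpha_bialgebra TYPE((nat \<Rightarrow> 'r) set) R H"
  shows "dual_comult_determined R H \<and> bialgebra_alpha_pairing TYPE('m) R H (fin_dual R H) (\<lambda>h f. f h) \<and>
    (commutative H \<longrightarrow> cocommutative R (fin_dual R H)) \<and> (cocommutative R H \<longrightarrow> commutative (fin_dual R H))"
proof -
  interpret fin_dual_bialg R H "fin_dual R H"
    using H by (intro fin_dual_bialg_fin_dual[OF R] pairing_factors_alpha[OF R]) (simp_all add: alpha_bialgebra_def)
  show ?thesis
    using dual_comult_determined bialgebra_alpha_pairing_K commutative_K cocommutative_K by blast
qed

lemma hopf_alpha_algebra_dual: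
  fixes R :: "('r, 'z) ring_scheme" and H :: "('r, 'a) hopf"
  assumes R: "cring R" "noetherian_ring R" and H: "hopf_alpha_algebra TYPE((nat \<Rightarrow> 'r) set) R H"
  shows "dual_comult_determined R H \<and> hopf_alpha_pairing TYPE('m) R H (hopf_dual R H) (\<lambda>h f. f h) \<and>
    (commutative H \<longrightarrow> cocommutative R (hopf_dual R H)) \<and> (cocommutative R H \<longrightarrow> commutative (hopf_dual R H))"
proof -
  interpret fin_dual_hopf R H "hopf_dual R H"
    using H by (intro fin_dual_hopf_hopf_dual[OF R] pairing_factors_alpha[OF R]) (simp_all add: hopf_alpha_algebra_def)
  have "hopf_alpha_pairing TYPE('m) R H (hopf_dual R H) (\<lambda>h f. f h)"
    unfolding hopf_alpha_pairing_def by (intro conjI H.hopf hopf_algebra_K bialgebra_alpha_pairing_K)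
  then show ?thesis
    using dual_comult_determined commutative_K cocommutative_K by blast
qed

theorem theorem4p16:
  fixes R :: "('r, 'z) ring_scheme"
  assumes "cring R" and "noetherian_ring R"
  shows
    "(\<forall>H :: ('r, 'a) bialg. alpha_bialgebra TYPE((nat \<Rightarrow> 'r) set) R H \<longrightarrow>
        dual_comult_determined R H \<and>
        bialgebra_alpha_pairing TYPE('m) R H (fin_dual R H) (\<lambda>h f. f h) \<and>
        (commutative H \<longrightarrow> cocommutative R (fin_dual R H)) \<and>
        (cocommutative R H \<longrightarrow> commutative (fin_dual R H))) \<and>
     (\<forall>H :: ('r, 'a) hopf. hopf_alpha_algebra TYPE((nat \<Rightarrow> 'r) set) R H \<longrightarrow>
        dual_comult_determined R H \<and>
        hopf_alpha_pairing TYPE('m) R H (hopf_dual R H) (\<lambda>h f. f h) \<and>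
        (commutative H \<longrightarrow> cocommutative R (hopf_dual R H)) \<and>
        (cocommutative R H \<longrightarrow> commutative (hopf_dual R H))) \<and>
     (hereditary_ring R \<longrightarrow>
        (\<forall>H \<in> Obj (Big R :: (('r, 'a) bialg, 'a) concrete_cat). dual_comult_determined R H) \<and>
        (\<forall>H \<in> Obj (Hopf R :: (('r, 'a) hopf, 'a) concrete_cat). dual_comult_determined R H) \<and>
        contravariant_functor (Big R :: (('r, 'a) bialg, 'a) concrete_cat) (Big R)
          (fin_dual R) (dual_map R) \<and>
        contravariant_adjoint (Big R :: (('r, 'a) bialg, 'a) concrete_cat)
          (Big R :: (('r, 'b) bialg, 'b) concrete_cat)
          (fin_dual R) (dual_map R) (fin_dual R) (dual_map R) (bialg_hom R) (bialg_hom R) \<and>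
        contravariant_functor (Hopf R :: (('r, 'a) hopf, 'a) concrete_cat) (Hopf R)
          (hopf_dual R) (dual_map R) \<and>
        contravariant_adjoint (Hopf R :: (('r, 'a) hopf, 'a) concrete_cat)
          (Hopf R :: (('r, 'b) hopf, 'b) concrete_cat)
          (hopf_dual R) (dual_map R) (hopf_dual R) (dual_map R) (hopf_hom R) (hopf_hom R) \<and>
        contravariant_functor (CBig R :: (('r, 'a) bialg, 'a) concrete_cat) (CCBig R)
          (fin_dual R) (dual_map R) \<and>
        contravariant_functor (CCBig R :: (('r, 'a) bialg, 'a) concrete_cat) (CBig R)
          (fin_dual R) (dual_map R) \<and>
        contravariant_adjoint (CBig R :: (('r, 'a) bialg, 'a) concrete_cat)
          (CCBig R :: (('r, 'b) bialg, 'b) concrete_cat)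
          (fin_dual R) (dual_map R) (fin_dual R) (dual_map R) (bialg_hom R) (bialg_hom R) \<and>
        contravariant_functor (CHopf R :: (('r, 'a) hopf, 'a) concrete_cat) (CCHopf R)
          (hopf_dual R) (dual_map R) \<and>
        contravariant_functor (CCHopf R :: (('r, 'a) hopf, 'a) concrete_cat) (CHopf R)
          (hopf_dual R) (dual_map R) \<and>
        contravariant_adjoint (CHopf R :: (('r, 'a) hopf, 'a) concrete_cat)
          (CCHopf R :: (('r, 'b) hopf, 'b) concrete_cat)
          (hopf_dual R) (dual_map R) (hopf_dual R) (dual_map R) (hopf_hom R) (hopf_hom R))"
proof -
  note B = fin_dual_bialg_hereditary[OF assms] and Hf = fin_dual_hopf_hereditary[OF assms]
  note FB = fin_dual_hopf.axioms(1)[OF Hf]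
  note BD = fin_dual_bialg.bialgebra_K[OF B] fin_dual_bialg.commutative_K[OF B] fin_dual_bialg.cocommutative_K[OF B]
  note HD = fin_dual_hopf.hopf_algebra_K[OF Hf] fin_dual_bialg.commutative_K[OF FB] fin_dual_bialg.cocommutative_K[OF FB]
  note det = finite_dual_alpha.dual_comult_determined[OF fin_dual_bialg.axioms(1)]
  note two = two_duals.dual_map_hom[OF two_duals.intro[OF B B]] two_duals.swap_hom[OF two_duals.intro[OF B B]]
    two_hopf_duals.dual_map_hopf_hom[OF two_hopf_duals.intro[OF Hf Hf]] two_hopf_duals.swap_hopf_hom[OF two_hopf_duals.intro[OF Hf Hf]]
  note cats = Big_def CBig_def CCBig_def Hopf_def CHopf_def CCHopf_def
  show ?thesis
    by (rule conjI, intro allI impI, rule alpha_bialgebra_dual[OF assms], assumption,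
        rule conjI, intro allI impI, rule hopf_alpha_algebra_dual[OF assms], assumption,
        intro impI conjI ballI functor_dual_map[OF assms] adjoint_dual_map[OF assms])
       (auto simp: cats simp del: hopf_dual_simps intro: B Hf FB BD HD two hopf_hom_bialg_hom det[OF B] det[OF FB])
qed

end
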